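(* Choose an integer $r>1$ and let $n>6r$. Let $\mathfrak{n}=\mathfrak{u}_n(q)$ and let $\lambda\in\mathfrak{n}^*$ be the linear map with, for $j<k$, $$\lambda_{jk}=\lambda(e_{jk})=\begin{cases}-1,&\text{if } j=k-r\in[1,r],\\ 1,&\text{if } j=k-2r\in[1,r],\\ -1,&\text{if } j=k-2r-1\in[r+1,2r],\\ 1,&\text{if } j=k-3r-1\in[r+1,2r],\\ 1,&\text{if } j=k-r\in[2r+1,3r+1],\\ 1,&\text{if } j=k-2r\in[3r+2,4r+1],\\ 0,&\text{otherwise.}\end{cases}$$ Let $\mathcal{A},\mathcal{B},\mathcal{C},\mathcal{D},\mathcal{Z}$ be the sets of matrix positions, $\tau$ the map, $\widehat{\mathfrak{l}}_\lambda,\widehat{\mathfrak{s}}_\lambda$ the subalgebras of $\mathfrak{n}$, $\widehat{S}_\lambda=1+\widehat{\mathfrak{s}}_\lambda$, $\xi_\lambda$ the character, and $\psi_\lambda,\psi^{\mathrm{Exp}}_\lambda$ the Kirillov and exponential Kirillov functions of $\mathrm{UT}_n(q)$ defined in the context. Then the following hold. (1) The character $\xi_\lambda$ of $\mathrm{UT}_n(q)$ is the sum of $q^{r-1}$ distinct irreducible characters of degree $q^{5r^2-2r}$, each of which is induced from a linear character of $\widehat{S}_\lambda$. Furthermore, $$\widehat{\mathfrak{l}}_\lambda=\{X\in\mathfrak{n}: X_\alpha=X_{\tau(\alpha)}\text{ if }\alpha\in\mathcal{A}\cup\mathcal{B}\cup\mathcal{C}\text{ and }X_\alpha=0\text{ if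 }\alpha\in\mathcal{D}\cup\mathcal{Z}\},$$ $$\widehat{\mathfrak{s}}_\lambda=\{X\in\mathfrak{n}: X_\alpha=X_{\tau(\alpha)}\text{ if }\alpha\in\mathcal{A}\cup\mathcal{B}\cup\mathcal{C}\cup\mathcal{D}\text{ and }X_\alpha=0\text{ if }\alpha\in\mathcal{Z}\},$$ and $\xi_\lambda(1)=q^{5r^2-r-1}$ and $\langle\xi_\lambda,\xi_\lambda\rangle_{\mathrm{UT}_n(q)}=q^{r-1}$. (2) If $p>0$ is the characteristic of $\mathbb{F}_q$ and $p^i$ is the largest power of $p$ less than or equal to $r$, then all irreducible constituents of $\xi_\lambda$ take values in $\mathbb{Q}(\zeta_{p^{i+1}})$, but some irreducible constituents have values which are not in $\mathbb{Q}(\zeta_{p^i})$. (3) The Kirillov functions $\psi_\lambda$ and $\psi^{\mathrm{Exp}}_\lambda$ have degree $q^{5r^2-2r}$ (that is, this is their value at $1$), and $\psi_\lambda$ is never a character of $\mathrm{UT}_n(q)$, while the exponential Kirillov function $\psi^{\mathrm{Exp}}_\lambda$ is a character if and only if $r<p$, where $p$ is the characteristic of $\mathbb{F}_q$.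
   Context: $\mathbb{F}_q$ is a finite field with $q$ elements and characteristic $p$; $\zeta_m=e^{2\pi i/m}$; $[a,b]=\{t\in\mathbb{Z}:a\le t\le b\}$, $[n]=[1,n]$. $\mathfrak{u}_n(q)$ is the algebra of strictly upper triangular $n\times n$ matrices over $\mathbb{F}_q$, $\mathrm{UT}_n(q)=1+\mathfrak{u}_n(q)$, and $e_{jk}$ is the elementary matrix with $1$ in position $(j,k)$. $X_\alpha$ denotes the entry of $X$ in position $\alpha=(i,j)$. $\langle f,g\rangle_G=\frac1{|G|}\sum_{x\in G}f(x)\overline{g(x)}$. Let $\mathfrak{n}$ be a finite-dimensional nilpotent associative $\mathbb{F}_q$-algebra, $\mathfrak{n}^*$ its dual space, and $G=1+\mathfrak{n}$ the group of formal sums $1+X$ with $(1+X)(1+Y)=1+X+Y+XY$. Fix a nontrivial homomorphism $\theta:\mathbb{F}_q^+\to\mathbb{C}^\times$ and let $\theta_\lambda(g)=\theta(\lambda(g-1))$ for $\lambda\in\mathfrak{n}^*$, $g\in G$. Kirillov functions: let $\lambda^g(X)=\lambda(gXg^{-1})$ and let $\lambda^G$ be the orbit of $\lambda$ under this coadjoint action. Set $\psi_\lambda=|\lambda^G|^{-1/2}\sum_{\mu\in\lambda^G}\theta_\mu$. With $\mathrm{Exp}(X)=1+X+\frac12X^2+\dots+\frac1{(p-1)!}X^{p-1}$ (a bijection $\mathfrak{n}\to G$), the exponential Kirillov function is defined by $\psi^{\mathrm{Exp}}_\lambda(\mathrm{Exp}(X))=\psi_\lambda(1+X)$ for $X\in\mathfrak{n}$.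 The character $\xi_\lambda$: put $\mathfrak{l}^0_\lambda=0$, $\mathfrak{s}^0_\lambda=\mathfrak{n}$, and inductively $$\mathfrak{l}^{i+1}_\lambda=\{X\in\mathfrak{s}^i_\lambda:\lambda(XY)=0\ \forall\,Y\in\mathfrak{s}^i_\lambda\},\qquad \mathfrak{s}^{i+1}_\lambda=\{X\in\mathfrak{s}^i_\lambda:\lambda(XY)=0\ \forall\,Y\in\mathfrak{l}^{i+1}_\lambda\}.$$ These are subalgebras, the $\mathfrak{l}^i_\lambda$ ascending and the $\mathfrak{s}^i_\lambda$ descending, and both sequences stabilize; $\widehat{\mathfrak{l}}_\lambda$ and $\widehat{\mathfrak{s}}_\lambda$ denote their terminal terms, $\widehat{L}_\lambda=1+\widehat{\mathfrak{l}}_\lambda$ and $\widehat{S}_\lambda=1+\widehat{\mathfrak{s}}_\lambda$. The function $\theta_\lambda$ restricts to a linear character of $\widehat{L}_\lambda$ and $\xi_\lambda=\mathrm{Ind}_{\widehat{L}_\lambda}^G(\theta_\lambda)$. Position sets (for the fixed integer $r>1$): for nonnegative integers $m,x,y$ let $\square(m;x,y)=\{(x+i,y+j):i,j\in[m]\}$, ${}^L\triangle(m;x,y)=\{(x+j,y+i):i,j\in[m],\,i<j\}$, ${}^U\triangle(m;x,y)=\{(x+i,y+j):i,j\in[m],\,i<j\}$. Define $\mathcal{A}={}^L\triangle(r;r,3r+1)$, $\mathcal{B}={}^U\triangle(r;r,r)$, $\mathcal{C}={}^L\triangle(r;0,r)$, $\mathcal{D}={}^U\triangle(r;0,0)\cup\{(i,2r+1):i\in[2,r]\}$,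 $\mathcal{Z}_1=\square(r;r,2r)\cup\{(r+i,3r+1):i\in[r]\}$, $\mathcal{Z}_2={}^L\triangle(r;r,4r+1)$, $\mathcal{Z}_3=\square(r;3r+1,4r+1)$, $\mathcal{Z}_4={}^L\triangle(r;3r+1,5r+1)$, $\mathcal{Z}=\mathcal{Z}_1\cup\mathcal{Z}_2\cup\mathcal{Z}_3\cup\mathcal{Z}_4$. The map $\tau$ from $\mathcal{A}\cup\mathcal{B}\cup\mathcal{C}\cup\mathcal{D}$ to positions $\{(i,j):1\le i<j\le 6r+1\}$ is given by: for $(i,j)\in\mathcal{A}$, $\tau(i,j)=(i+r+1,j)$; for $(i,j)\in\mathcal{B}$, $\tau(i,j)=(i+r+1,j+r+1)$; for $(i,j)\in\mathcal{C}$, $\tau(i,j)=(i+1,j+r+1)$ if $i<r$ and $\tau(i,j)=(2r+1,j+r+1)$ if $i=r$; for $(i,j)\in\mathcal{D}$, $\tau(i,j)=(i+1,j+1)$ if $j<r$, $\tau(i,j)=(i+1,2r+1)$ if $j=r$, and $\tau(i,j)=(1,r+2-i)$ if $j=2r+1$. *)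

theory Defs
  imports
    Complex_Main
    "HOL-Library.FuncSet"
    "HOL-Library.Cardinality"
    "HOL-Algebra.Generated_Fields"
    "Jordan_Normal_Form.VS_Connect"
begin

text \<open>Functions on a group \<open>G\<close> are represented by extensional functions, i.e. they are
  \<open>undefined\<close> off \<open>carrier G\<close>, so that equality of functions is equality on \<open>G\<close>.\<close>

definition mat_trace :: "'a::comm_monoid_add mat \<Rightarrow> 'a" where
  "mat_trace A = (\<Sum>i<dim_row A. A $$ (i, i))"

definition is_rep :: "('g, 'm) monoid_scheme \<Rightarrow> nat \<Rightarrow> ('g \<Rightarrow> complex mat) \<Rightarrow> bool" where
  "is_rep G d \<rho> \<longleftrightarrow> 0 < d \<and> (\<forall>g\<in>carrier G. \<rho> g \<in> carrier_mat d d) \<and> \<rho> \<one>\<^bsub>G\<^esub> = 1\<^sub>m d \<and>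
     (\<forall>g\<in>carrier G. \<forall>h\<in>carrier G. \<rho> (g \<otimes>\<^bsub>G\<^esub> h) = \<rho> g * \<rho> h)"

definition is_irreducible_rep :: "('g, 'm) monoid_scheme \<Rightarrow> nat \<Rightarrow> ('g \<Rightarrow> complex mat) \<Rightarrow> bool" where
  "is_irreducible_rep G d \<rho> \<longleftrightarrow> is_rep G d \<rho> \<and>
     (\<forall>W. VectorSpace.subspace class_ring W (module_vec TYPE(complex) d) \<and>
          (\<forall>g\<in>carrier G. \<forall>w\<in>W. \<rho> g *\<^sub>v w \<in> W) \<longrightarrow> W = {0\<^sub>v d} \<or> W = carrier_vec d)"

definition rep_character :: "('g, 'm) monoid_scheme \<Rightarrow> ('g \<Rightarrow> complex mat) \<Rightarrow> 'g \<Rightarrow> complex" where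
  "rep_character G \<rho> = (\<lambda>g\<in>carrier G. mat_trace (\<rho> g))"

definition characters :: "('g, 'm) monoid_scheme \<Rightarrow> ('g \<Rightarrow> complex) set" where
  "characters G = {rep_character G \<rho> | d \<rho>. is_rep G d \<rho>}"

definition irreducible_characters :: "('g, 'm) monoid_scheme \<Rightarrow> ('g \<Rightarrow> complex) set" where
  "irreducible_characters G = {rep_character G \<rho> | d \<rho>. is_irreducible_rep G d \<rho>}"

definition linear_characters :: "('g, 'm) monoid_scheme \<Rightarrow> ('g \<Rightarrow> complex) set" where
  "linear_characters G = {\<chi> \<in> characters G. \<chi> \<one>\<^bsub>G\<^esub> = 1}"

definition char_inner ::
  "('g, 'm) monoid_scheme \<Rightarrow> ('g \<Rightarrow> complex) \<Rightarrow> ('g \<Rightarrow> complex) \<Rightarrow> complex" where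
  "char_inner G f h = (\<Sum>x\<in>carrier G. f x * cnj (h x)) / of_nat (card (carrier G))"

definition irreducible_constituents ::
  "('g, 'm) monoid_scheme \<Rightarrow> ('g \<Rightarrow> complex) \<Rightarrow> ('g \<Rightarrow> complex) set" where
  "irreducible_constituents G \<xi> = {\<chi> \<in> irreducible_characters G. char_inner G \<xi> \<chi> \<noteq> 0}"

definition induced ::
  "('g, 'm) monoid_scheme \<Rightarrow> 'g set \<Rightarrow> ('g \<Rightarrow> complex) \<Rightarrow> 'g \<Rightarrow> complex" where
  "induced G H \<chi> = (\<lambda>g\<in>carrier G.
     (\<Sum>x \<in> {x \<in> carrier G. x \<otimes>\<^bsub>G\<^esub> g \<otimes>\<^bsub>G\<^esub> inv\<^bsub>G\<^esub> x \<in> H}. \<chi> (x \<otimes>\<^bsub>G\<^esub> g \<otimes>\<^bsub>G\<^esub> inv\<^bsub>G\<^esub> x)) / of_nat (card H))"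

definition cyclotomic_field :: "nat \<Rightarrow> complex set" where
  "cyclotomic_field m = generate_field class_ring (\<rat> \<union> {exp (2 * of_real pi * \<i> / of_nat m)})"

text \<open>Matrix positions are pairs with entries in \<open>{1..n}\<close>, whereas \<open>$$\<close> counts from \<open>0\<close>.\<close>

definition entry :: "'a mat \<Rightarrow> nat \<times> nat \<Rightarrow> 'a" where
  "entry X \<alpha> = X $$ (fst \<alpha> - 1, snd \<alpha> - 1)"

definition elem_mat :: "nat \<Rightarrow> nat \<Rightarrow> nat \<Rightarrow> 'a::zero_neq_one mat" where
  "elem_mat n j k = mat n n (\<lambda>(a, b). if a + 1 = j \<and> b + 1 = k then 1 else 0)"

definition strict_upper :: "nat \<Rightarrow> 'a::zero mat set" where
  "strict_upper n = {X \<in> carrier_mat n n. \<forall>i\<in>{1..n}. \<forall>j\<in>{1..n}. j \<le> i \<longrightarrow> entry X (i, j) = 0}"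

definition one_plus :: "nat \<Rightarrow> 'a::semiring_1 mat set \<Rightarrow> 'a mat set" where
  "one_plus n V = (\<lambda>X. 1\<^sub>m n + X) ` V"

definition UT :: "nat \<Rightarrow> 'a::semiring_1 mat monoid" where
  "UT n = \<lparr>carrier = one_plus n (strict_upper n), mult = (*), one = 1\<^sub>m n\<rparr>"

definition dual :: "nat \<Rightarrow> ('a::field mat \<Rightarrow> 'a) set" where
  "dual n = {lam \<in> extensional (strict_upper n).
     (\<forall>X\<in>strict_upper n. \<forall>Y\<in>strict_upper n. lam (X + Y) = lam X + lam Y) \<and>
     (\<forall>c. \<forall>X\<in>strict_upper n. lam (c \<cdot>\<^sub>m X) = c * lam X)}"

definition nontrivial_additive_character :: "('a::field \<Rightarrow> complex) \<Rightarrow> bool" where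
  "nontrivial_additive_character \<theta> \<longleftrightarrow>
     (\<forall>x. \<theta> x \<noteq> 0) \<and> (\<forall>x y. \<theta> (x + y) = \<theta> x * \<theta> y) \<and> (\<exists>x. \<theta> x \<noteq> 1)"

definition theta_fun :: "('a::field \<Rightarrow> complex) \<Rightarrow> nat \<Rightarrow> ('a mat \<Rightarrow> 'a) \<Rightarrow> 'a mat \<Rightarrow> complex" where
  "theta_fun \<theta> n lam = (\<lambda>g\<in>carrier (UT n). \<theta> (lam (g - 1\<^sub>m n)))"

definition coadjoint :: "nat \<Rightarrow> ('a::field mat \<Rightarrow> 'a) \<Rightarrow> 'a mat \<Rightarrow> 'a mat \<Rightarrow> 'a" where
  "coadjoint n lam g = (\<lambda>X\<in>strict_upper n. lam (g * X * inv\<^bsub>UT n\<^esub> g))"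

definition coadjoint_orbit :: "nat \<Rightarrow> ('a::field mat \<Rightarrow> 'a) \<Rightarrow> ('a mat \<Rightarrow> 'a) set" where
  "coadjoint_orbit n lam = coadjoint n lam ` carrier (UT n)"

definition kirillov :: "('a::field \<Rightarrow> complex) \<Rightarrow> nat \<Rightarrow> ('a mat \<Rightarrow> 'a) \<Rightarrow> 'a mat \<Rightarrow> complex" where
  "kirillov \<theta> n lam = (\<lambda>g\<in>carrier (UT n).
     of_real (real (card (coadjoint_orbit n lam)) powr (-1/2)) *
     (\<Sum>\<mu>\<in>coadjoint_orbit n lam. theta_fun \<theta> n \<mu> g))"

text \<open>\<open>1 + X + X\<^sup>2/2! + \<dots> + X\<^bsup>p-1\<^esup>/(p-1)!\<close> for \<open>p = CHAR('a)\<close>. The sum is taken entrywise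
  because the type of matrices is not an additive monoid; the denominators are invertible
  since \<open>k < p\<close>. On \<open>strict_upper n\<close> this is a bijection onto \<open>carrier (UT n)\<close>, and its inverse
  is used in \<open>exp_kirillov\<close>.\<close>

definition trunc_exp :: "nat \<Rightarrow> 'a::field mat \<Rightarrow> 'a mat" where
  "trunc_exp n X = mat n n (\<lambda>(i, j). \<Sum>k<CHAR('a). (X ^\<^sub>m k) $$ (i, j) / of_nat (fact k))"

definition exp_kirillov :: "('a::field \<Rightarrow> complex) \<Rightarrow> nat \<Rightarrow> ('a mat \<Rightarrow> 'a) \<Rightarrow> 'a mat \<Rightarrow> complex" where
  "exp_kirillov \<theta> n lam = (\<lambda>g\<in>carrier (UT n).
     kirillov \<theta> n lam (1\<^sub>m n + the_inv_into (strict_upper n) (trunc_exp n) g))"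

fun l_seq :: "nat \<Rightarrow> ('a::field mat \<Rightarrow> 'a) \<Rightarrow> nat \<Rightarrow> 'a mat set"
  and s_seq :: "nat \<Rightarrow> ('a::field mat \<Rightarrow> 'a) \<Rightarrow> nat \<Rightarrow> 'a mat set" where
  "l_seq n lam 0 = {0\<^sub>m n n}"
| "l_seq n lam (Suc i) = {X \<in> s_seq n lam i. \<forall>Y\<in>s_seq n lam i. lam (X * Y) = 0}"
| "s_seq n lam 0 = strict_upper n"
| "s_seq n lam (Suc i) = {X \<in> s_seq n lam i. \<forall>Y\<in>l_seq n lam (Suc i). lam (X * Y) = 0}"

text \<open>Over a finite field the sequence \<open>l_seq\<close> is ascending, \<open>s_seq\<close> is descending, and both
  consist of subsets of a finite set, so the eventual value exists.\<close>

definition terminal_term :: "(nat \<Rightarrow> 'b) \<Rightarrow> 'b" where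
  "terminal_term f = (THE V. \<forall>\<^sub>F i in sequentially. f i = V)"

definition l_hat :: "nat \<Rightarrow> ('a::field mat \<Rightarrow> 'a) \<Rightarrow> 'a mat set" where
  "l_hat n lam = terminal_term (l_seq n lam)"

definition s_hat :: "nat \<Rightarrow> ('a::field mat \<Rightarrow> 'a) \<Rightarrow> 'a mat set" where
  "s_hat n lam = terminal_term (s_seq n lam)"

abbreviation L_hat :: "nat \<Rightarrow> ('a::field mat \<Rightarrow> 'a) \<Rightarrow> 'a mat set" where
  "L_hat n lam \<equiv> one_plus n (l_hat n lam)"

abbreviation S_hat :: "nat \<Rightarrow> ('a::field mat \<Rightarrow> 'a) \<Rightarrow> 'a mat set" where
  "S_hat n lam \<equiv> one_plus n (s_hat n lam)"

definition xi :: "('a::field \<Rightarrow> complex) \<Rightarrow> nat \<Rightarrow> ('a mat \<Rightarrow> 'a) \<Rightarrow> 'a mat \<Rightarrow> complex" where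
  "xi \<theta> n lam = induced (UT n) (L_hat n lam) (theta_fun \<theta> n lam)"

definition lambda_coeff :: "nat \<Rightarrow> nat \<Rightarrow> nat \<Rightarrow> 'a::ring_1" where
  "lambda_coeff r j k =
     (if k = j + r \<and> j \<in> {1..r} then -1
      else if k = j + 2*r \<and> j \<in> {1..r} then 1
      else if k = j + 2*r + 1 \<and> j \<in> {r+1..2*r} then -1
      else if k = j + 3*r + 1 \<and> j \<in> {r+1..2*r} then 1
      else if k = j + r \<and> j \<in> {2*r+1..3*r+1} then 1
      else if k = j + 2*r \<and> j \<in> {3*r+2..4*r+1} then 1
      else 0)"

definition square :: "nat \<Rightarrow> nat \<Rightarrow> nat \<Rightarrow> (nat \<times> nat) set" where
  "square m x y = {(x + i, y + j) | i j. i \<in> {1..m} \<and> j \<in> {1..m}}"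

definition ltri :: "nat \<Rightarrow> nat \<Rightarrow> nat \<Rightarrow> (nat \<times> nat) set" where
  "ltri m x y = {(x + j, y + i) | i j. i \<in> {1..m} \<and> j \<in> {1..m} \<and> i < j}"

definition utri :: "nat \<Rightarrow> nat \<Rightarrow> nat \<Rightarrow> (nat \<times> nat) set" where
  "utri m x y = {(x + i, y + j) | i j. i \<in> {1..m} \<and> j \<in> {1..m} \<and> i < j}"

definition posA :: "nat \<Rightarrow> (nat \<times> nat) set" where
  "posA r = ltri r r (3*r + 1)"

definition posB :: "nat \<Rightarrow> (nat \<times> nat) set" where
  "posB r = utri r r r"

definition posC :: "nat \<Rightarrow> (nat \<times> nat) set" where
  "posC r = ltri r 0 r"

definition posD :: "nat \<Rightarrow> (nat \<times> nat) set" where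
  "posD r = utri r 0 0 \<union> {(i, 2*r + 1) | i. i \<in> {2..r}}"

definition posZ :: "nat \<Rightarrow> (nat \<times> nat) set" where
  "posZ r = (square r r (2*r) \<union> {(r + i, 3*r + 1) | i. i \<in> {1..r}})
     \<union> ltri r r (4*r + 1)
     \<union> square r (3*r + 1) (4*r + 1)
     \<union> ltri r (3*r + 1) (5*r + 1)"

text \<open>The four sets \<open>posA\<close>, \<open>posB\<close>, \<open>posC\<close>, \<open>posD\<close> are disjoint and \<open>tau\<close> is only meaningful on
  their union; the last two branches are the cases \<open>j = r\<close> and \<open>j = 2r+1\<close> within \<open>posD\<close>, where
  in the latter \<open>i \<le> r\<close>, so that the subtraction does not truncate.\<close>

definition tau :: "nat \<Rightarrow> nat \<times> nat \<Rightarrow> nat \<times> nat" where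
  "tau r = (\<lambda>(i, j).
     if (i, j) \<in> posA r then (i + r + 1, j)
     else if (i, j) \<in> posB r then (i + r + 1, j + r + 1)
     else if (i, j) \<in> posC r then (if i < r then (i + 1, j + r + 1) else (2*r + 1, j + r + 1))
     else if j < r then (i + 1, j + 1)
     else if j = r then (i + 1, 2*r + 1)
     else (1, r + 2 - i))"

end

theory Submission
  imports
    Defs
    "Jordan_Normal_Form.Schur_Decomposition"
    "HOL-Computational_Algebra.Polynomial_Factorial"
    "HOL-Computational_Algebra.Formal_Power_Series"
begin

text \<open>Clifford theory first: if \<open>L \<subseteq> S\<close> are subgroups of a finite group, \<open>\<theta>\<close> is a linear character
  of \<open>L\<close> trivial on the commutators of \<open>S\<close>, and every element outside \<open>S\<close> moves \<open>\<theta>\<close> on some part of \<open>L\<close>,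
  then \<open>Ind \<theta>\<close> is the multiplicity-free sum of the irreducible characters induced from the extensions
  of \<open>\<theta>\<close> to \<open>S\<close>, and a function on \<open>S\<close> that is equivariant under \<open>(L, \<theta>)\<close> and of modulus one induces a
  character exactly if it is itself a linear character. The stabilised pair of the sequences
  \<open>l_seq\<close>, \<open>s_seq\<close> satisfies these hypotheses whenever \<open>\<lambda>(XY)\<close> and \<open>\<lambda>(XYZ)\<close> are symmetric in \<open>X, Y \<in> s_hat\<close>; then
  the Kirillov function is induced from \<open>\<theta>\<^sub>\<lambda>\<close> on \<open>S_hat\<close> too.

  For the given \<open>\<lambda>\<close>, the Toeplitz block of an element of \<open>s_hat\<close> together with its value under \<open>\<lambda>\<close> defines
  a homomorphism from \<open>s_hat\<close> onto the maximal ideal of \<open>F\<^sub>q[u]/(u\<^bsup>r+1\<^esup>)\<close>, with \<open>\<lambda>\<close> as the top coefficient and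
  \<open>l_hat\<close> as the preimage of the socle. Everything is thereby read off from the unit group \<open>1 + (u)\<close>:
  its exponent \<open>p\<^bsup>i+1\<^esup>\<close> governs the fields of values, and the truncated exponential series is a
  homomorphism modulo \<open>u\<^bsup>r+1\<^esup>\<close>, after applying \<open>\<theta>\<close> to the top coefficient of the logarithm, exactly if \<open>r < p\<close>.\<close>

text \<open>A Kirillov function must be refused as the trace of any representation, and constituents
  range over all irreducible characters; hence Schur orthogonality, and the integrality of
  multiplicities through traces of idempotents, are proved for arbitrary complex representations.
  The coefficients of \<open>lam\<close> come in pairs of opposite sign: on a product in
  \<open>s_hat\<close> everything cancels except position (1, 2r+1), which gives the u^r coefficient
  of a product of two Toeplitz rows. That the equations for \<open>s_hat\<close> are complete
  follows from the resulting symmetry, not from running the sequence to its end: whatever commutes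
  with \<open>s_hat\<close> under \<open>lam\<close> lies in \<open>s_hat\<close>. Values of a
  constituent in the smaller cyclotomic field would be fixed by \<eta> -> \<eta>^(1 + p^i), which
  turns an extension \<chi> of \<theta> into the extension \<chi>^(1 + p^i) and so contradicts the
  injectivity of induction. The conjugation rests on the irreducibility of the cyclotomic
  polynomial, obtained from the total ramification of p. For i = 0 it would move \<theta> itself, so
  an explicit value is computed.\<close>

section \<open>Schur orthogonality\<close>

lemma mat_trace_mult_comm:
  fixes A B :: "'a::comm_semiring_0 mat"
  assumes "A \<in> carrier_mat n m" "B \<in> carrier_mat m n"
  shows "mat_trace (A * B) = mat_trace (B * A)"
proof -
  have "mat_trace (A * B) = (\<Sum>i<n. \<Sum>j<m. A $$ (i, j) * B $$ (j, i))"
    using assms by (simp add: mat_trace_def scalar_prod_def atLeast0LessThan)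
  also have "\<dots> = (\<Sum>j<m. \<Sum>i<n. A $$ (i, j) * B $$ (j, i))"
    by (rule sum.swap)
  also have "\<dots> = mat_trace (B * A)"
    using assms by (simp add: mat_trace_def scalar_prod_def atLeast0LessThan mult.commute)
  finally show ?thesis .
qed

lemma mat_trace_conj:
  fixes A B C :: "'a::comm_semiring_1 mat"
  assumes "A \<in> carrier_mat n n" "B \<in> carrier_mat n m" "C \<in> carrier_mat m n" "B * C = 1\<^sub>m n"
  shows "mat_trace (C * A * B) = mat_trace A"
proof -
  have "mat_trace (C * (A * B)) = mat_trace (A * B * C)"
    using assms by (intro mat_trace_mult_comm[of _ m n]) auto
  also have "A * B * C = A * (B * C)" by (rule assoc_mult_mat) (use assms in auto)
  also have "\<dots> = A" using assms by simp
  also have "C * (A * B) = C * A * B"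
    by (rule assoc_mult_mat[symmetric]) (use assms in auto)
  finally show ?thesis .
qed

text \<open>A Schur triangular form stays idempotent, so its diagonal entries are roots of x^2 = x
  and the trace counts the ones. Applied to an averaging projection this turns an inner product of
  characters into a natural number.\<close>

lemma trace_idempotent:
  fixes A :: "complex mat"
  assumes A: "A \<in> carrier_mat n n" and idem: "A * A = A"
  shows "mat_trace A \<in> \<nat>"
proof -
  obtain as where "char_poly A = (\<Prod>a\<leftarrow>as. [:- a, 1:])"
    using char_poly_factorized[OF A] by blast
  then obtain B where B: "B \<in> carrier_mat n n" "upper_triangular B" "similar_mat A B"
    using schur_decomposition_exists[OF A] by blast
  then obtain P Q where "similar_mat_wit A B P Q" unfolding similar_mat_def by blast
  from similar_mat_witD2[OF A this]
  have P: "P \<in> carrier_mat n n" and Q: "Q \<in> carrier_mat n n" and PQ: "P * Q = 1\<^sub>m n"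
    and QP: "Q * P = 1\<^sub>m n" and AB: "A = P * B * Q" by auto
  have tr: "mat_trace A = mat_trace B"
    unfolding AB by (rule mat_trace_conj) (use B P Q QP in auto)
  note assoc = assoc_mult_mat[of _ n n _ n _ n]
  have AP: "A * P = P * B"
    using assoc[of "P * B" Q P] B P Q QP unfolding AB by simp
  have "P * (B * B) = A * A * P"
    using AP A B P by (metis assoc)
  also have "\<dots> = P * B" unfolding idem by (rule AP)
  finally have "Q * P * (B * B) = Q * P * B"
    using B P Q by (metis assoc mult_carrier_mat)
  hence BB: "B * B = B" using QP B by simp
  have "B $$ (i, i) \<in> \<nat>" if i: "i < n" for i
  proof -
    have "(B * B) $$ (i, i) = (\<Sum>k<n. B $$ (i, k) * B $$ (k, i))"
      using B i by (simp add: scalar_prod_def atLeast0LessThan)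
    \<comment> \<open>By triangularity one of the two factors vanishes unless
      \<open>k = i\<close>.\<close>
    also have "\<dots> = (\<Sum>k<n. if k = i then B $$ (i, i) * B $$ (i, i) else 0)"
    proof (intro sum.cong refl)
      fix k assume "k \<in> {..<n}"
      hence "k < n" by simp
      thus "B $$ (i, k) * B $$ (k, i) = (if k = i then B $$ (i, i) * B $$ (i, i) else 0)"
        using B i unfolding upper_triangular_def by (cases k i rule: linorder_cases) auto
    qed
    also have "\<dots> = B $$ (i, i) * B $$ (i, i)" using i by simp
    finally have "B $$ (i, i) = 0 \<or> B $$ (i, i) = 1" using BB by (metis mult_cancel_right2)
    thus ?thesis by auto
  qed
  hence "(\<Sum>i<n. B $$ (i, i)) \<in> \<nat>" by (induction n) (auto intro!: Nats_add)
  thus ?thesis using tr B by (simp add: mat_trace_def)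
qed

lemma subspace_vec_iff:
  "VectorSpace.subspace class_ring W (module_vec TYPE(complex) d) \<longleftrightarrow>
     W \<subseteq> carrier_vec d \<and> 0\<^sub>v d \<in> W \<and> (\<forall>v\<in>W. \<forall>w\<in>W. v + w \<in> W) \<and> (\<forall>c. \<forall>v\<in>W. c \<cdot>\<^sub>v v \<in> W)"
proof -
  interpret vec_space "TYPE(complex)" d .
  show ?thesis
    unfolding VectorSpace.subspace_def LinearCombinations.submodule_def
    using vectorspace_axioms module_axioms by (auto simp: module_vec_simps)
qed

text \<open>The combination is formed coordinatewise because vectors of unspecified dimension do not
  form an additive monoid.\<close>

lemma weighted_sum_in_subspace:
  assumes W: "W \<subseteq> carrier_vec d" "0\<^sub>v d \<in> W" "\<forall>v\<in>W. \<forall>w\<in>W. v + w \<in> W"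
      "\<forall>c. \<forall>v\<in>W. c \<cdot>\<^sub>v v \<in> W"
    and "finite A" "\<And>a. a \<in> A \<Longrightarrow> v a \<in> W"
  shows "vec d (\<lambda>i. \<Sum>a\<in>A. c a * v a $ i) \<in> (W :: complex vec set)"
  using assms(5,6)
proof (induction A rule: finite_induct)
  case empty
  have "vec d (\<lambda>i. 0) = (0\<^sub>v d :: complex vec)" by auto
  thus ?case using W by simp
next
  case (insert x A)
  have vx: "v x \<in> carrier_vec d" using insert W by auto
  have "vec d (\<lambda>i. \<Sum>a\<in>insert x A. c a * v a $ i) = c x \<cdot>\<^sub>v v x + vec d (\<lambda>i. \<Sum>a\<in>A. c a * v a $ i)"
    using insert vx by (intro eq_vecI) auto
  thus ?case using insert W by auto
qed

lemma mat_vec_unit: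
  "A \<in> carrier_mat n m \<Longrightarrow> i < n \<Longrightarrow> j < m \<Longrightarrow> (A *\<^sub>v unit_vec m j) $ i = A $$ (i, j)"
  for A :: "complex mat"
  by simp

text \<open>The matrix units averaged over the group intertwine the two representations; Schur's lemma
  makes a nonzero intertwiner invertible.\<close>

lemma (in group) schur_orthogonality:
  assumes fin: "finite (carrier G)"
    and \<chi>: "\<chi> \<in> irreducible_characters G" and \<psi>: "\<psi> \<in> irreducible_characters G"
    and nz: "(\<Sum>g\<in>carrier G. \<chi> g * \<psi> (inv g)) \<noteq> 0"
  shows "\<chi> = \<psi>"
proof -
  obtain d \<rho> where irr1: "is_irreducible_rep G d \<rho>" and \<chi>_def: "\<chi> = rep_character G \<rho>"
    using \<chi> by (auto simp: irreducible_characters_def)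
  obtain e \<sigma> where irr2: "is_irreducible_rep G e \<sigma>" and \<psi>_def: "\<psi> = rep_character G \<sigma>"
    using \<psi> by (auto simp: irreducible_characters_def)
  have rep1: "is_rep G d \<rho>" and rep2: "is_rep G e \<sigma>"
    using irr1 irr2 by (auto simp: is_irreducible_rep_def)
  have c1 [simp]: "\<rho> g \<in> carrier_mat d d" and c2 [simp]: "\<sigma> g \<in> carrier_mat e e" if "g \<in> carrier G" for g
    using rep1 rep2 that by (auto simp: is_rep_def)
  have d1 [simp]: "dim_row (\<rho> g) = d" "dim_col (\<rho> g) = d"
    and d2 [simp]: "dim_row (\<sigma> g) = e" "dim_col (\<sigma> g) = e" if "g \<in> carrier G" for g
    using c1[OF that] c2[OF that] by auto
  have "(\<Sum>g\<in>carrier G. \<chi> g * \<psi> (inv g)) =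
      (\<Sum>g\<in>carrier G. \<Sum>i<d. \<Sum>k<e. \<rho> g $$ (i, i) * \<sigma> (inv g) $$ (k, k))"
    by (intro sum.cong refl) (simp add: \<chi>_def \<psi>_def rep_character_def mat_trace_def sum_product)
  also have "\<dots> = (\<Sum>i<d. \<Sum>g\<in>carrier G. \<Sum>k<e. \<rho> g $$ (i, i) * \<sigma> (inv g) $$ (k, k))"
    by (rule sum.swap)
  also have "\<dots> = (\<Sum>i<d. \<Sum>k<e. \<Sum>g\<in>carrier G. \<rho> g $$ (i, i) * \<sigma> (inv g) $$ (k, k))"
    by (intro sum.cong refl sum.swap)
  finally obtain i0 k0 where i0: "i0 < d" and k0: "k0 < e"
    and nz': "(\<Sum>g\<in>carrier G. \<rho> g $$ (i0, i0) * \<sigma> (inv g) $$ (k0, k0)) \<noteq> 0"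
    using nz by (metis (no_types, lifting) lessThan_iff sum.neutral)
  \<comment> \<open>Up to the factor 1/|G| this is the mean of \<rho>(g) E \<sigma>(inv g) for the
    matrix unit E at (i0, k0); the choice of that position makes the entry of \<open>T\<close> there
    nonzero.\<close>
  define T where "T = mat d e (\<lambda>(i, l). \<Sum>g\<in>carrier G. \<rho> g $$ (i, i0) * \<sigma> (inv g) $$ (k0, l))"
  have T: "T \<in> carrier_mat d e" and T_dims [simp]: "dim_row T = d" "dim_col T = e"
    by (auto simp: T_def)
  have T0: "T $$ (i0, k0) \<noteq> 0" using nz' i0 k0 by (simp add: T_def)
  have inter: "\<rho> h * T = T * \<sigma> h" if h: "h \<in> carrier G" for h
  proof (rule eq_matI)
    fix i l assume "i < dim_row (T * \<sigma> h)" "l < dim_col (T * \<sigma> h)"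
    hence il: "i < d" "l < e" using h by auto
    have "(\<rho> h * T) $$ (i, l) =
        (\<Sum>j<d. \<Sum>g\<in>carrier G. \<rho> h $$ (i, j) * (\<rho> g $$ (j, i0) * \<sigma> (inv g) $$ (k0, l)))"
      using il h by (simp add: scalar_prod_def atLeast0LessThan T_def sum_distrib_left)
    also have "\<dots> = (\<Sum>g\<in>carrier G. \<Sum>j<d. \<rho> h $$ (i, j) * (\<rho> g $$ (j, i0) * \<sigma> (inv g) $$ (k0, l)))"
      by (rule sum.swap)
    also have "\<dots> = (\<Sum>g\<in>carrier G. (\<rho> h * \<rho> g) $$ (i, i0) * \<sigma> (inv g) $$ (k0, l))"
      using il h i0 by (intro sum.cong refl) (simp add: scalar_prod_def atLeast0LessThan sum_distrib_right mult.assoc)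
    also have "\<dots> = (\<Sum>g\<in>carrier G. \<rho> (h \<otimes> g) $$ (i, i0) * \<sigma> (inv g) $$ (k0, l))"
      using h rep1 by (intro sum.cong refl) (simp add: is_rep_def)
    also have "\<dots> = (\<Sum>g\<in>carrier G. \<rho> g $$ (i, i0) * \<sigma> (inv g \<otimes> h) $$ (k0, l))"
    proof (rule sum.reindex_bij_witness[of _ "\<lambda>g. inv h \<otimes> g" "\<lambda>g. h \<otimes> g"])
      fix g assume "g \<in> carrier G"
      thus "\<rho> (h \<otimes> g) $$ (i, i0) * \<sigma> (inv (h \<otimes> g) \<otimes> h) $$ (k0, l) =
          \<rho> (h \<otimes> g) $$ (i, i0) * \<sigma> (inv g) $$ (k0, l)"
        using h by (simp add: inv_mult_group m_assoc)
    qed (use h in \<open>simp_all add: m_assoc[symmetric]\<close>)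
    also have "\<dots> = (\<Sum>g\<in>carrier G. \<rho> g $$ (i, i0) * (\<sigma> (inv g) * \<sigma> h) $$ (k0, l))"
      using h rep2 by (intro sum.cong refl) (simp add: is_rep_def)
    also have "\<dots> = (\<Sum>g\<in>carrier G. \<Sum>j<e. \<rho> g $$ (i, i0) * \<sigma> (inv g) $$ (k0, j) * \<sigma> h $$ (j, l))"
      using il h k0 by (intro sum.cong refl) (simp add: scalar_prod_def atLeast0LessThan sum_distrib_left mult.assoc)
    also have "\<dots> = (\<Sum>j<e. \<Sum>g\<in>carrier G. \<rho> g $$ (i, i0) * \<sigma> (inv g) $$ (k0, j) * \<sigma> h $$ (j, l))"
      by (rule sum.swap)
    also have "\<dots> = (T * \<sigma> h) $$ (i, l)"
      using il h by (simp add: scalar_prod_def atLeast0LessThan T_def sum_distrib_right)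
    finally show "(\<rho> h * T) $$ (i, l) = (T * \<sigma> h) $$ (i, l)" .
  qed (use that in auto)
  \<comment> \<open>The kernel of \<open>T\<close> is invariant under \<sigma> and misses the basis
    vector \<open>k0\<close>, so it is zero.\<close>
  define K where "K = {v \<in> carrier_vec e. T *\<^sub>v v = 0\<^sub>v d}"
  have "VectorSpace.subspace class_ring K (module_vec TYPE(complex) e)"
    unfolding subspace_vec_iff
  proof (intro conjI ballI allI)
    have "T *\<^sub>v 0\<^sub>v e = 0\<^sub>v d"
      by (intro eq_vecI) (auto simp: scalar_prod_def)
    thus "0\<^sub>v e \<in> K" by (simp add: K_def)
  next
    fix v w assume "v \<in> K" "w \<in> K"
    thus "v + w \<in> K" using mult_add_distrib_mat_vec[OF T, of v w] by (simp add: K_def)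
  next
    fix c v assume "v \<in> K"
    thus "c \<cdot>\<^sub>v v \<in> K" using mult_mat_vec[OF T, of v c] by (auto simp: K_def)
  qed (auto simp: K_def)
  moreover have "\<sigma> g *\<^sub>v v \<in> K" if "g \<in> carrier G" "v \<in> K" for g v
  proof -
    have v: "v \<in> carrier_vec e" "T *\<^sub>v v = 0\<^sub>v d" using that by (auto simp: K_def)
    have "T *\<^sub>v (\<sigma> g *\<^sub>v v) = \<rho> g *\<^sub>v (T *\<^sub>v v)"
      using inter[OF that(1)] assoc_mult_mat_vec[OF T c2[OF that(1)] v(1)]
        assoc_mult_mat_vec[OF c1[OF that(1)] T v(1)] by simp
    also have "\<dots> = 0\<^sub>v d" using v that by (intro eq_vecI) auto
    finally show ?thesis using v that by (auto simp: K_def mult_mat_vec_carrier[OF c2[OF that(1)]])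
  qed
  ultimately have "K = {0\<^sub>v e} \<or> K = carrier_vec e"
    using irr2 by (auto simp: is_irreducible_rep_def)
  moreover have "unit_vec e k0 \<notin> K"
  proof
    assume "unit_vec e k0 \<in> K"
    hence "(T *\<^sub>v unit_vec e k0) $ i0 = 0" using i0 by (auto simp: K_def)
    thus False using T0 i0 k0 by simp
  qed
  ultimately have K0: "K = {0\<^sub>v e}" by auto
  \<comment> \<open>The image of \<open>T\<close> is invariant under \<rho> and nonzero, so it is
    the whole space.\<close>
  define I where "I = (\<lambda>v. T *\<^sub>v v) ` carrier_vec e"
  have "VectorSpace.subspace class_ring I (module_vec TYPE(complex) d)"
    unfolding subspace_vec_iff
  proof (intro conjI ballI allI)
    show "I \<subseteq> carrier_vec d" using T by (auto simp: I_def)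
    have "T *\<^sub>v 0\<^sub>v e = 0\<^sub>v d"
      by (intro eq_vecI) (auto simp: scalar_prod_def)
    thus "0\<^sub>v d \<in> I" unfolding I_def by (metis imageI zero_carrier_vec)
  next
    fix v w assume "v \<in> I" "w \<in> I"
    thus "v + w \<in> I" unfolding I_def
      by (auto simp: mult_add_distrib_mat_vec[OF T, symmetric])
  next
    fix c v assume "v \<in> I"
    thus "c \<cdot>\<^sub>v v \<in> I" unfolding I_def
      by (auto simp: mult_mat_vec[OF T, symmetric])
  qed
  moreover have "\<rho> g *\<^sub>v v \<in> I" if g: "g \<in> carrier G" and vI: "v \<in> I" for g v
  proof -
    obtain w where w: "w \<in> carrier_vec e" "v = T *\<^sub>v w"
      using vI unfolding I_def by blast
    have "\<rho> g *\<^sub>v v = T *\<^sub>v (\<sigma> g *\<^sub>v w)"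
      using inter[OF g] assoc_mult_mat_vec[OF T c2[OF g] w(1)]
        assoc_mult_mat_vec[OF c1[OF g] T w(1)] w by simp
    thus ?thesis using w(1) mult_mat_vec_carrier[OF c2[OF g]] by (auto simp: I_def)
  qed
  ultimately have "I = {0\<^sub>v d} \<or> I = carrier_vec d"
    using irr1 by (auto simp: is_irreducible_rep_def)
  moreover have "T *\<^sub>v unit_vec e k0 \<in> I" "T *\<^sub>v unit_vec e k0 \<noteq> 0\<^sub>v d"
    using \<open>unit_vec e k0 \<notin> K\<close> by (auto simp: I_def K_def)
  ultimately have I1: "I = carrier_vec d" by auto
  have "\<forall>j<d. \<exists>v\<in>carrier_vec e. T *\<^sub>v v = unit_vec d j"
    using I1 unfolding I_def by (metis imageE unit_vec_carrier)
  then obtain v where v: "\<And>j. j < d \<Longrightarrow> v j \<in> carrier_vec e \<and> T *\<^sub>v v j = unit_vec d j"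
    by metis
  \<comment> \<open>Preimages of the unit vectors, taken as columns, form a right inverse of
    \<open>T\<close>; injectivity of \<open>T\<close> makes it two-sided.\<close>
  define T' where "T' = mat e d (\<lambda>(i, j). v j $ i)"
  have T': "T' \<in> carrier_mat e d" by (simp add: T'_def)
  have colT': "col T' j = v j" if "j < d" for j
    using that v[OF that] by (intro eq_vecI) (auto simp: T'_def)
  have TT': "T * T' = 1\<^sub>m d"
  proof (rule eq_matI)
    fix i j assume "i < dim_row (1\<^sub>m d :: complex mat)" "j < dim_col (1\<^sub>m d :: complex mat)"
    hence ij: "i < d" "j < d" by auto
    have "(T * T') $$ (i, j) = (T *\<^sub>v v j) $ i"
      using ij T T' colT' by simp
    thus "(T * T') $$ (i, j) = 1\<^sub>m d $$ (i, j)" using v ij by simp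
  qed (use T T' in auto)
  have T'T: "T' * T = 1\<^sub>m e"
  proof (rule eq_matI)
    fix i j assume "i < dim_row (1\<^sub>m e :: complex mat)" "j < dim_col (1\<^sub>m e :: complex mat)"
    hence ij: "i < e" "j < e" by auto
    let ?u = "unit_vec e j :: complex vec"
    let ?w = "T' *\<^sub>v (T *\<^sub>v ?u)"
    have w: "?w \<in> carrier_vec e" using T T' by auto
    have "T *\<^sub>v ?w = (T * T') *\<^sub>v (T *\<^sub>v ?u)"
      using T T' by (intro assoc_mult_mat_vec[symmetric]) auto
    also have "\<dots> = T *\<^sub>v ?u" using TT' T by auto
    finally have "T *\<^sub>v (?w + (-1) \<cdot>\<^sub>v ?u) = 0\<^sub>v d"
      using T w by (simp add: mult_add_distrib_mat_vec[of _ d e] mult_mat_vec[of _ d e], intro eq_vecI) auto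
    hence "?w + (-1) \<cdot>\<^sub>v ?u \<in> K" using w by (auto simp: K_def)
    hence "?w + (-1) \<cdot>\<^sub>v ?u = 0\<^sub>v e" using K0 by simp
    hence "(?w + (-1) \<cdot>\<^sub>v ?u) $ i = 0" using ij by simp
    hence *: "?w $ i = ?u $ i" using ij w T' by simp
    have "(T' * T) $$ (i, j) = ((T' * T) *\<^sub>v ?u) $ i"
      by (rule mat_vec_unit[symmetric]) (use T T' ij in auto)
    also have "(T' * T) *\<^sub>v ?u = ?w" using T T' by (intro assoc_mult_mat_vec) auto
    finally show "(T' * T) $$ (i, j) = 1\<^sub>m e $$ (i, j)" using * ij by simp
  qed (use T T' in auto)
  have "mat_trace (\<rho> g) = mat_trace (\<sigma> g)" if g: "g \<in> carrier G" for g
  proof -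
    have "mat_trace (T' * \<rho> g * T) = mat_trace (\<rho> g)"
      by (rule mat_trace_conj[of _ d _ e]) (use T T' TT' g in auto)
    moreover have "T' * \<rho> g * T = T' * T * \<sigma> g"
      using assoc_mult_mat[OF T' c1[OF g] T] assoc_mult_mat[OF T' T c2[OF g]] inter[OF g] by simp
    ultimately show ?thesis using T'T c2[OF g] by simp
  qed
  thus ?thesis by (auto simp: \<chi>_def \<psi>_def rep_character_def)
qed

section \<open>Monomial representations\<close>

text \<open>Extension by zero turns the sum over a varying index set in \<open>induced\<close> into
  a sum over the whole group.\<close>

definition ext0 :: "'g set \<Rightarrow> ('g \<Rightarrow> complex) \<Rightarrow> 'g \<Rightarrow> complex" where
  "ext0 S f x = (if x \<in> S then f x else 0)"

text \<open>Linear characters handled as plain functions on a subset: nothing is prescribed off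
  \<open>S\<close>, and the second clause rules out the zero function.\<close>

definition lin_char :: "('g, 'm) monoid_scheme \<Rightarrow> 'g set \<Rightarrow> ('g \<Rightarrow> complex) \<Rightarrow> bool" where
  "lin_char G S f \<longleftrightarrow> (\<forall>a\<in>S. \<forall>b\<in>S. f (a \<otimes>\<^bsub>G\<^esub> b) = f a * f b) \<and> f \<one>\<^bsub>G\<^esub> = 1"

context group begin

lemma cancel_inv_left:
  "x \<in> carrier G \<Longrightarrow> y \<in> carrier G \<Longrightarrow> inv x \<otimes> (x \<otimes> y) = y"
  "x \<in> carrier G \<Longrightarrow> y \<in> carrier G \<Longrightarrow> x \<otimes> (inv x \<otimes> y) = y"
  by (simp_all add: m_assoc[symmetric])

lemmas word_simps = m_assoc inv_mult_group cancel_inv_left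

lemma induced_altdef:
  assumes "finite (carrier G)" "g \<in> carrier G"
  shows "induced G S f g = (\<Sum>x\<in>carrier G. ext0 S f (x \<otimes> g \<otimes> inv x)) / of_nat (card S)"
  using assms by (simp add: induced_def ext0_def sum.inter_filter)

text \<open>With \<open>r i\<close> running through representatives of the right cosets of
  \<open>S\<close>, the index with \<open>r i \<otimes> x\<close> in \<open>S\<close> is that of the
  coset of \<open>inv x\<close>. This form gives monomial matrices exactly one nonzero entry in each
  column; the bijection splits sums over the group.\<close>

lemma right_transversal:
  assumes S: "subgroup S G" and fin: "finite (carrier G)"
  shows "\<exists>(d::nat) r. (\<forall>i<d. r i \<in> carrier G) \<and>
    (\<forall>x\<in>carrier G. \<exists>!i. i < d \<and> r i \<otimes> x \<in> S) \<and>
    bij_betw (\<lambda>(i, s). s \<otimes> r i) ({..<d} \<times> S) (carrier G)"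
proof -
  interpret S: subgroup S G by (rule S)
  define d where "d = card (rcosets S)"
  have "finite (rcosets S)" using fin by (auto simp: RCOSETS_def)
  then obtain e where e: "bij_betw e {..<d} (rcosets S)"
    using ex_bij_betw_nat_finite[of "rcosets S"] by (auto simp: d_def atLeast0LessThan)
  have "\<exists>y\<in>carrier G. e i = S #> y" if "i < d" for i
  proof -
    have "e i \<in> rcosets S" using e that by (auto simp: bij_betw_def)
    thus ?thesis by (auto simp: RCOSETS_def)
  qed
  then obtain r where r: "\<And>i. i < d \<Longrightarrow> r i \<in> carrier G \<and> e i = S #> r i" by metis
  have mem: "r i \<otimes> x \<in> S \<longleftrightarrow> e i = S #> inv x" if "i < d" "x \<in> carrier G" for i x
  proof
    assume *: "r i \<otimes> x \<in> S"
    have "r i = (r i \<otimes> x) \<otimes> inv x" using r that by (simp add: m_assoc)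
    hence "r i \<in> S #> inv x" using * by (auto simp: r_coset_def)
    thus "e i = S #> inv x" using r that S repr_independence[of "r i" S "inv x"] by auto
  next
    assume "e i = S #> inv x"
    hence "r i \<in> S #> inv x" using r that S by (metis rcos_self)
    then obtain s where "s \<in> S" "r i = s \<otimes> inv x" by (auto simp: r_coset_def)
    thus "r i \<otimes> x \<in> S" using that by (simp add: m_assoc)
  qed
  have ex1: "\<exists>!i. i < d \<and> r i \<otimes> x \<in> S" if "x \<in> carrier G" for x
  proof -
    have "S #> inv x \<in> rcosets S" using that by (auto simp: RCOSETS_def)
    then obtain i where i: "i < d" "e i = S #> inv x" using e unfolding bij_betw_def by (metis imageE lessThan_iff)
    moreover have "j = i" if "j < d" "e j = e i" for j
      using e that i by (auto simp: bij_betw_def inj_on_def)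
    ultimately show ?thesis using mem that by metis
  qed
  have "bij_betw (\<lambda>(i, s). s \<otimes> r i) ({..<d} \<times> S) (carrier G)"
    unfolding bij_betw_def
  proof
    show "inj_on (\<lambda>(i, s). s \<otimes> r i) ({..<d} \<times> S)"
    proof (rule inj_onI, clarify)
      fix i s j t assume *: "i < d" "s \<in> S" "j < d" "t \<in> S" "s \<otimes> r i = t \<otimes> r j"
      let ?x = "inv (s \<otimes> r i)"
      have ri: "r i \<in> carrier G" "r j \<in> carrier G" "s \<in> carrier G" "t \<in> carrier G" using * r by auto
      have "r i \<otimes> ?x = inv s" using ri by (simp add: word_simps)
      moreover have "r j \<otimes> ?x = inv t" unfolding *(5) using ri by (simp add: word_simps)
      moreover have "?x \<in> carrier G" using ri by simp
      ultimately have "i = j" using ex1[of ?x] * by auto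
      thus "i = j \<and> s = t" using * ri by auto
    qed
    show "(\<lambda>(i, s). s \<otimes> r i) ` ({..<d} \<times> S) = carrier G"
    proof (intro equalityI subsetI)
      fix y assume y: "y \<in> carrier G"
      obtain i where i: "i < d" "r i \<otimes> inv y \<in> S" using ex1[of "inv y"] y by auto
      have "inv (r i \<otimes> inv y) \<otimes> r i = y" using i r y by (simp add: word_simps)
      moreover have "inv (r i \<otimes> inv y) \<in> S" using i by simp
      ultimately show "y \<in> (\<lambda>(i, s). s \<otimes> r i) ` ({..<d} \<times> S)"
        using i by (intro image_eqI[of _ _ "(i, inv (r i \<otimes> inv y))"]) auto
    qed (use r in auto)
  qed
  with r ex1 show ?thesis
    by (intro exI[of _ d] exI[of _ r] conjI allI impI ballI) simp_all
qed

lemma lin_char_inv: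
  assumes "subgroup S G" "lin_char G S f" "a \<in> S"
  shows "f a * f (inv a) = 1" "f a \<noteq> 0" "f (inv a) = inverse (f a)"
proof -
  interpret S: subgroup S G by fact
  have "inv a \<in> S" using assms(3) by (rule S.m_inv_closed)
  hence "f (a \<otimes> inv a) = f a * f (inv a)" using assms unfolding lin_char_def by blast
  moreover have "a \<otimes> inv a = \<one>" using S.mem_carrier[OF assms(3)] by simp
  ultimately show 1: "f a * f (inv a) = 1" using assms by (simp add: lin_char_def)
  thus "f a \<noteq> 0" by auto
  thus "f (inv a) = inverse (f a)" using 1 by (simp add: field_simps)
qed

lemma lin_char_pow:
  assumes "subgroup S G" "lin_char G S f" "a \<in> S"
  shows "f (a [^] (k::nat)) = f a ^ k" "a [^] k \<in> S"
proof -
  interpret S: subgroup S G by fact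
  have "f (a [^] k) = f a ^ k \<and> a [^] k \<in> S"
    by (induction k) (use assms in \<open>auto simp: lin_char_def\<close>)
  thus "f (a [^] k) = f a ^ k" "a [^] k \<in> S" by auto
qed

lemma lin_char_norm:
  assumes "subgroup S G" "lin_char G S f" "a \<in> S" "finite (carrier G)"
  shows "f a ^ Coset.order G = 1" "norm (f a) = 1" "f (inv a) = cnj (f a)"
proof -
  have "a \<in> carrier G" using assms subgroup.mem_carrier by metis
  hence "a [^] Coset.order G = \<one>" by (simp add: pow_order_eq_1)
  thus 1: "f a ^ Coset.order G = 1" using lin_char_pow[OF assms(1-3), of "Coset.order G"] assms(2)
    by (simp add: lin_char_def)
  have "Coset.order G > 0" using assms by (simp add: order_gt_0_iff_finite)
  moreover have "norm (f a) ^ Coset.order G = 1" using 1 by (metis norm_one norm_power)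
  ultimately show 2: "norm (f a) = 1"
    by (metis norm_ge_zero power_eq_1_iff real_norm_def abs_of_nonneg neq0_conv)
  hence "f a * cnj (f a) = 1" by (simp add: complex_norm_square[symmetric])
  thus "f (inv a) = cnj (f a)" using lin_char_inv[OF assms(1-3)]
    by (metis mult_cancel_left)
qed

text \<open>The matrix of the representation induced from \<chi>, in the basis indexed by the coset
  representatives.\<close>

definition monomial_rep :: "'a set \<Rightarrow> ('a \<Rightarrow> complex) \<Rightarrow> nat \<Rightarrow> (nat \<Rightarrow> 'a) \<Rightarrow> 'a \<Rightarrow> complex mat" where
  "monomial_rep S \<chi> d r g = mat d d (\<lambda>(i, j). ext0 S \<chi> (r i \<otimes> g \<otimes> inv (r j)))"

lemma monomial_rep:
  assumes S: "subgroup S G" and fin: "finite (carrier G)" and \<chi>: "lin_char G S \<chi>"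
    and r: "\<And>i. i < d \<Longrightarrow> r i \<in> carrier G"
    and ex1: "\<And>x. x \<in> carrier G \<Longrightarrow> \<exists>!i. i < d \<and> r i \<otimes> x \<in> S"
    and bij: "bij_betw (\<lambda>(i, s). s \<otimes> r i) ({..<d} \<times> S) (carrier G)"
  shows "is_rep G d (monomial_rep S \<chi> d r)"
    and "rep_character G (monomial_rep S \<chi> d r) = induced G S \<chi>"
proof -
  interpret S: subgroup S G by (rule S)
  let ?\<rho> = "monomial_rep S \<chi> d r"
  have uniq: "i = j" if "i < d" "j < d" "r i \<otimes> x \<in> S" "r j \<otimes> x \<in> S" "x \<in> carrier G" for i j x
    using ex1[of x] that by blast
  have d0: "0 < d" using ex1[of \<one>] by auto
  have one: "?\<rho> \<one> = 1\<^sub>m d"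
  proof (rule eq_matI)
    fix i j assume "i < dim_row (1\<^sub>m d :: complex mat)" "j < dim_col (1\<^sub>m d :: complex mat)"
    hence ij: "i < d" "j < d" by auto
    have "r i \<otimes> inv (r j) \<in> S \<longleftrightarrow> i = j"
      using uniq[of i j "inv (r j)"] ij r by auto
    thus "?\<rho> \<one> $$ (i, j) = 1\<^sub>m d $$ (i, j)"
      using ij r \<chi> by (auto simp: monomial_rep_def ext0_def lin_char_def)
  qed (auto simp: monomial_rep_def)
  have mult: "?\<rho> (g \<otimes> h) = ?\<rho> g * ?\<rho> h" if gh: "g \<in> carrier G" "h \<in> carrier G" for g h
  proof (rule eq_matI)
    fix i j assume "i < dim_row (?\<rho> g * ?\<rho> h)" "j < dim_col (?\<rho> g * ?\<rho> h)"
    hence ij: "i < d" "j < d" by (auto simp: monomial_rep_def)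
    have hj: "h \<otimes> inv (r j) \<in> carrier G" using gh ij r by simp
    obtain k where k: "k < d" "r k \<otimes> (h \<otimes> inv (r j)) \<in> S" using ex1[OF hj] by auto
    let ?s = "r k \<otimes> h \<otimes> inv (r j)"
    have s: "?s \<in> S" using k hj gh ij r by (simp add: m_assoc)
    have "(?\<rho> g * ?\<rho> h) $$ (i, j) =
        (\<Sum>l<d. ext0 S \<chi> (r i \<otimes> g \<otimes> inv (r l)) * ext0 S \<chi> (r l \<otimes> h \<otimes> inv (r j)))"
      using ij by (simp add: monomial_rep_def scalar_prod_def atLeast0LessThan)
    \<comment> \<open>Only the summand at \<open>k\<close> survives, as \<open>k\<close> is the
      unique index that moves \<open>h \<otimes> inv (r j)\<close> into \<open>S\<close>.\<close>
    also have "\<dots> = (\<Sum>l<d. if l = k then ext0 S \<chi> (r i \<otimes> g \<otimes> inv (r k)) * \<chi> ?s else 0)"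
    proof (intro sum.cong refl)
      fix l assume "l \<in> {..<d}"
      hence l: "l < d" by simp
      have "r l \<otimes> h \<otimes> inv (r j) \<notin> S" if "l \<noteq> k"
        using uniq[OF l k(1) _ k(2) hj] that l gh ij r by (auto simp: m_assoc)
      thus "ext0 S \<chi> (r i \<otimes> g \<otimes> inv (r l)) * ext0 S \<chi> (r l \<otimes> h \<otimes> inv (r j)) =
          (if l = k then ext0 S \<chi> (r i \<otimes> g \<otimes> inv (r k)) * \<chi> ?s else 0)"
        using s by (auto simp: ext0_def)
    qed
    also have "\<dots> = ext0 S \<chi> (r i \<otimes> g \<otimes> inv (r k)) * \<chi> ?s" using k by simp
    also have "\<dots> = ext0 S \<chi> (r i \<otimes> (g \<otimes> h) \<otimes> inv (r j))"
    proof -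
      let ?t = "r i \<otimes> g \<otimes> inv (r k)"
      have t: "?t \<in> carrier G" using gh ij k r by simp
      have eq: "r i \<otimes> (g \<otimes> h) \<otimes> inv (r j) = ?t \<otimes> ?s"
        using gh ij k r by (simp add: word_simps)
      have "?t \<otimes> ?s \<in> S \<longleftrightarrow> ?t \<in> S"
      proof
        assume "?t \<otimes> ?s \<in> S"
        hence "?t \<otimes> ?s \<otimes> inv ?s \<in> S" using s by blast
        also have "?t \<otimes> ?s \<otimes> inv ?s = ?t" using t S.mem_carrier[OF s] by (simp only: inv_solve_right' m_closed)
        finally show "?t \<in> S" .
      qed (use s in auto)
      thus ?thesis unfolding eq using s \<chi> by (auto simp: ext0_def lin_char_def)
    qed
    finally show "?\<rho> (g \<otimes> h) $$ (i, j) = (?\<rho> g * ?\<rho> h) $$ (i, j)"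
      using ij by (simp add: monomial_rep_def)
  qed (auto simp: monomial_rep_def)
  show "is_rep G d ?\<rho>" using d0 one mult by (auto simp: is_rep_def monomial_rep_def)
  show "rep_character G ?\<rho> = induced G S \<chi>"
  proof
    fix g show "rep_character G ?\<rho> g = induced G S \<chi> g"
    proof (cases "g \<in> carrier G")
      case True
      let ?F = "\<lambda>x. ext0 S \<chi> (x \<otimes> g \<otimes> inv x)"
      \<comment> \<open>Conjugating by elements of \<open>S\<close> changes nothing, so the sum over
        the group in \<open>induced\<close> is |S| times the sum over the representatives, which is
        the trace.\<close>
      have conj: "?F (s \<otimes> r i) = ?F (r i)" if "i < d" "s \<in> S" for i s
      proof -
        let ?y = "r i \<otimes> g \<otimes> inv (r i)"
        have y: "?y \<in> carrier G" using r that True by simp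
        have sc: "s \<in> carrier G" using that by simp
        have eq: "s \<otimes> r i \<otimes> g \<otimes> inv (s \<otimes> r i) = s \<otimes> ?y \<otimes> inv s"
          using r that True sc by (simp add: word_simps)
        have "s \<otimes> ?y \<otimes> inv s \<in> S \<longleftrightarrow> ?y \<in> S"
        proof
          assume *: "s \<otimes> ?y \<otimes> inv s \<in> S"
          have "?y = inv s \<otimes> (s \<otimes> ?y \<otimes> inv s) \<otimes> s"
            using y sc by (simp add: word_simps)
          thus "?y \<in> S" using * that by (metis S.m_closed S.m_inv_closed)
        qed (use that in auto)
        moreover have "\<chi> (s \<otimes> ?y \<otimes> inv s) = \<chi> ?y" if "?y \<in> S"
        proof -
          have "\<chi> (s \<otimes> ?y \<otimes> inv s) = \<chi> s * \<chi> ?y * \<chi> (inv s)"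
            using \<chi> that \<open>s \<in> S\<close> by (simp add: lin_char_def)
          also have "\<dots> = \<chi> ?y" using lin_char_inv(1)[OF S \<chi> \<open>s \<in> S\<close>] by (simp add: mult_ac)
          finally show ?thesis .
        qed
        ultimately show ?thesis unfolding eq ext0_def by simp
      qed
      have "(\<Sum>x\<in>carrier G. ?F x) = (\<Sum>(i, s)\<in>{..<d} \<times> S. ?F (s \<otimes> r i))"
        using sum.reindex_bij_betw[OF bij, of ?F] by (simp add: case_prod_unfold)
      also have "\<dots> = (\<Sum>i<d. \<Sum>s\<in>S. ?F (s \<otimes> r i))" by (simp add: sum.cartesian_product)
      also have "\<dots> = (\<Sum>i<d. \<Sum>s\<in>S. ?F (r i))" by (intro sum.cong refl conj) auto
      also have "\<dots> = of_nat (card S) * (\<Sum>i<d. ?F (r i))" by (simp add: sum_distrib_left)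
      finally have "(\<Sum>x\<in>carrier G. ?F x) = of_nat (card S) * (\<Sum>i<d. ?F (r i))" .
      moreover have "card S \<noteq> 0" using S.finite_imp_card_positive[OF fin] by simp
      ultimately show ?thesis using True fin
        by (simp add: induced_altdef rep_character_def mat_trace_def monomial_rep_def)
    qed (auto simp: rep_character_def induced_def)
  qed
qed

lemma induced_character:
  assumes "subgroup S G" "finite (carrier G)" "lin_char G S \<chi>"
  shows "induced G S \<chi> \<in> characters G"
proof -
  obtain d :: nat and r where "\<And>i. i < d \<Longrightarrow> r i \<in> carrier G"
    "\<And>x. x \<in> carrier G \<Longrightarrow> \<exists>!i. i < d \<and> r i \<otimes> x \<in> S"
    "bij_betw (\<lambda>(i, s). s \<otimes> r i) ({..<d} \<times> S) (carrier G)"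
    using right_transversal[OF assms(1,2)] by metis
  from monomial_rep[OF assms this] show ?thesis
    unfolding characters_def by (metis (mono_tags, lifting) mem_Collect_eq)
qed

text \<open>The averaging operator attached to \<open>\<chi>\<close> is a multiple of the projection onto the basis vector
  of the trivial coset, and that vector generates the representation.\<close>

lemma induced_irreducible:
  assumes S: "subgroup S G" and fin: "finite (carrier G)" and \<chi>: "lin_char G S \<chi>"
    and mackey: "\<And>x. x \<in> carrier G - S \<Longrightarrow>
      \<exists>h\<in>S. x \<otimes> h \<otimes> inv x \<in> S \<and> \<chi> (x \<otimes> h \<otimes> inv x) \<noteq> \<chi> h"
  shows "induced G S \<chi> \<in> irreducible_characters G"
proof -
  interpret S: subgroup S G by (rule S)
  obtain d :: nat and r where r: "\<And>i. i < d \<Longrightarrow> r i \<in> carrier G"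
    and ex1: "\<And>x. x \<in> carrier G \<Longrightarrow> \<exists>!i. i < d \<and> r i \<otimes> x \<in> S"
    and bij: "bij_betw (\<lambda>(i, s). s \<otimes> r i) ({..<d} \<times> S) (carrier G)"
    using right_transversal[OF S fin] by metis
  let ?\<rho> = "monomial_rep S \<chi> d r"
  have rep: "is_rep G d ?\<rho>" and tr: "rep_character G ?\<rho> = induced G S \<chi>"
    using monomial_rep[OF S fin \<chi> r ex1 bij] by auto
  have uniq: "i = j" if "i < d" "j < d" "r i \<otimes> x \<in> S" "r j \<otimes> x \<in> S" "x \<in> carrier G" for i j x
    using ex1[of x] that by blast
  obtain i0 where i0: "i0 < d" "r i0 \<otimes> \<one> \<in> S" using ex1[of \<one>] by auto
  have r0: "r i0 \<in> S" using i0 r by simp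
  have r0': "r i \<in> S \<longleftrightarrow> i = i0" if "i < d" for i using uniq[of i i0 \<one>] that i0 r by auto
  have fS: "finite S" using fin S.subset finite_subset by blast
  define P where "P i j = (\<Sum>s\<in>S. \<chi> (inv s) * ?\<rho> s $$ (i, j))" for i j
  have P: "P i j = (if i = i0 \<and> j = i0 then of_nat (card S) else 0)" if ij: "i < d" "j < d" for i j
  proof (cases "i = i0")
    case True
    have "r i0 \<otimes> s \<otimes> inv (r j) \<in> S \<longleftrightarrow> j = i0" if "s \<in> S" for s
    proof
      assume *: "r i0 \<otimes> s \<otimes> inv (r j) \<in> S"
      have "r j = inv (r i0 \<otimes> s \<otimes> inv (r j)) \<otimes> (r i0 \<otimes> s)"
        using r ij that i0 by (simp add: word_simps)
      hence "r j \<in> S" using * r0 that by (metis S.m_closed S.m_inv_closed)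
      thus "j = i0" using r0' ij by simp
    qed (use r0 that in auto)
    moreover have "\<chi> (inv s) * \<chi> (r i0 \<otimes> s \<otimes> inv (r i0)) = 1" if "s \<in> S" for s
      using lin_char_inv[OF S \<chi> that] lin_char_inv[OF S \<chi> r0] \<chi> that r0
      by (simp add: lin_char_def field_simps)
    ultimately show ?thesis using True ij i0 by (auto simp: P_def monomial_rep_def ext0_def)
  next
    case False
    hence "r i \<in> carrier G - S" using r0' ij r by auto
    from mackey[OF this] obtain h where h: "h \<in> S" "r i \<otimes> h \<otimes> inv (r i) \<in> S"
      "\<chi> (r i \<otimes> h \<otimes> inv (r i)) \<noteq> \<chi> h" by auto
    let ?k = "r i \<otimes> h \<otimes> inv (r i)"
    \<comment> \<open>Substituting \<open>h \<otimes> s\<close> for \<open>s\<close> shows that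
      \<open>P i j\<close> equals itself times \<open>\<chi> (inv h) * \<chi> ?k\<close>, which the
      choice of \<open>h\<close> makes different from 1.\<close>
    have "P i j = (\<Sum>s\<in>S. \<chi> (inv (h \<otimes> s)) * ?\<rho> (h \<otimes> s) $$ (i, j))"
      unfolding P_def
      by (rule sum.reindex_bij_witness[of _ "\<lambda>s. h \<otimes> s" "\<lambda>s. inv h \<otimes> s"])
        (use h in \<open>auto simp: word_simps\<close>)
    also have "\<dots> = (\<Sum>s\<in>S. \<chi> (inv h) * \<chi> ?k * (\<chi> (inv s) * ?\<rho> s $$ (i, j)))"
    proof (intro sum.cong refl)
      fix s assume s: "s \<in> S"
      let ?t = "r i \<otimes> s \<otimes> inv (r j)"
      have t: "?t \<in> carrier G" using r ij s by simp
      have eq: "r i \<otimes> (h \<otimes> s) \<otimes> inv (r j) = ?k \<otimes> ?t"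
        using r ij s h by (simp add: word_simps)
      have "?k \<otimes> ?t \<in> S \<longleftrightarrow> ?t \<in> S"
      proof
        assume *: "?k \<otimes> ?t \<in> S"
        have "?t = inv ?k \<otimes> (?k \<otimes> ?t)" using t h S.mem_carrier[OF h(2)] by (simp only: m_assoc[symmetric] inv_closed l_inv l_one)
        thus "?t \<in> S" using * h by (metis S.m_closed S.m_inv_closed)
      qed (use h in auto)
      hence "?\<rho> (h \<otimes> s) $$ (i, j) = \<chi> ?k * ?\<rho> s $$ (i, j)"
        using ij h \<chi> unfolding monomial_rep_def by (auto simp: eq ext0_def lin_char_def)
      moreover have "\<chi> (inv (h \<otimes> s)) = \<chi> (inv h) * \<chi> (inv s)"
        using h s \<chi> by (simp add: inv_mult_group lin_char_def)
      ultimately show "\<chi> (inv (h \<otimes> s)) * ?\<rho> (h \<otimes> s) $$ (i, j) =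
          \<chi> (inv h) * \<chi> ?k * (\<chi> (inv s) * ?\<rho> s $$ (i, j))" by simp
    qed
    also have "\<dots> = \<chi> (inv h) * \<chi> ?k * P i j" by (simp add: P_def sum_distrib_left)
    finally have "P i j = 0 \<or> \<chi> (inv h) * \<chi> ?k = 1" by (metis mult_cancel_right2)
    moreover have "\<chi> (inv h) * \<chi> ?k \<noteq> 1"
    proof
      assume *: "\<chi> (inv h) * \<chi> ?k = 1"
      have "\<chi> ?k = \<chi> h * \<chi> (inv h) * \<chi> ?k" unfolding lin_char_inv(1)[OF S \<chi> h(1)] by simp
      also have "\<dots> = \<chi> h" using * by (simp add: mult.assoc)
      finally show False using h(3) by contradiction
    qed
    ultimately show ?thesis using False by simp
  qed
  have "W = {0\<^sub>v d} \<or> W = carrier_vec d"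
    if sub: "VectorSpace.subspace class_ring W (module_vec TYPE(complex) d)"
      and inv: "\<forall>g\<in>carrier G. \<forall>w\<in>W. ?\<rho> g *\<^sub>v w \<in> W" for W
  proof -
    note W = sub[unfolded subspace_vec_iff]
    have Wc: "W \<subseteq> carrier_vec d" and W0: "0\<^sub>v d \<in> W" and Wadd: "\<forall>v\<in>W. \<forall>w\<in>W. v + w \<in> W"
      and Wsm: "\<forall>c. \<forall>v\<in>W. c \<cdot>\<^sub>v v \<in> W" using W by auto
    show ?thesis
    proof (cases "W = {0\<^sub>v d}")
      case False
      then obtain w where w: "w \<in> W" "w \<noteq> 0\<^sub>v d" using W0 by blast
      have wc: "w \<in> carrier_vec d" using w Wc by auto
      have "\<exists>j<d. w $ j \<noteq> 0"
      proof (rule ccontr)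
        assume "\<not> (\<exists>j<d. w $ j \<noteq> 0)"
        hence "w = 0\<^sub>v d" using wc by (intro eq_vecI) auto
        thus False using w by simp
      qed
      then obtain j where j: "j < d" "w $ j \<noteq> 0" by blast
      \<comment> \<open>Acting with \<open>r j\<close> moves the nonzero coordinate \<open>j\<close>
        to the index \<open>i0\<close>, up to the factor \<open>\<chi> (r i0)\<close>, where the
        averaging operator can see it.\<close>
      define w' where "w' = ?\<rho> (r j) *\<^sub>v w"
      have w': "w' \<in> W" using inv w r j by (simp add: w'_def)
      have w'c: "w' \<in> carrier_vec d" using w' Wc by auto
      have "w' $ i0 = (\<Sum>k<d. ext0 S \<chi> (r i0 \<otimes> r j \<otimes> inv (r k)) * w $ k)"
        using wc i0 by (simp add: w'_def monomial_rep_def scalar_prod_def atLeast0LessThan)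
      also have "\<dots> = (\<Sum>k<d. if k = j then \<chi> (r i0) * w $ j else 0)"
      proof (intro sum.cong refl)
        fix k assume "k \<in> {..<d}"
        hence k: "k < d" by simp
        have "r i0 \<otimes> r j \<otimes> inv (r k) \<in> S \<longleftrightarrow> k = j"
        proof
          assume *: "r i0 \<otimes> r j \<otimes> inv (r k) \<in> S"
          have "r k \<otimes> inv (r j) = inv (r i0 \<otimes> r j \<otimes> inv (r k)) \<otimes> r i0"
            using r k j i0 by (simp add: word_simps)
          hence "r k \<otimes> inv (r j) \<in> S" using * r0 by (metis S.m_closed S.m_inv_closed)
          thus "k = j" using uniq[of k j "inv (r j)"] k j r by simp
        qed (use r j i0 r0 in \<open>simp add: m_assoc\<close>)
        thus "ext0 S \<chi> (r i0 \<otimes> r j \<otimes> inv (r k)) * w $ k = (if k = j then \<chi> (r i0) * w $ j else 0)"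
          using r j i0 by (auto simp: ext0_def m_assoc)
      qed
      also have "\<dots> = \<chi> (r i0) * w $ j" using j by simp
      finally have w'0: "w' $ i0 \<noteq> 0" using lin_char_inv[OF S \<chi> r0] j by simp
      define u where "u = vec d (\<lambda>i. \<Sum>s\<in>S. \<chi> (inv s) * (?\<rho> s *\<^sub>v w') $ i)"
      have u: "u \<in> W" unfolding u_def
        by (rule weighted_sum_in_subspace[OF Wc W0 Wadd Wsm fS]) (use inv w' in auto)
      have ueq: "u = (of_nat (card S) * w' $ i0) \<cdot>\<^sub>v unit_vec d i0"
      proof (rule eq_vecI)
        fix i assume "i < dim_vec ((of_nat (card S) * w' $ i0) \<cdot>\<^sub>v unit_vec d i0)"
        hence i: "i < d" by simp
        have "u $ i = (\<Sum>s\<in>S. \<Sum>k<d. \<chi> (inv s) * (?\<rho> s $$ (i, k) * w' $ k))"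
          using i w'c by (simp add: u_def monomial_rep_def scalar_prod_def atLeast0LessThan sum_distrib_left)
        also have "\<dots> = (\<Sum>k<d. P i k * w' $ k)"
          unfolding P_def by (subst sum.swap) (simp add: sum_distrib_right mult.assoc)
        also have "\<dots> = (\<Sum>k<d. if k = i0 then (if i = i0 then of_nat (card S) * w' $ i0 else 0) else 0)"
          using i by (intro sum.cong refl) (simp add: P)
        also have "\<dots> = ((of_nat (card S) * w' $ i0) \<cdot>\<^sub>v unit_vec d i0) $ i"
          using i i0 by (simp add: unit_vec_def)
        finally show "u $ i = ((of_nat (card S) * w' $ i0) \<cdot>\<^sub>v unit_vec d i0) $ i" .
      qed (simp add: u_def)
      have c0: "of_nat (card S) * w' $ i0 \<noteq> 0"
        using w'0 S.finite_imp_card_positive[OF fin] by simp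
      define c where "c = of_nat (card S) * w' $ i0"
      have "inverse c \<cdot>\<^sub>v u = unit_vec d i0"
        using c0 unfolding ueq c_def[symmetric] by (simp add: smult_smult_assoc)
      hence e0: "unit_vec d i0 \<in> W" using u Wsm by metis
      \<comment> \<open>\<open>inv (r k)\<close> carries the basis vector \<open>i0\<close> to a
        nonzero multiple of the basis vector \<open>k\<close>.\<close>
      have ek: "unit_vec d k \<in> W" if k: "k < d" for k
      proof -
        have "?\<rho> (inv (r k)) *\<^sub>v unit_vec d i0 = \<chi> (inv (r i0)) \<cdot>\<^sub>v unit_vec d k"
        proof (rule eq_vecI)
          fix i assume "i < dim_vec (\<chi> (inv (r i0)) \<cdot>\<^sub>v unit_vec d k)"
          hence i: "i < d" by simp
          have "r i \<otimes> inv (r k) \<otimes> inv (r i0) \<in> S \<longleftrightarrow> i = k"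
          proof
            assume *: "r i \<otimes> inv (r k) \<otimes> inv (r i0) \<in> S"
            have "r i \<otimes> inv (r k) = r i \<otimes> inv (r k) \<otimes> inv (r i0) \<otimes> r i0"
              using r k i i0 by (simp add: m_assoc)
            hence "r i \<otimes> inv (r k) \<in> S" using * r0 by (metis S.m_closed)
            thus "i = k" using uniq[of i k "inv (r k)"] k i r by simp
          qed (use r k i0 r0 in simp)
          moreover have "(?\<rho> (inv (r k)) *\<^sub>v unit_vec d i0) $ i = ?\<rho> (inv (r k)) $$ (i, i0)"
            by (rule mat_vec_unit[of _ d d]) (use i i0 in \<open>auto simp: monomial_rep_def\<close>)
          moreover have "r k \<otimes> inv (r k) \<otimes> inv (r i0) = inv (r i0)" using r k i0 by simp
          ultimately show "(?\<rho> (inv (r k)) *\<^sub>v unit_vec d i0) $ i = (\<chi> (inv (r i0)) \<cdot>\<^sub>v unit_vec d k) $ i"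
            using i i0 k by (auto simp: monomial_rep_def ext0_def unit_vec_def)
        qed (simp add: monomial_rep_def)
        hence "\<chi> (inv (r i0)) \<cdot>\<^sub>v unit_vec d k \<in> W" using inv e0 r k by (metis inv_closed)
        hence "\<chi> (r i0) \<cdot>\<^sub>v (\<chi> (inv (r i0)) \<cdot>\<^sub>v unit_vec d k) \<in> W" using Wsm by blast
        thus ?thesis using lin_char_inv[OF S \<chi> r0] by (simp add: smult_smult_assoc)
      qed
      have "v \<in> W" if v: "v \<in> carrier_vec d" for v
      proof -
        have "vec d (\<lambda>i. \<Sum>k\<in>{..<d}. v $ k * unit_vec d k $ i) \<in> W"
          by (rule weighted_sum_in_subspace[OF Wc W0 Wadd Wsm]) (use ek in auto)
        also have "vec d (\<lambda>i. \<Sum>k\<in>{..<d}. v $ k * unit_vec d k $ i) = v"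
        proof (rule eq_vecI)
          fix i assume "i < dim_vec v"
          hence i: "i < d" using v by simp
          have "(\<Sum>k<d. v $ k * unit_vec d k $ i) = (\<Sum>k<d. if k = i then v $ k else 0)"
            using i by (intro sum.cong refl) (auto simp: unit_vec_def)
          thus "vec d (\<lambda>i. \<Sum>k\<in>{..<d}. v $ k * unit_vec d k $ i) $ i = v $ i" using i by simp
        qed (use v in simp)
        finally show ?thesis .
      qed
      thus ?thesis using Wc by auto
    qed simp
  qed
  hence "is_irreducible_rep G d ?\<rho>" using rep by (auto simp: is_irreducible_rep_def)
  thus ?thesis unfolding irreducible_characters_def tr[symmetric] by blast
qed

end

section \<open>Extensions of linear characters\<close>

lemma norm_one_mult_cnj: "norm z = 1 \<Longrightarrow> z * cnj z = 1" for z :: complex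
  by (simp add: complex_norm_square[symmetric])

lemma norm_one_mult_cnj_eq:
  fixes w z :: complex
  assumes "norm z = 1" "w * cnj z = 1"
  shows "w = z"
proof -
  have "w = w * (z * cnj z)" using norm_one_mult_cnj[OF assms(1)] by simp
  also have "\<dots> = w * cnj z * z" by (simp add: mult_ac)
  finally show ?thesis using assms by simp
qed

lemma norm_one_Re_one:
  fixes z :: complex
  assumes "norm z = 1" "Re z = 1"
  shows "z = 1"
  using assms cmod_power2[of z] by (simp add: complex_eq_iff)

text \<open>The vanishing argument for character sums: a sum that a change of variables multiplies
  by \<open>w\<close> is zero unless \<open>w\<close> is 1.\<close>

lemma eq_scaled_imp: "z = w * z \<Longrightarrow> z = 0 \<or> w = 1" for w z :: complex
  by simp

lemma eq_scaled_imp': "z = z * w \<Longrightarrow> z = 0 \<or> w = 1" for w z :: complex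
  by simp

context group begin

text \<open>The hypothesis on commutators, applied to \<open>x \<otimes> s\<close> and
  \<open>inv x\<close>. Conjugation within \<open>S\<close> thus amounts to right translation by
  elements on which \<chi> is 1.\<close>

lemma conj_eq_mult:
  assumes S: "subgroup S G"
    and comm: "\<And>a b. a \<in> S \<Longrightarrow> b \<in> S \<Longrightarrow> \<exists>c\<in>H. a \<otimes> b = (b \<otimes> a) \<otimes> c \<and> \<chi> c = (1::complex)"
    and xs: "x \<in> S" "s \<in> S"
  shows "\<exists>c\<in>H. x \<otimes> s \<otimes> inv x = s \<otimes> c \<and> \<chi> c = 1"
proof -
  interpret S: subgroup S G by (rule S)
  obtain c where c: "c \<in> H" "(x \<otimes> s) \<otimes> inv x = (inv x \<otimes> (x \<otimes> s)) \<otimes> c" "\<chi> c = 1"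
    using comm[of "x \<otimes> s" "inv x"] xs by blast
  have "inv x \<otimes> (x \<otimes> s) = s" using xs by (simp add: cancel_inv_left)
  thus ?thesis using c by auto
qed

text \<open>The subgroup generated by \<open>H\<close> and \<open>x\<close> consists of the products
  h x^i, because \<open>x\<close> normalises \<open>H\<close> and leaves \<chi> invariant. The
  prescription \<chi> h * \<zeta>^i is well defined precisely when \<zeta>^m = \<chi> (x^m); leaving
  the root \<zeta> free yields different extensions later.\<close>

lemma lin_char_extend1:
  assumes S: "subgroup S G" and H: "subgroup H G" and HS: "H \<subseteq> S" and fin: "finite (carrier G)"
    and \<chi>: "lin_char G H \<chi>"
    and comm: "\<And>a b. a \<in> S \<Longrightarrow> b \<in> S \<Longrightarrow> \<exists>c\<in>H. a \<otimes> b = (b \<otimes> a) \<otimes> c \<and> \<chi> c = 1"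
    and x: "x \<in> S" and m: "0 < m" "x [^] (m::nat) \<in> H" "\<And>k. 0 < k \<Longrightarrow> k < m \<Longrightarrow> x [^] k \<notin> H"
    and \<zeta>: "\<zeta> ^ m = \<chi> (x [^] m)"
  shows "\<exists>H' \<chi>'. subgroup H' G \<and> H \<subseteq> H' \<and> H' \<subseteq> S \<and> x \<in> H' \<and> lin_char G H' \<chi>' \<and>
    (\<forall>h\<in>H. \<chi>' h = \<chi> h) \<and> \<chi>' x = \<zeta>"
proof -
  interpret S: subgroup S G by (rule S)
  interpret H: subgroup H G by (rule H)
  have xc: "x \<in> carrier G" using x by simp
  have powS: "x [^] (i::nat) \<in> S" for i by (induction i) (use x in auto)
  \<comment> \<open>Division of the exponent by \<open>m\<close>: minimality of \<open>m\<close>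
    forces the remainder to be 0.\<close>
  have pow: "m dvd i \<and> \<chi> (x [^] i) = \<zeta> ^ i" if "x [^] i \<in> H" for i :: nat
  proof -
    define q r where "q = i div m" and "r = i mod m"
    have i: "i = m * q + r" by (simp add: q_def r_def)
    have mq: "x [^] (m * q) \<in> H" "\<chi> (x [^] (m * q)) = \<zeta> ^ (m * q)"
      using lin_char_pow[OF H \<chi> m(2), of q] \<zeta> xc by (simp_all add: nat_pow_pow power_mult)
    have "x [^] r = inv (x [^] (m * q)) \<otimes> x [^] i"
      unfolding i using xc by (simp add: nat_pow_mult[symmetric] cancel_inv_left)
    hence "x [^] r \<in> H" using mq that by simp
    moreover have "r < m" using m(1) by (simp add: r_def)
    ultimately have "r = 0" using m(3)[of r] by auto
    thus ?thesis using mq i by simp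
  qed
  have \<chi>m: "\<chi> (a \<otimes> b) = \<chi> a * \<chi> b" if "a \<in> H" "b \<in> H" for a b
    using \<chi> that by (simp add: lin_char_def)
  have wd1: "\<chi> h * \<zeta> ^ i = \<chi> h' * \<zeta> ^ j"
    if hh: "h \<in> H" "h' \<in> H" and eq: "h \<otimes> x [^] i = h' \<otimes> x [^] j" and ij: "i \<le> j" for h h' and i j :: nat
  proof -
    have j: "x [^] j = x [^] (j - i) \<otimes> x [^] i" using ij xc by (simp add: nat_pow_mult)
    have "h \<otimes> x [^] i = (h' \<otimes> x [^] (j - i)) \<otimes> x [^] i"
      using eq hh xc by (simp add: j m_assoc)
    hence h: "h = h' \<otimes> x [^] (j - i)" using hh xc by simp
    hence "x [^] (j - i) = inv h' \<otimes> h" using hh xc by (simp add: cancel_inv_left)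
    hence mem: "x [^] (j - i) \<in> H" using hh by simp
    have "\<chi> h = \<chi> h' * \<zeta> ^ (j - i)" unfolding h using \<chi>m[OF hh(2) mem] pow[OF mem] by simp
    thus ?thesis using ij by (simp add: mult.assoc power_add[symmetric])
  qed
  have wd: "\<chi> h * \<zeta> ^ i = \<chi> h' * \<zeta> ^ j"
    if "h \<in> H" "h' \<in> H" "h \<otimes> x [^] i = h' \<otimes> x [^] j" for h h' and i j :: nat
    using wd1[OF that] wd1[OF that(2,1) that(3)[symmetric]] by (metis nat_le_linear)
  define H' where "H' = {h \<otimes> x [^] i | h i. h \<in> H \<and> (i::nat) \<in> UNIV}"
  define \<chi>' where "\<chi>' y = (SOME v. \<exists>h\<in>H. \<exists>i::nat. y = h \<otimes> x [^] i \<and> v = \<chi> h * \<zeta> ^ i)" for y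
  have \<chi>': "\<chi>' (h \<otimes> x [^] i) = \<chi> h * \<zeta> ^ i" if "h \<in> H" for h and i :: nat
    unfolding \<chi>'_def
  proof (rule some_equality)
    show "\<exists>h'\<in>H. \<exists>j::nat. h \<otimes> x [^] i = h' \<otimes> x [^] j \<and> \<chi> h * \<zeta> ^ i = \<chi> h' * \<zeta> ^ j"
      using that by blast
  next
    fix v assume "\<exists>h'\<in>H. \<exists>j::nat. h \<otimes> x [^] i = h' \<otimes> x [^] j \<and> v = \<chi> h' * \<zeta> ^ j"
    then obtain h' and j :: nat where "h' \<in> H" "h \<otimes> x [^] i = h' \<otimes> x [^] j" "v = \<chi> h' * \<zeta> ^ j" by blast
    thus "v = \<chi> h * \<zeta> ^ i" using wd[OF that, of h' i j] by simp
  qed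
  have move: "\<exists>h''\<in>H. x [^] i \<otimes> h = h'' \<otimes> x [^] i \<and> \<chi> h'' = \<chi> h" if h: "h \<in> H" for h and i :: nat
  proof -
    obtain c where c: "c \<in> H" "x [^] i \<otimes> h \<otimes> inv (x [^] i) = h \<otimes> c" "\<chi> c = 1"
      using conj_eq_mult[OF S comm powS[of i], of h] HS h by blast
    have "x [^] i \<otimes> h = (x [^] i \<otimes> h \<otimes> inv (x [^] i)) \<otimes> x [^] i"
      using h xc by (simp add: m_assoc)
    also have "\<dots> = (h \<otimes> c) \<otimes> x [^] i" using c by simp
    finally show ?thesis using c h \<chi>m by (intro bexI[of _ "h \<otimes> c"]) auto
  qed
  have prod: "\<exists>k\<in>H. (h \<otimes> x [^] i) \<otimes> (h' \<otimes> x [^] j) = k \<otimes> x [^] (i + j) \<and> \<chi> k = \<chi> h * \<chi> h'"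
    if hh: "h \<in> H" "h' \<in> H" for h h' and i j :: nat
  proof -
    obtain h'' where h'': "h'' \<in> H" "x [^] i \<otimes> h' = h'' \<otimes> x [^] i" "\<chi> h'' = \<chi> h'"
      using move[OF hh(2)] by blast
    have "(h \<otimes> x [^] i) \<otimes> (h' \<otimes> x [^] j) = h \<otimes> (x [^] i \<otimes> h') \<otimes> x [^] j"
      using hh xc by (simp add: m_assoc)
    also have "\<dots> = (h \<otimes> h'') \<otimes> x [^] (i + j)"
      unfolding h''(2) using hh h'' xc by (simp add: m_assoc nat_pow_mult)
    finally show ?thesis using h'' hh \<chi>m by (intro bexI[of _ "h \<otimes> h''"]) auto
  qed
  have inH': "h \<otimes> x [^] i \<in> H'" if "h \<in> H" for h and i :: nat using that by (auto simp: H'_def)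
  have HH': "h \<in> H'" if "h \<in> H" for h using inH'[OF that, of 0] that by simp
  have H'S: "H' \<subseteq> S" using HS powS by (auto simp: H'_def)
  have sub: "subgroup H' G"
  proof (rule subgroupI)
    show "H' \<subseteq> carrier G" using H'S S.subset by blast
    show "H' \<noteq> {}" using HH'[of \<one>] by auto
  next
    fix a assume "a \<in> H'"
    then obtain h and i :: nat where a: "h \<in> H" "a = h \<otimes> x [^] i" by (auto simp: H'_def)
    \<comment> \<open>Elements of \<open>H'\<close> carry natural exponents, so the inverse of x^i
      is rewritten as a nonnegative power through the order of the group.\<close>
    let ?k = "i * (Coset.order G - 1)"
    have "Coset.order G > 0" using fin by (simp add: order_gt_0_iff_finite)
    hence "i + ?k = Coset.order G * i" by (cases "Coset.order G") auto
    hence "x [^] ?k \<otimes> x [^] i = (x [^] Coset.order G) [^] i"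
      using xc by (simp add: nat_pow_mult nat_pow_pow add.commute)
    also have "\<dots> = \<one>" using xc by (simp add: pow_order_eq_1)
    finally have k: "inv (x [^] i) = x [^] ?k" using xc by (intro inv_equality) auto
    obtain h'' where "h'' \<in> H" "x [^] ?k \<otimes> inv h = h'' \<otimes> x [^] ?k"
      using move[of "inv h" ?k] a by auto
    thus "inv a \<in> H'" using a xc k inH' by (simp add: inv_mult_group)
  next
    fix a b assume "a \<in> H'" "b \<in> H'"
    then obtain h h' and i j :: nat where "h \<in> H" "a = h \<otimes> x [^] i" "h' \<in> H" "b = h' \<otimes> x [^] j"
      by (auto simp: H'_def)
    thus "a \<otimes> b \<in> H'" using prod[of h h' i j] inH' by auto
  qed
  have "\<chi>' (a \<otimes> b) = \<chi>' a * \<chi>' b" if ab: "a \<in> H'" "b \<in> H'" for a b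
  proof -
    obtain h h' and i j :: nat where a: "h \<in> H" "a = h \<otimes> x [^] i" and b: "h' \<in> H" "b = h' \<otimes> x [^] j"
      using ab by (auto simp: H'_def)
    obtain k where k: "k \<in> H" "a \<otimes> b = k \<otimes> x [^] (i + j)" "\<chi> k = \<chi> h * \<chi> h'"
      using prod[OF a(1) b(1), of i j] a b by auto
    show ?thesis unfolding k(2) \<chi>'[OF k(1)] unfolding a(2) b(2) \<chi>'[OF a(1)] \<chi>'[OF b(1)]
      by (simp add: k power_add)
  qed
  moreover have agree: "\<chi>' h = \<chi> h" if "h \<in> H" for h using \<chi>'[OF that, of 0] that by simp
  moreover have "\<chi>' x = \<zeta>" using \<chi>'[of \<one> 1] \<chi> xc by (simp add: lin_char_def)
  moreover have "x \<in> H'" using inH'[of \<one> 1] xc by simp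
  moreover have "\<chi>' \<one> = 1" using agree[of \<one>] \<chi> by (simp add: lin_char_def)
  ultimately show ?thesis using sub HH' H'S by (intro exI[of _ H'] exI[of _ \<chi>']) (auto simp: lin_char_def)
qed

lemma least_power_in:
  assumes "subgroup H G" "finite (carrier G)" "x \<in> carrier G"
  obtains m :: nat where "0 < m" "x [^] m \<in> H" "\<And>k. 0 < k \<Longrightarrow> k < m \<Longrightarrow> x [^] k \<notin> H"
proof -
  interpret H: subgroup H G by fact
  let ?P = "\<lambda>k::nat. 0 < k \<and> x [^] k \<in> H"
  have "?P (Coset.order G)" using assms by (simp add: order_gt_0_iff_finite pow_order_eq_1)
  hence "?P (LEAST k. ?P k)" by (rule LeastI)
  moreover have "x [^] k \<notin> H" if "0 < k" "k < (LEAST k. ?P k)" for k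
    using not_less_Least[OF that(2)] that(1) by auto
  ultimately show ?thesis using that by blast
qed

text \<open>Adjoin an element of \<open>S - H\<close> with any m-th root as its value, and repeat.
  The hypothesis on commutators survives, since its witnesses stay in the larger subgroup and keep
  their values.\<close>

lemma lin_char_extend:
  assumes S: "subgroup S G" and fin: "finite (carrier G)"
    and "subgroup H G" "H \<subseteq> S" "lin_char G H \<chi>"
    and "\<And>a b. a \<in> S \<Longrightarrow> b \<in> S \<Longrightarrow> \<exists>c\<in>H. a \<otimes> b = (b \<otimes> a) \<otimes> c \<and> \<chi> c = 1"
  shows "\<exists>\<chi>'. lin_char G S \<chi>' \<and> (\<forall>h\<in>H. \<chi>' h = \<chi> h)"
  using assms(3-)
proof (induction "card S - card H" arbitrary: H \<chi> rule: less_induct)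
  case less
  interpret S: subgroup S G by (rule S)
  interpret H: subgroup H G by (rule less.prems(1))
  show ?case
  proof (cases "H = S")
    case True
    thus ?thesis using less.prems by auto
  next
    case False
    then obtain x where x: "x \<in> S" "x \<notin> H" using less.prems by blast
    obtain m :: nat where m: "0 < m" "x [^] m \<in> H" "\<And>k. 0 < k \<Longrightarrow> k < m \<Longrightarrow> x [^] k \<notin> H"
      using least_power_in[OF less.prems(1) fin, of x] x by auto
    have "\<chi> (x [^] m) \<noteq> 0" using lin_char_inv[OF less.prems(1,3) m(2)] by simp
    hence "card {z. z ^ m = \<chi> (x [^] m)} = m" using m by (intro card_nth_roots) auto
    then obtain \<zeta> where \<zeta>: "\<zeta> ^ m = \<chi> (x [^] m)" using m(1) by (metis (mono_tags) card.empty empty_Collect_eq less_irrefl)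
    obtain H' \<chi>' where *: "subgroup H' G" "H \<subseteq> H'" "H' \<subseteq> S" "x \<in> H'" "lin_char G H' \<chi>'"
      "\<forall>h\<in>H. \<chi>' h = \<chi> h"
      using lin_char_extend1[OF S less.prems(1,2) fin less.prems(3,4) x(1) m \<zeta>] by blast
    have fS: "finite S" using fin S.subset finite_subset by blast
    have "card H < card H'" using * x fS by (intro psubset_card_mono) (auto intro: finite_subset)
    moreover have "card H' \<le> card S" using * fS by (intro card_mono)
    ultimately have "card S - card H' < card S - card H" by simp
    moreover have "\<exists>c\<in>H'. a \<otimes> b = (b \<otimes> a) \<otimes> c \<and> \<chi>' c = 1" if "a \<in> S" "b \<in> S" for a b
      using less.prems(4)[OF that] * by (metis subsetD)
    ultimately obtain \<chi>'' where "lin_char G S \<chi>''" "\<forall>h\<in>H'. \<chi>'' h = \<chi>' h"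
      using less.hyps[of H' \<chi>'] * by blast
    thus ?thesis using * by (intro exI[of _ \<chi>'']) auto
  qed
qed

text \<open>As \<open>x\<close> is outside \<open>H\<close>, its least positive power inside
  \<open>H\<close> has exponent m at least 2, and two distinct m-th roots of \<chi> (x^m) can be
  chosen as values at \<open>x\<close>.\<close>

lemma lin_char_extend_separate:
  assumes S: "subgroup S G" and fin: "finite (carrier G)"
    and H: "subgroup H G" and HS: "H \<subseteq> S" and \<chi>: "lin_char G H \<chi>"
    and comm: "\<And>a b. a \<in> S \<Longrightarrow> b \<in> S \<Longrightarrow> \<exists>c\<in>H. a \<otimes> b = (b \<otimes> a) \<otimes> c \<and> \<chi> c = 1"
    and x: "x \<in> S - H"
  shows "\<exists>\<chi>1 \<chi>2. lin_char G S \<chi>1 \<and> (\<forall>h\<in>H. \<chi>1 h = \<chi> h) \<and> lin_char G S \<chi>2 \<and>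
    (\<forall>h\<in>H. \<chi>2 h = \<chi> h) \<and> \<chi>1 x \<noteq> \<chi>2 x"
proof -
  interpret S: subgroup S G by (rule S)
  interpret H: subgroup H G by (rule H)
  have ext: "\<exists>\<chi>'. lin_char G S \<chi>' \<and> (\<forall>h\<in>H. \<chi>' h = \<chi> h) \<and> \<chi>' x = \<zeta>"
    if m: "0 < m" "x [^] (m::nat) \<in> H" "\<And>k. 0 < k \<Longrightarrow> k < m \<Longrightarrow> x [^] k \<notin> H"
      and \<zeta>: "\<zeta> ^ m = \<chi> (x [^] m)" for m \<zeta>
  proof -
    obtain H' \<chi>' where *: "subgroup H' G" "H \<subseteq> H'" "H' \<subseteq> S" "x \<in> H'" "lin_char G H' \<chi>'"
      "\<forall>h\<in>H. \<chi>' h = \<chi> h" "\<chi>' x = \<zeta>"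
      using lin_char_extend1[OF S H HS fin \<chi> comm _ m \<zeta>] x by blast
    have "\<exists>c\<in>H'. a \<otimes> b = (b \<otimes> a) \<otimes> c \<and> \<chi>' c = 1" if "a \<in> S" "b \<in> S" for a b
      using comm[OF that] * by (metis subsetD)
    then obtain \<chi>'' where "lin_char G S \<chi>''" "\<forall>h\<in>H'. \<chi>'' h = \<chi>' h"
      using lin_char_extend[OF S fin *(1,3,5)] by blast
    thus ?thesis using * by (intro exI[of _ \<chi>'']) auto
  qed
  obtain m :: nat where m: "0 < m" "x [^] m \<in> H" "\<And>k. 0 < k \<Longrightarrow> k < m \<Longrightarrow> x [^] k \<notin> H"
    using least_power_in[OF H fin, of x] x by auto
  have "m \<noteq> 1"
  proof
    assume "m = 1"
    hence "x \<in> H" using m(2) x by (simp add: S.mem_carrier)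
    thus False using x by simp
  qed
  hence m2: "m \<ge> 2" using m(1) by simp
  let ?R = "{z. z ^ m = \<chi> (x [^] m)}"
  have "\<chi> (x [^] m) \<noteq> 0" using lin_char_inv[OF H \<chi> m(2)] by simp
  hence "card ?R = m" using m by (intro card_nth_roots) auto
  moreover have "finite ?R" using m(1) by (rule finite_nth_roots)
  ultimately have "\<not> (\<forall>\<zeta>1\<in>?R. \<forall>\<zeta>2\<in>?R. \<zeta>1 = \<zeta>2)" using m2 card_le_Suc0_iff_eq[of ?R] by simp
  then obtain \<zeta>1 \<zeta>2 where \<zeta>: "\<zeta>1 ^ m = \<chi> (x [^] m)" "\<zeta>2 ^ m = \<chi> (x [^] m)" "\<zeta>1 \<noteq> \<zeta>2" by blast
  obtain \<chi>1 where 1: "lin_char G S \<chi>1" "\<forall>h\<in>H. \<chi>1 h = \<chi> h" "\<chi>1 x = \<zeta>1" using ext[OF m \<zeta>(1)] by blast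
  obtain \<chi>2 where 2: "lin_char G S \<chi>2" "\<forall>h\<in>H. \<chi>2 h = \<chi> h" "\<chi>2 x = \<zeta>2" using ext[OF m \<zeta>(2)] by blast
  from 1 2 \<zeta>(3) show ?thesis by (intro exI[of _ \<chi>1] exI[of _ \<chi>2]) simp
qed

lemma lin_char_orthogonal:
  assumes S: "subgroup S G" and fin: "finite (carrier G)"
    and \<chi>: "lin_char G S \<chi>" and \<chi>': "lin_char G S \<chi>'"
  shows "(\<Sum>s\<in>S. \<chi> s * cnj (\<chi>' s)) = (if \<forall>s\<in>S. \<chi> s = \<chi>' s then of_nat (card S) else 0)"
proof (cases "\<forall>s\<in>S. \<chi> s = \<chi>' s")
  case True
  have "\<chi> s * cnj (\<chi>' s) = 1" if "s \<in> S" for s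
    using True that norm_one_mult_cnj[OF lin_char_norm(2)[OF S \<chi>' that fin]] by simp
  thus ?thesis using True by simp
next
  case False
  interpret S: subgroup S G by (rule S)
  obtain t where t: "t \<in> S" "\<chi> t \<noteq> \<chi>' t" using False by blast
  let ?A = "\<Sum>s\<in>S. \<chi> s * cnj (\<chi>' s)"
  have "?A = (\<Sum>s\<in>S. \<chi> (t \<otimes> s) * cnj (\<chi>' (t \<otimes> s)))"
    by (rule sum.reindex_bij_witness[of _ "\<lambda>s. t \<otimes> s" "\<lambda>s. inv t \<otimes> s"])
      (use t in \<open>auto simp: cancel_inv_left\<close>)
  also have "\<dots> = \<chi> t * cnj (\<chi>' t) * ?A"
    using t \<chi> \<chi>' by (simp add: lin_char_def sum_distrib_left mult_ac)
  finally have *: "?A = 0 \<or> \<chi> t * cnj (\<chi>' t) = 1" by (rule eq_scaled_imp)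
  have "\<chi> t * cnj (\<chi>' t) \<noteq> 1"
    using norm_one_mult_cnj_eq[OF lin_char_norm(2)[OF S \<chi>' t(1) fin], of "\<chi> t"] t(2) by metis
  hence "?A = 0" using * by metis
  thus ?thesis using False by (simp only: if_False)
qed

end

section \<open>Clifford and Mackey theory for the pair \<open>L\<close>, \<open>S\<close>\<close>

locale mackey_pair = group G for G :: "('g, 'm) monoid_scheme" (structure) +
  fixes S L :: "'g set" and \<theta> :: "'g \<Rightarrow> complex"
  assumes fin: "finite (carrier G)" and S: "subgroup S G" and L: "subgroup L G" and LS: "L \<subseteq> S"
    and \<theta>: "lin_char G L \<theta>"
    and comm: "\<And>a b. a \<in> S \<Longrightarrow> b \<in> S \<Longrightarrow> \<exists>c\<in>L. a \<otimes> b = (b \<otimes> a) \<otimes> c \<and> \<theta> c = 1"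
    and sep: "\<And>x. x \<in> carrier G - S \<Longrightarrow> \<exists>h\<in>L. x \<otimes> h \<otimes> inv x \<in> L \<and> \<theta> (x \<otimes> h \<otimes> inv x) \<noteq> \<theta> h"
begin

sublocale S: subgroup S G by (rule S)
sublocale L: subgroup L G by (rule L)

lemma finS: "finite S" and cardS: "card S \<noteq> 0" "card L \<noteq> 0" and finL: "finite L"
  using fin S.subset L.subset finite_subset S.finite_imp_card_positive L.finite_imp_card_positive by auto

text \<open>The common ground of the extensions of \<theta> and of the functions from which the
  Kirillov functions are induced; the latter need not be multiplicative on \<open>S\<close>.\<close>

definition equivariant :: "('g \<Rightarrow> complex) \<Rightarrow> bool" where
  "equivariant f \<longleftrightarrow> (\<forall>s\<in>S. \<forall>l\<in>L. f (s \<otimes> l) = f s * \<theta> l)"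

lemma equivariant_conj:
  assumes "equivariant f" "x \<in> S" "s \<in> S"
  shows "f (x \<otimes> s \<otimes> inv x) = f s"
  using conj_eq_mult[OF S comm assms(2,3)] assms by (auto simp: equivariant_def)

lemma ext0_conj:
  assumes f: "equivariant f" and x: "x \<in> S" and g: "g \<in> carrier G"
  shows "ext0 S f (x \<otimes> g \<otimes> inv x) = ext0 S f g"
proof -
  have "x \<otimes> g \<otimes> inv x \<in> S \<longleftrightarrow> g \<in> S"
  proof
    assume *: "x \<otimes> g \<otimes> inv x \<in> S"
    have "g = inv x \<otimes> (x \<otimes> g \<otimes> inv x) \<otimes> x" using x g by (simp add: word_simps)
    thus "g \<in> S" using * x by (metis S.m_closed S.m_inv_closed)
  qed (use x in auto)
  thus ?thesis using equivariant_conj[OF f x] by (simp add: ext0_def)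
qed

lemma induced_class:
  assumes g: "g \<in> carrier G" and y: "y \<in> carrier G"
  shows "induced G A f (y \<otimes> g \<otimes> inv y) = induced G A f g"
proof -
  have "(\<Sum>x\<in>carrier G. ext0 A f (x \<otimes> (y \<otimes> g \<otimes> inv y) \<otimes> inv x)) =
      (\<Sum>x\<in>carrier G. ext0 A f (x \<otimes> g \<otimes> inv x))"
    by (rule sum.reindex_bij_witness[of _ "\<lambda>x. x \<otimes> inv y" "\<lambda>x. x \<otimes> y"])
      (use g y in \<open>auto simp: word_simps\<close>)
  thus ?thesis using g y fin by (simp add: induced_altdef)
qed

lemma frobenius:
  assumes F: "\<And>x g. x \<in> carrier G \<Longrightarrow> g \<in> carrier G \<Longrightarrow> F (x \<otimes> g \<otimes> inv x) = F g"
  shows "char_inner G F (induced G S f) = (\<Sum>s\<in>S. F s * cnj (f s)) / of_nat (card S)"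
proof -
  have "(\<Sum>g\<in>carrier G. F g * cnj (induced G S f g)) =
      (\<Sum>g\<in>carrier G. \<Sum>x\<in>carrier G. F g * cnj (ext0 S f (x \<otimes> g \<otimes> inv x))) / of_nat (card S)"
    using fin by (simp add: induced_altdef sum_distrib_left sum_divide_distrib)
  also have "(\<Sum>g\<in>carrier G. \<Sum>x\<in>carrier G. F g * cnj (ext0 S f (x \<otimes> g \<otimes> inv x))) =
      (\<Sum>x\<in>carrier G. \<Sum>g\<in>carrier G. F g * cnj (ext0 S f (x \<otimes> g \<otimes> inv x)))"
    by (rule sum.swap)
  also have "\<dots> = (\<Sum>x\<in>carrier G. \<Sum>g\<in>carrier G. F g * cnj (ext0 S f g))"
  proof (rule sum.cong[OF refl])
    fix x assume x: "x \<in> carrier G"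
    show "(\<Sum>g\<in>carrier G. F g * cnj (ext0 S f (x \<otimes> g \<otimes> inv x))) = (\<Sum>g\<in>carrier G. F g * cnj (ext0 S f g))"
      by (rule sum.reindex_bij_witness[of _ "\<lambda>g. inv x \<otimes> g \<otimes> x" "\<lambda>g. x \<otimes> g \<otimes> inv x"])
        (use x F in \<open>auto simp: word_simps\<close>)
  qed
  also have "\<dots> = of_nat (card (carrier G)) * (\<Sum>g\<in>carrier G. F g * cnj (ext0 S f g))" by simp
  also have "(\<Sum>g\<in>carrier G. F g * cnj (ext0 S f g)) = (\<Sum>s\<in>S. F s * cnj (f s))"
    by (rule sum.mono_neutral_cong_right[OF fin S.subset]) (auto simp: ext0_def)
  finally have "(\<Sum>g\<in>carrier G. F g * cnj (induced G S f g)) =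
      of_nat (card (carrier G)) * (\<Sum>s\<in>S. F s * cnj (f s)) / of_nat (card S)" .
  moreover have "card (carrier G) \<noteq> 0" using fin by auto
  ultimately show ?thesis by (simp add: char_inner_def)
qed

text \<open>Mackey's formula: the double cosets outside \<open>S\<close> contribute nothing because translating by a
  separating element multiplies their contribution by a constant different from \<open>1\<close>.\<close>

lemma inner_induced:
  assumes f1: "equivariant f1" and f2: "equivariant f2"
  shows "char_inner G (induced G S f1) (induced G S f2) = (\<Sum>s\<in>S. f1 s * cnj (f2 s)) / of_nat (card S)"
proof -
  have "(\<Sum>s\<in>S. induced G S f1 s * cnj (f2 s)) =
      (\<Sum>s\<in>S. \<Sum>x\<in>carrier G. ext0 S f1 (x \<otimes> s \<otimes> inv x) * cnj (f2 s)) / of_nat (card S)"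
    using fin by (simp add: induced_altdef sum_distrib_right sum_divide_distrib)
  also have "(\<Sum>s\<in>S. \<Sum>x\<in>carrier G. ext0 S f1 (x \<otimes> s \<otimes> inv x) * cnj (f2 s)) =
      (\<Sum>x\<in>carrier G. \<Sum>s\<in>S. ext0 S f1 (x \<otimes> s \<otimes> inv x) * cnj (f2 s))"
    by (rule sum.swap)
  also have "\<dots> = (\<Sum>x\<in>carrier G. if x \<in> S then (\<Sum>s\<in>S. f1 s * cnj (f2 s)) else 0)"
  proof (intro sum.cong refl)
    fix x assume x: "x \<in> carrier G"
    show "(\<Sum>s\<in>S. ext0 S f1 (x \<otimes> s \<otimes> inv x) * cnj (f2 s)) =
        (if x \<in> S then (\<Sum>s\<in>S. f1 s * cnj (f2 s)) else 0)"
    proof (cases "x \<in> S")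
      case True
      have "ext0 S f1 (x \<otimes> s \<otimes> inv x) = f1 s" if "s \<in> S" for s
        using ext0_conj[OF f1 True, of s] that by (auto simp: ext0_def[of S f1 s])
      thus ?thesis using True by simp
    next
      case False
      obtain h where h: "h \<in> L" "x \<otimes> h \<otimes> inv x \<in> L" "\<theta> (x \<otimes> h \<otimes> inv x) \<noteq> \<theta> h"
        using sep[of x] x False by auto
      let ?A = "\<Sum>s\<in>S. ext0 S f1 (x \<otimes> s \<otimes> inv x) * cnj (f2 s)"
      let ?k = "x \<otimes> h \<otimes> inv x"
      have hS: "h \<in> S" using h LS by auto
      have kS: "?k \<in> S" using h LS by auto
      have "?A = (\<Sum>s\<in>S. ext0 S f1 (x \<otimes> (s \<otimes> h) \<otimes> inv x) * cnj (f2 (s \<otimes> h)))"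
        by (rule sum.reindex_bij_witness[of _ "\<lambda>s. s \<otimes> h" "\<lambda>s. s \<otimes> inv h"])
          (use hS in \<open>auto simp: word_simps\<close>)
      also have "\<dots> = (\<Sum>s\<in>S. \<theta> ?k * cnj (\<theta> h) * (ext0 S f1 (x \<otimes> s \<otimes> inv x) * cnj (f2 s)))"
      proof (intro sum.cong refl)
        fix s assume s: "s \<in> S"
        let ?t = "x \<otimes> s \<otimes> inv x"
        have t: "?t \<in> carrier G" using x s by simp
        have eq: "x \<otimes> (s \<otimes> h) \<otimes> inv x = ?t \<otimes> ?k"
          using x s hS by (simp add: word_simps)
        have "?t \<otimes> ?k \<in> S \<longleftrightarrow> ?t \<in> S"
        proof
          assume *: "?t \<otimes> ?k \<in> S"
          have "(?t \<otimes> ?k) \<otimes> inv ?k \<in> S" by (intro S.m_closed S.m_inv_closed * kS)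
          thus "?t \<in> S" using t S.mem_carrier[OF kS] by (simp only: m_assoc inv_closed r_inv r_one)
        qed (use kS in auto)
        hence "ext0 S f1 (?t \<otimes> ?k) = ext0 S f1 ?t * \<theta> ?k"
          using f1 h(2) by (auto simp: ext0_def equivariant_def)
        thus "ext0 S f1 (x \<otimes> (s \<otimes> h) \<otimes> inv x) * cnj (f2 (s \<otimes> h)) =
            \<theta> ?k * cnj (\<theta> h) * (ext0 S f1 ?t * cnj (f2 s))"
          unfolding eq using f2 s h(1) by (simp add: equivariant_def)
      qed
      also have "\<dots> = \<theta> ?k * cnj (\<theta> h) * ?A" by (simp add: sum_distrib_left)
      finally have *: "?A = 0 \<or> \<theta> ?k * cnj (\<theta> h) = 1" by (rule eq_scaled_imp)
      have "\<theta> ?k * cnj (\<theta> h) \<noteq> 1"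
        using norm_one_mult_cnj_eq[OF lin_char_norm(2)[OF L \<theta> h(1) fin], of "\<theta> ?k"] h(3) by metis
      hence "?A = 0" using * by metis
      thus ?thesis using False by (simp only: if_False)
    qed
  qed
  also have "\<dots> = of_nat (card S) * (\<Sum>s\<in>S. f1 s * cnj (f2 s))"
  proof -
    have "(\<Sum>x\<in>carrier G. if x \<in> S then (\<Sum>s\<in>S. f1 s * cnj (f2 s)) else 0) =
        (\<Sum>x\<in>S. \<Sum>s\<in>S. f1 s * cnj (f2 s))"
      by (rule sum.mono_neutral_cong_right[OF fin S.subset]) auto
    thus ?thesis by simp
  qed
  finally have "(\<Sum>s\<in>S. induced G S f1 s * cnj (f2 s)) = (\<Sum>s\<in>S. f1 s * cnj (f2 s))"
    using cardS by simp
  moreover have "char_inner G (induced G S f1) (induced G S f2) =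
      (\<Sum>s\<in>S. induced G S f1 s * cnj (f2 s)) / of_nat (card S)"
    by (rule frobenius) (rule induced_class)
  ultimately show ?thesis by simp
qed

text \<open>Extensional functions, so that different members differ somewhere on \<open>S\<close>
  and the extensions can be counted.\<close>

definition exts :: "('g \<Rightarrow> complex) set" where
  "exts = {\<chi> \<in> extensional S. lin_char G S \<chi> \<and> (\<forall>l\<in>L. \<chi> l = \<theta> l)}"

lemma exts_restrict:
  assumes "lin_char G S \<chi>" "\<forall>l\<in>L. \<chi> l = \<theta> l"
  shows "restrict \<chi> S \<in> exts"
  using assms LS by (auto simp: exts_def lin_char_def)

lemma extsD: "\<chi> \<in> exts \<Longrightarrow> lin_char G S \<chi>" "\<chi> \<in> exts \<Longrightarrow> l \<in> L \<Longrightarrow> \<chi> l = \<theta> l"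
  by (auto simp: exts_def)

lemma exts_equivariant: "\<chi> \<in> exts \<Longrightarrow> equivariant \<chi>"
  using LS by (auto simp: exts_def equivariant_def lin_char_def subset_iff)

lemma exts_eqI: "\<chi> \<in> exts \<Longrightarrow> \<chi>' \<in> exts \<Longrightarrow> (\<And>s. s \<in> S \<Longrightarrow> \<chi> s = \<chi>' s) \<Longrightarrow> \<chi> = \<chi>'"
  unfolding exts_def by (auto intro: extensionalityI)

lemma finite_exts: "finite exts"
proof (rule finite_subset)
  show "exts \<subseteq> S \<rightarrow>\<^sub>E {z. z ^ Coset.order G = 1}"
    using lin_char_norm(1)[OF S _ _ fin] by (auto simp: exts_def PiE_def)
  have "Coset.order G > 0" using fin by (simp add: order_gt_0_iff_finite)
  thus "finite (S \<rightarrow>\<^sub>E {z::complex. z ^ Coset.order G = 1})"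
    by (intro finite_PiE finS finite_nth_roots)
qed

lemma exts_inner:
  assumes "\<chi> \<in> exts" "\<chi>' \<in> exts"
  shows "(\<Sum>s\<in>S. \<chi> s * cnj (\<chi>' s)) = (if \<chi> = \<chi>' then of_nat (card S) else 0)"
  using lin_char_orthogonal[OF S fin extsD(1)[OF assms(1)] extsD(1)[OF assms(2)]] exts_eqI[OF assms]
  by auto

lemma exts_separate:
  assumes s: "s \<in> S - L"
  shows "\<exists>\<chi>1\<in>exts. \<exists>\<chi>2\<in>exts. \<chi>1 s \<noteq> \<chi>2 s"
proof -
  obtain \<chi>1 \<chi>2 where "lin_char G S \<chi>1" "\<forall>h\<in>L. \<chi>1 h = \<theta> h" "lin_char G S \<chi>2"
    "\<forall>h\<in>L. \<chi>2 h = \<theta> h" "\<chi>1 s \<noteq> \<chi>2 s"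
    using lin_char_extend_separate[OF S fin L LS \<theta> comm s] by blast
  thus ?thesis using s by (intro bexI[OF _ exts_restrict[of \<chi>1]] bexI[OF _ exts_restrict[of \<chi>2]]) auto
qed

text \<open>Twisting by the quotient of two extensions that differ at \<open>s\<close> permutes
  \<open>exts\<close>, since the quotient is 1 on \<open>L\<close>, and multiplies the sum by a
  number other than 1.\<close>

lemma exts_sum:
  assumes s: "s \<in> S"
  shows "(\<Sum>\<chi>\<in>exts. \<chi> s) = (if s \<in> L then of_nat (card exts) * \<theta> s else 0)"
proof (cases "s \<in> L")
  case True
  thus ?thesis by (simp add: extsD)
next
  case False
  obtain \<chi>1 \<chi>2 where 12: "\<chi>1 \<in> exts" "\<chi>2 \<in> exts" "\<chi>1 s \<noteq> \<chi>2 s"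
    using exts_separate[of s] s False by auto
  have nz: "\<chi> t \<noteq> 0" if "\<chi> \<in> exts" "t \<in> S" for \<chi> t using lin_char_inv[OF S extsD(1)[OF that(1)] that(2)] by simp
  define tw where "tw \<alpha> \<beta> \<chi> = (\<lambda>t\<in>S. \<chi> t * \<alpha> t / \<beta> t)" for \<alpha> \<beta> \<chi> :: "'g \<Rightarrow> complex"
  have tw: "tw \<alpha> \<beta> \<chi> \<in> exts" if "\<alpha> \<in> exts" "\<beta> \<in> exts" "\<chi> \<in> exts" for \<alpha> \<beta> \<chi>
    unfolding tw_def
  proof (rule exts_restrict)
    show "lin_char G S (\<lambda>t. \<chi> t * \<alpha> t / \<beta> t)"
      using that[THEN extsD(1)] by (auto simp: lin_char_def)
    show "\<forall>l\<in>L. \<chi> l * \<alpha> l / \<beta> l = \<theta> l"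
      using that nz LS by (auto simp: extsD)
  qed
  have twtw: "tw \<alpha> \<beta> (tw \<beta> \<alpha> \<chi>) = \<chi>" if "\<alpha> \<in> exts" "\<beta> \<in> exts" "\<chi> \<in> exts" for \<alpha> \<beta> \<chi>
  proof (rule exts_eqI)
    show "tw \<alpha> \<beta> (tw \<beta> \<alpha> \<chi>) \<in> exts" by (intro tw that)
    show "tw \<alpha> \<beta> (tw \<beta> \<alpha> \<chi>) t = \<chi> t" if "t \<in> S" for t
      using that nz[OF \<open>\<alpha> \<in> exts\<close> that] nz[OF \<open>\<beta> \<in> exts\<close> that] by (simp add: tw_def)
  qed (rule that)
  have "(\<Sum>\<chi>\<in>exts. \<chi> s) = (\<Sum>\<chi>\<in>exts. tw \<chi>1 \<chi>2 \<chi> s)"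
    by (rule sum.reindex_bij_witness[of _ "tw \<chi>1 \<chi>2" "tw \<chi>2 \<chi>1"]) (use tw twtw 12 in auto)
  also have "\<dots> = (\<Sum>\<chi>\<in>exts. \<chi> s) * (\<chi>1 s / \<chi>2 s)" using s by (simp add: tw_def sum_distrib_right sum_divide_distrib)
  finally have "(\<Sum>\<chi>\<in>exts. \<chi> s) = 0 \<or> \<chi>1 s / \<chi>2 s = 1" by (rule eq_scaled_imp')
  thus ?thesis using 12 nz[of \<chi>2 s] s False by auto
qed

lemma exts_nonempty: "exts \<noteq> {}"
proof -
  obtain \<chi> where "lin_char G S \<chi>" "\<forall>h\<in>L. \<chi> h = \<theta> h"
    using lin_char_extend[OF S fin L LS \<theta> comm] by blast
  thus ?thesis using exts_restrict by blast
qed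

text \<open>The square norm of the sum of all extensions, computed by orthogonality and again by
  \<open>exts_sum\<close>, gives \<open>card exts * card S = card exts ^ 2 * card L\<close>.\<close>

lemma card_exts: "card exts * card L = card S"
proof -
  have "(\<Sum>s\<in>S. (\<Sum>\<chi>\<in>exts. \<chi> s) * cnj (\<Sum>\<chi>\<in>exts. \<chi> s)) =
      (\<Sum>s\<in>S. \<Sum>\<chi>\<in>exts. \<Sum>\<chi>'\<in>exts. \<chi> s * cnj (\<chi>' s))"
    by (simp add: sum_product)
  also have "\<dots> = (\<Sum>\<chi>\<in>exts. \<Sum>s\<in>S. \<Sum>\<chi>'\<in>exts. \<chi> s * cnj (\<chi>' s))" by (rule sum.swap)
  also have "\<dots> = (\<Sum>\<chi>\<in>exts. \<Sum>\<chi>'\<in>exts. \<Sum>s\<in>S. \<chi> s * cnj (\<chi>' s))" by (intro sum.cong refl sum.swap)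
  also have "\<dots> = (\<Sum>\<chi>\<in>exts. of_nat (card S))"
    using finite_exts by (simp add: exts_inner)
  finally have 1: "(\<Sum>s\<in>S. (\<Sum>\<chi>\<in>exts. \<chi> s) * cnj (\<Sum>\<chi>\<in>exts. \<chi> s)) = of_nat (card exts * card S)" by simp
  have "(\<Sum>s\<in>S. (\<Sum>\<chi>\<in>exts. \<chi> s) * cnj (\<Sum>\<chi>\<in>exts. \<chi> s)) =
      (\<Sum>s\<in>L. of_nat (card exts) * \<theta> s * cnj (of_nat (card exts) * \<theta> s))"
    by (rule sum.mono_neutral_cong_right[OF finS LS]) (use LS in \<open>auto simp: exts_sum simp del: cnj_sum\<close>)
  also have "\<dots> = (\<Sum>s\<in>L. of_nat (card exts * card exts))"
  proof (rule sum.cong[OF refl])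
    fix s assume "s \<in> L"
    hence "\<theta> s * cnj (\<theta> s) = 1"
      using lin_char_norm(2)[OF L \<theta> _ fin] by (intro norm_one_mult_cnj)
    thus "of_nat (card exts) * \<theta> s * cnj (of_nat (card exts) * \<theta> s) = of_nat (card exts * card exts)"
      by (simp add: mult_ac)
  qed
  also have "\<dots> = of_nat (card exts * card exts * card L)" by (simp add: mult_ac)
  finally have "of_nat (card exts * card S) = (of_nat (card exts * card exts * card L) :: complex)"
    using 1 by (simp only:)
  hence "card exts * card S = card exts * (card exts * card L)" by (simp only: of_nat_eq_iff mult.assoc)
  thus ?thesis using exts_nonempty finite_exts by simp
qed

lemma induced_inj: "inj_on (induced G S) exts"
proof (rule inj_onI, rule ccontr)
  fix \<chi> \<chi>' assume *: "\<chi> \<in> exts" "\<chi>' \<in> exts" "induced G S \<chi> = induced G S \<chi>'" "\<chi> \<noteq> \<chi>'"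
  have "char_inner G (induced G S \<chi>) (induced G S \<chi>') = 0"
    using *(1,2,4) by (simp add: inner_induced exts_equivariant exts_inner)
  moreover have "char_inner G (induced G S \<chi>) (induced G S \<chi>) = 1"
    using *(1) cardS by (simp add: inner_induced exts_equivariant exts_inner)
  ultimately show False using * by simp
qed

lemma induced_exts_irreducible: "\<chi> \<in> exts \<Longrightarrow> induced G S \<chi> \<in> irreducible_characters G"
  using sep LS by (intro induced_irreducible[OF S fin extsD(1)]) (metis extsD(2) subsetD)+

text \<open>By \<open>exts_sum\<close> the extensions add up to \<theta> extended by zero, times
  their number; by \<open>card_exts\<close> that number is the index of \<open>L\<close> in
  \<open>S\<close>, which the different normalisations of the two inductions absorb.\<close>

lemma xi_decomposition:
  assumes g: "g \<in> carrier G"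
  shows "induced G L \<theta> g = (\<Sum>\<chi>\<in>exts. induced G S \<chi> g)"
proof -
  have "(\<Sum>\<chi>\<in>exts. induced G S \<chi> g) =
      (\<Sum>\<chi>\<in>exts. \<Sum>x\<in>carrier G. ext0 S \<chi> (x \<otimes> g \<otimes> inv x)) / of_nat (card S)"
    using g fin by (simp add: induced_altdef sum_divide_distrib)
  also have "(\<Sum>\<chi>\<in>exts. \<Sum>x\<in>carrier G. ext0 S \<chi> (x \<otimes> g \<otimes> inv x)) =
      (\<Sum>x\<in>carrier G. \<Sum>\<chi>\<in>exts. ext0 S \<chi> (x \<otimes> g \<otimes> inv x))" by (rule sum.swap)
  also have "\<dots> = (\<Sum>x\<in>carrier G. of_nat (card exts) * ext0 L \<theta> (x \<otimes> g \<otimes> inv x))"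
  proof (rule sum.cong[OF refl])
    fix x
    show "(\<Sum>\<chi>\<in>exts. ext0 S \<chi> (x \<otimes> g \<otimes> inv x)) = of_nat (card exts) * ext0 L \<theta> (x \<otimes> g \<otimes> inv x)"
      using LS exts_sum[of "x \<otimes> g \<otimes> inv x"] by (cases "x \<otimes> g \<otimes> inv x \<in> S") (auto simp: ext0_def)
  qed
  also have "\<dots> / of_nat (card S) = (\<Sum>x\<in>carrier G. ext0 L \<theta> (x \<otimes> g \<otimes> inv x)) / of_nat (card L)"
    using cardS card_exts[symmetric] exts_nonempty finite_exts by (simp add: sum_distrib_left[symmetric])
  finally show ?thesis using g fin by (simp add: induced_altdef)
qed

lemma xi_inner:
  assumes "\<chi> \<in> exts"
  shows "char_inner G (induced G L \<theta>) (induced G S \<chi>) = 1"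
proof -
  have "char_inner G (induced G L \<theta>) (induced G S \<chi>) =
      (\<Sum>\<chi>'\<in>exts. char_inner G (induced G S \<chi>') (induced G S \<chi>))"
    by (simp add: char_inner_def xi_decomposition sum_divide_distrib sum_distrib_right sum.swap[of _ exts])
  also have "\<dots> = (\<Sum>\<chi>'\<in>exts. if \<chi>' = \<chi> then 1 else 0)"
    using assms cardS by (intro sum.cong refl) (simp add: inner_induced exts_equivariant exts_inner)
  finally show ?thesis using assms finite_exts by simp
qed

lemma xi_norm: "char_inner G (induced G L \<theta>) (induced G L \<theta>) = of_nat (card exts)"
proof -
  have "char_inner G (induced G L \<theta>) (induced G L \<theta>) =
      (\<Sum>\<chi>'\<in>exts. char_inner G (induced G L \<theta>) (induced G S \<chi>'))"
    by (simp add: char_inner_def xi_decomposition[of _, unfolded] sum_divide_distrib sum_distrib_left sum.swap[of _ exts])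
  thus ?thesis by (simp add: xi_inner)
qed

text \<open>A constituent pairs nontrivially with one of the summands
  \<open>induced G S \<chi>\<close>, and Schur orthogonality then identifies the two.\<close>

lemma xi_constituents:
  assumes "\<psi> \<in> irreducible_constituents G (induced G L \<theta>)"
  shows "\<psi> \<in> induced G S ` exts"
proof -
  have \<psi>: "\<psi> \<in> irreducible_characters G" and nz: "char_inner G (induced G L \<theta>) \<psi> \<noteq> 0"
    using assms by (auto simp: irreducible_constituents_def)
  have "char_inner G (induced G L \<theta>) \<psi> = (\<Sum>\<chi>\<in>exts. char_inner G (induced G S \<chi>) \<psi>)"
    by (simp add: char_inner_def xi_decomposition sum_divide_distrib sum_distrib_right sum.swap[of _ exts])
  then obtain \<chi> where \<chi>: "\<chi> \<in> exts" "char_inner G (induced G S \<chi>) \<psi> \<noteq> 0"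
    using nz by (metis (no_types, lifting) sum.neutral)
  \<comment> \<open>\<open>schur_orthogonality\<close> is phrased with \<open>inv g\<close>; for
    this character, passing to the inverse conjugates the value.\<close>
  have cnj_ind: "induced G S \<chi> (inv g) = cnj (induced G S \<chi> g)" if g: "g \<in> carrier G" for g
  proof -
    have "ext0 S \<chi> (x \<otimes> inv g \<otimes> inv x) = cnj (ext0 S \<chi> (x \<otimes> g \<otimes> inv x))" if x: "x \<in> carrier G" for x
    proof -
      have eq: "x \<otimes> inv g \<otimes> inv x = inv (x \<otimes> g \<otimes> inv x)" using x g by (simp add: word_simps)
      have "x \<otimes> g \<otimes> inv x \<in> carrier G" using x g by simp
      thus ?thesis unfolding eq using lin_char_norm(3)[OF S extsD(1)[OF \<chi>(1)] _ fin]
        by (auto simp: ext0_def) (metis S.m_inv_closed inv_inv)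
    qed
    thus ?thesis using g fin by (simp add: induced_altdef)
  qed
  have "(\<Sum>g\<in>carrier G. \<psi> g * induced G S \<chi> (inv g)) = cnj (\<Sum>g\<in>carrier G. induced G S \<chi> g * cnj (\<psi> g))"
    using cnj_ind by (simp add: mult.commute)
  also have "\<dots> \<noteq> 0" using \<chi>(2) by (metis char_inner_def complex_cnj_zero_iff div_0)
  finally have "\<psi> = induced G S \<chi>"
    using schur_orthogonality[OF fin \<psi> induced_exts_irreducible[OF \<chi>(1)]] by blast
  thus ?thesis using \<chi> by blast
qed

lemma exts_constituent:
  assumes "\<chi> \<in> exts"
  shows "induced G S \<chi> \<in> irreducible_constituents G (induced G L \<theta>)"
  using assms xi_inner induced_exts_irreducible by (simp add: irreducible_constituents_def)

text \<open>The mean of \<open>cnj (\<chi> s)\<close> times the matrix of \<open>s\<close> is the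
  projection onto the vectors on which \<open>S\<close> acts through \<chi>; the inner product is
  its trace.\<close>

lemma character_inner_Nats:
  assumes \<psi>: "\<psi> \<in> characters G" and \<chi>: "lin_char G S \<chi>"
  shows "(\<Sum>s\<in>S. \<psi> s * cnj (\<chi> s)) / of_nat (card S) \<in> \<nat>"
proof -
  obtain d \<rho> where \<rho>: "is_rep G d \<rho>" and \<psi>_def: "\<psi> = rep_character G \<rho>"
    using \<psi> by (auto simp: characters_def)
  define c where "c s = cnj (\<chi> s) / of_nat (card S)" for s
  define P where "P = mat d d (\<lambda>(i, j). \<Sum>s\<in>S. c s * \<rho> s $$ (i, j))"
  have \<rho>c [simp]: "\<rho> s \<in> carrier_mat d d" "dim_row (\<rho> s) = d" "dim_col (\<rho> s) = d" if "s \<in> S" for s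
    using \<rho> that by (auto simp: is_rep_def)
  have "P * P = P"
  proof (rule eq_matI)
    fix i j assume "i < dim_row P" "j < dim_col P"
    hence ij: "i < d" "j < d" by (auto simp: P_def)
    have "(P * P) $$ (i, j) = (\<Sum>k<d. (\<Sum>s\<in>S. c s * \<rho> s $$ (i, k)) * (\<Sum>t\<in>S. c t * \<rho> t $$ (k, j)))"
      using ij by (simp add: P_def scalar_prod_def atLeast0LessThan)
    also have "\<dots> = (\<Sum>k<d. \<Sum>s\<in>S. \<Sum>t\<in>S. c s * c t * (\<rho> s $$ (i, k) * \<rho> t $$ (k, j)))"
      unfolding sum_product by (intro sum.cong refl) (simp add: mult_ac)
    also have "\<dots> = (\<Sum>s\<in>S. \<Sum>k<d. \<Sum>t\<in>S. c s * c t * (\<rho> s $$ (i, k) * \<rho> t $$ (k, j)))"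
      by (rule sum.swap)
    also have "\<dots> = (\<Sum>s\<in>S. \<Sum>t\<in>S. \<Sum>k<d. c s * c t * (\<rho> s $$ (i, k) * \<rho> t $$ (k, j)))"
      by (intro sum.cong refl sum.swap)
    also have "\<dots> = (\<Sum>s\<in>S. \<Sum>t\<in>S. c (s \<otimes> t) / of_nat (card S) * \<rho> (s \<otimes> t) $$ (i, j))"
    proof (intro sum.cong refl)
      fix s t assume st: "s \<in> S" "t \<in> S"
      have "\<rho> (s \<otimes> t) = \<rho> s * \<rho> t" using \<rho> st by (simp add: is_rep_def)
      hence "\<rho> (s \<otimes> t) $$ (i, j) = (\<Sum>k<d. \<rho> s $$ (i, k) * \<rho> t $$ (k, j))"
        using ij st by (simp add: scalar_prod_def atLeast0LessThan)
      moreover have "c (s \<otimes> t) / of_nat (card S) = c s * c t"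
        using \<chi> st by (simp add: c_def lin_char_def)
      ultimately show "(\<Sum>k<d. c s * c t * (\<rho> s $$ (i, k) * \<rho> t $$ (k, j))) =
          c (s \<otimes> t) / of_nat (card S) * \<rho> (s \<otimes> t) $$ (i, j)"
        by (simp add: sum_distrib_left)
    qed
    also have "\<dots> = (\<Sum>s\<in>S. \<Sum>t\<in>S. c t / of_nat (card S) * \<rho> t $$ (i, j))"
    proof (rule sum.cong[OF refl])
      fix s assume s: "s \<in> S"
      show "(\<Sum>t\<in>S. c (s \<otimes> t) / of_nat (card S) * \<rho> (s \<otimes> t) $$ (i, j)) =
          (\<Sum>t\<in>S. c t / of_nat (card S) * \<rho> t $$ (i, j))"
        by (rule sum.reindex_bij_witness[of _ "\<lambda>t. inv s \<otimes> t" "\<lambda>t. s \<otimes> t"])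
          (use s in \<open>auto simp: cancel_inv_left\<close>)
    qed
    also have "\<dots> = P $$ (i, j)" using ij cardS by (simp add: P_def sum_distrib_left)
    finally show "(P * P) $$ (i, j) = P $$ (i, j)" .
  qed (auto simp: P_def)
  hence "mat_trace P \<in> \<nat>" by (intro trace_idempotent[of P d]) (auto simp: P_def)
  also have "mat_trace P = (\<Sum>s\<in>S. \<psi> s * cnj (\<chi> s)) / of_nat (card S)"
    by (simp add: P_def mat_trace_def \<psi>_def rep_character_def c_def sum.swap[of _ S] sum_distrib_left
        sum_divide_distrib mult_ac)
  finally show ?thesis .
qed

text \<open>The coefficients \<open>\<langle>f, \<chi>\<rangle>\<close> over all \<open>\<chi> \<in> exts\<close> sum to \<open>1\<close>, and for a character they are natural
  numbers; hence one of them is \<open>1\<close>, which forces \<open>f\<close> to be that \<open>\<chi>\<close>.\<close>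

lemma induced_character_iff:
  assumes f: "equivariant f" and norm: "\<And>s. s \<in> S \<Longrightarrow> norm (f s) = 1" and f1: "f \<one> = 1"
  shows "induced G S f \<in> characters G \<longleftrightarrow> lin_char G S f"
proof
  assume "lin_char G S f"
  thus "induced G S f \<in> characters G" by (rule induced_character[OF S fin])
next
  assume char: "induced G S f \<in> characters G"
  define a where "a \<chi> = (\<Sum>s\<in>S. f s * cnj (\<chi> s)) / of_nat (card S)" for \<chi>
  \<comment> \<open>Reciprocity replaces \<open>f\<close> by the function induced from it, which is
    a character by assumption, so \<open>character_inner_Nats\<close> applies.\<close>
  have aN: "a \<chi> \<in> \<nat>" if \<chi>: "\<chi> \<in> exts" for \<chi>
  proof -
    have "a \<chi> = char_inner G (induced G S f) (induced G S \<chi>)"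
      using inner_induced[OF f exts_equivariant[OF \<chi>]] by (simp add: a_def)
    also have "\<dots> = (\<Sum>s\<in>S. induced G S f s * cnj (\<chi> s)) / of_nat (card S)"
      by (rule frobenius) (rule induced_class)
    also have "\<dots> \<in> \<nat>" by (rule character_inner_Nats[OF char extsD(1)[OF \<chi>]])
    finally show ?thesis .
  qed
  have fL: "f l = \<theta> l" if "l \<in> L" for l using f f1 that by (auto simp: equivariant_def dest!: bspec[of S _ \<one>])
  have "(\<Sum>\<chi>\<in>exts. a \<chi>) = (\<Sum>s\<in>S. f s * cnj (\<Sum>\<chi>\<in>exts. \<chi> s)) / of_nat (card S)"
    by (simp add: a_def sum_divide_distrib sum_distrib_left sum.swap[of _ exts])
  also have "(\<Sum>s\<in>S. f s * cnj (\<Sum>\<chi>\<in>exts. \<chi> s)) = (\<Sum>s\<in>L. of_nat (card exts))"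
  proof (rule sum.mono_neutral_cong_right[OF finS LS])
    show "\<forall>s\<in>S - L. f s * cnj (\<Sum>\<chi>\<in>exts. \<chi> s) = 0" by (simp add: exts_sum del: cnj_sum)
  next
    fix s assume s: "s \<in> L"
    have "\<theta> s * cnj (\<theta> s) = 1"
      by (rule norm_one_mult_cnj[OF lin_char_norm(2)[OF L \<theta> s fin]])
    moreover have "(\<Sum>\<chi>\<in>exts. \<chi> s) = of_nat (card exts) * \<theta> s" using s LS exts_sum[of s] by auto
    ultimately show "f s * cnj (\<Sum>\<chi>\<in>exts. \<chi> s) = of_nat (card exts)"
      using fL[OF s] by (simp only: complex_cnj_mult complex_cnj_of_nat mult.left_commute[of "\<theta> s"] mult_1_right)
  qed
  also have "(\<Sum>s\<in>L. of_nat (card exts)) / of_nat (card S) = (1::complex)"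
    using card_exts[symmetric] cardS by (simp add: mult.commute)
  finally have suma: "(\<Sum>\<chi>\<in>exts. a \<chi>) = 1" .
  have "\<exists>\<chi>\<in>exts. a \<chi> \<noteq> 0"
  proof (rule ccontr)
    assume "\<not> (\<exists>\<chi>\<in>exts. a \<chi> \<noteq> 0)"
    hence "(\<Sum>\<chi>\<in>exts. a \<chi>) = 0" by (intro sum.neutral) auto
    thus False using suma by simp
  qed
  then obtain \<chi> where \<chi>: "\<chi> \<in> exts" "a \<chi> \<noteq> 0" by blast
  obtain k where k: "a \<chi> = of_nat k" using aN[OF \<chi>(1)] by (auto simp: Nats_def)
  have \<chi>n: "norm (\<chi> s) = 1" if "s \<in> S" for s by (rule lin_char_norm(2)[OF S extsD(1)[OF \<chi>(1)] that fin])
  \<comment> \<open>Each term of the mean \<open>a \<chi>\<close> has modulus 1, so a mean of at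
    least 1 leaves real part 1, and hence the value 1, for every term.\<close>
  have Re_le: "Re (f s * cnj (\<chi> s)) \<le> 1" if "s \<in> S" for s
    using complex_Re_le_cmod[of "f s * cnj (\<chi> s)"] norm[OF that] \<chi>n[OF that] by (simp add: norm_mult)
  have "real k \<ge> 1" using \<chi>(2) k by (cases k) auto
  hence "real (card S) \<le> real k * real (card S)" by (simp add: mult_le_cancel_right1)
  also have "\<dots> = Re (of_nat (card S) * a \<chi>)" by (simp add: k)
  also have "of_nat (card S) * a \<chi> = (\<Sum>s\<in>S. f s * cnj (\<chi> s))" using cardS by (simp add: a_def)
  finally have "(\<Sum>s\<in>S. 1 - Re (f s * cnj (\<chi> s))) \<le> 0" by (simp add: sum_subtractf)
  moreover have nn: "\<forall>s\<in>S. 0 \<le> 1 - Re (f s * cnj (\<chi> s))" using Re_le by simp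
  ultimately have "(\<Sum>s\<in>S. 1 - Re (f s * cnj (\<chi> s))) = 0"
    by (meson order_antisym sum_nonneg)
  hence Re1: "Re (f s * cnj (\<chi> s)) = 1" if "s \<in> S" for s
    using sum_nonneg_eq_0_iff[OF finS, of "\<lambda>s. 1 - Re (f s * cnj (\<chi> s))"] nn that by auto
  have eq: "f s = \<chi> s" if s: "s \<in> S" for s
  proof -
    let ?z = "f s * cnj (\<chi> s)"
    have "norm ?z = 1" using norm[OF s] \<chi>n[OF s] by (simp add: norm_mult)
    hence z: "?z = 1" using Re1[OF s] by (rule norm_one_Re_one)
    show ?thesis by (rule norm_one_mult_cnj_eq[OF \<chi>n[OF s] z])
  qed
  show "lin_char G S f"
    using extsD(1)[OF \<chi>(1)] eq by (auto simp: lin_char_def)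
qed

end

section \<open>The sequences of subalgebras\<close>

lemma (in group) finite_mult_closed_subgroup:
  assumes fin: "finite (carrier G)" and H: "H \<subseteq> carrier G" "\<one> \<in> H"
    and mult: "\<And>a b. a \<in> H \<Longrightarrow> b \<in> H \<Longrightarrow> a \<otimes> b \<in> H"
  shows "subgroup H G"
proof (rule subgroupI)
  fix a assume a: "a \<in> H"
  have ac: "a \<in> carrier G" using a H by auto
  have pow: "a [^] (k::nat) \<in> H" for k by (induction k) (use a H mult in auto)
  have "Coset.order G > 0" using fin by (simp add: order_gt_0_iff_finite)
  hence "a [^] (Coset.order G - 1) \<otimes> a = a [^] Coset.order G"
    using ac by (cases "Coset.order G") auto
  also have "\<dots> = \<one>" using ac by (simp add: pow_order_eq_1)
  finally have "inv a = a [^] (Coset.order G - 1)" using ac by (intro inv_equality) auto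
  thus "inv a \<in> H" using pow by simp
qed (use H mult in auto)

lemma eventual_value:
  assumes "\<And>j. j \<ge> M \<Longrightarrow> f j = f M"
  shows "terminal_term f = f M"
  unfolding terminal_term_def
proof (rule the_equality)
  show "\<forall>\<^sub>F i in sequentially. f i = f M"
    using assms eventually_sequentially by blast
next
  fix V assume "\<forall>\<^sub>F i in sequentially. f i = V"
  then obtain K where "\<And>j. j \<ge> K \<Longrightarrow> f j = V" by (auto simp: eventually_sequentially)
  hence "f (max K M) = V" by simp
  thus "V = f M" using assms[of "max K M"] by simp
qed

lemma finite_decseq_stable:
  fixes f :: "nat \<Rightarrow> 'b set"
  assumes fin: "finite (f 0)" and dec: "\<And>i. f (Suc i) \<subseteq> f i"
  obtains m where "\<And>j. j \<ge> m \<Longrightarrow> f j = f m"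
proof -
  have anti: "f j \<subseteq> f i" if "i \<le> j" for i j
    using lift_Suc_antimono_le[of f, OF dec that] .
  have finite: "finite (f i)" for i using finite_subset[OF anti[of 0 i] fin] by simp
  obtain m where m: "\<And>j. card (f m) \<le> card (f j)"
    using ex_has_least_nat[of "\<lambda>_. True" 0 "\<lambda>j. card (f j)"] by auto
  have "f j = f m" if "j \<ge> m" for j
    using card_subset_eq[OF finite anti[OF that]] m[of j] card_mono[OF finite anti[OF that]] by simp
  thus ?thesis using that by blast
qed

section \<open>Strictly upper triangular matrices and the unitriangular group\<close>

lemma strict_upper_iff:
  "X \<in> strict_upper n \<longleftrightarrow> X \<in> carrier_mat n n \<and> (\<forall>a<n. \<forall>b\<le>a. X $$ (a, b) = 0)"
proof -
  have "(\<forall>i\<in>{1..n}. \<forall>j\<in>{1..n}. j \<le> i \<longrightarrow> entry X (i, j) = 0) \<longleftrightarrow> (\<forall>a<n. \<forall>b\<le>a. X $$ (a, b) = 0)"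
  proof (intro iffI allI ballI impI)
    fix a b assume *: "\<forall>i\<in>{1..n}. \<forall>j\<in>{1..n}. j \<le> i \<longrightarrow> entry X (i, j) = 0" "a < n" "b \<le> a"
    have "entry X (Suc a, Suc b) = 0" using * by auto
    thus "X $$ (a, b) = 0" by (simp add: entry_def)
  next
    fix i j assume "\<forall>a<n. \<forall>b\<le>a. X $$ (a, b) = 0" "i \<in> {1..n}" "j \<in> {1..n}" "j \<le> i"
    thus "entry X (i, j) = 0" by (auto simp: entry_def)
  qed
  thus ?thesis by (auto simp: strict_upper_def)
qed

text \<open>The filtration by superdiagonals. It is additive under multiplication and reaches zero
  at \<open>n\<close>, and so carries the arguments based on nilpotency.\<close>

definition depth_ge :: "nat \<Rightarrow> nat \<Rightarrow> 'a::zero mat \<Rightarrow> bool" where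
  "depth_ge n k X \<longleftrightarrow> X \<in> carrier_mat n n \<and> (\<forall>a<n. \<forall>b<n. b < a + k \<longrightarrow> X $$ (a, b) = 0)"

lemma strict_upper_depth: "X \<in> strict_upper n \<longleftrightarrow> depth_ge n 1 X"
  by (auto simp: strict_upper_iff depth_ge_def)

lemma depth_ge_mult:
  fixes X Y :: "'a::semiring_0 mat"
  assumes X: "depth_ge n j X" and Y: "depth_ge n k Y"
  shows "depth_ge n (j + k) (X * Y)"
  unfolding depth_ge_def
proof (intro conjI allI impI)
  fix a b assume ab: "a < n" "b < n" "b < a + (j + k)"
  have XY: "X \<in> carrier_mat n n" "Y \<in> carrier_mat n n" using X Y by (auto simp: depth_ge_def)
  have "(X * Y) $$ (a, b) = (\<Sum>c<n. X $$ (a, c) * Y $$ (c, b))"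
    using XY ab by (simp add: scalar_prod_def atLeast0LessThan)
  also have "\<dots> = 0"
  proof (rule sum.neutral, rule ballI)
    fix c assume "c \<in> {..<n}"
    thus "X $$ (a, c) * Y $$ (c, b) = 0"
      using X Y ab by (cases "c < a + j") (auto simp: depth_ge_def)
  qed
  finally show "(X * Y) $$ (a, b) = 0" .
qed (use X Y in \<open>auto simp: depth_ge_def\<close>)

lemma depth_ge_large: "depth_ge n n X \<Longrightarrow> X = 0\<^sub>m n n"
  unfolding depth_ge_def by (intro eq_matI) auto

lemma depth_ge_mono: "depth_ge n k X \<Longrightarrow> j \<le> k \<Longrightarrow> depth_ge n j X"
  by (auto simp: depth_ge_def)

context
  fixes n :: nat
begin

lemmas mat_assoc = assoc_mult_mat[of _ n n _ n _ n]
lemmas mat_distrib = mult_add_distrib_mat[of _ n n _ n] add_mult_distrib_mat[of _ n n _ _ n]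
end

lemma strict_upper_carrier: "X \<in> strict_upper n \<Longrightarrow> X \<in> carrier_mat n n"
  by (simp add: strict_upper_iff)

lemma strict_upper_mult:
  "X \<in> strict_upper n \<Longrightarrow> Y \<in> strict_upper n \<Longrightarrow> X * Y \<in> strict_upper n" for X Y :: "'a::semiring_0 mat"
  unfolding strict_upper_depth by (rule depth_ge_mono[OF depth_ge_mult]) auto

lemma strict_upper_closed:
  fixes X Y :: "'a::ring_1 mat"
  shows "0\<^sub>m n n \<in> strict_upper n"
    and "X \<in> strict_upper n \<Longrightarrow> Y \<in> strict_upper n \<Longrightarrow> X + Y \<in> strict_upper n"
    and "X \<in> strict_upper n \<Longrightarrow> Y \<in> strict_upper n \<Longrightarrow> X - Y \<in> strict_upper n"
    and "X \<in> strict_upper n \<Longrightarrow> c \<cdot>\<^sub>m X \<in> strict_upper n"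
    and "X \<in> strict_upper n \<Longrightarrow> - X \<in> strict_upper n"
  by (auto simp: strict_upper_iff)

lemma finite_strict_upper: "finite (strict_upper n :: 'a::{zero,finite} mat set)"
proof (rule finite_subset)
  show "strict_upper n \<subseteq> mat n n ` (({..<n} \<times> {..<n}) \<rightarrow>\<^sub>E (UNIV :: 'a set))"
  proof
    fix X :: "'a mat" assume X: "X \<in> strict_upper n"
    have "X = mat n n (restrict (\<lambda>ij. X $$ ij) ({..<n} \<times> {..<n}))"
      using X by (intro eq_matI) (auto simp: strict_upper_iff)
    moreover have "restrict (\<lambda>ij. X $$ ij) ({..<n} \<times> {..<n}) \<in> ({..<n} \<times> {..<n}) \<rightarrow>\<^sub>E UNIV" by auto
    ultimately show "X \<in> mat n n ` (({..<n} \<times> {..<n}) \<rightarrow>\<^sub>E (UNIV :: 'a set))" by blast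
  qed
qed (intro finite_imageI finite_PiE, auto)

lemma UT_simps [simp]:
  "x \<otimes>\<^bsub>UT n\<^esub> y = x * y" "\<one>\<^bsub>UT n\<^esub> = 1\<^sub>m n" "carrier (UT n) = one_plus n (strict_upper n)"
  by (simp_all add: UT_def)

lemma one_plus_iff:
  fixes V :: "'a::ring_1 mat set"
  assumes V: "V \<subseteq> strict_upper n"
  shows "g \<in> one_plus n V \<longleftrightarrow> g \<in> carrier_mat n n \<and> g - 1\<^sub>m n \<in> V"
proof
  assume "g \<in> one_plus n V"
  then obtain X where X: "X \<in> V" "g = 1\<^sub>m n + X" by (auto simp: one_plus_def)
  hence "X \<in> carrier_mat n n" using V strict_upper_carrier by auto
  hence "g - 1\<^sub>m n = X" using X by (intro eq_matI) auto
  thus "g \<in> carrier_mat n n \<and> g - 1\<^sub>m n \<in> V" using X \<open>X \<in> carrier_mat n n\<close> by auto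
next
  assume g: "g \<in> carrier_mat n n \<and> g - 1\<^sub>m n \<in> V"
  hence "g = 1\<^sub>m n + (g - 1\<^sub>m n)" by (intro eq_matI) auto
  thus "g \<in> one_plus n V" using g unfolding one_plus_def by blast
qed

lemma one_plus_minus:
  fixes X :: "'a::ring_1 mat"
  shows "X \<in> carrier_mat n n \<Longrightarrow> (1\<^sub>m n + X) - 1\<^sub>m n = X"
  by (intro eq_matI) auto

lemma one_plus_mult:
  fixes X Y :: "'a::ring_1 mat"
  assumes "X \<in> carrier_mat n n" "Y \<in> carrier_mat n n"
  shows "(1\<^sub>m n + X) * (1\<^sub>m n + Y) = 1\<^sub>m n + (X + Y + X * Y)"
proof -
  have "(1\<^sub>m n + X) * (1\<^sub>m n + Y) = (1\<^sub>m n + X) + (Y + X * Y)"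
    using assms by (simp add: mat_distrib[where n = n])
  also have "\<dots> = 1\<^sub>m n + (X + Y + X * Y)"
    using assms by (simp add: assoc_add_mat[of _ n n])
  finally show ?thesis .
qed

lemma card_one_plus:
  fixes V :: "'a::ring_1 mat set"
  assumes "V \<subseteq> strict_upper n"
  shows "card (one_plus n V) = card V"
  unfolding one_plus_def
proof (rule card_image, rule inj_onI)
  fix X Y assume "X \<in> V" "Y \<in> V" "1\<^sub>m n + X = 1\<^sub>m n + Y"
  thus "X = Y" using assms one_plus_minus strict_upper_carrier by (metis subsetD)
qed

lemma UT_det:
  fixes g :: "'a::field mat"
  assumes "g \<in> carrier (UT n)"
  shows "det g = 1"
proof -
  have g: "g \<in> carrier_mat n n" "g - 1\<^sub>m n \<in> strict_upper n"
    using assms by (auto simp: one_plus_iff)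
  have entry: "g $$ (a, b) = (if a = b then 1 else 0)" if "a < n" "b \<le> a" for a b
  proof -
    have "(g - 1\<^sub>m n) $$ (a, b) = 0" using g that by (auto simp: strict_upper_iff)
    thus ?thesis using g that by (auto split: if_splits)
  qed
  have "upper_triangular g" using entry g by (auto simp: upper_triangular_def)
  hence "det g = prod_list (diag_mat g)" using g(1) by (rule det_upper_triangular)
  moreover have "diag_mat g = map (\<lambda>i. 1) [0..<n]" using entry g by (auto simp: diag_mat_def)
  moreover have "prod_list (map (\<lambda>i. 1) xs) = (1::'a)" for xs :: "nat list" by (induction xs) auto
  ultimately show ?thesis by metis
qed

lemma one_plus_strict_mult_closed:
  fixes V :: "'a::ring_1 mat set"
  assumes V: "V \<subseteq> strict_upper n" and add: "\<And>X Y. X \<in> V \<Longrightarrow> Y \<in> V \<Longrightarrow> X + Y \<in> V"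
    and mult: "\<And>X Y. X \<in> V \<Longrightarrow> Y \<in> V \<Longrightarrow> X * Y \<in> V"
    and gh: "g \<in> one_plus n V" "h \<in> one_plus n V"
  shows "g * h \<in> one_plus n V"
proof -
  obtain X Y where XY: "X \<in> V" "Y \<in> V" "g = 1\<^sub>m n + X" "h = 1\<^sub>m n + Y"
    using gh by (auto simp: one_plus_def)
  have "X \<in> carrier_mat n n" "Y \<in> carrier_mat n n" using XY V strict_upper_carrier by auto
  hence "g * h = 1\<^sub>m n + (X + Y + X * Y)" unfolding XY by (rule one_plus_mult)
  thus ?thesis using XY add mult by (auto simp: one_plus_def)
qed

lemma finite_UT: "finite (carrier (UT n :: 'a::{field,finite} mat monoid))"
  by (simp add: one_plus_def finite_strict_upper)

lemma group_UT: "group (UT n :: 'a::{field,finite} mat monoid)"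
proof (rule groupI)
  let ?G = "UT n :: 'a mat monoid"
  have c: "g \<in> carrier_mat n n" if "g \<in> carrier ?G" for g
    using that by (simp add: one_plus_iff)
  have closed: "g * h \<in> carrier ?G" if "g \<in> carrier ?G" "h \<in> carrier ?G" for g h
    unfolding UT_simps
    by (rule one_plus_strict_mult_closed[of "strict_upper n"])
      (use that in \<open>auto intro: strict_upper_closed strict_upper_mult\<close>)
  show "x \<otimes>\<^bsub>?G\<^esub> y \<in> carrier ?G" if "x \<in> carrier ?G" "y \<in> carrier ?G" for x y
    using closed that by simp
  show one: "\<one>\<^bsub>?G\<^esub> \<in> carrier ?G"
    unfolding UT_simps one_plus_def using strict_upper_closed(1)
    by (intro image_eqI[of _ _ "0\<^sub>m n n"]) auto
  show "x \<otimes>\<^bsub>?G\<^esub> y \<otimes>\<^bsub>?G\<^esub> z = x \<otimes>\<^bsub>?G\<^esub> (y \<otimes>\<^bsub>?G\<^esub> z)"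
    if "x \<in> carrier ?G" "y \<in> carrier ?G" "z \<in> carrier ?G" for x y z
    using c[OF that(1)] c[OF that(2)] c[OF that(3)] by (simp add: mat_assoc[where n = n])
  show "\<one>\<^bsub>?G\<^esub> \<otimes>\<^bsub>?G\<^esub> x = x" if "x \<in> carrier ?G" for x using c[OF that] by simp
  show "\<exists>y\<in>carrier ?G. y \<otimes>\<^bsub>?G\<^esub> x = \<one>\<^bsub>?G\<^esub>" if x: "x \<in> carrier ?G" for x
  proof -
    \<comment> \<open>The inverse obtained from the determinant is just some matrix. It makes right
      multiplication by \<open>x\<close> injective on the finite carrier, hence onto, which produces
      an inverse inside the carrier.\<close>
    have "x \<in> Units (ring_mat TYPE('a) n ())"
      using det_non_zero_imp_unit[OF c[OF x]] UT_det[OF x] by simp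
    then obtain B where B: "B \<in> carrier_mat n n" "x * B = 1\<^sub>m n"
      unfolding Units_def ring_mat_def by auto
    have "inj_on (\<lambda>y. y * x) (carrier ?G)"
    proof (rule inj_onI)
      fix y z assume yz: "y \<in> carrier ?G" "z \<in> carrier ?G" "y * x = z * x"
      have "y * (x * B) = z * (x * B)"
        using yz(3) mat_assoc[OF c[OF yz(1)] c[OF x] B(1)] mat_assoc[OF c[OF yz(2)] c[OF x] B(1)] by simp
      thus "y = z" using B c[OF yz(1)] c[OF yz(2)] by simp
    qed
    hence "(\<lambda>y. y * x) ` carrier ?G = carrier ?G"
      using closed x by (intro endo_inj_surj[OF finite_UT]) auto
    hence "1\<^sub>m n \<in> (\<lambda>y. y * x) ` carrier ?G" using one by simp
    thus ?thesis by auto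
  qed
qed

section \<open>The sequences \<open>l_seq\<close>, \<open>s_seq\<close> of a functional on strictly
  upper triangular matrices\<close>

locale ut_form =
  fixes n :: nat and lam :: "'a::{field,finite} mat \<Rightarrow> 'a" and \<theta> :: "'a \<Rightarrow> complex"
  assumes lam: "lam \<in> dual n" and \<theta>: "nontrivial_additive_character \<theta>"
begin

abbreviation "N \<equiv> (strict_upper n :: 'a mat set)"
abbreviation "G \<equiv> (UT n :: 'a mat monoid)"
abbreviation "l \<equiv> l_seq n lam"
abbreviation "s \<equiv> s_seq n lam"

sublocale G: group G by (rule group_UT)

lemmas asc = mat_assoc[where n = n]
lemmas dis = mat_distrib[where n = n]

lemma \<theta>_add: "\<theta> (x + y) = \<theta> x * \<theta> y" and \<theta>_nz [simp]: "\<theta> x \<noteq> 0"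
  using \<theta> by (auto simp: nontrivial_additive_character_def)

lemma \<theta>_0 [simp]: "\<theta> 0 = 1"
proof -
  have "\<theta> 0 * \<theta> 0 = \<theta> 0" using \<theta>_add[of 0 0] by simp
  thus ?thesis by simp
qed

lemma exists_\<theta>: "x \<noteq> 0 \<Longrightarrow> \<exists>c. \<theta> (c * x) \<noteq> 1"
proof -
  assume x: "x \<noteq> 0"
  obtain y where "\<theta> y \<noteq> 1" using \<theta> by (auto simp: nontrivial_additive_character_def)
  thus ?thesis using x by (intro exI[of _ "y / x"]) simp
qed

lemma lam_add: "X \<in> N \<Longrightarrow> Y \<in> N \<Longrightarrow> lam (X + Y) = lam X + lam Y"
  and lam_smult: "X \<in> N \<Longrightarrow> lam (c \<cdot>\<^sub>m X) = c * lam X"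
  using lam by (auto simp: dual_def)

lemma lam_0 [simp]: "lam (0\<^sub>m n n) = 0"
  using lam_smult[OF strict_upper_closed(1), of 0] by simp

lemma Nc: "X \<in> N \<Longrightarrow> X \<in> carrier_mat n n"
  by (rule strict_upper_carrier)

lemma minus_smult: "X \<in> N \<Longrightarrow> Y \<in> N \<Longrightarrow> X - Y = X + (-1) \<cdot>\<^sub>m Y"
  using Nc[of X] Nc[of Y] by (intro eq_matI) auto

lemma lam_minus: "X \<in> N \<Longrightarrow> Y \<in> N \<Longrightarrow> lam (X - Y) = lam X - lam Y"
  by (simp add: minus_smult lam_add lam_smult strict_upper_closed)

lemma N_closed:
  "0\<^sub>m n n \<in> N" "X \<in> N \<Longrightarrow> Y \<in> N \<Longrightarrow> X + Y \<in> N" "X \<in> N \<Longrightarrow> Y \<in> N \<Longrightarrow> X - Y \<in> N"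
  "X \<in> N \<Longrightarrow> c \<cdot>\<^sub>m X \<in> N" "X \<in> N \<Longrightarrow> - X \<in> N" "X \<in> N \<Longrightarrow> Y \<in> N \<Longrightarrow> X * Y \<in> N"
  by (simp_all add: strict_upper_closed strict_upper_mult)

definition lin_closed :: "'a mat set \<Rightarrow> bool" where
  "lin_closed V \<longleftrightarrow> V \<subseteq> N \<and> 0\<^sub>m n n \<in> V \<and> (\<forall>X\<in>V. \<forall>Y\<in>V. X + Y \<in> V) \<and> (\<forall>c. \<forall>X\<in>V. c \<cdot>\<^sub>m X \<in> V)"

lemma lin_closedD:
  assumes "lin_closed V"
  shows "V \<subseteq> N" "0\<^sub>m n n \<in> V" "X \<in> V \<Longrightarrow> Y \<in> V \<Longrightarrow> X + Y \<in> V" "X \<in> V \<Longrightarrow> c \<cdot>\<^sub>m X \<in> V"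
    "X \<in> V \<Longrightarrow> Y \<in> V \<Longrightarrow> X - Y \<in> V"
  using assms minus_smult[of X Y] by (auto simp: lin_closed_def subset_iff)

lemma lin_closed_N: "lin_closed N"
  by (simp add: lin_closed_def N_closed)

lemma lin_closed_annihilator:
  assumes V: "lin_closed V" and W: "W \<subseteq> N"
  shows "lin_closed {X \<in> V. \<forall>Y\<in>W. lam (X * Y) = 0}"
proof -
  have VN: "V \<subseteq> N" using V by (simp add: lin_closed_def)
  have "lam ((X + X') * Y) = lam (X * Y) + lam (X' * Y)" if "X \<in> V" "X' \<in> V" "Y \<in> W" for X X' Y
    using that VN W by (simp add: dis lam_add N_closed Nc subset_iff)
  moreover have "lam ((c \<cdot>\<^sub>m X) * Y) = c * lam (X * Y)" if "X \<in> V" "Y \<in> W" for c X Y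
    using that VN W by (simp add: lam_smult N_closed Nc[of X] Nc[of Y] subset_iff mult_smult_assoc_mat[of _ n n _ n])
  moreover have "0\<^sub>m n n * Y = 0\<^sub>m n n" if "Y \<in> W" for Y
    using that W Nc by (intro left_mult_zero_mat) auto
  ultimately show ?thesis using V by (auto simp: lin_closed_def)
qed

text \<open>The induction needs an ideal property: \<open>l (Suc i)\<close> absorbs
  \<open>s i\<close> on the right by associativity, hence absorbs \<open>s (Suc i)\<close> on the
  left. A product of two elements of \<open>s (Suc i)\<close> then pairs trivially with
  \<open>l (Suc i)\<close>, because the right factor maps \<open>l (Suc i)\<close> into
  itself.\<close>

lemma s_props: "lin_closed (s i) \<and> (\<forall>X\<in>s i. \<forall>Y\<in>s i. X * Y \<in> s i)"
proof (induction i)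
  case 0
  show ?case using lin_closed_N N_closed by auto
next
  case (Suc i)
  have sN: "s i \<subseteq> N" using Suc by (simp add: lin_closed_def)
  have ideal: "X * Y \<in> l (Suc i)" if "X \<in> l (Suc i)" "Y \<in> s i" for X Y
    using that Suc sN by (auto simp: asc Nc subset_iff)
  have "X * Y \<in> l (Suc i)" if X: "X \<in> s (Suc i)" and Y: "Y \<in> l (Suc i)" for X Y
  proof -
    have "lam (X * Y * Z) = 0" if "Z \<in> s i" for Z
    proof -
      have "X * Y * Z = X * (Y * Z)" using X Y that sN by (auto intro!: asc Nc)
      thus ?thesis using X ideal[OF Y that] by auto
    qed
    thus ?thesis using X Y Suc by auto
  qed
  hence "X * Y \<in> s (Suc i)" if "X \<in> s (Suc i)" "Y \<in> s (Suc i)" for X Y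
    using that Suc sN by (auto simp: asc Nc subset_iff)
  moreover have "lin_closed (s (Suc i))"
    unfolding s_seq.simps(2) using Suc sN by (intro lin_closed_annihilator) auto
  ultimately show ?case by blast
qed

lemma s_lin: "lin_closed (s i)" and s_mult: "X \<in> s i \<Longrightarrow> Y \<in> s i \<Longrightarrow> X * Y \<in> s i"
  using s_props by auto

lemma sN: "X \<in> s i \<Longrightarrow> X \<in> N" using s_lin[of i] by (auto simp: lin_closed_def)

lemma l_lin: "lin_closed (l i)"
proof (cases i)
  case 0
  have "0\<^sub>m n n + 0\<^sub>m n n = (0\<^sub>m n n :: 'a mat)" by simp
  thus ?thesis using 0 by (auto simp: lin_closed_def N_closed)
next
  case (Suc j)
  show ?thesis unfolding Suc l_seq.simps(2) by (intro lin_closed_annihilator s_lin subsetI) (rule sN)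
qed

lemma s_dec: "s (Suc i) \<subseteq> s i" by auto

lemma s_anti: "i \<le> j \<Longrightarrow> s j \<subseteq> s i"
  by (induction j) (auto simp: le_Suc_eq)

lemma l_s_Suc: "l (Suc i) \<subseteq> s (Suc i)" by auto

lemma l_s: "l i \<subseteq> s i"
proof (cases i)
  case 0
  thus ?thesis using N_closed by auto
qed (use l_s_Suc in blast)

lemma l_inc: "l i \<subseteq> l (Suc i)"
proof
  fix X assume X: "X \<in> l i"
  hence Xs: "X \<in> s i" using l_s by blast
  show "X \<in> l (Suc i)"
  proof (cases i)
    case 0
    hence "X = 0\<^sub>m n n" using X by simp
    moreover have "0\<^sub>m n n * Y = 0\<^sub>m n n" if "Y \<in> s i" for Y
      using sN[OF that] Nc by (intro left_mult_zero_mat) auto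
    ultimately show ?thesis using Xs by auto
  next
    case (Suc j)
    thus ?thesis using X Xs by auto
  qed
qed

lemma l_right_ideal: "X \<in> l (Suc i) \<Longrightarrow> Y \<in> s i \<Longrightarrow> X * Y \<in> l (Suc i)"
  using s_mult by (auto simp: asc Nc sN)

lemma l_lam: "X \<in> l (Suc i) \<Longrightarrow> Y \<in> s i \<Longrightarrow> lam (X * Y) = 0"
  by auto

lemma l_mult: "X \<in> l i \<Longrightarrow> Y \<in> l i \<Longrightarrow> X * Y \<in> l i"
proof (cases i)
  case 0
  thus "X \<in> l i \<Longrightarrow> Y \<in> l i \<Longrightarrow> X * Y \<in> l i" by simp
next
  case (Suc j)
  thus "X \<in> l i \<Longrightarrow> Y \<in> l i \<Longrightarrow> X * Y \<in> l i"
    using l_right_ideal[of X j Y] l_s[of i] s_dec[of j] by auto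
qed

lemma hat_stage:
  obtains M where "\<And>j. j \<ge> M \<Longrightarrow> s j = s_hat n lam" "\<And>j. j \<ge> M \<Longrightarrow> l j = l_hat n lam"
proof -
  have "finite (s 0)" by (simp add: finite_strict_upper)
  then obtain m where m: "\<And>j. j \<ge> m \<Longrightarrow> s j = s m"
    using finite_decseq_stable[of s] s_dec by metis
  have m': "l j = l (Suc m)" if "j \<ge> Suc m" for j
  proof -
    obtain k where k: "j = Suc k" "k \<ge> m" using \<open>j \<ge> Suc m\<close> by (cases j) auto
    show ?thesis unfolding k l_seq.simps m[OF k(2)] by simp
  qed
  have sh: "s_hat n lam = s m" unfolding s_hat_def by (rule eventual_value) (rule m)
  have lh: "l_hat n lam = l (Suc m)" unfolding l_hat_def by (rule eventual_value) (rule m')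
  have "s j = s_hat n lam" if "j \<ge> Suc m" for j unfolding sh by (rule m) (use that in simp)
  moreover have "l j = l_hat n lam" if "j \<ge> Suc m" for j unfolding lh by (rule m') (rule that)
  ultimately show ?thesis by (rule that)
qed

abbreviation "sh \<equiv> s_hat n lam"
abbreviation "lh \<equiv> l_hat n lam"

text \<open>Read at a stage where both sequences are constant, the recursions say that
  \<open>lam (X * Y)\<close> vanishes on \<open>sh\<close> as soon as one factor lies in
  \<open>lh\<close>.\<close>

lemma hat_eqs:
  "lin_closed sh" "lin_closed lh" "X \<in> sh \<Longrightarrow> Y \<in> sh \<Longrightarrow> X * Y \<in> sh" "X \<in> lh \<Longrightarrow> Y \<in> lh \<Longrightarrow> X * Y \<in> lh"
  "lh = {X \<in> sh. \<forall>Y\<in>sh. lam (X * Y) = 0}" "sh \<subseteq> s i" "l i \<subseteq> lh"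
  "X \<in> sh \<Longrightarrow> Y \<in> lh \<Longrightarrow> lam (X * Y) = 0"
proof -
  obtain M where M: "\<And>j. j \<ge> M \<Longrightarrow> s j = sh" "\<And>j. j \<ge> M \<Longrightarrow> l j = lh"
    by (rule hat_stage) blast
  have M': "s M = sh" "l M = lh" "s (Suc M) = sh" "l (Suc M) = lh"
    by (rule M; simp only: le_SucI order_refl)+
  show "lin_closed sh" "lin_closed lh" using s_lin[of M] l_lin[of M] M' by auto
  show "X \<in> sh \<Longrightarrow> Y \<in> sh \<Longrightarrow> X * Y \<in> sh" using s_mult[of X M Y] M' by simp
  show "X \<in> lh \<Longrightarrow> Y \<in> lh \<Longrightarrow> X * Y \<in> lh" using l_mult[of X M Y] M' by simp
  show "lh = {X \<in> sh. \<forall>Y\<in>sh. lam (X * Y) = 0}" using l_seq.simps(2)[of n lam M] unfolding M' .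
  show "sh \<subseteq> s i" using s_anti[of i "max i M"] M(1)[of "max i M"] by simp
  have "l i \<subseteq> l j" if "i \<le> j" for j using that
    by (induction j) (use l_inc in \<open>auto simp: le_Suc_eq\<close>)
  from this[of "max i M"] show "l i \<subseteq> lh" using M(2)[of "max i M"] by simp
  show "lam (X * Y) = 0" if "X \<in> sh" "Y \<in> lh"
  proof -
    have "X \<in> s (Suc M)" "Y \<in> l (Suc M)" using that by (simp_all only: M'(3,4))
    thus ?thesis unfolding s_seq.simps by blast
  qed
qed

lemma shN: "X \<in> sh \<Longrightarrow> X \<in> N" using hat_eqs(1) by (auto simp: lin_closed_def)

lemma lhN: "X \<in> lh \<Longrightarrow> X \<in> N" using hat_eqs(2) by (auto simp: lin_closed_def)

lemma lh_sh: "X \<in> lh \<Longrightarrow> X \<in> sh" by (subst (asm) hat_eqs(5)) simp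

lemma exists_stage:
  assumes "X \<in> N - sh"
  shows "\<exists>i. X \<in> s i - s (Suc i)"
proof (rule ccontr)
  assume "\<not> ?thesis"
  hence step: "X \<in> s i \<Longrightarrow> X \<in> s (Suc i)" for i by blast
  have all: "X \<in> s i" for i
  proof (induction i)
    case 0
    show ?case using assms by simp
  qed (rule step)
  obtain M where "\<And>j. j \<ge> M \<Longrightarrow> s j = sh" "\<And>j. j \<ge> M \<Longrightarrow> l j = lh"
    by (rule hat_stage) blast
  from this(1)[of M] all[of M] assms show False by simp
qed

text \<open>Among the elements of the right ideal pairing nontrivially with \<open>X\<close>, one of maximal depth
  cannot be multiplied further, so that \<open>X * Y\<close> itself lies in the ideal.\<close>

lemma separating_element:
  assumes X: "X \<in> s i - s (Suc i)"
  shows "\<exists>Y\<in>l (Suc i). X * Y \<in> l (Suc i) \<and> lam (X * Y) \<noteq> 0"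
proof -
  let ?P = "\<lambda>k. \<exists>Y\<in>l (Suc i). lam (X * Y) \<noteq> 0 \<and> depth_ge n k Y"
  have XN: "X \<in> N" using X sN by auto
  have lN: "Y \<in> N" if "Y \<in> l (Suc i)" for Y using lin_closedD(1)[OF l_lin[of "Suc i"]] that by (rule subsetD)
  obtain Y0 where Y0: "Y0 \<in> l (Suc i)" "lam (X * Y0) \<noteq> 0" using X by auto
  have "depth_ge n 1 Y0" using lN[OF Y0(1)] by (simp only: strict_upper_depth)
  hence "depth_ge n 0 Y0" by (rule depth_ge_mono) simp
  hence P0: "?P 0" using Y0 by blast
  have bound: "k \<le> n" if Pk: "?P k" for k
  proof (rule ccontr)
    assume "\<not> k \<le> n"
    obtain Y where Y: "Y \<in> l (Suc i)" "lam (X * Y) \<noteq> 0" "depth_ge n k Y" using Pk by blast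
    have "depth_ge n n Y" using depth_ge_mono[OF Y(3), of n] \<open>\<not> k \<le> n\<close> by simp
    hence "Y = 0\<^sub>m n n" by (rule depth_ge_large)
    hence "X * Y = 0\<^sub>m n n" using Nc[OF XN] by simp
    thus False using Y by simp
  qed
  define k where "k = Greatest ?P"
  have k: "?P k" "\<And>y. ?P y \<Longrightarrow> y \<le> k"
    unfolding k_def using GreatestI_nat[of ?P 0 n, OF P0] Greatest_le_nat[of ?P _ n] bound by simp_all
  obtain Y where Y: "Y \<in> l (Suc i)" "lam (X * Y) \<noteq> 0" "depth_ge n k Y" using k(1) by blast
  have YN: "Y \<in> N" using Y(1) by (auto intro: sN)
  have "lam (X * Y * Z) = 0" if Z: "Z \<in> s i" for Z
  proof (rule ccontr)
    assume nz: "lam (X * Y * Z) \<noteq> 0"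
    have ZN: "Z \<in> N" using Z sN by auto
    have "X * Y * Z = X * (Y * Z)" using XN YN ZN by (simp add: asc Nc)
    moreover have "Y * Z \<in> l (Suc i)" using l_right_ideal[OF Y(1) Z] .
    moreover have "depth_ge n (k + 1) (Y * Z)"
      using depth_ge_mult[OF Y(3), of 1 Z] ZN unfolding strict_upper_depth .
    ultimately have "?P (k + 1)" using nz by metis
    thus False using k(2)[of "k + 1"] by simp
  qed
  moreover have "X * Y \<in> s i" using X Y(1) by (intro s_mult) simp_all
  ultimately have "X * Y \<in> l (Suc i)" by simp
  thus ?thesis using Y by blast
qed

lemma one_plus_subgroup:
  assumes V: "lin_closed V" and mult: "\<And>X Y. X \<in> V \<Longrightarrow> Y \<in> V \<Longrightarrow> X * Y \<in> V"
  shows "subgroup (one_plus n V) G"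
proof (rule G.finite_mult_closed_subgroup[OF finite_UT])
  show "one_plus n V \<subseteq> carrier G" using V by (auto simp: one_plus_def lin_closed_def)
  have "1\<^sub>m n = 1\<^sub>m n + (0\<^sub>m n n :: 'a mat)" by simp
  moreover have "0\<^sub>m n n \<in> V" using V by (simp add: lin_closed_def)
  ultimately show "\<one>\<^bsub>G\<^esub> \<in> one_plus n V" unfolding UT_simps one_plus_def by (rule image_eqI)
  show "a \<otimes>\<^bsub>G\<^esub> b \<in> one_plus n V" if "a \<in> one_plus n V" "b \<in> one_plus n V" for a b
    unfolding UT_simps using lin_closedD(1,3)[OF V] mult that by (intro one_plus_strict_mult_closed) auto
qed

lemma S_subgroup: "subgroup (S_hat n lam) G" and L_subgroup: "subgroup (L_hat n lam) G"
  by (intro one_plus_subgroup hat_eqs(1-4); assumption)+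

lemma Gc: "g \<in> carrier G \<Longrightarrow> g \<in> carrier_mat n n"
  by (simp add: one_plus_iff)

lemma G_minus: "g \<in> carrier G \<Longrightarrow> g - 1\<^sub>m n \<in> N"
  by (simp add: one_plus_iff)

lemma G_mult_N: "g \<in> carrier G \<Longrightarrow> X \<in> N \<Longrightarrow> g * X \<in> N" "g \<in> carrier G \<Longrightarrow> X \<in> N \<Longrightarrow> X * g \<in> N"
proof -
  assume g: "g \<in> carrier G" and X: "X \<in> N"
  obtain Z where Z: "Z \<in> N" "g = 1\<^sub>m n + Z" using g by (auto simp: one_plus_def)
  have "g * X = X + Z * X" "X * g = X + X * Z" unfolding Z(2) using Nc[OF X] Nc[OF Z(1)] by (simp_all add: dis)
  thus "g * X \<in> N" "X * g \<in> N" using Z X N_closed by auto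
qed

lemma G_inv: "g \<in> carrier G \<Longrightarrow> inv\<^bsub>G\<^esub> g \<in> carrier G" "g \<in> carrier G \<Longrightarrow> g * inv\<^bsub>G\<^esub> g = 1\<^sub>m n"
  "g \<in> carrier G \<Longrightarrow> inv\<^bsub>G\<^esub> g * g = 1\<^sub>m n"
  using G.r_inv[of g] G.l_inv[of g] G.inv_closed[of g] by auto

lemma conj_one_plus:
  assumes g: "g \<in> carrier G" and X: "X \<in> N"
  shows "g * (1\<^sub>m n + X) * inv\<^bsub>G\<^esub> g = 1\<^sub>m n + g * X * inv\<^bsub>G\<^esub> g"
  using Gc[OF g] Gc[OF G_inv(1)[OF g]] Nc[OF X] G_inv(2)[OF g] by (simp add: dis asc)

lemma S_hat_iff: "g \<in> S_hat n lam \<longleftrightarrow> g \<in> carrier_mat n n \<and> g - 1\<^sub>m n \<in> sh"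
  using shN by (intro one_plus_iff) auto

lemma L_hat_iff: "g \<in> L_hat n lam \<longleftrightarrow> g \<in> carrier_mat n n \<and> g - 1\<^sub>m n \<in> lh"
  using lhN by (intro one_plus_iff) auto

lemma theta_fun_one_plus: "X \<in> N \<Longrightarrow> theta_fun \<theta> n lam (1\<^sub>m n + X) = \<theta> (lam X)"
  by (auto simp: theta_fun_def one_plus_minus Nc one_plus_def)

lemma theta_fun_lin_char: "lin_char G (L_hat n lam) (theta_fun \<theta> n lam)"
  unfolding lin_char_def
proof (intro conjI ballI)
  fix a b assume "a \<in> L_hat n lam" "b \<in> L_hat n lam"
  then obtain X Y where XY: "X \<in> lh" "a = 1\<^sub>m n + X" "Y \<in> lh" "b = 1\<^sub>m n + Y"
    by (auto simp: one_plus_def)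
  have N: "X \<in> N" "Y \<in> N" using XY lhN by auto
  have "lam (X * Y) = 0" using XY hat_eqs(8) lh_sh by blast
  hence "lam (X + Y + X * Y) = lam X + lam Y" using N by (simp add: lam_add N_closed)
  thus "theta_fun \<theta> n lam (a \<otimes>\<^bsub>G\<^esub> b) = theta_fun \<theta> n lam a * theta_fun \<theta> n lam b"
    using XY N by (simp add: one_plus_mult Nc theta_fun_one_plus N_closed \<theta>_add)
next
  have "1\<^sub>m n = 1\<^sub>m n + (0\<^sub>m n n :: 'a mat)" by simp
  thus "theta_fun \<theta> n lam \<one>\<^bsub>G\<^esub> = 1" using theta_fun_one_plus[OF N_closed(1)] by simp
qed

text \<open>Conjugation by \<open>x = 1 + X\<close> takes \<open>1 + Z x\<close> to
  \<open>1 + x Z\<close>. For \<open>Z\<close> a multiple of the separating element,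
  \<open>lam\<close> kills \<open>Z X\<close> but not \<open>X Z\<close>; the multiple is chosen so
  that \<theta> notices.\<close>

lemma separation:
  assumes x: "x \<in> carrier G - S_hat n lam"
  shows "\<exists>h\<in>L_hat n lam. x \<otimes>\<^bsub>G\<^esub> h \<otimes>\<^bsub>G\<^esub> inv\<^bsub>G\<^esub> x \<in> L_hat n lam \<and>
    theta_fun \<theta> n lam (x \<otimes>\<^bsub>G\<^esub> h \<otimes>\<^bsub>G\<^esub> inv\<^bsub>G\<^esub> x) \<noteq> theta_fun \<theta> n lam h"
proof -
  have xG: "x \<in> carrier G" using x by simp
  obtain X where X: "X \<in> N" "x = 1\<^sub>m n + X" using xG by (auto simp: one_plus_def)
  have "X \<notin> sh" using x X by (auto simp: one_plus_def)
  then obtain i where i: "X \<in> s i - s (Suc i)" using exists_stage[of X] X by auto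
  obtain Y where Y: "Y \<in> l (Suc i)" "X * Y \<in> l (Suc i)" "lam (X * Y) \<noteq> 0"
    using separating_element[OF i] by blast
  have YN: "Y \<in> N" using Y(1) by (auto intro: sN)
  obtain c where c: "\<theta> (c * lam (X * Y)) \<noteq> 1" using exists_\<theta>[OF Y(3)] by blast
  define Z where "Z = c \<cdot>\<^sub>m Y"
  have XZ_eq: "X * Z = c \<cdot>\<^sub>m (X * Y)" unfolding Z_def using X YN by (intro mult_smult_distrib[of _ n n _ n] Nc)
  have Z: "Z \<in> l (Suc i)" "X * Z \<in> l (Suc i)" "lam (X * Z) = c * lam (X * Y)"
    using lin_closedD(4)[OF l_lin[of "Suc i"]] Y unfolding XZ_eq
    by (auto simp: Z_def lam_smult N_closed X YN)
  have ZN: "Z \<in> N" by (simp add: Z_def YN N_closed)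
  have ZX: "Z * X \<in> l (Suc i)" "lam (Z * X) = 0"
    using l_right_ideal[OF Z(1), of X] l_lam[OF Z(1), of X] i by auto
  define h where "h = 1\<^sub>m n + (Z + Z * X)"
  have ll: "l (Suc i) \<subseteq> lh" by (rule hat_eqs(7))
  have hL: "Z + Z * X \<in> lh" using ll lin_closedD(3)[OF l_lin[of "Suc i"] Z(1) ZX(1)] by blast
  have kL: "Z + X * Z \<in> lh" using ll lin_closedD(3)[OF l_lin[of "Suc i"] Z(1,2)] by blast
  have Zx: "Z + Z * X = Z * x" unfolding X(2) using Nc[OF ZN] Nc[OF X(1)] by (simp add: dis)
  have xZ: "Z + X * Z = x * Z" unfolding X(2) using Nc[OF ZN] Nc[OF X(1)] by (simp add: dis)
  have "x * (Z * x) * inv\<^bsub>G\<^esub> x = x * Z"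
    using Gc[OF xG] Gc[OF G_inv(1)[OF xG]] Nc[OF ZN] G_inv(2)[OF xG] by (simp add: asc)
  hence conj: "x * h * inv\<^bsub>G\<^esub> x = 1\<^sub>m n + (Z + X * Z)"
    unfolding h_def Zx xZ using conj_one_plus[OF xG G_mult_N(2)[OF xG ZN]] by simp
  have "theta_fun \<theta> n lam h = \<theta> (lam Z)"
    unfolding h_def using ZN X ZX by (simp add: theta_fun_one_plus N_closed lam_add)
  moreover have "theta_fun \<theta> n lam (x * h * inv\<^bsub>G\<^esub> x) = \<theta> (lam Z) * \<theta> (c * lam (X * Y))"
    unfolding conj using ZN X Z(3) by (simp add: theta_fun_one_plus N_closed lam_add \<theta>_add)
  ultimately have "theta_fun \<theta> n lam (x * h * inv\<^bsub>G\<^esub> x) \<noteq> theta_fun \<theta> n lam h" using c by simp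
  moreover have "h \<in> L_hat n lam" "x * h * inv\<^bsub>G\<^esub> x \<in> L_hat n lam"
    using hL kL conj by (auto simp: h_def one_plus_def)
  ultimately show ?thesis by auto
qed

end

section \<open>Kirillov functions\<close>

context ut_form begin

text \<open>Homogeneity of \<open>f\<close> matters: \<theta> may be 1 at a nonzero value of
  \<open>f\<close>, and scaling the argument moves to a value where it is not.\<close>

lemma lin_closed_sum:
  assumes V: "lin_closed V"
    and add: "\<And>X Y. X \<in> V \<Longrightarrow> Y \<in> V \<Longrightarrow> f (X + Y) = f X + f Y"
    and sm: "\<And>c X. X \<in> V \<Longrightarrow> f (c \<cdot>\<^sub>m X) = c * f X"
  shows "(\<Sum>X\<in>V. \<theta> (f X)) = (if \<forall>X\<in>V. f X = 0 then of_nat (card V) else 0)"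
proof (cases "\<forall>X\<in>V. f X = 0")
  case True
  thus ?thesis by simp
next
  case False
  then obtain Y where Y: "Y \<in> V" "f Y \<noteq> 0" by blast
  obtain c where c: "\<theta> (c * f Y) \<noteq> 1" using exists_\<theta>[OF Y(2)] by blast
  define Z where "Z = c \<cdot>\<^sub>m Y"
  have Z: "Z \<in> V" "\<theta> (f Z) \<noteq> 1" using lin_closedD(4)[OF V Y(1)] sm[OF Y(1)] c by (auto simp: Z_def)
  have VN: "X \<in> carrier_mat n n" if "X \<in> V" for X using V that Nc by (auto simp: lin_closed_def)
  have "(\<Sum>X\<in>V. \<theta> (f X)) = (\<Sum>X\<in>V. \<theta> (f (X + Z)))"
  proof (rule sum.reindex_bij_witness[of _ "\<lambda>X. X + Z" "\<lambda>X. X - Z"])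
    fix X assume X: "X \<in> V"
    show "X - Z + Z = X" "X + Z - Z = X" using VN[OF X] VN[OF Z(1)] by (auto intro!: eq_matI)
    show "X - Z \<in> V" "X + Z \<in> V" using lin_closedD(3,5)[OF V X Z(1)] by auto
    show "\<theta> (f (X - Z + Z)) = \<theta> (f X)" using \<open>X - Z + Z = X\<close> by simp
  qed
  also have "\<dots> = (\<Sum>X\<in>V. \<theta> (f Z) * \<theta> (f X))"
    using add Z by (intro sum.cong refl) (simp add: \<theta>_add mult.commute)
  also have "\<dots> = \<theta> (f Z) * (\<Sum>X\<in>V. \<theta> (f X))" by (simp add: sum_distrib_left)
  finally have "(\<Sum>X\<in>V. \<theta> (f X)) = 0 \<or> \<theta> (f Z) = 1" by (rule eq_scaled_imp)
  hence 0: "(\<Sum>X\<in>V. \<theta> (f X)) = 0" using Z(2) by simp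
  show ?thesis unfolding if_not_P[OF False] by (rule 0)
qed

text \<open>\<open>X\<close> stays in every \<open>s i\<close>: elements \<open>Y\<close> of
  \<open>l (Suc i)\<close> lie in \<open>sh\<close> and satisfy lam (Y X) = 0 by definition, hence
  lam (X Y) = 0 by the assumed symmetry. So the orthogonal space of \<open>sh\<close> under the form
  lam (X Y) - lam (Y X) is contained in \<open>sh\<close>.\<close>

lemma perp_in_sh:
  assumes X: "X \<in> N" and perp: "\<And>Y. Y \<in> sh \<Longrightarrow> lam (X * Y) = lam (Y * X)"
  shows "X \<in> sh"
proof (rule ccontr)
  assume nX: "X \<notin> sh"
  have all: "X \<in> s i" for i
  proof (induction i)
    case (Suc i)
    have "lam (X * Y) = 0" if Y: "Y \<in> l (Suc i)" for Y
    proof -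
      have "Y \<in> sh" using hat_eqs(7)[of "Suc i"] Y lh_sh by blast
      thus ?thesis using perp l_lam[OF Y Suc] by simp
    qed
    thus ?case using Suc unfolding s_seq.simps by blast
  qed (use X in simp)
  obtain i where "X \<notin> s (Suc i)" using exists_stage[of X] X nX by blast
  thus False using all by blast
qed

lemma conj_N: "x \<in> carrier G \<Longrightarrow> Y \<in> N \<Longrightarrow> x * Y * inv\<^bsub>G\<^esub> x \<in> N"
  by (intro G_mult_N G_inv)

lemma conj_N_comp:
  assumes x: "x \<in> carrier G" and y: "y \<in> carrier G" and Y: "Y \<in> N"
  shows "(x * y) * Y * inv\<^bsub>G\<^esub> (x * y) = x * (y * Y * inv\<^bsub>G\<^esub> y) * inv\<^bsub>G\<^esub> x"
proof -
  have "inv\<^bsub>G\<^esub> (x * y) = inv\<^bsub>G\<^esub> y * inv\<^bsub>G\<^esub> x" using G.inv_mult_group[OF x y] by simp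
  thus ?thesis using Gc[OF x] Gc[OF y] Gc[OF G_inv(1)[OF x]] Gc[OF G_inv(1)[OF y]] Nc[OF Y] by (simp add: asc)
qed

text \<open>Replacing \<open>x\<close> by \<open>v x\<close>, where \<open>v\<close> is inverse to
  \<open>1 + Z\<close> with \<open>Z\<close> in \<open>l (Suc i)\<close>, permutes the summation set
  and multiplies each term by \<theta> (lam (C x * Z)). Averaged over \<open>Z\<close> this factor
  is 0, because \<open>C x\<close> is outside \<open>s (Suc i)\<close>.\<close>

lemma stage_sum:
  assumes Y: "Y \<in> N"
  shows "(\<Sum>x | x \<in> carrier G \<and> x * Y * inv\<^bsub>G\<^esub> x \<in> s i - s (Suc i). \<theta> (lam (x * Y * inv\<^bsub>G\<^esub> x))) = 0"
proof -
  define C where "C x = x * Y * inv\<^bsub>G\<^esub> x" for x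
  define A where "A = {x \<in> carrier G. C x \<in> s i - s (Suc i)}"
  have AG: "x \<in> carrier G" if "x \<in> A" for x using that by (simp add: A_def)
  have sub: "subgroup (one_plus n (l (Suc i))) G" by (intro one_plus_subgroup l_lin l_mult)
  have shift: "(\<Sum>x\<in>A. \<theta> (lam (C x))) = (\<Sum>x\<in>A. \<theta> (lam (C x)) * \<theta> (lam (C x * Z)))"
    if Z: "Z \<in> l (Suc i)" for Z
  proof -
    define u where "u = 1\<^sub>m n + Z"
    define v where "v = inv\<^bsub>G\<^esub> u"
    have u: "u \<in> one_plus n (l (Suc i))" using Z by (auto simp: u_def one_plus_def)
    have uG: "u \<in> carrier G" using subgroup.subset[OF sub] u by blast
    have v: "v \<in> one_plus n (l (Suc i))" unfolding v_def by (rule subgroup.m_inv_closed[OF sub u])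
    have vG: "v \<in> carrier G" using subgroup.subset[OF sub] v by blast
    obtain Z' where Z': "Z' \<in> l (Suc i)" "v = 1\<^sub>m n + Z'" using v by (auto simp: one_plus_def)
    have ZN: "Z \<in> N" "Z' \<in> N" using lin_closedD(1)[OF l_lin[of "Suc i"]] Z Z'(1) by blast+
    have Zs: "Z \<in> s j" "Z' \<in> s j" if "j \<le> Suc i" for j
      using s_anti[OF that] l_s[of "Suc i"] Z Z'(1) by blast+
    have conj: "v * X * u = X + X * Z + Z' * (X + X * Z)" if "X \<in> N" for X
    proof -
      have "v * X * u = v * (X * u)" using Gc[OF vG] Gc[OF uG] Nc[OF that] by (simp add: asc)
      also have "X * u = X + X * Z" unfolding u_def using Nc[OF that] Nc[OF ZN(1)] by (simp add: dis)
      also have "v * (X + X * Z) = X + X * Z + Z' * (X + X * Z)"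
        unfolding Z'(2) using Nc[OF that] Nc[OF ZN(1)] Nc[OF ZN(2)] by (simp add: add_mult_distrib_mat[of _ n n _ _ n])
      finally show ?thesis .
    qed
    have conj': "u * X * v = X + X * Z' + Z * (X + X * Z')" if "X \<in> N" for X
    proof -
      have "u * X * v = u * (X * v)" using Gc[OF vG] Gc[OF uG] Nc[OF that] by (simp add: asc)
      also have "X * v = X + X * Z'" unfolding Z'(2) using Nc[OF that] Nc[OF ZN(2)] by (simp add: dis)
      also have "u * (X + X * Z') = X + X * Z' + Z * (X + X * Z')"
        unfolding u_def using Nc[OF that] Nc[OF ZN(1)] Nc[OF ZN(2)] by (simp add: add_mult_distrib_mat[of _ n n _ _ n])
      finally show ?thesis .
    qed
    have mem: "v * X * u \<in> s j" "u * X * v \<in> s j" if X: "X \<in> s j" and j: "j \<le> Suc i" for X j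
      unfolding conj[OF sN[OF X]] conj'[OF sN[OF X]]
      by (intro lin_closedD(3)[OF s_lin] s_mult X Zs[OF j])+
    have Cv: "C (v * x) = v * C x * u" if "x \<in> A" for x
      unfolding C_def using conj_N_comp[OF vG AG[OF that] Y] uG by (simp add: v_def)
    have Cu: "C (u * x) = u * C x * v" if "x \<in> A" for x
      unfolding C_def using conj_N_comp[OF uG AG[OF that] Y] by (simp add: v_def)
    have uv: "u * v = 1\<^sub>m n" "v * u = 1\<^sub>m n" unfolding v_def using G_inv(2,3)[OF uG] by auto
    have CN: "C x \<in> N" if "x \<in> A" for x unfolding C_def by (rule conj_N[OF AG[OF that] Y])
    have undo: "u * (v * X * u) * v = X" "v * (u * X * v) * u = X" if "X \<in> N" for X
    proof -
      note cc = Gc[OF vG] Gc[OF uG] Nc[OF that]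
      have "u * (v * X * u) * v = (u * v) * X * (u * v)" using cc by (simp add: asc)
      thus "u * (v * X * u) * v = X" using cc uv by simp
      have "v * (u * X * v) * u = (v * u) * X * (v * u)" using cc by (simp add: asc)
      thus "v * (u * X * v) * u = X" using cc uv by simp
    qed
    have vA: "v * x \<in> A" if x: "x \<in> A" for x
    proof -
      have "C x \<in> s i" "C x \<notin> s (Suc i)" using x by (auto simp only: A_def mem_Collect_eq Diff_iff)
      hence "v * C x * u \<in> s i" "v * C x * u \<notin> s (Suc i)"
        using mem(1)[of "C x" i] mem(2)[of "v * C x * u" "Suc i"] undo(1)[OF CN[OF x]] by force+
      moreover have "v * x \<in> carrier G" using G.m_closed[OF vG AG[OF x]] by simp
      ultimately show ?thesis unfolding A_def mem_Collect_eq Cv[OF x] by blast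
    qed
    have uA: "u * x \<in> A" if x: "x \<in> A" for x
    proof -
      have "C x \<in> s i" "C x \<notin> s (Suc i)" using x by (auto simp only: A_def mem_Collect_eq Diff_iff)
      hence "u * C x * v \<in> s i" "u * C x * v \<notin> s (Suc i)"
        using mem(2)[of "C x" i] mem(1)[of "u * C x * v" "Suc i"] undo(2)[OF CN[OF x]] by force+
      moreover have "u * x \<in> carrier G" using G.m_closed[OF uG AG[OF x]] by simp
      ultimately show ?thesis unfolding A_def mem_Collect_eq Cu[OF x] by blast
    qed
    have "(\<Sum>x\<in>A. \<theta> (lam (C x))) = (\<Sum>x\<in>A. \<theta> (lam (C (v * x))))"
    proof (rule sum.reindex_bij_witness[of _ "\<lambda>x. v * x" "\<lambda>x. u * x"])
      fix x assume x: "x \<in> A"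
      note cc = Gc[OF vG] Gc[OF uG] Gc[OF AG[OF x]]
      have vu: "v * (u * x) = x" using cc uv by (simp add: asc[symmetric])
      have uv': "u * (v * x) = x" using cc uv by (simp add: asc[symmetric])
      show "v * (u * x) = x" by (rule vu)
      show "u * (v * x) = x" by (rule uv')
      show "u * x \<in> A" by (rule uA[OF x])
      show "v * x \<in> A" by (rule vA[OF x])
      show "\<theta> (lam (C (v * (u * x)))) = \<theta> (lam (C x))" by (simp only: vu)
    qed
    also have "\<dots> = (\<Sum>x\<in>A. \<theta> (lam (C x)) * \<theta> (lam (C x * Z)))"
    proof (rule sum.cong[OF refl])
      fix x assume x: "x \<in> A"
      have Cs: "C x \<in> s i" using x by (simp add: A_def)
      have "C x + C x * Z \<in> s i" by (intro lin_closedD(3)[OF s_lin] s_mult Cs Zs) simp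
      \<comment> \<open>The part of the conjugate multiplied by \<open>Z'\<close> on the left is
        invisible to \<open>lam\<close>, since \<open>Z'\<close> is in
        \<open>l (Suc i)\<close>.\<close>
      hence "lam (Z' * (C x + C x * Z)) = 0" by (rule l_lam[OF Z'(1)])
      hence "lam (v * C x * u) = lam (C x) + lam (C x * Z)"
        unfolding conj[OF CN[OF x]] using CN[OF x] ZN by (simp add: lam_add N_closed)
      thus "\<theta> (lam (C (v * x))) = \<theta> (lam (C x)) * \<theta> (lam (C x * Z))" by (simp add: Cv[OF x] \<theta>_add)
    qed
    finally show ?thesis .
  qed
  have "of_nat (card (l (Suc i))) * (\<Sum>x\<in>A. \<theta> (lam (C x))) = (\<Sum>Z\<in>l (Suc i). \<Sum>x\<in>A. \<theta> (lam (C x)))"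
    by simp
  also have "\<dots> = (\<Sum>Z\<in>l (Suc i). \<Sum>x\<in>A. \<theta> (lam (C x)) * \<theta> (lam (C x * Z)))"
    by (rule sum.cong[OF refl]) (rule shift)
  also have "\<dots> = (\<Sum>x\<in>A. \<theta> (lam (C x)) * (\<Sum>Z\<in>l (Suc i). \<theta> (lam (C x * Z))))"
    by (subst sum.swap) (simp only: sum_distrib_left)
  also have "\<dots> = 0"
  proof (rule sum.neutral, rule ballI)
    fix x assume x: "x \<in> A"
    have CN: "C x \<in> N" unfolding C_def by (rule conj_N[OF AG[OF x] Y])
    have lN: "Z \<in> N" if "Z \<in> l (Suc i)" for Z using lin_closedD(1)[OF l_lin[of "Suc i"]] that by (rule subsetD)
    have "\<not> (\<forall>Z\<in>l (Suc i). lam (C x * Z) = 0)" using x by (auto simp only: A_def mem_Collect_eq Diff_iff s_seq.simps)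
    moreover have "(\<Sum>Z\<in>l (Suc i). \<theta> (lam (C x * Z))) =
        (if \<forall>Z\<in>l (Suc i). lam (C x * Z) = 0 then of_nat (card (l (Suc i))) else 0)"
    proof (rule lin_closed_sum[OF l_lin])
      fix Z Z' assume ZZ: "Z \<in> l (Suc i)" "Z' \<in> l (Suc i)"
      show "lam (C x * (Z + Z')) = lam (C x * Z) + lam (C x * Z')"
        using CN lN[OF ZZ(1)] lN[OF ZZ(2)] by (simp add: dis Nc lam_add N_closed)
    next
      fix c Z assume Z: "Z \<in> l (Suc i)"
      have "C x * (c \<cdot>\<^sub>m Z) = c \<cdot>\<^sub>m (C x * Z)" by (rule mult_smult_distrib[of _ n n _ n]) (use CN lN[OF Z] Nc in auto)
      thus "lam (C x * (c \<cdot>\<^sub>m Z)) = c * lam (C x * Z)" using CN lN[OF Z] by (simp add: lam_smult N_closed)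
    qed
    ultimately show "\<theta> (lam (C x)) * (\<Sum>Z\<in>l (Suc i). \<theta> (lam (C x * Z))) = 0"
      by (simp only: if_False mult_zero_right)
  qed
  finally have "of_nat (card (l (Suc i))) * (\<Sum>x\<in>A. \<theta> (lam (C x))) = 0" .
  moreover have "finite (l (Suc i))"
    by (rule finite_subset[OF lin_closedD(1)[OF l_lin] finite_strict_upper])
  hence "card (l (Suc i)) \<noteq> 0"
    using lin_closedD(2)[OF l_lin[of "Suc i"]] by (metis card_0_eq empty_iff)
  ultimately have "(\<Sum>x\<in>A. \<theta> (lam (C x))) = 0" by (metis mult_eq_0_iff of_nat_eq_0_iff)
  thus ?thesis by (simp only: A_def C_def)
qed

text \<open>Removing the stages one by one leaves only conjugates inside \<open>sh\<close>, which is
  where a function induced from \<open>S_hat\<close> gets its contributions.\<close>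

lemma conj_sum_outside:
  assumes Y: "Y \<in> N"
  shows "(\<Sum>x\<in>carrier G. \<theta> (lam (x * Y * inv\<^bsub>G\<^esub> x))) =
    (\<Sum>x | x \<in> carrier G \<and> x * Y * inv\<^bsub>G\<^esub> x \<in> sh. \<theta> (lam (x * Y * inv\<^bsub>G\<^esub> x)))"
proof -
  have main: "(\<Sum>x\<in>carrier G. \<theta> (lam (x * Y * inv\<^bsub>G\<^esub> x))) =
      (\<Sum>x | x \<in> carrier G \<and> x * Y * inv\<^bsub>G\<^esub> x \<in> s i. \<theta> (lam (x * Y * inv\<^bsub>G\<^esub> x)))" for i
  proof (induction i)
    case 0
    have "{x. x \<in> carrier G \<and> x * Y * inv\<^bsub>G\<^esub> x \<in> s 0} = carrier G" using conj_N[OF _ Y] by auto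
    thus ?case by simp
  next
    case (Suc i)
    let ?B = "{x. x \<in> carrier G \<and> x * Y * inv\<^bsub>G\<^esub> x \<in> s (Suc i)}"
    let ?A = "{x. x \<in> carrier G \<and> x * Y * inv\<^bsub>G\<^esub> x \<in> s i - s (Suc i)}"
    have un: "{x. x \<in> carrier G \<and> x * Y * inv\<^bsub>G\<^esub> x \<in> s i} = ?B \<union> ?A"
      using s_dec[of i] by blast
    have fin: "finite {x. x \<in> carrier G \<and> P x}" for P using finite_UT by (rule rev_finite_subset) auto
    have "(\<Sum>x\<in>?B \<union> ?A. \<theta> (lam (x * Y * inv\<^bsub>G\<^esub> x))) =
        (\<Sum>x\<in>?B. \<theta> (lam (x * Y * inv\<^bsub>G\<^esub> x))) + (\<Sum>x\<in>?A. \<theta> (lam (x * Y * inv\<^bsub>G\<^esub> x)))"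
      by (rule sum.union_disjoint[OF fin fin]) blast
    thus ?case unfolding Suc un stage_sum[OF Y] by (simp only: add_0_right)
  qed
  obtain M where "\<And>j. j \<ge> M \<Longrightarrow> s j = sh" "\<And>j. j \<ge> M \<Longrightarrow> l j = lh"
    by (rule hat_stage) blast
  from main[of M, unfolded this(1)[OF order_refl]] show ?thesis .
qed

text \<open>The radical of the alternating form lam (X Y) - lam (Y X); \<open>1 + rad\<close> is the
  stabiliser of \<open>lam\<close> under the coadjoint action.\<close>

definition rad :: "'a mat set" where
  "rad = {X \<in> N. \<forall>Y\<in>N. lam (X * Y) = lam (Y * X)}"

lemma coadjoint_eq_iff:
  assumes g: "g \<in> carrier G" and h: "h \<in> carrier G"
  shows "coadjoint n lam g = coadjoint n lam h \<longleftrightarrow> g * inv\<^bsub>G\<^esub> h - 1\<^sub>m n \<in> rad"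
proof -
  define k where "k = g * inv\<^bsub>G\<^esub> h"
  have k: "k \<in> carrier G" unfolding k_def using G.m_closed[OF g G_inv(1)[OF h]] by simp
  define K where "K = k - 1\<^sub>m n"
  have K: "K \<in> N" "k = 1\<^sub>m n + K"
    unfolding K_def using G_minus[OF k] Gc[OF k] by (auto intro!: eq_matI)
  have gkh: "g = k * h" unfolding k_def using Gc[OF g] Gc[OF h] Gc[OF G_inv(1)[OF h]] G_inv(3)[OF h] by (simp add: asc)
  have *: "lam (g * X * inv\<^bsub>G\<^esub> g) = lam (k * (h * X * inv\<^bsub>G\<^esub> h) * inv\<^bsub>G\<^esub> k)" if "X \<in> N" for X
    unfolding gkh using conj_N_comp[OF k h that] by simp
  have "coadjoint n lam g = coadjoint n lam h \<longleftrightarrow>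
      (\<forall>X\<in>N. lam (k * (h * X * inv\<^bsub>G\<^esub> h) * inv\<^bsub>G\<^esub> k) = lam (h * X * inv\<^bsub>G\<^esub> h))"
    unfolding coadjoint_def fun_eq_iff restrict_def using * by (simp cong: if_cong) metis
  also have "\<dots> \<longleftrightarrow> (\<forall>Y\<in>N. lam (k * Y * inv\<^bsub>G\<^esub> k) = lam Y)"
  proof
    assume H: "\<forall>X\<in>N. lam (k * (h * X * inv\<^bsub>G\<^esub> h) * inv\<^bsub>G\<^esub> k) = lam (h * X * inv\<^bsub>G\<^esub> h)"
    show "\<forall>Y\<in>N. lam (k * Y * inv\<^bsub>G\<^esub> k) = lam Y"
    proof
      fix Y assume Y: "Y \<in> N"
      have X: "inv\<^bsub>G\<^esub> h * Y * h \<in> N" by (intro G_mult_N G_inv h Y)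
      have "h * (inv\<^bsub>G\<^esub> h * Y * h) * inv\<^bsub>G\<^esub> h = (h * inv\<^bsub>G\<^esub> h) * Y * (h * inv\<^bsub>G\<^esub> h)"
        using Gc[OF h] Gc[OF G_inv(1)[OF h]] Nc[OF Y] by (simp add: asc)
      also have "\<dots> = Y" using Nc[OF Y] G_inv(2)[OF h] by simp
      finally show "lam (k * Y * inv\<^bsub>G\<^esub> k) = lam Y" using H X by metis
    qed
  qed (use conj_N[OF h] in blast)
  \<comment> \<open>Replacing \<open>Y\<close> by \<open>Y k\<close> removes the inverse and makes
    the condition linear in \<open>k\<close>.\<close>
  also have "\<dots> \<longleftrightarrow> (\<forall>Y\<in>N. lam (k * Y) = lam (Y * k))"
  proof -
    have a: "k * (Y * k) * inv\<^bsub>G\<^esub> k = k * Y" if "Y \<in> N" for Y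
      using Gc[OF k] Gc[OF G_inv(1)[OF k]] Nc[OF that] G_inv(2)[OF k] by (simp add: asc)
    have b: "Y * inv\<^bsub>G\<^esub> k * k = Y" "k * (Y * inv\<^bsub>G\<^esub> k) = k * Y * inv\<^bsub>G\<^esub> k" if "Y \<in> N" for Y
      using Gc[OF k] Gc[OF G_inv(1)[OF k]] Nc[OF that] G_inv(3)[OF k] by (simp_all add: asc)
    show ?thesis
    proof
      assume H: "\<forall>Y\<in>N. lam (k * Y * inv\<^bsub>G\<^esub> k) = lam Y"
      show "\<forall>Y\<in>N. lam (k * Y) = lam (Y * k)" using H a G_mult_N(2)[OF k] by metis
    next
      assume H: "\<forall>Y\<in>N. lam (k * Y) = lam (Y * k)"
      show "\<forall>Y\<in>N. lam (k * Y * inv\<^bsub>G\<^esub> k) = lam Y" using H b G_mult_N(2)[OF G_inv(1)[OF k]] by metis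
    qed
  qed
  also have "\<dots> \<longleftrightarrow> (\<forall>Y\<in>N. lam (K * Y) = lam (Y * K))"
  proof (intro ball_cong refl)
    fix Y assume Y: "Y \<in> N"
    have "k * Y = Y + K * Y" "Y * k = Y + Y * K" unfolding K(2) using Nc[OF Y] Nc[OF K(1)] by (simp_all add: dis)
    thus "lam (k * Y) = lam (Y * k) \<longleftrightarrow> lam (K * Y) = lam (Y * K)" using Y K(1) by (simp add: lam_add N_closed)
  qed
  finally show ?thesis using K(1) by (simp add: rad_def K_def k_def)
qed

text \<open>Orbit and stabiliser: the fibres of the map from \<open>x\<close> to
  \<open>coadjoint n lam x\<close> are the right cosets of \<open>1 + rad\<close>.\<close>

lemma orbit_sum:
  fixes F :: "('a mat \<Rightarrow> 'a) \<Rightarrow> complex"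
  shows "(\<Sum>x\<in>carrier G. F (coadjoint n lam x)) = of_nat (card rad) * (\<Sum>\<mu>\<in>coadjoint_orbit n lam. F \<mu>)"
proof -
  have fibre: "card {x \<in> carrier G. coadjoint n lam x = coadjoint n lam h} = card rad" if h: "h \<in> carrier G" for h
  proof -
    have radN: "rad \<subseteq> N" by (auto simp: rad_def)
    have "bij_betw (\<lambda>k. k * h) (one_plus n rad) {x \<in> carrier G. coadjoint n lam x = coadjoint n lam h}"
    proof (rule bij_betw_byWitness[of _ "\<lambda>x. x * inv\<^bsub>G\<^esub> h"])
      have kc: "k \<in> carrier G" if "k \<in> one_plus n rad" for k using that radN by (auto simp: one_plus_def)
      have kh: "k * h * inv\<^bsub>G\<^esub> h = k" if "k \<in> carrier G" for k
        using Gc[OF that] Gc[OF h] Gc[OF G_inv(1)[OF h]] G_inv(2)[OF h] by (simp add: asc)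
      show "\<forall>k\<in>one_plus n rad. k * h * inv\<^bsub>G\<^esub> h = k" using kc kh by blast
      have xh: "x * inv\<^bsub>G\<^esub> h * h = x" if "x \<in> carrier G" for x
        using Gc[OF that] Gc[OF h] Gc[OF G_inv(1)[OF h]] G_inv(3)[OF h] by (simp add: asc)
      show "\<forall>x\<in>{x \<in> carrier G. coadjoint n lam x = coadjoint n lam h}. x * inv\<^bsub>G\<^esub> h * h = x" using xh by blast
      show "(\<lambda>k. k * h) ` one_plus n rad \<subseteq> {x \<in> carrier G. coadjoint n lam x = coadjoint n lam h}"
      proof (intro image_subsetI CollectI conjI)
        fix k assume k: "k \<in> one_plus n rad"
        show kG: "k * h \<in> carrier G" using G.m_closed[OF kc[OF k] h] by simp
        have "k - 1\<^sub>m n \<in> rad" using k one_plus_iff[OF radN] by simp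
        thus "coadjoint n lam (k * h) = coadjoint n lam h"
          unfolding coadjoint_eq_iff[OF kG h] kh[OF kc[OF k]] .
      qed
      show "(\<lambda>x. x * inv\<^bsub>G\<^esub> h) ` {x \<in> carrier G. coadjoint n lam x = coadjoint n lam h} \<subseteq> one_plus n rad"
      proof (rule image_subsetI, elim CollectE conjE)
        fix x assume x: "x \<in> carrier G" "coadjoint n lam x = coadjoint n lam h"
        have "x * inv\<^bsub>G\<^esub> h \<in> carrier_mat n n" using Gc[OF x(1)] Gc[OF G_inv(1)[OF h]] by simp
        thus "x * inv\<^bsub>G\<^esub> h \<in> one_plus n rad"
          using x(2) unfolding coadjoint_eq_iff[OF x(1) h] one_plus_iff[OF radN] by blast
      qed
    qed
    hence "card (one_plus n rad) = card {x \<in> carrier G. coadjoint n lam x = coadjoint n lam h}" by (rule bij_betw_same_card)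
    thus ?thesis using card_one_plus[OF radN] by simp
  qed
  have "(\<Sum>x\<in>carrier G. F (coadjoint n lam x)) =
      (\<Sum>\<mu>\<in>coadjoint n lam ` carrier G. \<Sum>x | x \<in> carrier G \<and> coadjoint n lam x = \<mu>. F (coadjoint n lam x))"
    by (rule sum.image_gen[OF finite_UT])
  also have "\<dots> = (\<Sum>\<mu>\<in>coadjoint n lam ` carrier G. of_nat (card rad) * F \<mu>)"
  proof (rule sum.cong[OF refl])
    fix \<mu> assume "\<mu> \<in> coadjoint n lam ` carrier G"
    then obtain h where h: "h \<in> carrier G" "\<mu> = coadjoint n lam h" by blast
    have "(\<Sum>x | x \<in> carrier G \<and> coadjoint n lam x = \<mu>. F (coadjoint n lam x)) =
        (\<Sum>x | x \<in> carrier G \<and> coadjoint n lam x = \<mu>. F \<mu>)"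
      by (rule sum.cong) auto
    also have "\<dots> = of_nat (card rad) * F \<mu>" using fibre[OF h(1)] h(2) by simp
    finally show "(\<Sum>x | x \<in> carrier G \<and> coadjoint n lam x = \<mu>. F (coadjoint n lam x)) = of_nat (card rad) * F \<mu>" .
  qed
  finally show ?thesis by (simp add: coadjoint_orbit_def sum_distrib_left)
qed

end

text \<open>\<open>iso\<close> makes \<open>sh\<close> isotropic for the form lam (X Y) - lam (Y X);
  \<open>comm3\<close> puts the additive commutators of \<open>sh\<close> into \<open>lh\<close>.
  Together they give the commutator hypothesis of \<open>mackey_pair\<close>.\<close>

locale ut_form_comm = ut_form +
  assumes iso: "X \<in> s_hat n lam \<Longrightarrow> Y \<in> s_hat n lam \<Longrightarrow> lam (X * Y) = lam (Y * X)"
    and comm3: "X \<in> s_hat n lam \<Longrightarrow> Y \<in> s_hat n lam \<Longrightarrow> Z \<in> s_hat n lam \<Longrightarrow> lam (X * Y * Z) = lam (Y * X * Z)"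
begin

lemma commutators:
  assumes a: "a \<in> S_hat n lam" and b: "b \<in> S_hat n lam"
  shows "\<exists>c\<in>L_hat n lam. a \<otimes>\<^bsub>G\<^esub> b = (b \<otimes>\<^bsub>G\<^esub> a) \<otimes>\<^bsub>G\<^esub> c \<and> theta_fun \<theta> n lam c = 1"
proof -
  obtain X where X: "X \<in> sh" "a = 1\<^sub>m n + X" using a by (auto simp: one_plus_def)
  obtain Y where Y: "Y \<in> sh" "b = 1\<^sub>m n + Y" using b by (auto simp: one_plus_def)
  have ba: "b * a \<in> S_hat n lam" using subgroup.m_closed[OF S_subgroup b a] by simp
  have baG: "b * a \<in> carrier G" using subgroup.subset[OF S_subgroup] ba by blast
  have inv_ba: "inv\<^bsub>G\<^esub> (b * a) \<in> S_hat n lam" by (rule subgroup.m_inv_closed[OF S_subgroup ba])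
  then obtain W where W: "W \<in> sh" "inv\<^bsub>G\<^esub> (b * a) = 1\<^sub>m n + W" by (auto simp: one_plus_def)
  note XN = shN[OF X(1)] and YN = shN[OF Y(1)] and WN = shN[OF W(1)]
  note cc = Nc[OF XN] Nc[OF YN] Nc[OF WN]
  define D where "D = X * Y - Y * X"
  have XY: "X * Y \<in> sh" "Y * X \<in> sh" using X Y hat_eqs(3) by auto
  have D: "D \<in> sh" unfolding D_def by (rule lin_closedD(5)[OF hat_eqs(1) XY])
  have DZ: "lam (D * Z) = 0" if Z: "Z \<in> sh" for Z
  proof -
    have "D * Z = X * Y * Z - Y * X * Z" unfolding D_def
      by (rule minus_mult_distrib_mat[of _ n n]) (use cc Nc[OF shN[OF Z]] in auto)
    thus ?thesis using comm3[OF X(1) Y(1) Z] XN YN shN[OF Z] by (simp add: lam_minus N_closed)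
  qed
  have DN: "D \<in> N" by (rule shN[OF D])
  have lamD: "lam D = 0" unfolding D_def using iso[OF X(1) Y(1)] XN YN by (simp add: lam_minus N_closed)
  have WD: "W * D \<in> sh" by (rule hat_eqs(3)[OF W(1) D])
  \<comment> \<open>From \<open>a b = b a + D\<close> the quotient is
    \<open>1 + inv (b a) D\<close>, and \<open>inv (b a) = 1 + W\<close>.\<close>
  define c where "c = 1\<^sub>m n + (D + W * D)"
  have "D + W * D \<in> lh"
  proof -
    have "lam ((D + W * D) * Z) = 0" if Z: "Z \<in> sh" for Z
    proof -
      have ZN: "Z \<in> N" by (rule shN[OF Z])
      have "(D + W * D) * Z = D * Z + W * (D * Z)" using cc Nc[OF DN] Nc[OF ZN] by (simp add: dis asc)
      moreover have "lam (W * (D * Z)) = lam (D * Z * W)" by (rule iso[OF W(1) hat_eqs(3)[OF D Z]])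
      moreover have "D * Z * W = D * (Z * W)" using cc Nc[OF DN] Nc[OF ZN] by (simp add: asc)
      moreover have "lam (D * (Z * W)) = 0" by (rule DZ[OF hat_eqs(3)[OF Z W(1)]])
      ultimately show ?thesis using DZ[OF Z] DN ZN WN by (simp add: lam_add N_closed)
    qed
    thus ?thesis using lin_closedD(3)[OF hat_eqs(1) D WD] by (subst hat_eqs(5)) blast
  qed
  hence cL: "c \<in> L_hat n lam" by (auto simp: c_def one_plus_def)
  have "theta_fun \<theta> n lam c = \<theta> (lam D + lam (W * D))"
    unfolding c_def using DN WN by (simp add: theta_fun_one_plus N_closed lam_add)
  also have "lam (W * D) = lam (D * W)" by (rule iso[OF W(1) D])
  also have "\<dots> = 0" by (rule DZ[OF W(1)])
  finally have th: "theta_fun \<theta> n lam c = 1" using lamD by simp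
  have "a * b = 1\<^sub>m n + (X + Y + X * Y)" "b * a = 1\<^sub>m n + (Y + X + Y * X)"
    unfolding X(2) Y(2) using cc by (simp_all add: one_plus_mult)
  hence ab: "a * b = b * a + D" unfolding D_def using cc by (intro eq_matI) auto
  have "(b * a) * c = (b * a) + (b * a) * (inv\<^bsub>G\<^esub> (b * a) * D)"
  proof -
    have e: "inv\<^bsub>G\<^esub> (b * a) * D = D + W * D" unfolding W(2) using cc Nc[OF DN] by (simp add: dis)
    have "(b * a) * (1\<^sub>m n + (D + W * D)) = (b * a) * 1\<^sub>m n + (b * a) * (D + W * D)"
      by (rule mult_add_distrib_mat[of _ n n _ n]) (use Gc[OF baG] Nc[OF DN] cc in auto)
    thus ?thesis unfolding c_def e right_mult_one_mat[OF Gc[OF baG]] .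
  qed
  also have "(b * a) * (inv\<^bsub>G\<^esub> (b * a) * D) = ((b * a) * inv\<^bsub>G\<^esub> (b * a)) * D"
    by (rule asc[symmetric]) (use Gc[OF baG] Gc[OF G_inv(1)[OF baG]] Nc[OF DN] in auto)
  also have "\<dots> = D" using G_inv(2)[OF baG] Nc[OF DN] by simp
  finally have "a * b = (b * a) * c" using ab by simp
  thus ?thesis using cL th by auto
qed

sublocale mackey_pair G "S_hat n lam" "L_hat n lam" "theta_fun \<theta> n lam"
proof (rule mackey_pair.intro[OF group_UT], rule mackey_pair_axioms.intro)
  show "L_hat n lam \<subseteq> S_hat n lam" using lh_sh by (auto simp: one_plus_def)
qed (fact finite_UT S_subgroup L_subgroup theta_fun_lin_char | rule commutators separation; assumption)+

text \<open>Double count of \<theta> (lam (X Y) - lam (Y X)) over \<open>N\<close> times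
  \<open>sh\<close>. Summing over \<open>Y\<close> first detects \<open>sh\<close>, which is its own
  orthogonal space; summing over \<open>X\<close> first detects \<open>rad\<close>. The result is
  the size of a maximal isotropic subspace.\<close>

lemma card_rad: "card N * card rad = card sh ^ 2"
proof -
  have fin: "finite N" by (rule finite_strict_upper)
  have shsub: "sh \<subseteq> N" using shN by blast
  let ?B = "\<lambda>X Y. lam (X * Y) - lam (Y * X)"
  have "(\<Sum>Y\<in>sh. \<theta> (?B X Y)) = (if X \<in> sh then of_nat (card sh) else 0)" if X: "X \<in> N" for X
  proof -
    have "(\<Sum>Y\<in>sh. \<theta> (?B X Y)) = (if \<forall>Y\<in>sh. ?B X Y = 0 then of_nat (card sh) else 0)"
    proof (rule lin_closed_sum[OF hat_eqs(1)])
      fix Y Z assume "Y \<in> sh" "Z \<in> sh"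
      hence YZ: "Y \<in> N" "Z \<in> N" using shN by auto
      show "?B X (Y + Z) = ?B X Y + ?B X Z"
        using X YZ Nc[OF X] Nc[OF YZ(1)] Nc[OF YZ(2)] by (simp add: dis lam_add N_closed)
    next
      fix c Y assume "Y \<in> sh"
      hence Y: "Y \<in> N" using shN by auto
      have "X * (c \<cdot>\<^sub>m Y) = c \<cdot>\<^sub>m (X * Y)" "(c \<cdot>\<^sub>m Y) * X = c \<cdot>\<^sub>m (Y * X)"
        by (rule mult_smult_distrib[of _ n n _ n] mult_smult_assoc_mat[of _ n n _ n]; use Nc[OF X] Nc[OF Y] in simp)+
      thus "?B X (c \<cdot>\<^sub>m Y) = c * ?B X Y" using X Y by (simp add: lam_smult N_closed right_diff_distrib)
    qed
    moreover have "(\<forall>Y\<in>sh. ?B X Y = 0) \<longleftrightarrow> X \<in> sh"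
      using perp_in_sh[OF X] iso[of X] by auto
    ultimately show ?thesis by simp
  qed
  hence "(\<Sum>X\<in>N. \<Sum>Y\<in>sh. \<theta> (?B X Y)) = (\<Sum>X\<in>N. if X \<in> sh then of_nat (card sh) else 0)"
    by (intro sum.cong refl) auto
  also have "\<dots> = (\<Sum>X\<in>sh. of_nat (card sh))"
    by (rule sum.mono_neutral_cong_right[OF fin shsub]) auto
  finally have 1: "(\<Sum>X\<in>N. \<Sum>Y\<in>sh. \<theta> (?B X Y)) = of_nat (card sh ^ 2)" by (simp add: power2_eq_square)
  have radsh: "rad \<subseteq> sh"
  proof
    fix X assume "X \<in> rad"
    thus "X \<in> sh" using shN by (intro perp_in_sh) (auto simp: rad_def)
  qed
  have "(\<Sum>X\<in>N. \<theta> (?B X Y)) = (if Y \<in> rad then of_nat (card N) else 0)" if Y: "Y \<in> N" for Y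
  proof -
    have "(\<Sum>X\<in>N. \<theta> (?B X Y)) = (if \<forall>X\<in>N. ?B X Y = 0 then of_nat (card N) else 0)"
    proof (rule lin_closed_sum[OF lin_closed_N])
      fix X Z assume XZ: "X \<in> N" "Z \<in> N"
      show "?B (X + Z) Y = ?B X Y + ?B Z Y"
        using Y XZ Nc[OF Y] Nc[OF XZ(1)] Nc[OF XZ(2)] by (simp add: dis lam_add N_closed)
    next
      fix c X assume X: "X \<in> N"
      have "Y * (c \<cdot>\<^sub>m X) = c \<cdot>\<^sub>m (Y * X)" "(c \<cdot>\<^sub>m X) * Y = c \<cdot>\<^sub>m (X * Y)"
        by (rule mult_smult_distrib[of _ n n _ n] mult_smult_assoc_mat[of _ n n _ n]; use Nc[OF X] Nc[OF Y] in simp)+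
      thus "?B (c \<cdot>\<^sub>m X) Y = c * ?B X Y" using X Y by (simp add: lam_smult N_closed right_diff_distrib)
    qed
    moreover have "(\<forall>X\<in>N. ?B X Y = 0) \<longleftrightarrow> Y \<in> rad" using Y by (auto simp: rad_def)
    ultimately show ?thesis by simp
  qed
  hence "(\<Sum>Y\<in>sh. \<Sum>X\<in>N. \<theta> (?B X Y)) = (\<Sum>Y\<in>sh. if Y \<in> rad then of_nat (card N) else 0)"
    using shN by (intro sum.cong refl) auto
  also have "\<dots> = (\<Sum>Y\<in>rad. of_nat (card N))"
    by (rule sum.mono_neutral_cong_right[OF finite_subset[OF shsub fin] radsh]) auto
  finally have "(\<Sum>Y\<in>sh. \<Sum>X\<in>N. \<theta> (?B X Y)) = of_nat (card N * card rad)" by simp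
  moreover have "(\<Sum>Y\<in>sh. \<Sum>X\<in>N. \<theta> (?B X Y)) = (\<Sum>X\<in>N. \<Sum>Y\<in>sh. \<theta> (?B X Y))" by (rule sum.swap)
  ultimately have "of_nat (card N * card rad) = (of_nat (card sh ^ 2) :: complex)" using 1 by simp
  thus ?thesis by (simp only: of_nat_eq_iff)
qed

lemma card_nonzero: "card N \<noteq> 0" "card sh \<noteq> 0" "card rad \<noteq> 0"
proof -
  show 1: "card N \<noteq> 0" using finite_strict_upper[of n, where 'a = 'a] N_closed(1) by auto
  have "sh \<subseteq> N" using shN by blast
  thus 2: "card sh \<noteq> 0" using cardS(1) card_one_plus[of sh n] by simp
  show "card rad \<noteq> 0"
  proof
    assume "card rad = 0"
    hence "card sh ^ 2 = 0" using card_rad by simp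
    thus False using 2 by simp
  qed
qed

lemma card_orbit: "card (coadjoint_orbit n lam) * card sh ^ 2 = card N ^ 2"
proof -
  have "of_nat (card (carrier G)) = of_nat (card rad) * (of_nat (card (coadjoint_orbit n lam)) :: complex)"
    using orbit_sum[of "\<lambda>_. 1"] by (simp del: UT_simps)
  hence "card (carrier G) = card rad * card (coadjoint_orbit n lam)"
    by (simp only: of_nat_mult[symmetric] of_nat_eq_iff)
  moreover have "card (carrier G) = card N" using card_one_plus[of N n] by simp
  ultimately have "card (coadjoint_orbit n lam) * (card N * card rad) = card N ^ 2"
    by (simp add: power2_eq_square mult_ac)
  thus ?thesis by (simp only: card_rad)
qed

text \<open>By \<open>orbit_sum\<close> the left side is a sum of \<theta> (lam (x Y inv x)) over
  the group, and \<open>conj_sum_outside\<close> discards the conjugates off \<open>sh\<close>,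
  which leaves the sum defining the right side. The factors agree because the orbit has (card N /
  card sh)^2 elements.\<close>

lemma kirillov_induced: "kirillov \<theta> n lam = induced G (S_hat n lam) (theta_fun \<theta> n lam)"
proof
  fix g
  show "kirillov \<theta> n lam g = induced G (S_hat n lam) (theta_fun \<theta> n lam) g"
  proof (cases "g \<in> carrier G")
    case g: True
    define Y where "Y = g - 1\<^sub>m n"
    have Y: "Y \<in> N" "g = 1\<^sub>m n + Y" unfolding Y_def using G_minus[OF g] Gc[OF g] by (auto intro!: eq_matI)
    let ?O = "coadjoint_orbit n lam"
    have conj: "x * g * inv\<^bsub>G\<^esub> x = 1\<^sub>m n + x * Y * inv\<^bsub>G\<^esub> x" if "x \<in> carrier G" for x
      unfolding Y(2) by (rule conj_one_plus[OF that Y(1)])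
    have ext: "ext0 (S_hat n lam) (theta_fun \<theta> n lam) (x * g * inv\<^bsub>G\<^esub> x) =
        (if x * Y * inv\<^bsub>G\<^esub> x \<in> sh then \<theta> (lam (x * Y * inv\<^bsub>G\<^esub> x)) else 0)" if x: "x \<in> carrier G" for x
    proof -
      have c: "x * Y * inv\<^bsub>G\<^esub> x \<in> N" by (rule conj_N[OF x Y(1)])
      have "1\<^sub>m n + x * Y * inv\<^bsub>G\<^esub> x \<in> S_hat n lam \<longleftrightarrow> x * Y * inv\<^bsub>G\<^esub> x \<in> sh"
        unfolding S_hat_iff using Nc[OF c] by (simp add: one_plus_minus)
      thus ?thesis unfolding conj[OF x] ext0_def using theta_fun_one_plus[OF c] by simp
    qed
    have "of_nat (card rad) * (\<Sum>\<mu>\<in>?O. theta_fun \<theta> n \<mu> g) = (\<Sum>x\<in>carrier G. theta_fun \<theta> n (coadjoint n lam x) g)"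
      using orbit_sum[of "\<lambda>\<mu>. theta_fun \<theta> n \<mu> g"] by simp
    also have "\<dots> = (\<Sum>x\<in>carrier G. \<theta> (lam (x * Y * inv\<^bsub>G\<^esub> x)))"
      using g Y(1) by (intro sum.cong refl) (simp add: theta_fun_def coadjoint_def Y_def)
    also have "\<dots> = (\<Sum>x | x \<in> carrier G \<and> x * Y * inv\<^bsub>G\<^esub> x \<in> sh. \<theta> (lam (x * Y * inv\<^bsub>G\<^esub> x)))"
      by (rule conj_sum_outside[OF Y(1)])
    also have "\<dots> = (\<Sum>x\<in>carrier G. if x * Y * inv\<^bsub>G\<^esub> x \<in> sh then \<theta> (lam (x * Y * inv\<^bsub>G\<^esub> x)) else 0)"
      by (rule sum.inter_filter[OF finite_UT])
    also have "\<dots> = (\<Sum>x\<in>carrier G. ext0 (S_hat n lam) (theta_fun \<theta> n lam) (x * g * inv\<^bsub>G\<^esub> x))"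
      by (intro sum.cong refl ext[symmetric])
    also have "\<dots> = of_nat (card sh) * induced G (S_hat n lam) (theta_fun \<theta> n lam) g"
    proof -
      have "card (S_hat n lam) = card sh" by (rule card_one_plus) (use shN in blast)
      thus ?thesis using card_nonzero(2) by (simp only: G.induced_altdef[OF finite_UT g] UT_simps(1)) simp
    qed
    finally have 1: "of_nat (card rad) * (\<Sum>\<mu>\<in>?O. theta_fun \<theta> n \<mu> g) =
        of_nat (card sh) * induced G (S_hat n lam) (theta_fun \<theta> n lam) g" .
    have "real (card ?O) = (real (card N) / real (card sh)) ^ 2"
    proof -
      have "real (card ?O) * real (card sh) ^ 2 = real (card N) ^ 2"
        using card_orbit by (metis of_nat_mult of_nat_power)
      thus ?thesis using card_nonzero by (simp add: field_simps)
    qed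
    moreover have pos: "real (card N) / real (card sh) > 0" using card_nonzero by simp
    ultimately have "real (card ?O) powr (-1/2) = real (card sh) / real (card N)"
      by (simp add: powr_minus_divide powr_half_sqrt[symmetric] real_sqrt_unique)
    hence "kirillov \<theta> n lam g = of_real (real (card sh) / real (card N)) * (\<Sum>\<mu>\<in>?O. theta_fun \<theta> n \<mu> g)"
      using g by (simp add: kirillov_def)
    also have "\<dots> = of_nat (card sh) * (of_nat (card rad) * (\<Sum>\<mu>\<in>?O. theta_fun \<theta> n \<mu> g)) / of_nat (card N * card rad)"
      using card_nonzero by simp
    also have "\<dots> = induced G (S_hat n lam) (theta_fun \<theta> n lam) g"
      unfolding 1 card_rad using card_nonzero by (simp add: power2_eq_square)
    finally show ?thesis .
  qed (auto simp: kirillov_def induced_def)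
qed

end

section \<open>Cyclotomic fields of prime power order\<close>

abbreviation ev :: "int poly \<Rightarrow> complex \<Rightarrow> complex" where
  "ev P z \<equiv> poly (map_poly of_int P) z"

lemma ev_simps:
  "ev (P + Q) z = ev P z + ev Q z" "ev (P * Q) z = ev P z * ev Q z" "ev (P - Q) z = ev P z - ev Q z"
  "ev (- P) z = - ev P z" "ev (smult c P) z = of_int c * ev P z" "ev 0 z = 0" "ev 1 z = 1"
  "ev [:c:] z = of_int c" "ev [:0, 1:] z = z" "ev (monom c i) z = of_int c * z ^ i"
  by (simp_all add: of_int_poly_hom.hom_add of_int_poly_hom.hom_mult of_int_poly_hom.hom_minus
      of_int_poly_hom.hom_uminus of_int_hom.map_poly_hom_smult of_int_hom.map_poly_hom_monom poly_monom of_int_hom.map_poly_pCons_hom)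

lemma ev_sum: "ev (\<Sum>a\<in>A. f a) z = (\<Sum>a\<in>A. ev (f a) z)"
  by (induction A rule: infinite_finite_induct) (simp_all add: ev_simps)

lemma ev_pcompose: "ev (pcompose P Q) z = ev P (ev Q z)"
  by (induction P) (simp_all add: pcompose_pCons ev_simps of_int_hom.map_poly_pCons_hom)

lemma dvd_prod_diff:
  fixes f g :: "'b \<Rightarrow> 'c::comm_ring_1"
  assumes "finite A" "\<And>i. i \<in> A \<Longrightarrow> d dvd f i - g i"
  shows "d dvd prod f A - prod g A"
  using assms
proof (induction A rule: finite_induct)
  case (insert a A)
  have "prod f (insert a A) - prod g (insert a A) = (f a - g a) * prod f A + g a * (prod f A - prod g A)"
    using insert.hyps by (simp add: algebra_simps)
  thus ?case using insert by (metis dvd_add dvd_mult dvd_mult2 insertI1 insertI2)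
qed simp

lemma root_of_unity_exp:
  fixes z :: complex
  assumes "z ^ n = 1" "n > 0"
  shows "\<exists>j. z = exp (2 * of_real pi * \<i> / of_nat n) ^ j"
proof -
  have "z \<in> {z. z ^ n = 1}" using assms by simp
  also have "\<dots> = (\<lambda>k. cis (2 * pi * real k / real n)) ` {..<n}"
    using bij_betw_roots_unity[OF assms(2)] by (simp add: bij_betw_def)
  finally obtain k where "z = cis (2 * pi * real k / real n)" by auto
  also have "\<dots> = exp (2 * of_real pi * \<i> / of_nat n) ^ k"
    by (simp add: cis_conv_exp exp_of_nat_mult[symmetric] mult_ac)
  finally show ?thesis by blast
qed

locale prime_power_cyclotomic =
  fixes p k :: nat
  assumes p: "prime p" and k: "0 < k"
begin

text \<open>Chosen so that p q = p^k; in this locale \<open>q\<close> is not the order of the finite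
  field.\<close>

definition "q = p ^ (k - 1)"

definition "\<eta> = exp (2 * of_real pi * \<i> / of_nat (p ^ k))"

lemma p1: "1 < p" and q0: "0 < q" and pk: "p ^ k = p * q" and pq0: "0 < p * q"
proof -
  show 1: "1 < p" using prime_gt_1_nat[OF p] .
  show 2: "0 < q" using 1 by (simp add: q_def)
  show "p ^ k = p * q" using k power_Suc[of p "k - 1"] by (simp add: q_def)
  show "0 < p * q" using 1 2 by simp
qed

lemma \<eta>_pow: "\<eta> ^ (p * q) = 1"
  using pq0 by (simp add: \<eta>_def pk exp_of_nat_mult[symmetric])

lemma \<eta>_eq_1: "\<eta> ^ j = 1 \<longleftrightarrow> p * q dvd j"
proof
  assume *: "\<eta> ^ j = 1"
  define r where "r = j mod (p * q)"
  have "\<eta> ^ j = (\<eta> ^ (p * q)) ^ (j div (p * q)) * \<eta> ^ r"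
    by (simp add: power_mult[symmetric] power_add[symmetric] r_def del: mult_Suc)
  hence "\<eta> ^ r = 1" using * \<eta>_pow by simp
  hence "cis (2 * pi * real r / real (p * q)) = 1"
    by (simp add: \<eta>_def pk cis_conv_exp exp_of_nat_mult[symmetric] mult_ac)
  moreover have "r < p * q" using pq0 by (simp add: r_def)
  hence "r \<in> {..<p * q}" "0 \<in> {..<p * q}" using pq0 by auto
  hence "cis (2 * pi * real r / real (p * q)) = cis (2 * pi * real 0 / real (p * q)) \<Longrightarrow> r = 0"
    using bij_betw_roots_unity[OF pq0] unfolding bij_betw_def inj_on_def by blast
  ultimately have "r = 0" by simp
  thus "p * q dvd j" by (simp add: r_def dvd_eq_mod_eq_0)
next
  assume "p * q dvd j"
  then obtain c where "j = p * q * c" by (auto simp: dvd_def)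
  hence "\<eta> ^ j = (\<eta> ^ (p * q)) ^ c" by (simp only: power_mult)
  thus "\<eta> ^ j = 1" by (simp add: \<eta>_pow)
qed

text \<open>The ring of integer combinations of powers of \<eta>. All p^k powers are allowed, so
  coefficients are not unique, and closure under products uses no relation beyond \<eta>^(p q) =
  1.\<close>

definition ZE :: "complex set" where
  "ZE = {z. \<exists>c. z = (\<Sum>j<p * q. of_int (c j) * \<eta> ^ j)}"

lemma ZE_sum:
  assumes "finite A"
  shows "(\<Sum>a\<in>A. of_int (c a) * \<eta> ^ e a) \<in> ZE"
proof -
  have "(\<Sum>a\<in>A. of_int (c a) * \<eta> ^ e a) = (\<Sum>a\<in>A. of_int (c a) * \<eta> ^ (e a mod (p * q)))"
  proof (intro sum.cong refl)
    fix a
    have "\<eta> ^ e a = (\<eta> ^ (p * q)) ^ (e a div (p * q)) * \<eta> ^ (e a mod (p * q))"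
      by (simp add: power_mult[symmetric] power_add[symmetric] del: mult_Suc)
    thus "of_int (c a) * \<eta> ^ e a = of_int (c a) * \<eta> ^ (e a mod (p * q))" by (simp add: \<eta>_pow)
  qed
  also have "\<dots> = (\<Sum>j<p * q. \<Sum>a | a \<in> A \<and> e a mod (p * q) = j. of_int (c a) * \<eta> ^ (e a mod (p * q)))"
    by (rule sum.group[symmetric]) (use assms pq0 in auto)
  also have "\<dots> = (\<Sum>j<p * q. of_int (\<Sum>a | a \<in> A \<and> e a mod (p * q) = j. c a) * \<eta> ^ j)"
    by (intro sum.cong refl) (simp add: sum_distrib_right)
  finally show ?thesis unfolding ZE_def mem_Collect_eq
    by (rule exI[of _ "\<lambda>j. \<Sum>a | a \<in> A \<and> e a mod (p * q) = j. c a"])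
qed

lemma ZE_int: "of_int c \<in> ZE"
  using ZE_sum[of "{0::nat}" "\<lambda>_. c" "\<lambda>_. 0"] by simp

lemma ZE_1: "1 \<in> ZE" and ZE_0: "0 \<in> ZE" and ZE_nat: "of_nat m \<in> ZE"
  using ZE_int[of 1] ZE_int[of 0] ZE_int[of "int m"] by simp_all

lemma ZE_\<eta>: "\<eta> \<in> ZE"
  using ZE_sum[of "{0::nat}" "\<lambda>_. 1" "\<lambda>_. 1"] by simp

lemma ZE_add: "x \<in> ZE \<Longrightarrow> y \<in> ZE \<Longrightarrow> x + y \<in> ZE"
proof -
  assume "x \<in> ZE" "y \<in> ZE"
  then obtain c d where "x = (\<Sum>j<p * q. of_int (c j) * \<eta> ^ j)" "y = (\<Sum>j<p * q. of_int (d j) * \<eta> ^ j)"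
    by (auto simp: ZE_def)
  hence "x + y = (\<Sum>j<p * q. of_int (c j + d j) * \<eta> ^ j)" by (simp add: sum.distrib ring_distribs)
  thus ?thesis unfolding ZE_def by (intro CollectI exI[of _ "\<lambda>j. c j + d j"])
qed

lemma ZE_mult: "x \<in> ZE \<Longrightarrow> y \<in> ZE \<Longrightarrow> x * y \<in> ZE"
proof -
  assume "x \<in> ZE" "y \<in> ZE"
  then obtain c d where "x = (\<Sum>j<p * q. of_int (c j) * \<eta> ^ j)" "y = (\<Sum>j<p * q. of_int (d j) * \<eta> ^ j)"
    by (auto simp: ZE_def)
  hence "x * y = (\<Sum>(i, j)\<in>{..<p * q} \<times> {..<p * q}. of_int (c i * d j) * \<eta> ^ (i + j))"
    by (simp add: sum_product sum.cartesian_product power_add mult_ac)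
  also have "\<dots> = (\<Sum>a\<in>{..<p * q} \<times> {..<p * q}. of_int (c (fst a) * d (snd a)) * \<eta> ^ (fst a + snd a))"
    by (simp add: case_prod_unfold)
  also have "\<dots> \<in> ZE" by (rule ZE_sum) simp
  finally show ?thesis .
qed

lemma ZE_uminus: "x \<in> ZE \<Longrightarrow> - x \<in> ZE"
  using ZE_mult[OF ZE_int[of "-1"]] by simp

lemma ZE_diff: "x \<in> ZE \<Longrightarrow> y \<in> ZE \<Longrightarrow> x - y \<in> ZE"
  using ZE_add[OF _ ZE_uminus] by simp

lemma ZE_pow: "x \<in> ZE \<Longrightarrow> x ^ m \<in> ZE"
  by (induction m) (auto intro: ZE_1 ZE_mult)

lemma ZE_sum': "(\<And>a. a \<in> A \<Longrightarrow> f a \<in> ZE) \<Longrightarrow> (\<Sum>a\<in>A. f a) \<in> ZE"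
  by (induction A rule: infinite_finite_induct) (auto intro: ZE_0 ZE_add)

lemmas ZE_closed = ZE_int ZE_1 ZE_0 ZE_nat ZE_\<eta> ZE_add ZE_mult ZE_uminus ZE_diff ZE_pow ZE_sum'

text \<open>Multiplication by an element \<open>z\<close> with \<open>m = p z\<close> is given on the powers of \<open>\<eta>\<close> by an integer
  matrix \<open>A\<close>, and \<open>det (m - p A) = 0\<close> is congruent to a power of \<open>m\<close> modulo \<open>p\<close>.\<close>

lemma int_dvd_of_ZE:
  assumes z: "z \<in> ZE" and m: "of_int m = of_nat p * z"
  shows "int p dvd m"
proof -
  let ?n = "p * q"
  have "\<exists>c. z * \<eta> ^ i = (\<Sum>j<?n. of_int (c j) * \<eta> ^ j)" for i
    using ZE_mult[OF z ZE_pow[OF ZE_\<eta>, of i]] by (auto simp: ZE_def)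
  hence "\<exists>c. \<forall>i. z * \<eta> ^ i = (\<Sum>j<?n. of_int (c i j) * \<eta> ^ j)" by (intro choice allI)
  then obtain c where c: "\<And>i. z * \<eta> ^ i = (\<Sum>j<?n. of_int (c i j) * \<eta> ^ j)" by blast
  define M where "M = mat ?n ?n (\<lambda>(i, j). (if i = j then m else 0) - int p * c i j)"
  define v where "v = vec ?n (\<lambda>j. \<eta> ^ j)"
  have M: "map_mat complex_of_int M \<in> carrier_mat ?n ?n" by (simp add: M_def)
  have "map_mat complex_of_int M *\<^sub>v v = 0\<^sub>v ?n"
  proof (rule eq_vecI)
    fix i assume "i < dim_vec (0\<^sub>v ?n :: complex vec)"
    hence i: "i < ?n" by simp
    have "(map_mat complex_of_int M *\<^sub>v v) $ i =
        (\<Sum>j<?n. ((if i = j then of_int m else 0) - of_nat p * of_int (c i j)) * \<eta> ^ j)"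
      using i by (simp add: M_def v_def scalar_prod_def atLeast0LessThan if_distrib[of complex_of_int] cong: if_cong)
    also have "\<dots> = (\<Sum>j<?n. (if i = j then of_int m * \<eta> ^ j else 0)) - of_nat p * (\<Sum>j<?n. of_int (c i j) * \<eta> ^ j)"
      unfolding sum_distrib_left sum_subtractf[symmetric]
      by (intro sum.cong refl) (simp add: algebra_simps)
    also have "\<dots> = of_int m * \<eta> ^ i - of_nat p * (z * \<eta> ^ i)" using i by (simp add: c)
    also have "\<dots> = 0" by (simp add: m mult.assoc)
    finally show "(map_mat complex_of_int M *\<^sub>v v) $ i = 0\<^sub>v ?n $ i" using i by simp
  qed (simp add: M_def)
  moreover have "v \<in> carrier_vec ?n" by (simp add: v_def)
  moreover have "v \<noteq> 0\<^sub>v ?n"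
  proof
    assume "v = 0\<^sub>v ?n"
    hence "v $ 0 = 0" using pq0 by simp
    thus False using pq0 by (simp add: v_def)
  qed
  ultimately have "det (map_mat complex_of_int M) = 0" using det_0_iff_vec_prod_zero[OF M] by blast
  hence "complex_of_int (det M) = 0" by (simp add: of_int_hom.hom_det)
  hence "det M = 0" by simp
  moreover have "int p dvd det M - det (m \<cdot>\<^sub>m 1\<^sub>m ?n)"
  proof -
    have a: "int p dvd (\<Prod>i = 0..<?n. M $$ (i, f i)) - (\<Prod>i = 0..<?n. (m \<cdot>\<^sub>m 1\<^sub>m ?n) $$ (i, f i))"
      if f: "f permutes {0..<?n}" for f
    proof (rule dvd_prod_diff)
      fix i assume "i \<in> {0..<?n}"
      moreover from this have "f i \<in> {0..<?n}" using permutes_in_image[OF f] by simp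
      ultimately show "int p dvd M $$ (i, f i) - (m \<cdot>\<^sub>m 1\<^sub>m ?n) $$ (i, f i)" by (simp add: M_def)
    qed simp
    have b: "det M - det (m \<cdot>\<^sub>m 1\<^sub>m ?n) = (\<Sum>f | f permutes {0..<?n}. signof f *
        ((\<Prod>i = 0..<?n. M $$ (i, f i)) - (\<Prod>i = 0..<?n. (m \<cdot>\<^sub>m 1\<^sub>m ?n) $$ (i, f i))))"
      by (simp add: det_def M_def right_diff_distrib sum_subtractf)
    show ?thesis unfolding b by (intro dvd_sum dvd_mult a) simp
  qed
  moreover have "det (m \<cdot>\<^sub>m 1\<^sub>m ?n) = m ^ ?n" by simp
  ultimately have "int p dvd 0 - m ^ ?n" by (simp only:)
  hence "int p dvd m ^ ?n" by (simp only: diff_0 dvd_minus_iff)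
  moreover have "prime (int p)" using p by simp
  ultimately show ?thesis by (metis prime_dvd_power)
qed

text \<open>The inner binomial coefficients are divisible by \<open>p\<close>. The linear term is
  kept apart since it supplies the term \<open>p\<close> once the expansion of (1 + x)^p = 1 is
  divided by \<open>x\<close>.\<close>

lemma binomial_prime:
  assumes x: "x \<in> ZE"
  shows "\<exists>g\<in>ZE. (1 + x) ^ p = 1 + of_nat p * x + of_nat p * x ^ 2 * g + x ^ p"
proof -
  define g where "g = (\<Sum>j\<in>{2..<p}. of_nat ((p choose j) div p) * x ^ (j - 2))"
  have gZ: "g \<in> ZE" unfolding g_def by (intro ZE_sum' ZE_mult ZE_nat ZE_pow x)
  have "(1 + x) ^ p = (\<Sum>j\<le>p. of_nat (p choose j) * x ^ j)"
    using binomial_ring[of x 1 p] by (simp only: power_one mult_1_right add.commute[of 1 x])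
  also have "{..p} = insert 0 (insert 1 (insert p {2..<p}))" using p1 by auto
  also have "(\<Sum>j\<in>insert 0 (insert 1 (insert p {2..<p})). of_nat (p choose j) * x ^ j) =
      1 + of_nat p * x + (\<Sum>j\<in>{2..<p}. of_nat (p choose j) * x ^ j) + x ^ p"
    using p1 by simp
  also have "(\<Sum>j\<in>{2..<p}. of_nat (p choose j) * x ^ j) = of_nat p * x ^ 2 * g"
    unfolding g_def sum_distrib_left
  proof (intro sum.cong refl)
    fix j assume j: "j \<in> {2..<p}"
    have "p dvd (p choose j)" using j p by (intro dvd_choose_prime) auto
    hence "of_nat (p choose j) = of_nat p * (of_nat ((p choose j) div p) :: complex)"
      by (metis dvd_mult_div_cancel of_nat_mult)
    moreover have "2 \<le> j" using j by simp
    hence "2 + (j - 2) = j" by (rule le_add_diff_inverse)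
    hence "x ^ j = x ^ 2 * x ^ (j - 2)" by (metis power_add)
    ultimately show "of_nat (p choose j) * x ^ j = of_nat p * x ^ 2 * (of_nat ((p choose j) div p) * x ^ (j - 2))"
      by (simp only: mult_ac)
  qed
  finally show ?thesis using gZ by blast
qed

definition "\<pi> = \<eta> - 1"

lemma ZE_\<pi>: "\<pi> \<in> ZE" by (simp add: \<pi>_def ZE_closed)

text \<open>The Frobenius congruence holds modulo p \<pi>, not merely modulo \<open>p\<close>; the
  additional \<pi> is what produces the factor 1 + \<pi> g in \<open>p_pi\<close>.\<close>

lemma eta_frobenius: "\<exists>h\<in>ZE. \<eta> ^ (p ^ a) = 1 + \<pi> ^ (p ^ a) + of_nat p * \<pi> * h"
proof (induction a)
  case 0
  show ?case by (rule bexI[OF _ ZE_0]) (simp add: \<pi>_def)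
next
  case (Suc a)
  then obtain h where h: "h \<in> ZE" "\<eta> ^ (p ^ a) = 1 + \<pi> ^ (p ^ a) + of_nat p * \<pi> * h" by blast
  define x where "x = \<pi> ^ (p ^ a) + of_nat p * \<pi> * h"
  have xZ: "x \<in> ZE" unfolding x_def using h by (intro ZE_closed ZE_\<pi>)
  obtain g where g: "g \<in> ZE" "(1 + x) ^ p = 1 + of_nat p * x + of_nat p * x ^ 2 * g + x ^ p"
    using binomial_prime[OF xZ] by blast
  have "p ^ a > 0" using p1 by simp
  then obtain b where b: "p ^ a = Suc b" by (cases "p ^ a") auto
  define y where "y = \<pi> ^ b + of_nat p * h"
  have y: "x = \<pi> * y" unfolding x_def y_def b by (simp add: algebra_simps)
  have yZ: "y \<in> ZE" unfolding y_def using h by (intro ZE_closed ZE_\<pi>)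
  define w where "w = (\<Sum>i<p. (\<pi> ^ (p ^ a)) ^ (p - Suc i) * x ^ i)"
  have wZ: "w \<in> ZE" unfolding w_def by (intro ZE_closed xZ ZE_\<pi>)
  have "x ^ p - (\<pi> ^ (p ^ a)) ^ p = (x - \<pi> ^ (p ^ a)) * w"
    unfolding w_def by (rule power_diff_sumr2)
  moreover have "x - \<pi> ^ (p ^ a) = of_nat p * \<pi> * h" by (simp add: x_def)
  moreover have "(\<pi> ^ (p ^ a)) ^ p = \<pi> ^ (p ^ Suc a)" by (simp add: power_mult[symmetric] mult.commute)
  ultimately have "x ^ p - \<pi> ^ (p ^ Suc a) = of_nat p * \<pi> * h * w" by (simp only:)
  hence xp: "x ^ p = \<pi> ^ (p ^ Suc a) + of_nat p * \<pi> * h * w" by (simp only: diff_eq_eq add.commute)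
  have "\<eta> ^ (p ^ Suc a) = (\<eta> ^ (p ^ a)) ^ p" by (simp add: power_mult[symmetric] mult.commute)
  also have "\<eta> ^ (p ^ a) = 1 + x" using h by (simp add: x_def)
  also have "(1 + x) ^ p = 1 + \<pi> ^ (p ^ Suc a) + of_nat p * \<pi> * (y + \<pi> * y ^ 2 * g + h * w)"
    unfolding g(2) xp unfolding y by (simp add: algebra_simps power2_eq_square)
  finally show ?case using h(1) g(1) yZ wZ ZE_\<pi>
    by (intro bexI[of _ "y + \<pi> * y ^ 2 * g + h * w"]) (auto intro!: ZE_closed)
qed

text \<open>Euler's totient of p^k: the degree of the cyclotomic polynomial and the ramification
  index of \<open>p\<close>.\<close>

definition "\<phi> = q * (p - 1)"

text \<open>With \<eta>^q = 1 + x, dividing (1 + x)^p = 1 by the nonzero \<open>x\<close> gives p +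
  p x g + x^(p-1) = 0, and x^(p-1) agrees with \<pi>^\<phi> modulo p \<pi>.\<close>

lemma p_pi: "\<exists>g\<in>ZE. of_nat p * (1 + \<pi> * g) = - (\<pi> ^ \<phi>)"
proof -
  obtain h where h: "h \<in> ZE" "\<eta> ^ q = 1 + \<pi> ^ q + of_nat p * \<pi> * h"
    using eta_frobenius[of "k - 1"] by (auto simp: q_def)
  define x where "x = \<pi> ^ q + of_nat p * \<pi> * h"
  have xZ: "x \<in> ZE" unfolding x_def using h by (intro ZE_closed ZE_\<pi>)
  have \<eta>x: "\<eta> ^ q = 1 + x" using h by (simp add: x_def)
  obtain b where b: "q = Suc b" using q0 by (cases q) auto
  define y where "y = \<pi> ^ b + of_nat p * h"
  have y: "x = \<pi> * y" unfolding x_def y_def b by (simp add: algebra_simps)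
  have yZ: "y \<in> ZE" unfolding y_def using h by (intro ZE_closed ZE_\<pi>)
  have "\<not> p * q dvd q" using p1 q0 by (auto dest: dvd_imp_le)
  hence x0: "x \<noteq> 0" using \<eta>x \<eta>_eq_1[of q] by auto
  obtain g where g: "g \<in> ZE" "(1 + x) ^ p = 1 + of_nat p * x + of_nat p * x ^ 2 * g + x ^ p"
    using binomial_prime[OF xZ] by blast
  have "(1 + x) ^ p = 1" using \<eta>_pow by (simp add: \<eta>x[symmetric] power_mult[symmetric] mult.commute)
  moreover have "x ^ p = x * x ^ (p - 1)" using p1 by (cases p) auto
  ultimately have "x * (of_nat p + of_nat p * x * g + x ^ (p - 1)) = 0"
    using g(2) by (simp add: algebra_simps power2_eq_square)
  hence 1: "of_nat p + of_nat p * x * g + x ^ (p - 1) = 0" using x0 by simp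
  define w where "w = (\<Sum>i<p - 1. (\<pi> ^ q) ^ (p - 1 - Suc i) * x ^ i)"
  have wZ: "w \<in> ZE" unfolding w_def by (intro ZE_closed xZ ZE_\<pi>)
  have "x ^ (p - 1) - (\<pi> ^ q) ^ (p - 1) = (x - \<pi> ^ q) * w"
    unfolding w_def by (rule power_diff_sumr2)
  moreover have "x - \<pi> ^ q = of_nat p * \<pi> * h" by (simp add: x_def)
  moreover have "(\<pi> ^ q) ^ (p - 1) = \<pi> ^ \<phi>" by (simp add: \<phi>_def power_mult)
  ultimately have "x ^ (p - 1) - \<pi> ^ \<phi> = of_nat p * \<pi> * h * w" by (simp only:)
  hence xp: "x ^ (p - 1) = \<pi> ^ \<phi> + of_nat p * \<pi> * h * w" by (simp only: diff_eq_eq add.commute)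
  have "of_nat p * (1 + \<pi> * (y * g + h * w)) = - (\<pi> ^ \<phi>)"
    using 1 unfolding xp unfolding y by (simp add: algebra_simps eq_neg_iff_add_eq_0)
  thus ?thesis using yZ g(1) h(1) wZ by (intro bexI[of _ "y * g + h * w"]) (auto intro!: ZE_closed)
qed

text \<open>Instead of inverting 1 + \<pi> g in \<open>ZE\<close>, the relation of
  \<open>p_pi\<close> is substituted into itself until the remainder, too, carries the factor
  \<pi>^\<phi>.\<close>

lemma p_in_pi: "\<exists>w\<in>ZE. of_nat p = \<pi> ^ \<phi> * w"
proof -
  obtain g where g: "g \<in> ZE" "of_nat p * (1 + \<pi> * g) = - (\<pi> ^ \<phi>)" using p_pi by blast
  have "\<exists>u\<in>ZE. \<exists>v\<in>ZE. of_nat p = \<pi> ^ \<phi> * u + of_nat p * \<pi> ^ m * v" for m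
  proof (induction m)
    case 0
    show ?case by (rule bexI[OF _ ZE_0], rule bexI[OF _ ZE_1]) simp
  next
    case (Suc m)
    then obtain u v where uv: "u \<in> ZE" "v \<in> ZE" "of_nat p = \<pi> ^ \<phi> * u + of_nat p * \<pi> ^ m * v" by blast
    have p': "of_nat p = - (\<pi> ^ \<phi>) - of_nat p * \<pi> * g" using g(2) by (simp add: algebra_simps)
    have "of_nat p * \<pi> ^ m * v = (- (\<pi> ^ \<phi>) - of_nat p * \<pi> * g) * \<pi> ^ m * v" using p' by simp
    also have "\<dots> = \<pi> ^ \<phi> * (- (\<pi> ^ m * v)) + of_nat p * \<pi> ^ Suc m * (- (g * v))" by (simp add: algebra_simps)
    finally have e: "of_nat p * \<pi> ^ m * v = \<pi> ^ \<phi> * (- (\<pi> ^ m * v)) + of_nat p * \<pi> ^ Suc m * (- (g * v))" .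
    note uv(3)
    also have "\<pi> ^ \<phi> * u + of_nat p * \<pi> ^ m * v =
        \<pi> ^ \<phi> * (u + - (\<pi> ^ m * v)) + of_nat p * \<pi> ^ Suc m * (- (g * v))"
      unfolding e by (simp add: algebra_simps)
    finally have "of_nat p = \<pi> ^ \<phi> * (u + - (\<pi> ^ m * v)) + of_nat p * \<pi> ^ Suc m * (- (g * v))" .
    thus ?case using uv g(1) ZE_\<pi>
      by (intro bexI[of _ "u + - (\<pi> ^ m * v)"] bexI[of _ "- (g * v)"]) (auto intro!: ZE_closed)
  qed
  from this[of \<phi>] obtain u v where uv: "u \<in> ZE" "v \<in> ZE" "of_nat p = \<pi> ^ \<phi> * u + of_nat p * \<pi> ^ \<phi> * v" by blast
  hence "of_nat p = \<pi> ^ \<phi> * (u + of_nat p * v)" by (simp add: algebra_simps)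
  thus ?thesis using uv by (intro bexI[of _ "u + of_nat p * v"]) (auto intro!: ZE_closed)
qed

lemma \<pi>_nz: "\<pi> \<noteq> 0"
proof -
  have "\<not> p * q dvd 1" using p1 q0 by auto
  thus ?thesis using \<eta>_eq_1[of 1] by (auto simp: \<pi>_def)
qed

text \<open>A power of \<pi> is divisible by \<open>p\<close>, because \<eta>^(p^k) = 1 in
  \<open>eta_frobenius\<close>; so a power of \<open>m\<close> is divisible by \<open>p\<close> in
  \<open>ZE\<close>, and then in the integers.\<close>

lemma int_in_pi:
  assumes "z \<in> ZE" "of_int m = \<pi> * z"
  shows "int p dvd m"
proof -
  obtain h where h: "h \<in> ZE" "\<eta> ^ (p ^ k) = 1 + \<pi> ^ (p ^ k) + of_nat p * \<pi> * h"
    using eta_frobenius by blast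
  hence "\<pi> ^ (p ^ k) = of_nat p * (- (\<pi> * h))" using \<eta>_pow by (simp add: pk algebra_simps eq_neg_iff_add_eq_0)
  hence "of_int (m ^ (p ^ k)) = of_nat p * (- (\<pi> * h) * z ^ (p ^ k))"
    using assms(2) by (simp add: power_mult_distrib)
  moreover have "- (\<pi> * h) * z ^ (p ^ k) \<in> ZE" using h(1) assms(1) ZE_\<pi> by (intro ZE_closed)
  ultimately have "int p dvd m ^ (p ^ k)" by (intro int_dvd_of_ZE)
  moreover have "prime (int p)" using p by simp
  ultimately show ?thesis by (metis prime_dvd_power)
qed

text \<open>Comparison of orders in \<pi>: the coefficients before \<open>j\<close> are already
  divisible by \<open>p\<close>, hence by \<pi>^\<phi>, and the later terms carry \<pi>^(j+1), so
  \<pi> divides \<open>a j\<close>.\<close>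

lemma small_relation_dvd:
  assumes rel: "(\<Sum>j<\<phi>. of_int (a j) * \<pi> ^ j) = 0" and j: "j < \<phi>"
  shows "int p dvd a j"
  using j
proof (induction j rule: less_induct)
  case (less j)
  obtain w where w: "w \<in> ZE" "of_nat p = \<pi> ^ \<phi> * w" using p_in_pi by blast
  have "\<exists>z\<in>ZE. of_int (a i) * \<pi> ^ i = \<pi> ^ Suc j * z" if i: "i < \<phi>" "i \<noteq> j" for i
  proof (cases "i < j")
    case True
    then obtain b where "a i = int p * b" using less.IH i by (auto simp: dvd_def)
    hence "of_int (a i) * \<pi> ^ i = \<pi> ^ \<phi> * (w * of_int b * \<pi> ^ i)" using w(2) by simp
    also have "\<pi> ^ \<phi> = \<pi> ^ Suc j * \<pi> ^ (\<phi> - Suc j)"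
      using less.prems le_add_diff_inverse[of "Suc j" \<phi>] by (metis Suc_leI power_add)
    finally have "of_int (a i) * \<pi> ^ i = \<pi> ^ Suc j * (\<pi> ^ (\<phi> - Suc j) * (w * of_int b * \<pi> ^ i))"
      by (simp only: mult.assoc)
    moreover have "\<pi> ^ (\<phi> - Suc j) * (w * of_int b * \<pi> ^ i) \<in> ZE" by (intro ZE_closed w(1) ZE_\<pi>)
    ultimately show ?thesis by (rule bexI)
  next
    case False
    hence "Suc j \<le> i" using i by simp
    hence "\<pi> ^ i = \<pi> ^ Suc j * \<pi> ^ (i - Suc j)" by (metis le_add_diff_inverse power_add)
    hence "of_int (a i) * \<pi> ^ i = \<pi> ^ Suc j * (of_int (a i) * \<pi> ^ (i - Suc j))" by (simp only: mult_ac)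
    moreover have "of_int (a i) * \<pi> ^ (i - Suc j) \<in> ZE" by (intro ZE_closed ZE_\<pi>)
    ultimately show ?thesis by (rule bexI)
  qed
  then obtain f where f: "\<And>i. i < \<phi> \<Longrightarrow> i \<noteq> j \<Longrightarrow> f i \<in> ZE \<and> of_int (a i) * \<pi> ^ i = \<pi> ^ Suc j * f i" by metis
  have "(\<Sum>i<\<phi>. of_int (a i) * \<pi> ^ i) = of_int (a j) * \<pi> ^ j + (\<Sum>i\<in>{..<\<phi>} - {j}. of_int (a i) * \<pi> ^ i)"
    using less.prems by (intro sum.remove) auto
  also have "(\<Sum>i\<in>{..<\<phi>} - {j}. of_int (a i) * \<pi> ^ i) = \<pi> ^ Suc j * (\<Sum>i\<in>{..<\<phi>} - {j}. f i)"
    unfolding sum_distrib_left using f by (intro sum.cong refl) auto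
  finally have "\<pi> ^ j * (of_int (a j) + \<pi> * (\<Sum>i\<in>{..<\<phi>} - {j}. f i)) = 0" using rel by (simp add: algebra_simps)
  hence "of_int (a j) = \<pi> * (- (\<Sum>i\<in>{..<\<phi>} - {j}. f i))" using \<pi>_nz by (simp add: eq_neg_iff_add_eq_0)
  moreover have "- (\<Sum>i\<in>{..<\<phi>} - {j}. f i) \<in> ZE" using f by (intro ZE_closed) auto
  ultimately show ?case by (intro int_in_pi)
qed

text \<open>Irreducibility of the cyclotomic polynomial, in the form that \<eta> satisfies no
  integer equation of degree below \<phi>. Expanding around 1 and dividing by the content leaves a
  primitive relation, whose coefficients \<open>p\<close> cannot all divide.\<close>

lemma small_root_zero:
  assumes deg: "degree R < \<phi>" and root: "ev R \<eta> = 0"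
  shows "R = 0"
proof (rule ccontr)
  assume "R \<noteq> 0"
  define T where "T = pcompose R [:1, 1:]"
  have T0: "T \<noteq> 0" using \<open>R \<noteq> 0\<close> by (simp add: T_def pcompose_eq_0_iff)
  define U where "U = primitive_part T"
  have TU: "T = smult (content T) U" by (simp add: U_def)
  have "degree U < \<phi>" using deg by (simp add: U_def T_def)
  have "ev [:1, 1:] \<pi> = \<eta>" by (simp add: \<pi>_def)
  hence "ev T \<pi> = 0" using root by (simp add: T_def ev_pcompose)
  hence "ev (smult (content T) U) \<pi> = 0" unfolding U_def content_times_primitive_part .
  hence U0: "ev U \<pi> = 0" using T0 by (simp add: ev_simps)
  have "ev U \<pi> = (\<Sum>j<\<phi>. of_int (coeff U j) * \<pi> ^ j)"
    unfolding poly_altdef using \<open>degree U < \<phi>\<close>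
    by (intro sum.mono_neutral_cong_left) (auto simp: coeff_eq_0 degree_map_poly)
  hence rel: "(\<Sum>j<\<phi>. of_int (coeff U j) * \<pi> ^ j) = 0" using U0 by simp
  have "int p dvd coeff U j" if "j < \<phi>" for j by (rule small_relation_dvd[OF rel that])
  hence "int p dvd coeff U j" for j using \<open>degree U < \<phi>\<close> by (cases "j < \<phi>") (auto simp: coeff_eq_0)
  hence "int p dvd content U" by (simp add: const_poly_dvd_iff_dvd_content[symmetric] const_poly_dvd_iff)
  moreover have "content U = 1" using T0 by (simp add: U_def)
  ultimately show False using p1 by simp
qed

text \<open>This replaces the automorphism \<eta> -> \<eta>'. \<open>F\<close> is the cyclotomic
  polynomial; pseudo-division of \<open>P\<close> by it leaves a remainder of degree below \<phi>
  with root \<eta>, hence 0, and \<eta>' is a root of \<open>F\<close>.\<close>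

lemma conjugate_root:
  assumes P: "ev P \<eta> = 0" and \<eta>': "\<eta>' ^ (p * q) = 1" "\<eta>' ^ q \<noteq> 1"
  shows "ev P \<eta>' = 0"
proof -
  define F where "F = (\<Sum>i<p. monom 1 (i * q) :: int poly)"
  have evF: "ev F z = 0" if "z ^ (p * q) = 1" "z ^ q \<noteq> 1" for z
  proof -
    have "ev F z = (\<Sum>i<p. (z ^ q) ^ i)"
      unfolding F_def ev_sum ev_simps by (intro sum.cong refl) (simp add: power_mult[symmetric] mult.commute)
    moreover have "(z ^ q - 1) * (\<Sum>i<p. (z ^ q) ^ i) = (z ^ q) ^ p - 1" by (rule power_diff_1_eq[symmetric])
    moreover have "(z ^ q) ^ p = 1" using that by (simp add: power_mult[symmetric] mult.commute)
    ultimately show ?thesis using that by simp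
  qed
  have coeffF: "coeff F j = (if q dvd j \<and> j < p * q then 1 else 0)" for j
  proof (cases "q dvd j \<and> j < p * q")
    case True
    then obtain i where i: "j = i * q" "i < p" using q0 by (auto simp: dvd_def mult.commute)
    have "coeff F j = (\<Sum>i'<p. if i' = i then 1 else 0)"
      unfolding F_def coeff_sum using i q0 by (intro sum.cong refl) auto
    thus ?thesis using True i by simp
  next
    case False
    have "coeff (monom (1::int) (i * q)) j = 0" if "i < p" for i using that False q0 by auto
    thus ?thesis unfolding F_def coeff_sum using False by simp
  qed
  have "p * q = \<phi> + q" using p1 by (simp add: \<phi>_def algebra_simps)
  have degF: "degree F = \<phi>"
  proof (rule antisym)
    show "degree F \<le> \<phi>"
    proof (rule degree_le, intro allI impI)
      fix i assume i: "\<phi> < i"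
      show "coeff F i = 0"
      proof (rule ccontr)
        assume "coeff F i \<noteq> 0"
        hence "q dvd i" "i < p * q" by (auto simp: coeffF split: if_splits)
        then obtain b where b: "i = q * b" by blast
        have "b < p" using \<open>i < p * q\<close> q0 by (simp add: b mult.commute)
        hence "b \<le> p - 1" by simp
        hence "q * b \<le> q * (p - 1)" by simp
        thus False using i b by (simp add: \<phi>_def mult.commute)
      qed
    qed
    have "q dvd \<phi>" by (simp add: \<phi>_def)
    thus "\<phi> \<le> degree F" using \<open>p * q = \<phi> + q\<close> q0 by (intro le_degree) (simp add: coeffF)
  qed
  have F0: "F \<noteq> 0" using coeffF[of 0] pq0 by auto
  obtain a Q where aQ: "a \<noteq> 0" "smult a P = F * Q + pseudo_mod P F"
    using pseudo_mod(1)[OF F0] by blast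
  have R: "pseudo_mod P F = 0 \<or> degree (pseudo_mod P F) < \<phi>" using pseudo_mod(2)[OF F0] degF by simp
  have "\<not> p * q dvd q" using p1 q0 by (auto dest: dvd_imp_le)
  hence "ev F \<eta> = 0" using \<eta>_eq_1[of q] \<eta>_pow by (intro evF) auto
  hence "ev (pseudo_mod P F) \<eta> = 0" using arg_cong[OF aQ(2), of "\<lambda>P. ev P \<eta>"] P by (simp add: ev_simps)
  hence "pseudo_mod P F = 0" using R small_root_zero by blast
  hence "of_int a * ev P \<eta>' = ev F \<eta>' * ev Q \<eta>'" using arg_cong[OF aQ(2), of "\<lambda>P. ev P \<eta>'"] by (simp add: ev_simps)
  thus ?thesis using evF[OF \<eta>'] aQ(1) by simp
qed

end

section \<open>Membership in cyclotomic fields and conjugation of sums of roots of unity\<close>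

lemma cyclotomic_field_closed:
  "1 \<in> cyclotomic_field m" "x \<in> cyclotomic_field m \<Longrightarrow> y \<in> cyclotomic_field m \<Longrightarrow> x + y \<in> cyclotomic_field m"
  "x \<in> cyclotomic_field m \<Longrightarrow> y \<in> cyclotomic_field m \<Longrightarrow> x * y \<in> cyclotomic_field m"
  "r \<in> \<rat> \<Longrightarrow> r \<in> cyclotomic_field m" "exp (2 * of_real pi * \<i> / of_nat m) \<in> cyclotomic_field m"
  unfolding cyclotomic_field_def
  using generate_field.one[of class_ring] generate_field.eng_add[of x class_ring _ y]
    generate_field.eng_mult[of x class_ring _ y]
  by (auto simp: class_ring_simps intro: generate_field.incl)

lemma cyclotomic_field_pow: "x \<in> cyclotomic_field m \<Longrightarrow> x ^ i \<in> cyclotomic_field m"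
  by (induction i) (auto intro: cyclotomic_field_closed)

lemma cyclotomic_field_sum: "(\<And>a. a \<in> A \<Longrightarrow> f a \<in> cyclotomic_field m) \<Longrightarrow> (\<Sum>a\<in>A. f a) \<in> cyclotomic_field m"
  by (induction A rule: infinite_finite_induct) (auto intro: cyclotomic_field_closed)

text \<open>Quotients of integer polynomials in the root of unity turn membership in the field into
  a polynomial relation, the input of \<open>conjugate_root\<close>.\<close>

lemma cyclotomic_field_fraction:
  assumes "v \<in> cyclotomic_field m"
  shows "\<exists>g h. ev h (exp (2 * of_real pi * \<i> / of_nat m)) \<noteq> 0 \<and>
    v * ev h (exp (2 * of_real pi * \<i> / of_nat m)) = ev g (exp (2 * of_real pi * \<i> / of_nat m))"
proof -
  let ?w = "exp (2 * of_real pi * \<i> / of_nat m) :: complex"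
  show ?thesis using assms unfolding cyclotomic_field_def
  proof (induction rule: generate_field.induct)
    case one
    show ?case by (intro exI[of _ 1]) (simp add: class_ring_simps ev_simps)
  next
    case (incl h)
    then consider "h \<in> \<rat>" | "h = ?w" by blast
    thus ?case
    proof cases
      case 1
      then obtain a b where "b > 0" "h = of_int a / of_int b" by (metis Rats_cases')
      thus ?thesis by (intro exI[of _ "[:a:]"] exI[of _ "[:b:]"]) (simp add: ev_simps)
    next
      case 2
      thus ?thesis by (intro exI[of _ "[:0, 1:]"] exI[of _ 1]) (simp add: ev_simps)
    qed
  next
    case (a_inv x)
    then obtain g h where "ev h ?w \<noteq> 0" "x * ev h ?w = ev g ?w" by blast
    thus ?case by (intro exI[of _ "- g"] exI[of _ h]) (simp add: class_ring_simps ev_simps)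
  next
    case (m_inv x)
    then obtain g h where "ev h ?w \<noteq> 0" "x * ev h ?w = ev g ?w" by blast
    thus ?case using m_inv.hyps by (intro exI[of _ h] exI[of _ g]) (auto simp: class_ring_simps field_simps)
  next
    case (eng_add x y)
    then obtain g h g' h' where *: "ev h ?w \<noteq> 0" "x * ev h ?w = ev g ?w" "ev h' ?w \<noteq> 0" "y * ev h' ?w = ev g' ?w" by blast
    have "(x + y) * ev (h * h') ?w = (x * ev h ?w) * ev h' ?w + (y * ev h' ?w) * ev h ?w"
      by (simp add: ev_simps algebra_simps)
    also have "\<dots> = ev (g * h' + g' * h) ?w" unfolding * by (simp add: ev_simps)
    finally show ?case using *(1,3) unfolding class_ring_simps
      by (intro exI[of _ "g * h' + g' * h"] exI[of _ "h * h'"]) (simp add: ev_simps(2))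
  next
    case (eng_mult x y)
    then obtain g h g' h' where *: "ev h ?w \<noteq> 0" "x * ev h ?w = ev g ?w" "ev h' ?w \<noteq> 0" "y * ev h' ?w = ev g' ?w" by blast
    have "(x * y) * ev (h * h') ?w = (x * ev h ?w) * (y * ev h' ?w)"
      by (simp add: ev_simps algebra_simps)
    also have "\<dots> = ev (g * g') ?w" unfolding * by (simp add: ev_simps)
    finally show ?case using *(1,3) unfolding class_ring_simps
      by (intro exI[of _ "g * g'"] exI[of _ "h * h'"]) (simp add: ev_simps(2))
  qed
qed

text \<open>For \<eta>' = \<eta>^(1+q) one has \<eta>'^p = \<eta>^p, so the conjugation fixes the
  smaller field. For k > 1 the prime \<open>p\<close> divides \<open>q\<close>, which keeps
  \<eta>'^q = \<eta>^q different from 1.\<close>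

lemma cyclotomic_sum_conjugate:
  assumes p: "prime p" and k: "k > 1" and fin: "finite X" and c: "c \<noteq> (0::nat)"
    and v: "(\<Sum>x\<in>X. exp (2 * of_real pi * \<i> / of_nat (p ^ k)) ^ m x) / of_nat c \<in> cyclotomic_field (p ^ (k - 1))"
  shows "(\<Sum>x\<in>X. exp (2 * of_real pi * \<i> / of_nat (p ^ k)) ^ ((1 + p ^ (k - 1)) * m x)) =
    (\<Sum>x\<in>X. exp (2 * of_real pi * \<i> / of_nat (p ^ k)) ^ m x)"
proof -
  interpret prime_power_cyclotomic p k using p k by unfold_locales auto
  define \<eta>' where "\<eta>' = \<eta> ^ (1 + q)"
  have p0: "p > 0" using p1 by simp
  have w: "exp (2 * of_real pi * \<i> / of_nat (p ^ (k - 1))) = \<eta> ^ p"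
    using p0 q0 unfolding \<eta>_def pk q_def[symmetric] by (simp add: exp_of_nat_mult[symmetric])
  have "k - 1 = Suc (k - 2)" using assms(2) by simp
  hence "q = p * p ^ (k - 2)" by (simp add: q_def)
  then obtain b where b: "q = p * b" by blast
  have \<eta>'p: "\<eta>' ^ p = \<eta> ^ p"
  proof -
    have "\<eta>' ^ p = \<eta> ^ p * \<eta> ^ (p * q)" by (simp add: \<eta>'_def power_mult[symmetric] power_add[symmetric] algebra_simps)
    thus ?thesis by (simp add: \<eta>_pow)
  qed
  have 1: "\<eta>' ^ (p * q) = 1" by (simp add: power_mult \<eta>'p) (simp add: power_mult[symmetric] \<eta>_pow)
  have "\<eta>' ^ q = \<eta> ^ q" unfolding b by (simp add: power_mult \<eta>'p)
  moreover have "\<not> p * q dvd q" using p1 q0 by (auto dest: dvd_imp_le)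
  ultimately have 2: "\<eta>' ^ q \<noteq> 1" using \<eta>_eq_1[of q] by simp
  obtain g h where gh: "ev h (\<eta> ^ p) \<noteq> 0"
    "(\<Sum>x\<in>X. \<eta> ^ m x) / of_nat c * ev h (\<eta> ^ p) = ev g (\<eta> ^ p)"
    using cyclotomic_field_fraction[OF v] unfolding w \<eta>_def by blast
  \<comment> \<open>The relation with denominators cleared. Apart from the sum over \<open>X\<close>
    it depends on its argument only through the p-th power, which \<eta> and \<eta>' share.\<close>
  define P where "P = (\<Sum>x\<in>X. monom 1 (m x)) * pcompose h (monom 1 p) - smult (int c) (pcompose g (monom 1 p))"
  have evP: "ev P z = (\<Sum>x\<in>X. z ^ m x) * ev h (z ^ p) - of_nat c * ev g (z ^ p)" for z
    by (simp add: P_def ev_simps ev_sum ev_pcompose poly_monom)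
  have "ev P \<eta> = 0" using gh c by (simp add: evP field_simps)
  hence "ev P \<eta>' = 0" by (rule conjugate_root[OF _ 1 2])
  hence "(\<Sum>x\<in>X. \<eta>' ^ m x) * ev h (\<eta> ^ p) = (\<Sum>x\<in>X. \<eta> ^ m x) * ev h (\<eta> ^ p)"
    using gh c by (simp add: evP \<eta>'p field_simps)
  hence "(\<Sum>x\<in>X. \<eta>' ^ m x) = (\<Sum>x\<in>X. \<eta> ^ m x)" using gh(1) by simp
  thus ?thesis unfolding \<eta>'_def power_mult[symmetric] unfolding \<eta>_def q_def .
qed

lemma cyclotomic_field_1_real: "v \<in> cyclotomic_field 1 \<Longrightarrow> v \<in> \<real>"
  unfolding cyclotomic_field_def
proof (induction rule: generate_field.induct)
  case (incl h)
  have "exp (2 * of_real pi * \<i> / of_nat 1) = (1::complex)" by simp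
  moreover have "x \<in> \<real>" if "x \<in> \<rat>" for x :: complex
    using that by (metis Rats_cases' Reals_divide Reals_of_int)
  ultimately show ?case using incl by auto
qed (auto simp: class_ring_simps)

section \<open>The linear form of the proposition\<close>

lemma entry_mult:
  fixes X Y :: "'a::semiring_0 mat"
  assumes "X \<in> carrier_mat n n" "Y \<in> carrier_mat n n" "i \<in> {1..n}" "k \<in> {1..n}"
  shows "entry (X * Y) (i, k) = (\<Sum>j\<in>{1..n}. entry X (i, j) * entry Y (j, k))"
proof -
  have "entry (X * Y) (i, k) = (\<Sum>j\<in>{0..<n}. X $$ (i - 1, j) * Y $$ (j, k - 1))"
  proof -
    have "i - 1 < n" "k - 1 < n" using assms(3,4) by auto
    thus ?thesis using assms(1,2) unfolding entry_def fst_conv snd_conv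
      by (auto simp: scalar_prod_def intro!: sum.cong)
  qed
  also have "\<dots> = (\<Sum>j\<in>{1..n}. entry X (i, j) * entry Y (j, k))"
    by (rule sum.reindex_bij_witness[of _ "\<lambda>j. j - 1" "\<lambda>j. j + 1"]) (auto simp: entry_def)
  finally show ?thesis .
qed

lemma entry_add:
  "X \<in> carrier_mat n n \<Longrightarrow> Y \<in> carrier_mat n n \<Longrightarrow> i \<in> {1..n} \<Longrightarrow> j \<in> {1..n} \<Longrightarrow>
    entry (X + Y) (i, j) = entry X (i, j) + entry Y (i, j)"
  unfolding entry_def fst_conv snd_conv atLeastAtMost_iff by (subst index_add_mat) auto

lemma entry_lower: "X \<in> strict_upper n \<Longrightarrow> i \<in> {1..n} \<Longrightarrow> j \<in> {1..n} \<Longrightarrow> j \<le> i \<Longrightarrow> entry X (i, j) = 0"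
  by (auto simp: strict_upper_def)

lemma entry_elem_mat:
  "i \<in> {1..n} \<Longrightarrow> k \<in> {1..n} \<Longrightarrow> entry (elem_mat n a b) (i, k) = (if i = a \<and> k = b then 1 else 0)"
  by (auto simp: entry_def elem_mat_def)

lemma elem_mat_strict: "a < b \<Longrightarrow> elem_mat n a b \<in> strict_upper n"
  by (auto simp: strict_upper_iff elem_mat_def)

text \<open>For row by column products whose middle index survives only in two blocks: writing the
  blocks over common index sets lets products at different positions be compared term by
  term.\<close>

lemma two_block_sum:
  assumes "finite A" "inj_on f B" "inj_on g C" "f ` B \<inter> g ` C = {}" "f ` B \<subseteq> A" "g ` C \<subseteq> A"
    and zero: "\<And>j. j \<in> A \<Longrightarrow> j \<notin> f ` B \<Longrightarrow> j \<notin> g ` C \<Longrightarrow> h j = 0"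
  shows "sum h A = (\<Sum>b\<in>B. h (f b)) + (\<Sum>c\<in>C. h (g c))"
proof -
  have fin: "finite (f ` B)" "finite (g ` C)" using finite_subset[OF assms(5,1)] finite_subset[OF assms(6,1)] .
  have "sum h A = sum h (f ` B \<union> g ` C)"
    by (rule sum.mono_neutral_right) (use assms(1,5,6) zero in auto)
  also have "\<dots> = sum h (f ` B) + sum h (g ` C)" by (rule sum.union_disjoint[OF fin assms(4)])
  also have "\<dots> = (\<Sum>b\<in>B. h (f b)) + (\<Sum>c\<in>C. h (g c))"
    unfolding sum.reindex[OF assms(2)] sum.reindex[OF assms(3)] comp_def ..
  finally show ?thesis .
qed

locale ut_lambda = ut_form n lam \<theta> for n :: nat and lam :: "'a::{field,finite} mat \<Rightarrow> 'a" and \<theta> +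
  fixes r :: nat
  assumes r: "r > 1" and n: "n > 6 * r"
    and lam_elem: "\<And>j k. 1 \<le> j \<Longrightarrow> j < k \<Longrightarrow> k \<le> n \<Longrightarrow> lam (elem_mat n j k) = lambda_coeff r j k"
begin

lemma lam_sum:
  assumes X: "X \<in> N"
  shows "lam X = (\<Sum>i\<in>{1..n}. \<Sum>k\<in>{1..n}. lambda_coeff r i k * entry X (i, k))"
proof -
  \<comment> \<open>\<open>R P\<close> keeps the entries of \<open>X\<close> at positions in
    \<open>P\<close>; adding the positions one at a time takes the place of a sum of
    matrices.\<close>
  define R where "R P = mat n n (\<lambda>(a, b). if (a + 1, b + 1) \<in> P then X $$ (a, b) else 0)" for P
  have RN: "R P \<in> N" for P using X by (auto simp: R_def strict_upper_iff)
  have step: "lam (R P) = (\<Sum>(i, k)\<in>P. lambda_coeff r i k * entry X (i, k))"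
    if "finite P" "P \<subseteq> {1..n} \<times> {1..n}" for P
    using that
  proof (induction P rule: finite_induct)
    case empty
    have "R {} = 0\<^sub>m n n" by (intro eq_matI) (auto simp: R_def)
    thus ?case by simp
  next
    case (insert x P)
    obtain i k where x: "x = (i, k)" by fastforce
    have ik: "i \<in> {1..n}" "k \<in> {1..n}" using insert.prems x by auto
    show ?case
    proof (cases "i < k")
      case True
      have "R (insert x P) = R P + entry X (i, k) \<cdot>\<^sub>m elem_mat n i k"
        using ik insert.hyps x by (intro eq_matI) (auto simp: R_def elem_mat_def entry_def)
      hence "lam (R (insert x P)) = lam (R P) + entry X (i, k) * lambda_coeff r i k"
        using lam_add[OF RN[of P] N_closed(4)[OF elem_mat_strict[OF True], of "entry X (i, k)"]]
          lam_smult[OF elem_mat_strict[OF True], of "entry X (i, k)"] lam_elem[of i k] True ik by simp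
      moreover have "lam (R P) = (\<Sum>(i, k)\<in>P. lambda_coeff r i k * entry X (i, k))" using insert by simp
      ultimately show ?thesis using insert.hyps x by (simp add: mult.commute add.commute)
    next
      case False
      hence 0: "entry X (i, k) = 0" using entry_lower[OF X ik] by simp
      have "R (insert x P) = R P"
        using ik x 0 by (intro eq_matI) (auto simp: R_def entry_def)
      thus ?thesis using insert x 0 by simp
    qed
  qed
  have "R ({1..n} \<times> {1..n}) = X" using Nc[OF X] by (intro eq_matI) (auto simp: R_def)
  hence "lam X = (\<Sum>(i, k)\<in>{1..n} \<times> {1..n}. lambda_coeff r i k * entry X (i, k))"
    using step[of "{1..n} \<times> {1..n}"] by simp
  thus ?thesis by (simp add: sum.cartesian_product)
qed

text \<open>The value of \<open>lam\<close> on a matrix with the single nonzero row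
  \<open>i\<close>, whose entries are given by \<open>f\<close>.\<close>

definition rowval :: "nat \<Rightarrow> (nat \<Rightarrow> 'a) \<Rightarrow> 'a" where
  "rowval i f = (if i \<le> r then - f (i + r) + f (i + 2*r)
     else if i \<le> 2*r then - f (i + 2*r + 1) + f (i + 3*r + 1)
     else if i \<le> 3*r + 1 then f (i + r)
     else if i \<le> 4*r + 1 then f (i + 2*r) else 0)"

text \<open>The same for a single column \<open>k\<close>. Column 3r+1 stands apart: it belongs to
  the extra row 2r+1, which interrupts the blocks of length \<open>r\<close>.\<close>

definition colval :: "nat \<Rightarrow> (nat \<Rightarrow> 'a) \<Rightarrow> 'a" where
  "colval k f = (if k \<le> r then 0 else if k \<le> 2*r then - f (k - r)
     else if k \<le> 3*r then f (k - 2*r)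
     else if k = 3*r + 1 then f (k - r)
     else if k \<le> 4*r + 1 then - f (k - 2*r - 1) + f (k - r)
     else if k \<le> 5*r + 1 then f (k - 3*r - 1)
     else if k \<le> 6*r + 1 then f (k - 2*r) else 0)"

lemma sum_delta2:
  assumes "finite A" "a \<in> A" "b \<in> A" "\<And>k. k \<in> A \<Longrightarrow> g k = (if k = a then u else 0) + (if k = b then v else 0)"
  shows "(\<Sum>k\<in>A. g k * f k) = u * f a + v * (f b :: 'a)"
proof -
  have "(\<Sum>k\<in>A. g k * f k) = (\<Sum>k\<in>A. (if k = a then u * f a else 0) + (if k = b then v * f b else 0))"
    using assms(4) by (intro sum.cong refl) (auto simp: ring_distribs)
  thus ?thesis using assms(1-3) by (simp add: sum.distrib)
qed

lemma row_sum:
  assumes "i \<in> {1..n}"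
  shows "(\<Sum>k\<in>{1..n}. lambda_coeff r i k * f k) = rowval i f"
proof -
  consider "i \<le> r" | "r < i" "i \<le> 2*r" | "2*r < i" "i \<le> 3*r + 1" | "3*r + 1 < i" "i \<le> 4*r + 1" | "4*r + 1 < i"
        using not_le_imp_less[of i "r"] not_le_imp_less[of i "2*r"] not_le_imp_less[of i "3*r + 1"] not_le_imp_less[of i "4*r + 1"]
        by blast
  thus ?thesis
  proof cases
    case 1
    have "(\<Sum>k\<in>{1..n}. lambda_coeff r i k * f k) = (-1) * f (i + r) + 1 * f (i + 2*r)"
      by (rule sum_delta2) (use 1 assms n r in \<open>auto simp: lambda_coeff_def\<close>)
    thus ?thesis using 1 by (simp add: rowval_def)
  next
    case 2
    have "(\<Sum>k\<in>{1..n}. lambda_coeff r i k * f k) = (-1) * f (i + 2*r + 1) + 1 * f (i + 3*r + 1)"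
      by (rule sum_delta2) (use 2 assms n r in \<open>auto simp: lambda_coeff_def\<close>)
    thus ?thesis using 2 by (simp add: rowval_def)
  next
    case 3
    have "(\<Sum>k\<in>{1..n}. lambda_coeff r i k * f k) = 1 * f (i + r) + 0 * f (i + r)"
      by (rule sum_delta2) (use 3 assms n r in \<open>auto simp: lambda_coeff_def\<close>)
    thus ?thesis using 3 by (simp add: rowval_def)
  next
    case 4
    have "(\<Sum>k\<in>{1..n}. lambda_coeff r i k * f k) = 1 * f (i + 2*r) + 0 * f (i + 2*r)"
      by (rule sum_delta2) (use 4 assms n r in \<open>auto simp: lambda_coeff_def\<close>)
    thus ?thesis using 4 by (simp add: rowval_def)
  next
    case 5
    have "(\<Sum>k\<in>{1..n}. lambda_coeff r i k * f k) = 0"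
      by (rule sum.neutral) (use 5 r in \<open>auto simp: lambda_coeff_def\<close>)
    thus ?thesis using 5 r by (simp add: rowval_def)
  qed
qed

lemma coeff_rows:
  "1 \<le> i \<Longrightarrow> i \<le> r \<Longrightarrow> lambda_coeff r i k = (if k = i + r then -1 else if k = i + 2*r then 1 else (0::'a))"
  "r < i \<Longrightarrow> i \<le> 2*r \<Longrightarrow>
    lambda_coeff r i k = (if k = i + 2*r + 1 then -1 else if k = i + 3*r + 1 then 1 else (0::'a))"
  "2*r < i \<Longrightarrow> i \<le> 3*r + 1 \<Longrightarrow> lambda_coeff r i k = (if k = i + r then 1 else (0::'a))"
  "3*r + 1 < i \<Longrightarrow> i \<le> 4*r + 1 \<Longrightarrow> lambda_coeff r i k = (if k = i + 2*r then 1 else (0::'a))"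
  "4*r + 1 < i \<Longrightarrow> lambda_coeff r i k = (0::'a)"
  by (simp_all add: lambda_coeff_def)

lemma rows_induct:
  assumes "i \<in> {1..n}" "1 \<le> i \<Longrightarrow> i \<le> r \<Longrightarrow> Q" "r < i \<Longrightarrow> i \<le> 2*r \<Longrightarrow> Q" "2*r < i \<Longrightarrow> i \<le> 3*r + 1 \<Longrightarrow> Q"
    "3*r + 1 < i \<Longrightarrow> i \<le> 4*r + 1 \<Longrightarrow> Q" "4*r + 1 < i \<Longrightarrow> Q"
  shows Q
proof -
  have "1 \<le> i" using assms(1) by simp
  thus ?thesis using assms(2-) not_le_imp_less[of i r] not_le_imp_less[of i "2*r"]
      not_le_imp_less[of i "3*r + 1"] not_le_imp_less[of i "4*r + 1"] by blast
qed

lemma col_sum: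
  assumes "k \<in> {1..n}"
  shows "(\<Sum>i\<in>{1..n}. lambda_coeff r i k * f i) = colval k f"
proof -
  consider "k \<le> r" | "r < k" "k \<le> 2*r" | "2*r < k" "k \<le> 3*r" | "3*r < k" "k \<le> 3*r + 1" | "3*r + 1 < k" "k \<le> 4*r + 1"
    | "4*r + 1 < k" "k \<le> 5*r + 1" | "5*r + 1 < k" "k \<le> 6*r + 1" | "6*r + 1 < k"
        using not_le_imp_less[of k "r"] not_le_imp_less[of k "2*r"] not_le_imp_less[of k "3*r"] not_le_imp_less[of k "3*r + 1"] not_le_imp_less[of k "4*r + 1"] not_le_imp_less[of k "5*r + 1"] not_le_imp_less[of k "6*r + 1"]
        by blast
  thus ?thesis
  proof cases
    case 1
    have "(\<Sum>i\<in>{1..n}. lambda_coeff r i k * f i) = 0"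
      by (rule sum.neutral) (use 1 r in \<open>auto simp: lambda_coeff_def\<close>)
    thus ?thesis using 1 by (simp add: colval_def)
  next
    case 2
    have "(\<Sum>i\<in>{1..n}. lambda_coeff r i k * f i) = (-1) * f (k - r) + 0 * f (k - r)"
      by (rule sum_delta2) (use 2 assms n r in \<open>auto simp: lambda_coeff_def\<close>)
    thus ?thesis using 2 by (simp add: colval_def)
  next
    case 3
    have "(\<Sum>i\<in>{1..n}. lambda_coeff r i k * f i) = 1 * f (k - 2*r) + 0 * f (k - 2*r)"
      by (rule sum_delta2) (use 3 assms n r in \<open>auto simp: lambda_coeff_def\<close>)
    thus ?thesis using 3 by (simp add: colval_def)
  next
    case 4
    hence 4: "k = 3*r + 1" by simp
    have "(\<Sum>i\<in>{1..n}. lambda_coeff r i k * f i) = 1 * f (k - r) + 0 * f (k - r)"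
      by (rule sum_delta2) (use 4 assms n r in \<open>auto simp: lambda_coeff_def\<close>)
    thus ?thesis using 4 r by (simp add: colval_def)
  next
    case 5
    define c where "c = k - (3*r + 1)"
    have c: "k = 3*r + 1 + c" "1 \<le> c" "c \<le> r" using 5 by (auto simp: c_def)
    have "(\<Sum>i\<in>{1..n}. lambda_coeff r i k * f i) = (-1) * f (r + c) + 1 * f (2*r + 1 + c)"
    proof (rule sum_delta2)
      fix i assume i: "i \<in> {1..n}"
      show "lambda_coeff r i k = (if i = r + c then (-1) else 0) + (if i = 2*r + 1 + c then 1 else (0::'a))"
        by (rule rows_induct[OF i]) (use c in \<open>auto simp: coeff_rows\<close>)
    qed (use c n in auto)
    thus ?thesis using c r by (simp add: colval_def)
  next
    case 6
    define c where "c = k - (4*r + 1)"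
    have c: "k = 4*r + 1 + c" "1 \<le> c" "c \<le> r" using 6 by (auto simp: c_def)
    have "(\<Sum>i\<in>{1..n}. lambda_coeff r i k * f i) = 1 * f (r + c) + 0 * f (r + c)"
    proof (rule sum_delta2)
      fix i assume i: "i \<in> {1..n}"
      show "lambda_coeff r i k = (if i = r + c then 1 else 0) + (if i = r + c then 0 else (0::'a))"
        by (rule rows_induct[OF i]) (use c in \<open>auto simp: coeff_rows\<close>)
    qed (use c n in auto)
    thus ?thesis using c r by (simp add: colval_def)
  next
    case 7
    define c where "c = k - (5*r + 1)"
    have c: "k = 5*r + 1 + c" "1 \<le> c" "c \<le> r" using 7 by (auto simp: c_def)
    have "(\<Sum>i\<in>{1..n}. lambda_coeff r i k * f i) = 1 * f (3*r + 1 + c) + 0 * f (3*r + 1 + c)"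
    proof (rule sum_delta2)
      fix i assume i: "i \<in> {1..n}"
      show "lambda_coeff r i k = (if i = 3*r + 1 + c then 1 else 0) + (if i = 3*r + 1 + c then 0 else (0::'a))"
        by (rule rows_induct[OF i]) (use c in \<open>auto simp: coeff_rows\<close>)
    qed (use c n in auto)
    thus ?thesis using c r by (simp add: colval_def)
  next
    case 8
    have "lambda_coeff r i k * f i = 0" if i: "i \<in> {1..n}" for i
      by (rule rows_induct[OF i]) (use 8 r in \<open>auto simp: coeff_rows\<close>)
    hence "(\<Sum>i\<in>{1..n}. lambda_coeff r i k * f i) = 0" by (intro sum.neutral ballI)
    thus ?thesis using 8 r by (simp add: colval_def)
  qed
qed

lemma lam_rows: "X \<in> N \<Longrightarrow> lam X = (\<Sum>i\<in>{1..n}. rowval i (\<lambda>k. entry X (i, k)))"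
  unfolding lam_sum by (rule sum.cong[OF refl], rule row_sum)

lemma lam_elem_left:
  assumes X: "X \<in> N" and jk: "1 \<le> j" "j < k" "k \<le> n"
  shows "lam (elem_mat n j k * X) = rowval j (\<lambda>m. entry X (k, m))"
proof -
  have eN: "elem_mat n j k \<in> N" using elem_mat_strict[OF jk(2)] .
  have ent: "entry (elem_mat n j k * X) (i, m) = (if i = j then entry X (k, m) else 0)"
    if im: "i \<in> {1..n}" "m \<in> {1..n}" for i m
  proof -
    have "entry (elem_mat n j k * X) (i, m) = (\<Sum>b\<in>{1..n}. entry (elem_mat n j k) (i, b) * entry X (b, m))"
      using eN X im by (intro entry_mult Nc)
    also have "\<dots> = (\<Sum>b\<in>{1..n}. if b = k then (if i = j then entry X (k, m) else 0) else 0)"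
      using im by (intro sum.cong refl) (auto simp: entry_elem_mat)
    finally show ?thesis using jk by simp
  qed
  have "lam (elem_mat n j k * X) = (\<Sum>i\<in>{1..n}. \<Sum>m\<in>{1..n}. lambda_coeff r i m * entry (elem_mat n j k * X) (i, m))"
    by (rule lam_sum[OF N_closed(6)[OF eN X]])
  also have "\<dots> = (\<Sum>i\<in>{1..n}. \<Sum>m\<in>{1..n}. lambda_coeff r i m * (if i = j then entry X (k, m) else 0))"
    by (intro sum.cong refl) (simp add: ent del: One_nat_def)
  also have "\<dots> = (\<Sum>i\<in>{1..n}. if i = j then (\<Sum>m\<in>{1..n}. lambda_coeff r j m * entry X (k, m)) else 0)"
    by (intro sum.cong refl) auto
  also have "\<dots> = rowval j (\<lambda>m. entry X (k, m))" using jk row_sum[of j "\<lambda>m. entry X (k, m)"] by simp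
  finally show ?thesis .
qed

lemma lam_elem_right:
  assumes X: "X \<in> N" and jk: "1 \<le> j" "j < k" "k \<le> n"
  shows "lam (X * elem_mat n j k) = colval k (\<lambda>i. entry X (i, j))"
proof -
  have eN: "elem_mat n j k \<in> N" using elem_mat_strict[OF jk(2)] .
  have ent: "entry (X * elem_mat n j k) (i, m) = (if m = k then entry X (i, j) else 0)"
    if im: "i \<in> {1..n}" "m \<in> {1..n}" for i m
  proof -
    have "entry (X * elem_mat n j k) (i, m) = (\<Sum>b\<in>{1..n}. entry X (i, b) * entry (elem_mat n j k) (b, m))"
      using eN X im by (intro entry_mult Nc)
    also have "\<dots> = (\<Sum>b\<in>{1..n}. if b = j then (if m = k then entry X (i, j) else 0) else 0)"
      using im by (intro sum.cong refl) (auto simp: entry_elem_mat)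
    finally show ?thesis using jk by simp
  qed
  have "lam (X * elem_mat n j k) = (\<Sum>i\<in>{1..n}. \<Sum>m\<in>{1..n}. lambda_coeff r i m * entry (X * elem_mat n j k) (i, m))"
    by (rule lam_sum[OF N_closed(6)[OF X eN]])
  also have "\<dots> = (\<Sum>i\<in>{1..n}. \<Sum>m\<in>{1..n}. lambda_coeff r i m * (if m = k then entry X (i, j) else 0))"
    by (intro sum.cong refl) (simp add: ent del: One_nat_def)
  also have "\<dots> = (\<Sum>i\<in>{1..n}. \<Sum>m\<in>{1..n}. if m = k then lambda_coeff r i k * entry X (i, j) else 0)"
    by (intro sum.cong refl) auto
  also have "\<dots> = colval k (\<lambda>i. entry X (i, j))" using jk col_sum[of k "\<lambda>i. entry X (i, j)"] by simp
  finally show ?thesis .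
qed

text \<open>The index following \<open>j\<close> in the chain \<open>1, 2, \<dots>, r, 2r+1\<close>, along which the entries in
  positions of \<open>posD\<close> form a Toeplitz matrix.\<close>

definition nx :: "nat \<Rightarrow> nat" where
  "nx j = (if j < r then j + 1 else 2*r + 1)"

text \<open>The zeros at \<open>posZ\<close>. In the first line \<open>b\<close> starts at 0 so as
  to join the square in columns 2r+1 to 3r with the extra column 3r+1.\<close>

definition condZ :: "'a mat \<Rightarrow> bool" where
  "condZ X \<longleftrightarrow> (\<forall>c\<in>{1..r}. \<forall>b\<in>{0..r}. entry X (r + c, 2*r + 1 + b) = 0)
     \<and> (\<forall>c\<in>{1..r}. \<forall>b\<in>{1..<c}. entry X (r + c, 4*r + 1 + b) = 0)
     \<and> (\<forall>c\<in>{1..r}. \<forall>b\<in>{1..r}. entry X (3*r + 1 + c, 4*r + 1 + b) = 0)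
     \<and> (\<forall>c\<in>{1..r}. \<forall>b\<in>{1..<c}. entry X (3*r + 1 + c, 5*r + 1 + b) = 0)"

definition condA :: "'a mat \<Rightarrow> bool" where
  "condA X \<longleftrightarrow> (\<forall>j\<in>{1..r}. \<forall>i\<in>{1..<j}. entry X (r + j, 3*r + 1 + i) = entry X (2*r + 1 + j, 3*r + 1 + i))"

definition condB :: "'a mat \<Rightarrow> bool" where
  "condB X \<longleftrightarrow> (\<forall>j\<in>{1..r}. \<forall>i\<in>{1..<j}. entry X (r + i, r + j) = entry X (2*r + 1 + i, 2*r + 1 + j))"

definition condC :: "'a mat \<Rightarrow> bool" where
  "condC X \<longleftrightarrow> (\<forall>j\<in>{1..r}. \<forall>i\<in>{1..<j}. entry X (j, r + i) = entry X (nx j, 2*r + 1 + i))"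

text \<open>The equations at the positions (i, 2r+1) of \<open>posD\<close> are consequences, see
  \<open>toeplitz_last\<close>.\<close>

definition condD :: "'a mat \<Rightarrow> bool" where
  "condD X \<longleftrightarrow> (\<forall>j\<in>{1..r}. \<forall>i\<in>{1..<j}. entry X (i, j) = entry X (i + 1, nx j))"

lemma condZD:
  assumes "condZ X"
  shows "r < i \<Longrightarrow> i \<le> 2*r \<Longrightarrow> 2*r < k \<Longrightarrow> k \<le> 3*r + 1 \<Longrightarrow> entry X (i, k) = 0"
    and "r < i \<Longrightarrow> i \<le> 2*r \<Longrightarrow> 4*r + 1 < k \<Longrightarrow> k < i + 3*r + 1 \<Longrightarrow> entry X (i, k) = 0"
    and "3*r + 1 < i \<Longrightarrow> i \<le> 4*r + 1 \<Longrightarrow> 4*r + 1 < k \<Longrightarrow> k \<le> 5*r + 1 \<Longrightarrow> entry X (i, k) = 0"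
    and "3*r + 1 < i \<Longrightarrow> i \<le> 4*r + 1 \<Longrightarrow> 5*r + 1 < k \<Longrightarrow> k < i + 2*r \<Longrightarrow> entry X (i, k) = 0"
proof -
  note Z = assms[unfolded condZ_def]
  show "entry X (i, k) = 0" if "r < i" "i \<le> 2*r" "2*r < k" "k \<le> 3*r + 1"
  proof -
    have "i - r \<in> {1..r}" "k - (2*r + 1) \<in> {0..r}" "i = r + (i - r)" "k = 2*r + 1 + (k - (2*r + 1))" using that by auto
    thus ?thesis using Z by metis
  qed
  show "entry X (i, k) = 0" if "r < i" "i \<le> 2*r" "4*r + 1 < k" "k < i + 3*r + 1"
  proof -
    have "i - r \<in> {1..r}" "k - (4*r + 1) \<in> {1..<i - r}" "i = r + (i - r)" "k = 4*r + 1 + (k - (4*r + 1))" using that by auto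
    thus ?thesis using Z by metis
  qed
  show "entry X (i, k) = 0" if "3*r + 1 < i" "i \<le> 4*r + 1" "4*r + 1 < k" "k \<le> 5*r + 1"
  proof -
    have "i - (3*r + 1) \<in> {1..r}" "k - (4*r + 1) \<in> {1..r}" "i = 3*r + 1 + (i - (3*r + 1))" "k = 4*r + 1 + (k - (4*r + 1))" using that by auto
    thus ?thesis using Z by metis
  qed
  show "entry X (i, k) = 0" if "3*r + 1 < i" "i \<le> 4*r + 1" "5*r + 1 < k" "k < i + 2*r"
  proof -
    have "i - (3*r + 1) \<in> {1..r}" "k - (5*r + 1) \<in> {1..<i - (3*r + 1)}" "i = 3*r + 1 + (i - (3*r + 1))" "k = 5*r + 1 + (k - (5*r + 1))" using that by auto
    thus ?thesis using Z by metis
  qed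
qed

text \<open>Test elements, one for each equation: \<open>lam (X * tA i j)\<close> is the difference
  of the two entries equated by \<open>condA\<close>, and likewise for \<open>tB\<close> (given
  \<open>condZ\<close>), \<open>tC\<close> and \<open>tD\<close>. Where there are two summands, they
  are matched so that left products cancel once earlier conditions hold.\<close>

definition tA :: "nat \<Rightarrow> nat \<Rightarrow> 'a mat" where
  "tA i j = elem_mat n (3*r + 1 + i) (3*r + 1 + j)"
definition tB :: "nat \<Rightarrow> nat \<Rightarrow> 'a mat" where
  "tB i j = elem_mat n (r + j) (3*r + 1 + i) + elem_mat n (2*r + 1 + j) (3*r + 1 + i)"
definition tC :: "nat \<Rightarrow> nat \<Rightarrow> 'a mat" where
  "tC i j = elem_mat n (r + i) (r + j) + elem_mat n (2*r + 1 + i) (2*r + 1 + j)"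
definition tD :: "nat \<Rightarrow> nat \<Rightarrow> 'a mat" where
  "tD i j = elem_mat n j (r + i) + elem_mat n (nx j) (2*r + 1 + i)"

lemma lam_add_mult:
  assumes "X \<in> N" "Y \<in> N" "Z \<in> N"
  shows "lam (X * (Y + Z)) = lam (X * Y) + lam (X * Z)" "lam ((Y + Z) * X) = lam (Y * X) + lam (Z * X)"
  using assms Nc[OF assms(1)] Nc[OF assms(2)] Nc[OF assms(3)] by (simp_all add: dis lam_add N_closed)

context
  fixes i j :: nat
  assumes ij: "1 \<le> i" "i < j" "j \<le> r"
begin

lemma tests_N: "tA i j \<in> N" "tB i j \<in> N" "tC i j \<in> N" "tD i j \<in> N"
  unfolding tA_def tB_def tC_def tD_def using ij r
  by (auto intro!: N_closed elem_mat_strict simp: nx_def)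

lemma right_tests:
  assumes X: "X \<in> N"
  shows "lam (X * tA i j) = - entry X (r + j, 3*r + 1 + i) + entry X (2*r + 1 + j, 3*r + 1 + i)"
    and "condZ X \<Longrightarrow> lam (X * tB i j) = - entry X (r + i, r + j) + entry X (2*r + 1 + i, 2*r + 1 + j)"
    and "lam (X * tC i j) = - entry X (j, r + i) + entry X (nx j, 2*r + 1 + i)"
    and "lam (X * tD i j) = - entry X (i, j) + entry X (i + 1, nx j)"
proof -
  show "lam (X * tA i j) = - entry X (r + j, 3*r + 1 + i) + entry X (2*r + 1 + j, 3*r + 1 + i)"
    unfolding tA_def using lam_elem_right[OF X, of "3*r + 1 + i" "3*r + 1 + j"] ij n
    by (simp add: colval_def add.commute)
  show "lam (X * tC i j) = - entry X (j, r + i) + entry X (nx j, 2*r + 1 + i)"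
    unfolding tC_def using lam_elem_right[OF X, of "r + i" "r + j"]
      lam_elem_right[OF X, of "2*r + 1 + i" "2*r + 1 + j"] ij n r
    by (cases "j = r") (auto simp: lam_add_mult X elem_mat_strict colval_def nx_def mult_2[symmetric])
  show "lam (X * tD i j) = - entry X (i, j) + entry X (i + 1, nx j)"
    unfolding tD_def using lam_elem_right[OF X, of j "r + i"]
      lam_elem_right[OF X, of "nx j" "2*r + 1 + i"] ij n r
    by (auto simp: lam_add_mult X elem_mat_strict colval_def nx_def)
  assume Z: "condZ X"
  have "entry X (2*r + 1 + i, r + j) = 0" using ij n by (intro entry_lower[OF X]) auto
  moreover have "entry X (r + i, 2*r + 1 + j) = 0" using ij by (intro condZD(1)[OF Z]) auto
  ultimately show "lam (X * tB i j) = - entry X (r + i, r + j) + entry X (2*r + 1 + i, 2*r + 1 + j)"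
    unfolding tB_def using lam_elem_right[OF X, of "r + j" "3*r + 1 + i"]
      lam_elem_right[OF X, of "2*r + 1 + j" "3*r + 1 + i"] ij n r
    by (auto simp: lam_add_mult X elem_mat_strict colval_def add.commute)
qed

text \<open>Vanishing of the left products is what admits the tests into the sequence
  \<open>l\<close>. \<open>tC\<close> relies on \<open>condA\<close> and \<open>tD\<close> on
  \<open>condB\<close>, which is why these two enter one stage later.\<close>

lemma left_tests:
  assumes X: "X \<in> N" and Z: "condZ X"
  shows "lam (tA i j * X) = 0" "lam (tB i j * X) = 0"
    and "condA X \<Longrightarrow> lam (tC i j * X) = 0"
    and "condB X \<Longrightarrow> lam (tD i j * X) = 0"
proof -
  have "entry X (3*r + 1 + j, 5*r + 1 + i) = 0" using ij by (intro condZD(4)[OF Z]) auto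
  thus "lam (tA i j * X) = 0"
    unfolding tA_def using lam_elem_left[OF X, of "3*r + 1 + i" "3*r + 1 + j"] ij n
    by (simp add: rowval_def add.commute)
  have "entry X (3*r + 1 + i, 4*r + 1 + j) = 0" using ij by (intro condZD(3)[OF Z]) auto
  thus "lam (tB i j * X) = 0"
    unfolding tB_def using lam_elem_left[OF X, of "r + j" "3*r + 1 + i"]
      lam_elem_left[OF X, of "2*r + 1 + j" "3*r + 1 + i"] ij n r
    by (simp add: lam_add_mult X elem_mat_strict rowval_def add.commute)
  assume A: "condA X"
  have "entry X (r + j, 4*r + 1 + i) = 0" using ij by (intro condZD(2)[OF Z]) auto
  moreover have "entry X (r + j, 3*r + 1 + i) = entry X (2*r + 1 + j, 3*r + 1 + i)"
    using A ij by (auto simp: condA_def)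
  ultimately show "lam (tC i j * X) = 0"
    unfolding tC_def using lam_elem_left[OF X, of "r + i" "r + j"]
      lam_elem_left[OF X, of "2*r + 1 + i" "2*r + 1 + j"] ij n r
    by (simp add: lam_add_mult X elem_mat_strict rowval_def add.commute)
next
  assume B: "condB X"
  have 1: "entry X (r + i, 2*r + j) = 0" using ij by (intro condZD(1)[OF Z]) auto
  have 2: "entry X (r + i, r + j) = entry X (2*r + 1 + i, 2*r + 1 + j)"
    using B ij by (auto simp: condB_def)
  have 3: "entry X (2*r + 1 + i, r + 1 + j) = 0" if "j < r" using ij n that by (intro entry_lower[OF X]) auto
  show "lam (tD i j * X) = 0"
    unfolding tD_def using lam_elem_left[OF X, of j "r + i"]
      lam_elem_left[OF X, of "nx j" "2*r + 1 + i"] ij n r 1 2 3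
    by (cases "j < r") (simp_all add: lam_add_mult X elem_mat_strict rowval_def nx_def add.commute)
qed

end

lemma s_SucI: "Y \<in> s i \<Longrightarrow> (\<And>W. W \<in> l (Suc i) \<Longrightarrow> lam (Y * W) = 0) \<Longrightarrow> Y \<in> s (Suc i)"
  and l_SucI: "Y \<in> s i \<Longrightarrow> (\<And>W. W \<in> s i \<Longrightarrow> lam (Y * W) = 0) \<Longrightarrow> Y \<in> l (Suc i)"
  and s_SucD: "Y \<in> s (Suc i) \<Longrightarrow> W \<in> l (Suc i) \<Longrightarrow> lam (Y * W) = 0"
  by simp_all

lemma l1I: "Y \<in> N \<Longrightarrow> (\<And>X. X \<in> N \<Longrightarrow> lam (Y * X) = 0) \<Longrightarrow> Y \<in> l (Suc 0)"
  by simp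

text \<open>An elementary matrix at (j, k) lies in \<open>l (Suc 0)\<close> as soon as row
  \<open>j\<close> of \<open>lambda_coeff\<close> sees, in row \<open>k\<close> of a strictly upper
  triangular matrix, at most entries on or below the diagonal. Pairing \<open>X\<close> with it
  reads off a single entry of \<open>X\<close>.\<close>

lemma s1_condZ:
  assumes X: "X \<in> s (Suc 0)"
  shows "condZ X"
proof -
  have XN: "X \<in> N" by (rule sN[OF X])
  have test: "lam (X * elem_mat n j k) = 0"
    if jk: "1 \<le> j" "j < k" "k \<le> n" and z: "\<And>W. W \<in> N \<Longrightarrow> rowval j (\<lambda>m. entry W (k, m)) = 0" for j k
  proof -
    have "elem_mat n j k \<in> l (Suc 0)"
      using jk z by (intro l1I elem_mat_strict) (auto simp: lam_elem_left)
    thus ?thesis by (rule s_SucD[OF X])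
  qed
  have c: "colval k (\<lambda>i. entry X (i, j)) = 0"
    if jk: "1 \<le> j" "j < k" "k \<le> n" and z: "\<And>W. W \<in> N \<Longrightarrow> rowval j (\<lambda>m. entry W (k, m)) = 0" for j k
    using test[OF jk z] lam_elem_right[OF XN jk] by simp
  show ?thesis
    unfolding condZ_def
  proof (intro conjI ballI)
    fix c b assume cb: "c \<in> {1..r}" "b \<in> {0..r}"
    have "colval (4*r + 1 + c) (\<lambda>i. entry X (i, 2*r + 1 + b)) = 0"
    proof (rule c)
      fix W assume W: "W \<in> N"
      have "entry W (4*r + 1 + c, 3*r + 1 + b) = 0" using cb n by (intro entry_lower[OF W]) auto
      thus "rowval (2*r + 1 + b) (\<lambda>m. entry W (4*r + 1 + c, m)) = 0"
        using cb by (simp add: rowval_def add.commute add.left_commute)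
    qed (use cb n in auto)
    thus "entry X (r + c, 2*r + 1 + b) = 0" using cb by (simp add: colval_def)
  next
    fix c b assume cb: "c \<in> {1..r}" "b \<in> {1..<c}"
    have "colval (4*r + 1 + c) (\<lambda>i. entry X (i, 4*r + 1 + b)) = 0"
      by (rule c) (use cb n in \<open>auto simp: rowval_def\<close>)
    thus "entry X (r + c, 4*r + 1 + b) = 0" using cb by (simp add: colval_def)
  next
    fix c b assume cb: "c \<in> {1..r}" "b \<in> {1..r}"
    have "colval (5*r + 1 + c) (\<lambda>i. entry X (i, 4*r + 1 + b)) = 0"
      by (rule c) (use cb n in \<open>auto simp: rowval_def\<close>)
    thus "entry X (3*r + 1 + c, 4*r + 1 + b) = 0" using cb by (simp add: colval_def)
  next
    fix c b assume cb: "c \<in> {1..r}" "b \<in> {1..<c}"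
    have "colval (5*r + 1 + c) (\<lambda>i. entry X (i, 5*r + 1 + b)) = 0"
      by (rule c) (use cb n in \<open>auto simp: rowval_def\<close>)
    thus "entry X (3*r + 1 + c, 5*r + 1 + b) = 0" using cb by (simp add: colval_def)
  qed
qed

definition tests :: "'a mat set" where
  "tests = {t i j | t i j. t \<in> {tA, tB, tC, tD} \<and> 1 \<le> i \<and> i < j \<and> j \<le> r}"

lemma tests_in_N: "tests \<subseteq> N"
  using tests_N by (auto simp: tests_def)

lemma conds_of_tests:
  assumes X: "X \<in> N" and Z: "condZ X"
  shows "(\<And>i j. 1 \<le> i \<Longrightarrow> i < j \<Longrightarrow> j \<le> r \<Longrightarrow> lam (X * tA i j) = 0) \<Longrightarrow> condA X"
    and "(\<And>i j. 1 \<le> i \<Longrightarrow> i < j \<Longrightarrow> j \<le> r \<Longrightarrow> lam (X * tB i j) = 0) \<Longrightarrow> condB X"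
    and "(\<And>i j. 1 \<le> i \<Longrightarrow> i < j \<Longrightarrow> j \<le> r \<Longrightarrow> lam (X * tC i j) = 0) \<Longrightarrow> condC X"
    and "(\<And>i j. 1 \<le> i \<Longrightarrow> i < j \<Longrightarrow> j \<le> r \<Longrightarrow> lam (X * tD i j) = 0) \<Longrightarrow> condD X"
  using X Z by (auto simp: condA_def condB_def condC_def condD_def right_tests neg_eq_iff_add_eq_0 eq_neg_iff_add_eq_0 add_eq_0_iff)

text \<open>A bootstrap: annihilating all tests on one side yields \<open>condA\<close> and
  \<open>condB\<close>, and with these the tests annihilate on the other side.\<close>

lemma left_tests_zero:
  assumes X: "X \<in> N" and Z: "condZ X" and T: "\<And>Y. Y \<in> tests \<Longrightarrow> lam (X * Y) = 0" and Y: "Y \<in> tests"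
  shows "lam (Y * X) = 0"
proof -
  have "condA X" by (rule conds_of_tests(1)[OF X Z], rule T) (auto simp: tests_def)
  moreover have "condB X" by (rule conds_of_tests(2)[OF X Z], rule T) (auto simp: tests_def)
  ultimately show ?thesis using Y left_tests[OF _ _ _ X Z] by (auto simp: tests_def)
qed

lemma l_condZ: "W \<in> l (Suc i) \<Longrightarrow> condZ W"
  using l_s_Suc[of i] s_anti[of "Suc 0" "Suc i"] s1_condZ by blast

lemma tests_s1: "tests \<subseteq> s (Suc 0)"
proof
  fix Y assume Y: "Y \<in> tests"
  have "lam (Y * W) = 0" if W: "W \<in> l (Suc 0)" for W
  proof (rule left_tests_zero[OF _ l_condZ[OF W] _ Y])
    show "W \<in> N" using lin_closedD(1)[OF l_lin] W by (rule subsetD)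
    show "lam (W * Y') = 0" if "Y' \<in> tests" for Y'
    proof -
      have "Y' \<in> N" using tests_in_N that by (rule subsetD)
      thus ?thesis using W by simp
    qed
  qed
  moreover have "Y \<in> s 0" using subsetD[OF tests_in_N Y] by simp
  ultimately show "Y \<in> s (Suc 0)" by (intro s_SucI)
qed

lemma tests_s2: "tests \<subseteq> s (Suc (Suc 0))"
proof
  fix Y assume Y: "Y \<in> tests"
  have "lam (Y * W) = 0" if W: "W \<in> l (Suc (Suc 0))" for W
  proof (rule left_tests_zero[OF _ l_condZ[OF W] _ Y])
    show "W \<in> N" using lin_closedD(1)[OF l_lin] W by (rule subsetD)
    show "lam (W * Y') = 0" if "Y' \<in> tests" for Y'
      by (rule l_lam[OF W subsetD[OF tests_s1 that]])
  qed
  thus "Y \<in> s (Suc (Suc 0))" by (rule s_SucI[OF subsetD[OF tests_s1 Y]])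
qed

text \<open>\<open>tA\<close> and \<open>tB\<close> belong to stage 2 of \<open>l\<close>, as their
  left products vanish on all of \<open>s (Suc 0)\<close>, where \<open>condZ\<close> holds.\<close>

lemma s2_conds:
  assumes X: "X \<in> s (Suc (Suc 0))"
  shows "condA X" "condB X"
proof -
  have XN: "X \<in> N" by (rule sN[OF X])
  have Z: "condZ X" using s1_condZ[OF subsetD[OF s_dec X]] .
  have mem: "tA i j \<in> l (Suc (Suc 0))" "tB i j \<in> l (Suc (Suc 0))" if "1 \<le> i" "i < j" "j \<le> r" for i j
  proof -
    have "tA i j \<in> tests" "tB i j \<in> tests" using that by (auto simp: tests_def)
    hence *: "tA i j \<in> s (Suc 0)" "tB i j \<in> s (Suc 0)" using subsetD[OF tests_s1] by simp_all
    have "lam (tA i j * W) = 0" "lam (tB i j * W) = 0" if "W \<in> s (Suc 0)" for W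
      using left_tests(1,2)[OF \<open>1 \<le> i\<close> \<open>i < j\<close> \<open>j \<le> r\<close> sN[OF that] s1_condZ[OF that]] .
    thus "tA i j \<in> l (Suc (Suc 0))" "tB i j \<in> l (Suc (Suc 0))"
      using l_SucI[OF *(1)] l_SucI[OF *(2)] by simp_all
  qed
  have z: "lam (X * Y) = 0" if "Y \<in> l (Suc (Suc 0))" for Y
    by (rule s_SucD[OF X that])
  show "condA X" by (rule conds_of_tests(1)[OF XN Z], rule z, rule mem)
  show "condB X" by (rule conds_of_tests(2)[OF XN Z], rule z, rule mem)
qed

text \<open>At stage 3 the tests \<open>tC\<close> and \<open>tD\<close> join \<open>l\<close>,
  since the elements of stage 2 of \<open>s\<close> already satisfy \<open>condA\<close> and
  \<open>condB\<close>.\<close>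

lemma sh_conds:
  assumes "X \<in> sh"
  shows "X \<in> N" "condZ X" "condA X" "condB X" "condC X" "condD X"
proof -
  have X3: "X \<in> s (Suc (Suc (Suc 0)))" using hat_eqs(6) assms by blast
  have X2: "X \<in> s (Suc (Suc 0))" using subsetD[OF s_dec X3] .
  have X1: "X \<in> s (Suc 0)" using subsetD[OF s_dec X2] .
  show XN: "X \<in> N" by (rule shN[OF assms])
  show Z: "condZ X" by (rule s1_condZ[OF X1])
  show "condA X" "condB X" by (rule s2_conds[OF X2])+
  have mem: "tC i j \<in> l (Suc (Suc (Suc 0)))" "tD i j \<in> l (Suc (Suc (Suc 0)))" if "1 \<le> i" "i < j" "j \<le> r" for i j
  proof -
    have "tC i j \<in> tests" "tD i j \<in> tests" using that by (auto simp: tests_def)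
    hence *: "tC i j \<in> s (Suc (Suc 0))" "tD i j \<in> s (Suc (Suc 0))" using subsetD[OF tests_s2] by simp_all
    have "lam (tC i j * W) = 0" "lam (tD i j * W) = 0" if W: "W \<in> s (Suc (Suc 0))" for W
    proof -
      have "condZ W" using s1_condZ[OF subsetD[OF s_dec W]] .
      thus "lam (tC i j * W) = 0" "lam (tD i j * W) = 0"
        using left_tests(3,4)[OF \<open>1 \<le> i\<close> \<open>i < j\<close> \<open>j \<le> r\<close> sN[OF W]] s2_conds[OF W] by auto
    qed
    thus "tC i j \<in> l (Suc (Suc (Suc 0)))" "tD i j \<in> l (Suc (Suc (Suc 0)))"
      using l_SucI[OF *(1)] l_SucI[OF *(2)] by simp_all
  qed
  have z: "lam (X * Y) = 0" if "Y \<in> l (Suc (Suc (Suc 0)))" for Y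
    by (rule s_SucD[OF X3 that])
  show "condC X" by (rule conds_of_tests(3)[OF XN Z], rule z, rule mem)
  show "condD X" by (rule conds_of_tests(4)[OF XN Z], rule z, rule mem)
qed

text \<open>The candidate for \<open>sh\<close>. That no further equations arise is shown in
  \<open>sh_star\<close> by the symmetry of \<open>lam\<close> on this set, not by computing further
  stages.\<close>

definition star :: "'a mat set" where
  "star = {X \<in> N. condZ X \<and> condA X \<and> condB X \<and> condC X \<and> condD X}"

lemma toeplitz:
  assumes D: "condD X" and ij: "1 \<le> i" "i < j" "j \<le> r"
  shows "entry X (i, j) = entry X (1, j - i + 1)"
  using ij
proof (induction i arbitrary: j)
  case (Suc i)
  show ?case
  proof (cases "i = 0")
    case False
    have "entry X (i, j - 1) = entry X (i + 1, nx (j - 1))"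
      using Suc.prems False by (intro D[unfolded condD_def, rule_format]) auto
    moreover have "nx (j - 1) = j" using Suc.prems by (simp add: nx_def)
    moreover have "entry X (i, j - 1) = entry X (1, j - 1 - i + 1)"
      using Suc.prems False by (intro Suc.IH) auto
    ultimately show ?thesis using Suc.prems by simp
  qed (use Suc.prems in simp)
qed simp

lemma toeplitz_last:
  assumes D: "condD X" and i: "2 \<le> i" "i \<le> r"
  shows "entry X (i, 2*r + 1) = entry X (1, r + 2 - i)"
proof -
  have "entry X (i - 1, r) = entry X (i - 1 + 1, nx r)"
    using i r by (intro D[unfolded condD_def, rule_format]) auto
  hence "entry X (i, 2*r + 1) = entry X (i - 1, r)" using i by (simp add: nx_def)
  also have "\<dots> = entry X (1, r - (i - 1) + 1)" using i by (intro toeplitz[OF D]) auto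
  also have "r - (i - 1) + 1 = r + 2 - i" using i by simp
  finally show ?thesis .
qed

context
  fixes X Y :: "'a mat"
  assumes X: "X \<in> star" and Y: "Y \<in> star"
begin

lemma XN: "X \<in> N" and YN: "Y \<in> N" and Xc: "condZ X" "condA X" "condB X" "condC X" "condD X"
  and Yc: "condZ Y" "condA Y" "condB Y" "condC Y" "condD Y"
  using X Y by (auto simp: star_def)

abbreviation "P \<equiv> \<lambda>i k. entry (X * Y) (i, k)"

lemma P_sum: "1 \<le> i \<Longrightarrow> i \<le> n \<Longrightarrow> 1 \<le> k \<Longrightarrow> k \<le> n \<Longrightarrow> P i k = (\<Sum>j\<in>{1..n}. entry X (i, j) * entry Y (j, k))"
  using XN YN by (intro entry_mult Nc) auto

lemma Xl: "1 \<le> j \<Longrightarrow> j \<le> i \<Longrightarrow> i \<le> n \<Longrightarrow> entry X (i, j) = 0"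
  and Yl: "1 \<le> j \<Longrightarrow> j \<le> i \<Longrightarrow> i \<le> n \<Longrightarrow> entry Y (i, j) = 0"
  using entry_lower[OF XN, of i j] entry_lower[OF YN, of i j] by auto

text \<open>Every middle index \<open>j\<close> falls into a range where the entry of
  \<open>X\<close> or that of \<open>Y\<close> is 0, by triangularity or by \<open>condZ\<close>;
  \<open>P_row1\<close> holds for the same reason.\<close>

lemma P_row3:
  assumes a: "1 \<le> a" "a \<le> r"
  shows "P (3*r + 1 + a) (5*r + 1 + a) = 0"
proof -
  have "entry X (3*r + 1 + a, j) * entry Y (j, 5*r + 1 + a) = 0" if j: "j \<in> {1..n}" for j
  proof -
    consider "j \<le> 3*r + 1 + a" | "3*r + 1 + a < j" "j \<le> 4*r + 1" | "4*r + 1 < j" "j \<le> 5*r + 1"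
      | "5*r + 1 < j" "j < 5*r + 1 + a" | "5*r + 1 + a \<le> j"
        using not_le_imp_less[of j "3*r + 1 + a"] not_le_imp_less[of j "4*r + 1"] not_le_imp_less[of j "5*r + 1"] leI[of j "5*r + 1 + a"]
        by blast
    thus ?thesis
    proof cases
      case 1 thus ?thesis using a j n Xl[of j "3*r + 1 + a"] by simp
    next
      case 2 thus ?thesis using a condZD(4)[OF Yc(1), of j "5*r + 1 + a"] by simp
    next
      case 3 thus ?thesis using a condZD(3)[OF Xc(1), of "3*r + 1 + a" j] by simp
    next
      case 4 thus ?thesis using a condZD(4)[OF Xc(1), of "3*r + 1 + a" j] by simp
    next
      case 5 thus ?thesis using a j n Yl[of "5*r + 1 + a" j] by simp
    qed
  qed
  hence "(\<Sum>j\<in>{1..n}. entry X (3*r + 1 + a, j) * entry Y (j, 5*r + 1 + a)) = 0" by (intro sum.neutral ballI)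
  moreover have "P (3*r + 1 + a) (5*r + 1 + a) = (\<Sum>j\<in>{1..n}. entry X (3*r + 1 + a, j) * entry Y (j, 5*r + 1 + a))"
    using a n by (intro P_sum) auto
  ultimately show ?thesis by simp
qed

lemma P_row1:
  assumes a: "1 \<le> a" "a \<le> r"
  shows "P (r + a) (4*r + 1 + a) = 0"
proof -
  have "entry X (r + a, j) * entry Y (j, 4*r + 1 + a) = 0" if j: "j \<in> {1..n}" for j
  proof -
    consider "j \<le> r + a" | "r + a < j" "j \<le> 2*r" | "2*r < j" "j \<le> 3*r + 1" | "3*r + 1 < j" "j \<le> 4*r + 1"
      | "4*r + 1 < j" "j < 4*r + 1 + a" | "4*r + 1 + a \<le> j"
        using not_le_imp_less[of j "r + a"] not_le_imp_less[of j "2*r"] not_le_imp_less[of j "3*r + 1"] not_le_imp_less[of j "4*r + 1"] leI[of j "4*r + 1 + a"]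
        by blast
    thus ?thesis
    proof cases
      case 1 thus ?thesis using a j n Xl[of j "r + a"] by simp
    next
      case 2 thus ?thesis using a condZD(2)[OF Yc(1), of j "4*r + 1 + a"] by simp
    next
      case 3 thus ?thesis using a condZD(1)[OF Xc(1), of "r + a" j] by simp
    next
      case 4 thus ?thesis using a condZD(3)[OF Yc(1), of j "4*r + 1 + a"] by simp
    next
      case 5 thus ?thesis using a condZD(2)[OF Xc(1), of "r + a" j] by simp
    next
      case 6 thus ?thesis using a j n Yl[of "4*r + 1 + a" j] by simp
    qed
  qed
  hence "(\<Sum>j\<in>{1..n}. entry X (r + a, j) * entry Y (j, 4*r + 1 + a)) = 0" by (intro sum.neutral ballI)
  moreover have "P (r + a) (4*r + 1 + a) = (\<Sum>j\<in>{1..n}. entry X (r + a, j) * entry Y (j, 4*r + 1 + a))"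
    using a n by (intro P_sum) auto
  ultimately show ?thesis by simp
qed

text \<open>In rows r+a and 2r+1+a the product survives in two corresponding blocks, and
  \<open>condA\<close>, \<open>condB\<close> equate the factors entry by entry.\<close>

lemma P_row12:
  assumes a: "1 \<le> a" "a \<le> r"
  shows "P (r + a) (3*r + 1 + a) = P (2*r + 1 + a) (3*r + 1 + a)"
proof -
  let ?k = "3*r + 1 + a"
  have "P (r + a) ?k = (\<Sum>b\<in>{a<..r}. entry X (r + a, r + b) * entry Y (r + b, ?k)) +
      (\<Sum>b\<in>{1..<a}. entry X (r + a, 3*r + 1 + b) * entry Y (3*r + 1 + b, ?k))"
  proof -
    have zero: "entry X (r + a, j) * entry Y (j, ?k) = 0"
      if j: "j \<in> {1..n}" "j \<notin> (+) r ` {a<..r}" "j \<notin> (+) (3*r + 1) ` {1..<a}" for j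
    proof -
      consider "j \<le> r + a" | "r + a < j" "j \<le> 2*r" | "2*r < j" "j \<le> 3*r + 1" | "3*r + 1 < j" "j < ?k" | "?k \<le> j"
        using not_le_imp_less[of j "r + a"] not_le_imp_less[of j "2*r"] not_le_imp_less[of j "3*r + 1"] leI[of j "?k"]
        by blast
      thus ?thesis
      proof cases
        case 1 thus ?thesis using a j n Xl[of j "r + a"] by simp
      next
        case 2 hence "j \<in> (+) r ` {a<..r}" by (intro image_eqI[of _ _ "j - r"]) auto
        thus ?thesis using j by blast
      next
        case 3 thus ?thesis using a condZD(1)[OF Xc(1), of "r + a" j] by simp
      next
        case 4 hence "j \<in> (+) (3*r + 1) ` {1..<a}" by (intro image_eqI[of _ _ "j - (3*r + 1)"]) auto
        thus ?thesis using j by blast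
      next
        case 5 thus ?thesis using a j n Yl[of ?k j] by simp
      qed
    qed
    have "(\<Sum>j\<in>{1..n}. entry X (r + a, j) * entry Y (j, ?k)) =
      (\<Sum>b\<in>{a<..r}. entry X (r + a, r + b) * entry Y (r + b, ?k)) +
      (\<Sum>b\<in>{1..<a}. entry X (r + a, 3*r + 1 + b) * entry Y (3*r + 1 + b, ?k))"
      by (rule two_block_sum[where f = "(+) r" and g = "(+) (3*r + 1)"]) (use a n zero in auto)
    thus ?thesis using a n by (simp add: P_sum)
  qed
  also have "\<dots> = (\<Sum>b\<in>{a<..r}. entry X (2*r + 1 + a, 2*r + 1 + b) * entry Y (2*r + 1 + b, ?k)) +
      (\<Sum>b\<in>{1..<a}. entry X (2*r + 1 + a, 3*r + 1 + b) * entry Y (3*r + 1 + b, ?k))"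
    using a Xc(2,3) Yc(2) by (intro arg_cong2[of _ _ _ _ "(+)"] sum.cong refl) (auto simp: condA_def condB_def)
  also have "\<dots> = P (2*r + 1 + a) ?k"
  proof -
    have zero: "entry X (2*r + 1 + a, j) * entry Y (j, ?k) = 0"
      if j: "j \<in> {1..n}" "j \<notin> (+) (2*r + 1) ` {a<..r}" "j \<notin> (+) (3*r + 1) ` {1..<a}" for j
    proof -
      consider "j \<le> 2*r + 1 + a" | "2*r + 1 + a < j" "j \<le> 3*r + 1" | "3*r + 1 < j" "j < ?k" | "?k \<le> j"
        using not_le_imp_less[of j "2*r + 1 + a"] not_le_imp_less[of j "3*r + 1"] leI[of j "?k"]
        by blast
      thus ?thesis
      proof cases
        case 1 thus ?thesis using a j n Xl[of j "2*r + 1 + a"] by simp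
      next
        case 2 hence "j \<in> (+) (2*r + 1) ` {a<..r}" by (intro image_eqI[of _ _ "j - (2*r + 1)"]) auto
        thus ?thesis using j by blast
      next
        case 3 hence "j \<in> (+) (3*r + 1) ` {1..<a}" by (intro image_eqI[of _ _ "j - (3*r + 1)"]) auto
        thus ?thesis using j by blast
      next
        case 4 thus ?thesis using a j n Yl[of ?k j] by simp
      qed
    qed
    have "(\<Sum>j\<in>{1..n}. entry X (2*r + 1 + a, j) * entry Y (j, ?k)) =
      (\<Sum>b\<in>{a<..r}. entry X (2*r + 1 + a, 2*r + 1 + b) * entry Y (2*r + 1 + b, ?k)) +
      (\<Sum>b\<in>{1..<a}. entry X (2*r + 1 + a, 3*r + 1 + b) * entry Y (3*r + 1 + b, ?k))"
      by (rule two_block_sum[where f = "(+) (2*r + 1)" and g = "(+) (3*r + 1)"]) (use a n zero in auto)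
    thus ?thesis using a n by (simp add: P_sum)
  qed
  finally show ?thesis .
qed

text \<open>The middle indices b and r+b on the left match \<open>nx b\<close> and 2r+1+b on the
  right, and \<open>condB\<close>, \<open>condC\<close>, \<open>condD\<close> equate the
  factors.\<close>

lemma P_row0:
  assumes a: "1 \<le> a" "a \<le> r"
  shows "P a (r + a) = P (nx a) (2*r + 1 + a)"
proof -
  let ?k = "2*r + 1 + a"
  have nx_le: "1 \<le> nx a" "nx a \<le> n" using a n by (auto simp: nx_def)
  have "P a (r + a) = (\<Sum>b\<in>{a<..r}. entry X (a, b) * entry Y (b, r + a)) +
      (\<Sum>b\<in>{1..<a}. entry X (a, r + b) * entry Y (r + b, r + a))"
  proof -
    have zero: "entry X (a, j) * entry Y (j, r + a) = 0"
      if j: "j \<in> {1..n}" "j \<notin> (\<lambda>b. b) ` {a<..r}" "j \<notin> (+) r ` {1..<a}" for j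
    proof -
      consider "j \<le> a" | "a < j" "j \<le> r" | "r < j" "j < r + a" | "r + a \<le> j"
        using not_le_imp_less[of j "a"] not_le_imp_less[of j "r"] leI[of j "r + a"]
        by blast
      thus ?thesis
      proof cases
        case 1 thus ?thesis using a j n Xl[of j a] by simp
      next
        case 2 thus ?thesis using j by auto
      next
        case 3 hence "j \<in> (+) r ` {1..<a}" by (intro image_eqI[of _ _ "j - r"]) auto
        thus ?thesis using j by blast
      next
        case 4 thus ?thesis using a j n Yl[of "r + a" j] by simp
      qed
    qed
    have "(\<Sum>j\<in>{1..n}. entry X (a, j) * entry Y (j, r + a)) =
      (\<Sum>b\<in>{a<..r}. entry X (a, b) * entry Y (b, r + a)) +
      (\<Sum>b\<in>{1..<a}. entry X (a, r + b) * entry Y (r + b, r + a))"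
      by (rule two_block_sum[where f = "\<lambda>b. b" and g = "(+) r"]) (use a n zero in auto)
    thus ?thesis using a n by (simp add: P_sum)
  qed
  also have "\<dots> = (\<Sum>b\<in>{a<..r}. entry X (nx a, nx b) * entry Y (nx b, ?k)) +
      (\<Sum>b\<in>{1..<a}. entry X (nx a, 2*r + 1 + b) * entry Y (2*r + 1 + b, ?k))"
  proof (intro arg_cong2[of _ _ _ _ "(+)"] sum.cong refl)
    fix b assume b: "b \<in> {a<..r}"
    have "entry X (a, b) = entry X (a + 1, nx b)" using Xc(5) a b by (auto simp: condD_def)
    moreover have "nx a = a + 1" using b by (simp add: nx_def)
    moreover have "entry Y (b, r + a) = entry Y (nx b, ?k)" using Yc(4) a b by (auto simp: condC_def)
    ultimately show "entry X (a, b) * entry Y (b, r + a) = entry X (nx a, nx b) * entry Y (nx b, ?k)" by simp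
  next
    fix b assume b: "b \<in> {1..<a}"
    have "entry X (a, r + b) = entry X (nx a, 2*r + 1 + b)" using Xc(4) a b by (auto simp: condC_def)
    moreover have "entry Y (r + b, r + a) = entry Y (2*r + 1 + b, ?k)" using Yc(3) a b by (auto simp: condB_def)
    ultimately show "entry X (a, r + b) * entry Y (r + b, r + a) =
        entry X (nx a, 2*r + 1 + b) * entry Y (2*r + 1 + b, ?k)" by simp
  qed
  also have "\<dots> = P (nx a) ?k"
  proof -
    have zero: "entry X (nx a, j) * entry Y (j, ?k) = 0"
      if j: "j \<in> {1..n}" "j \<notin> nx ` {a<..r}" "j \<notin> (+) (2*r + 1) ` {1..<a}" for j
    proof -
      consider "j \<le> nx a" | "nx a < j" "j \<le> r" | "nx a < j" "r < j" "j \<le> 2*r" | "nx a < j" "2*r < j" "j \<le> 2*r + 1"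
        | "2*r + 1 < j" "j < ?k" | "?k \<le> j"
        using not_le_imp_less[of j "nx a"] not_le_imp_less[of j "r"] not_le_imp_less[of j "2*r"] not_le_imp_less[of j "2*r + 1"] leI[of j "?k"]
        by blast
      thus ?thesis
      proof cases
        case 1 thus ?thesis using a j n nx_le Xl[of j "nx a"] by simp
      next
        case 2 hence "j \<in> nx ` {a<..r}" using a by (intro image_eqI[of _ _ "j - 1"]) (auto simp: nx_def split: if_splits)
        thus ?thesis using j by blast
      next
        case 3 hence "a < r" by (auto simp: nx_def split: if_splits)
        thus ?thesis using 3 a condZD(1)[OF Yc(1), of j ?k] by simp
      next
        case 4 hence "j = 2*r + 1" by simp
        with 4 have "j \<in> nx ` {a<..r}" using a by (intro image_eqI[of _ _ r]) (auto simp: nx_def split: if_splits)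
        thus ?thesis using j by blast
      next
        case 5 hence "j \<in> (+) (2*r + 1) ` {1..<a}" by (intro image_eqI[of _ _ "j - (2*r + 1)"]) auto
        thus ?thesis using j by blast
      next
        case 6 thus ?thesis using a j n Yl[of ?k j] by simp
      qed
    qed
    have "(\<Sum>j\<in>{1..n}. entry X (nx a, j) * entry Y (j, ?k)) =
      (\<Sum>b\<in>{a<..r}. entry X (nx a, nx b) * entry Y (nx b, ?k)) +
      (\<Sum>b\<in>{1..<a}. entry X (nx a, 2*r + 1 + b) * entry Y (2*r + 1 + b, ?k))"
      by (rule two_block_sum[where f = nx and g = "(+) (2*r + 1)"])
        (use a n zero in \<open>auto simp: nx_def inj_on_def split: if_splits\<close>)
    thus ?thesis using a n nx_le by (simp add: P_sum)
  qed
  finally show ?thesis .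
qed

text \<open>The coefficients of \<open>lam\<close> pair off with opposite signs: (a, r+a) with (nx
  a, 2r+1+a) by \<open>P_row0\<close>, and (r+a, 3r+1+a) with (2r+1+a, 3r+1+a) by
  \<open>P_row12\<close>. Those at (r+a, 4r+1+a) and (3r+1+a, 5r+1+a) meet zero entries, and (1,
  2r+1) has no partner.\<close>

lemma lam_P: "lam (X * Y) = P 1 (2*r + 1)"
proof -
  have split: "{1..n} = {1..r} \<union> {r+1..2*r} \<union> {2*r+1..3*r+1} \<union> {3*r+2..4*r+1} \<union> {4*r+2..n}"
    using n by auto
  define f where "f i = rowval i (\<lambda>k. P i k)" for i
  have shift: "sum f A = (\<Sum>a\<in>{1..r}. f (u + a))" if "A = {u+1..u+r}" for u A
    unfolding that by (rule sum.reindex_bij_witness[of _ "\<lambda>a. u + a" "\<lambda>a. a - u"]) auto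
  define B where "B = (\<Sum>a\<in>{1..r}. P (2*r + 1 + a) (3*r + 1 + a))"
  define C where "C = P (2*r + 1) (3*r + 1)"
  have 0: "lam (X * Y) = sum f {1..n}" using XN YN by (simp add: lam_rows N_closed f_def)
  have 1: "sum f {1..n} = sum f {1..r} + sum f {r+1..2*r} + sum f {2*r+1..3*r+1} + sum f {3*r+2..4*r+1} + sum f {4*r+2..n}"
    unfolding split by (subst sum.union_disjoint; (simp; fail)?; fastforce?)+
  have "sum f {r+1..2*r} = (\<Sum>a\<in>{1..r}. f (r + a))" by (rule shift) auto
  also have "\<dots> = (\<Sum>a\<in>{1..r}. - P (2*r + 1 + a) (3*r + 1 + a))"
  proof (rule sum.cong[OF refl])
    fix a assume "a \<in> {1..r}"
    hence a: "1 \<le> a" "a \<le> r" by auto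
    have "f (r + a) = - P (r + a) (3*r + 1 + a) + P (r + a) (4*r + 1 + a)"
      using a by (simp add: f_def rowval_def algebra_simps)
    thus "f (r + a) = - P (2*r + 1 + a) (3*r + 1 + a)" using P_row12[OF a] P_row1[OF a] by simp
  qed
  finally have 2: "sum f {r+1..2*r} = - B" by (simp add: B_def sum_negf)
  have e: "{2*r+1..3*r+1} = insert (2*r+1) {2*r+1+1..2*r+1+r}" by auto
  have "sum f {2*r+1..3*r+1} = f (2*r + 1) + sum f {2*r+1+1..2*r+1+r}" unfolding e by (rule sum.insert) auto
  also have "sum f {2*r+1+1..2*r+1+r} = (\<Sum>a\<in>{1..r}. f (2*r + 1 + a))" by (rule shift[OF refl])
  also have "(\<Sum>a\<in>{1..r}. f (2*r + 1 + a)) = B"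
    unfolding B_def
  proof (rule sum.cong[OF refl])
    fix a assume "a \<in> {1..r}"
    thus "f (2*r + 1 + a) = P (2*r + 1 + a) (3*r + 1 + a)" by (simp add: f_def rowval_def algebra_simps)
  qed
  also have "f (2*r + 1) = C" using r by (simp add: f_def rowval_def C_def algebra_simps)
  finally have 3: "sum f {2*r+1..3*r+1} = C + B" .
  have "sum f {3*r+2..4*r+1} = (\<Sum>a\<in>{1..r}. f (3*r + 1 + a))" by (rule shift) auto
  also have "\<dots> = 0"
  proof (rule sum.neutral, rule ballI)
    fix a assume "a \<in> {1..r}"
    hence a: "1 \<le> a" "a \<le> r" by auto
    have "f (3*r + 1 + a) = P (3*r + 1 + a) (5*r + 1 + a)"
      using a by (simp add: f_def rowval_def algebra_simps)
    thus "f (3*r + 1 + a) = 0" using P_row3[OF a] by simp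
  qed
  finally have 4: "sum f {3*r+2..4*r+1} = 0" .
  have 5: "sum f {4*r+2..n} = 0" by (rule sum.neutral) (auto simp: f_def rowval_def)
  have "sum f {1..r} = (\<Sum>a\<in>{1..r}. P a (2*r + a) - P a (r + a))"
    by (rule sum.cong[OF refl]) (simp add: f_def rowval_def add.commute)
  hence 6: "sum f {1..r} = (\<Sum>a\<in>{1..r}. P a (2*r + a)) - (\<Sum>a\<in>{1..r}. P a (r + a))"
    by (simp add: sum_subtractf)
  have "{1..r} = insert r {1..<r}" using r by auto
  hence "(\<Sum>a\<in>{1..r}. P a (r + a)) = P r (r + r) + (\<Sum>a\<in>{1..<r}. P a (r + a))" by simp
  also have "P r (r + r) = C"
  proof -
    have "2*r + 1 + r = 3*r + 1" by simp
    thus ?thesis using P_row0[of r] r by (simp add: nx_def C_def)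
  qed
  also have "(\<Sum>a\<in>{1..<r}. P a (r + a)) = (\<Sum>a\<in>{2..r}. P a (2*r + a))"
  proof (rule sum.reindex_bij_witness[of _ "\<lambda>a. a - 1" "\<lambda>a. a + 1"])
    fix a assume a: "a \<in> {1..<r}"
    have "2*r + (a + 1) = 2*r + 1 + a" by simp
    thus "P (a + 1) (2*r + (a + 1)) = P a (r + a)" using P_row0[of a] a by (simp add: nx_def)
  qed auto
  finally have 7: "(\<Sum>a\<in>{1..r}. P a (r + a)) = C + (\<Sum>a\<in>{2..r}. P a (2*r + a))" .
  have "{1..r} = insert 1 {2..r}" using r by auto
  hence 8: "(\<Sum>a\<in>{1..r}. P a (2*r + a)) = P 1 (2*r + 1) + (\<Sum>a\<in>{2..r}. P a (2*r + a))" by simp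
  show ?thesis unfolding 0 1 2 3 4 5 6 7 8 by simp
qed

lemma lam_mult_star: "lam (X * Y) = (\<Sum>j\<in>{2..r}. entry X (1, j) * entry Y (1, r + 2 - j))"
proof -
  have "P 1 (2*r + 1) = (\<Sum>j\<in>{1..n}. entry X (1, j) * entry Y (j, 2*r + 1))" using n by (simp add: P_sum)
  also have "\<dots> = (\<Sum>j\<in>{2..r}. entry X (1, j) * entry Y (j, 2*r + 1))"
  proof (rule sum.mono_neutral_right)
    show "\<forall>j\<in>{1..n} - {2..r}. entry X (1, j) * entry Y (j, 2*r + 1) = 0"
    proof
      fix j assume j: "j \<in> {1..n} - {2..r}"
      hence "j = 1 \<or> r < j" "j \<le> n" by auto
      then consider "j = 1" | "r < j" "j \<le> 2*r" | "2*r < j" "j \<le> n"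
        using not_le_imp_less[of j "2*r"] by blast
      thus "entry X (1, j) * entry Y (j, 2*r + 1) = 0"
      proof cases
        case 1 thus ?thesis using n Xl[of 1 1] by simp
      next
        case 2 thus ?thesis using condZD(1)[OF Yc(1), of j "2*r + 1"] r by simp
      next
        case 3 thus ?thesis using Yl[of "2*r + 1" j] by simp
      qed
    qed
  qed (use n in auto)
  also have "\<dots> = (\<Sum>j\<in>{2..r}. entry X (1, j) * entry Y (1, r + 2 - j))"
    using toeplitz_last[OF Yc(5)] by (intro sum.cong refl) auto
  finally show ?thesis using lam_P by simp
qed

lemma entry_mult_star:
  assumes k: "2 \<le> k" "k \<le> r"
  shows "entry (X * Y) (1, k) = (\<Sum>j\<in>{2..<k}. entry X (1, j) * entry Y (1, k + 1 - j))"
proof -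
  have "P 1 k = (\<Sum>j\<in>{1..n}. entry X (1, j) * entry Y (j, k))" using n k by (simp add: P_sum)
  also have "\<dots> = (\<Sum>j\<in>{2..<k}. entry X (1, j) * entry Y (j, k))"
  proof (rule sum.mono_neutral_right)
    show "\<forall>j\<in>{1..n} - {2..<k}. entry X (1, j) * entry Y (j, k) = 0"
    proof
      fix j assume j: "j \<in> {1..n} - {2..<k}"
      hence "j = 1 \<or> k \<le> j" "j \<le> n" by auto
      then consider "j = 1" | "k \<le> j" "j \<le> n" by blast
      thus "entry X (1, j) * entry Y (j, k) = 0"
      proof cases
        case 1 thus ?thesis using n Xl[of 1 1] by simp
      next
        case 2 thus ?thesis using Yl[of k j] k by simp
      qed
    qed
  qed (use n k in auto)
  also have "\<dots> = (\<Sum>j\<in>{2..<k}. entry X (1, j) * entry Y (1, k + 1 - j))"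
  proof (intro sum.cong refl)
    fix j assume "j \<in> {2..<k}"
    hence j: "2 \<le> j" "j < k" by auto
    have t: "entry Y (j, k) = entry Y (1, k - j + 1)" by (rule toeplitz[OF Yc(5)]) (use j k in auto)
    have "k - j + 1 = k + 1 - j" using j by simp
    thus "entry X (1, j) * entry Y (j, k) = entry X (1, j) * entry Y (1, k + 1 - j)" by (simp only: t)
  qed
  finally show ?thesis .
qed

end

lemma star_iso:
  assumes "X \<in> star" "Y \<in> star"
  shows "lam (X * Y) = lam (Y * X)"
  unfolding lam_mult_star[OF assms] lam_mult_star[OF assms(2,1)]
  by (rule sum.reindex_bij_witness[of _ "\<lambda>j. r + 2 - j" "\<lambda>j. r + 2 - j"]) auto

text \<open>The symmetry of \<open>lam\<close> on \<open>star\<close>, which contains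
  \<open>sh\<close>, is the hypothesis of \<open>perp_in_sh\<close> and gives the inclusion that the
  tests do not reach.\<close>

lemma sh_star: "sh = star"
proof
  show sub: "sh \<subseteq> star" using sh_conds by (auto simp: star_def)
  show "star \<subseteq> sh"
  proof
    fix X assume X: "X \<in> star"
    hence "X \<in> N" by (simp add: star_def)
    thus "X \<in> sh" using star_iso[OF X] sub by (intro perp_in_sh) auto
  qed
qed

end

section \<open>The Toeplitz quotient\<close>

lemma mat_entry_eqI:
  assumes "X \<in> carrier_mat n n" "Y \<in> carrier_mat n n"
    and eq: "\<And>i k. i \<in> {1..n} \<Longrightarrow> k \<in> {1..n} \<Longrightarrow> entry X (i, k) = entry Y (i, k)"
  shows "X = Y"
proof (rule eq_matI)
  fix a b assume "a < dim_row Y" "b < dim_col Y"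
  thus "X $$ (a, b) = Y $$ (a, b)" using assms(2) eq[of "a + 1" "b + 1"] by (simp add: entry_def)
qed (use assms in auto)

section \<open>Position sets, \<open>tau\<close>, and the count of matrices with prescribed
  coincidences and zeros\<close>

definition upper_positions :: "nat \<Rightarrow> (nat \<times> nat) set" where
  "upper_positions m = {(i, k). 1 \<le> i \<and> i < k \<and> k \<le> m}"

lemma finite_upper_positions [simp]: "finite (upper_positions m)"
proof (rule finite_subset)
  show "upper_positions m \<subseteq> {1..m} \<times> {1..m}" by (auto simp: upper_positions_def)
qed simp

lemma card_upper_positions: "card (upper_positions m) * 2 + m = m * m"
proof (induction m)
  case (Suc m)
  have eq: "upper_positions (Suc m) = upper_positions m \<union> (\<lambda>i. (i, Suc m)) ` {1..m}"
    by (auto simp: upper_positions_def)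
  have "card (upper_positions (Suc m)) = card (upper_positions m) + card ((\<lambda>i. (i, Suc m)) ` {1..m})"
    unfolding eq by (rule card_Un_disjoint) (simp, simp, auto simp: upper_positions_def)
  also have "card ((\<lambda>i. (i, Suc m)) ` {1..m}) = m" by (subst card_image) (auto simp: inj_on_def)
  finally show ?case using Suc by simp
next
  case 0
  have "upper_positions 0 = {}" by (auto simp: upper_positions_def)
  thus ?case by simp
qed

text \<open>The equations are independent because \<sigma> sends \<open>Q1\<close> to positions
  outside \<open>Q0\<close> and \<open>Q1\<close>, and exactly those remain as free
  coordinates.\<close>

lemma card_pattern:
  fixes \<sigma> :: "nat \<times> nat \<Rightarrow> nat \<times> nat"
  assumes Q: "Q0 \<subseteq> upper_positions n" "Q1 \<subseteq> upper_positions n" "Q0 \<inter> Q1 = {}"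
    and \<sigma>: "\<And>\<alpha>. \<alpha> \<in> Q1 \<Longrightarrow> \<sigma> \<alpha> \<in> upper_positions n - (Q0 \<union> Q1)"
  shows "card {X \<in> strict_upper n :: 'a::{zero,finite} mat set.
      (\<forall>\<alpha>\<in>Q1. entry X \<alpha> = entry X (\<sigma> \<alpha>)) \<and> (\<forall>\<alpha>\<in>Q0. entry X \<alpha> = 0)} =
    CARD('a) ^ (card (upper_positions n) - card (Q0 \<union> Q1))"
proof -
  let ?U = "upper_positions n - (Q0 \<union> Q1)"
  let ?V = "{X \<in> strict_upper n :: 'a mat set.
      (\<forall>\<alpha>\<in>Q1. entry X \<alpha> = entry X (\<sigma> \<alpha>)) \<and> (\<forall>\<alpha>\<in>Q0. entry X \<alpha> = 0)}"
  define h where "h f \<alpha> = (if \<alpha> \<in> ?U then f \<alpha> else if \<alpha> \<in> Q1 then f (\<sigma> \<alpha>) else 0)"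
    for f :: "nat \<times> nat \<Rightarrow> 'a" and \<alpha>
  define m where "m f = mat n n (\<lambda>(a, b). h f (a + 1, b + 1))" for f
  have box: "\<alpha> \<in> {1..n} \<times> {1..n}" if "\<alpha> \<in> upper_positions n" for \<alpha>
    using that by (auto simp: upper_positions_def)
  have ent: "entry (m f) \<alpha> = h f \<alpha>" if "\<alpha> \<in> {1..n} \<times> {1..n}" for f \<alpha>
    using that by (cases \<alpha>) (auto simp: m_def entry_def)
  have ent': "entry (m f) \<alpha> = h f \<alpha>" if "\<alpha> \<in> upper_positions n" for f \<alpha>
    by (rule ent[OF box[OF that]])
  have mV: "m f \<in> ?V" for f
  proof -
    have "m f \<in> carrier_mat n n" by (simp add: m_def)
    moreover have "h f (i, j) = 0" if "j \<le> i" for i j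
      using that Q(2) by (auto simp: h_def upper_positions_def)
    hence "entry (m f) (i, j) = 0" if "i \<in> {1..n}" "j \<in> {1..n}" "j \<le> i" for i j
      using ent[of "(i, j)" f] that by simp
    ultimately have "m f \<in> strict_upper n" by (simp add: strict_upper_def)
    moreover have "entry (m f) \<alpha> = entry (m f) (\<sigma> \<alpha>)" if \<alpha>: "\<alpha> \<in> Q1" for \<alpha>
    proof -
      have "h f (\<sigma> \<alpha>) = f (\<sigma> \<alpha>)" using \<sigma>[OF \<alpha>] by (simp add: h_def)
      moreover have "h f \<alpha> = f (\<sigma> \<alpha>)" using \<alpha> by (simp add: h_def)
      ultimately show ?thesis using ent'[of \<alpha> f] ent'[of "\<sigma> \<alpha>" f] \<sigma>[OF \<alpha>] Q(2) \<alpha> by auto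
    qed
    moreover have "entry (m f) \<alpha> = 0" if \<alpha>: "\<alpha> \<in> Q0" for \<alpha>
    proof -
      have "h f \<alpha> = 0" using \<alpha> Q(3) by (auto simp: h_def)
      thus ?thesis using ent'[of \<alpha> f] Q(1) \<alpha> by auto
    qed
    ultimately show ?thesis by simp
  qed
  have "bij_betw (\<lambda>X. restrict (entry X) ?U) ?V (?U \<rightarrow>\<^sub>E (UNIV :: 'a set))"
  proof (rule bij_betw_byWitness[where f' = m])
    show "\<forall>X\<in>?V. m (restrict (entry X) ?U) = X"
    proof
      fix X assume X: "X \<in> ?V"
      show "m (restrict (entry X) ?U) = X"
      proof (rule mat_entry_eqI)
        show "X \<in> carrier_mat n n" using X by (auto simp: strict_upper_def)
        show "m (restrict (entry X) ?U) \<in> carrier_mat n n" by (simp add: m_def)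
        fix i k assume ik: "i \<in> {1..n}" "k \<in> {1..n}"
        have "h (restrict (entry X) ?U) (i, k) = entry X (i, k)"
        proof (cases "(i, k) \<in> upper_positions n")
          case True
          thus ?thesis using X \<sigma>[of "(i, k)"] by (auto simp: h_def)
        next
          case False
          hence "k \<le> i" using ik by (auto simp: upper_positions_def)
          hence "entry X (i, k) = 0" using X ik by (auto simp: strict_upper_def)
          thus ?thesis using False Q(2) by (auto simp: h_def)
        qed
        thus "entry (m (restrict (entry X) ?U)) (i, k) = entry X (i, k)" using ent[of "(i, k)"] ik by simp
      qed
    qed
    show "\<forall>f\<in>?U \<rightarrow>\<^sub>E UNIV. restrict (entry (m f)) ?U = f"
    proof
      fix f :: "nat \<times> nat \<Rightarrow> 'a" assume f: "f \<in> ?U \<rightarrow>\<^sub>E UNIV"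
      show "restrict (entry (m f)) ?U = f"
      proof (rule extensionalityI[of _ ?U])
        fix \<alpha> assume "\<alpha> \<in> ?U"
        thus "restrict (entry (m f)) ?U \<alpha> = f \<alpha>" using ent'[of \<alpha> f] by (simp add: h_def)
      qed (use f in \<open>auto simp: PiE_def\<close>)
    qed
    show "m ` (?U \<rightarrow>\<^sub>E UNIV) \<subseteq> ?V" using mV by blast
    show "(\<lambda>X. restrict (entry X) ?U) ` ?V \<subseteq> ?U \<rightarrow>\<^sub>E UNIV"
      by (intro image_subsetI) (simp only: restrict_PiE_iff UNIV_I, blast)
  qed
  hence "card ?V = card (?U \<rightarrow>\<^sub>E (UNIV :: 'a set))" by (rule bij_betw_same_card)
  also have "\<dots> = CARD('a) ^ card ?U" by (simp add: card_PiE)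
  also have "card ?U = card (upper_positions n) - card (Q0 \<union> Q1)"
    using Q by (intro card_Diff_subset finite_subset[OF _ finite_upper_positions]) auto
  finally show ?thesis .
qed

lemma utri_image: "utri m x y = (\<lambda>(i, j). (x + i, y + j)) ` upper_positions m"
  and ltri_image: "ltri m x y = (\<lambda>(i, j). (x + j, y + i)) ` upper_positions m"
  and square_image: "square m x y = (\<lambda>(i, j). (x + i, y + j)) ` ({1..m} \<times> {1..m})"
  by (auto simp: utri_def ltri_def square_def upper_positions_def image_iff)

lemma card_positions:
  "card (utri m x y) = card (upper_positions m)" "card (ltri m x y) = card (upper_positions m)"
  "card (square m x y) = m * m"
  unfolding utri_image ltri_image square_image by (subst card_image; auto simp: inj_on_def)+

lemma finite_positions [simp]: "finite (utri m x y)" "finite (ltri m x y)" "finite (square m x y)"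
  unfolding utri_image ltri_image square_image by auto

lemma posA_ball: "(\<forall>\<alpha>\<in>posA r. P \<alpha>) \<longleftrightarrow> (\<forall>j\<in>{1..r}. \<forall>i\<in>{1..<j}. P (r + j, 3*r + 1 + i))"
  and posB_ball: "(\<forall>\<alpha>\<in>posB r. P \<alpha>) \<longleftrightarrow> (\<forall>j\<in>{1..r}. \<forall>i\<in>{1..<j}. P (r + i, r + j))"
  and posC_ball: "(\<forall>\<alpha>\<in>posC r. P \<alpha>) \<longleftrightarrow> (\<forall>j\<in>{1..r}. \<forall>i\<in>{1..<j}. P (j, r + i))"
  unfolding posA_def posB_def posC_def utri_image ltri_image by (auto simp: upper_positions_def)

lemma posD_ball: "(\<forall>\<alpha>\<in>posD r. P \<alpha>) \<longleftrightarrow>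
    (\<forall>j\<in>{1..r}. \<forall>i\<in>{1..<j}. P (i, j)) \<and> (\<forall>i\<in>{2..r}. P (i, 2*r + 1))"
  unfolding posD_def utri_image ball_Un by (auto simp: upper_positions_def)

lemma posZ_ball: "(\<forall>\<alpha>\<in>posZ r. P \<alpha>) \<longleftrightarrow>
    (\<forall>c\<in>{1..r}. \<forall>b\<in>{0..r}. P (r + c, 2*r + 1 + b)) \<and>
    (\<forall>c\<in>{1..r}. \<forall>b\<in>{1..<c}. P (r + c, 4*r + 1 + b)) \<and>
    (\<forall>c\<in>{1..r}. \<forall>b\<in>{1..r}. P (3*r + 1 + c, 4*r + 1 + b)) \<and>
    (\<forall>c\<in>{1..r}. \<forall>b\<in>{1..<c}. P (3*r + 1 + c, 5*r + 1 + b))"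
proof -
  have 1: "(\<forall>\<alpha>\<in>square r r (2*r) \<union> {(r + i, 3*r + 1) | i. i \<in> {1..r}}. P \<alpha>) \<longleftrightarrow>
      (\<forall>c\<in>{1..r}. \<forall>b\<in>{0..r}. P (r + c, 2*r + 1 + b))" (is "?L \<longleftrightarrow> ?R")
  proof
    assume L: ?L
    show ?R
    proof (intro ballI)
      fix c b assume cb: "c \<in> {1..r}" "b \<in> {0..r}"
      show "P (r + c, 2*r + 1 + b)"
      proof (cases "b = r")
        case True
        have "(r + c, 3*r + 1) \<in> {(r + i, 3*r + 1) | i. i \<in> {1..r}}" using cb by blast
        hence "P (r + c, 3*r + 1)" using L by blast
        moreover have "3*r + 1 = 2*r + 1 + b" using True by simp
        ultimately show ?thesis by simp
      next
        case False
        have "(r + c, 2*r + (b + 1)) \<in> square r r (2*r)" unfolding square_def using cb False by auto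
        hence "P (r + c, 2*r + (b + 1))" using L by blast
        moreover have "2*r + (b + 1) = 2*r + 1 + b" by simp
        ultimately show ?thesis by metis
      qed
    qed
  next
    assume R: ?R
    show ?L
    proof
      fix \<alpha> assume "\<alpha> \<in> square r r (2*r) \<union> {(r + i, 3*r + 1) | i. i \<in> {1..r}}"
      then consider i j where "\<alpha> = (r + i, 2*r + j)" "i \<in> {1..r}" "j \<in> {1..r}" | i where "\<alpha> = (r + i, 3*r + 1)" "i \<in> {1..r}"
        unfolding square_def by blast
      thus "P \<alpha>"
      proof cases
        case 1
        have "j - 1 \<in> {0..r}" "2*r + 1 + (j - 1) = 2*r + j" using 1 by auto
        thus ?thesis using 1 R by metis
      next
        case 2
        have "r \<in> {0..r}" "2*r + 1 + r = 3*r + 1" by auto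
        thus ?thesis using 2 R by metis
      qed
    qed
  qed
  have 2: "(\<forall>\<alpha>\<in>ltri r x y. P \<alpha>) \<longleftrightarrow> (\<forall>c\<in>{1..r}. \<forall>b\<in>{1..<c}. P (x + c, y + b))" for x y
    unfolding ltri_image by (auto simp: upper_positions_def)
  have 3: "(\<forall>\<alpha>\<in>square r x y. P \<alpha>) \<longleftrightarrow> (\<forall>c\<in>{1..r}. \<forall>b\<in>{1..r}. P (x + c, y + b))" for x y
    unfolding square_image by auto
  show ?thesis unfolding posZ_def ball_Un[of "square r r (2*r) \<union> _ \<union> _"] ball_Un[of _ "square r (3*r+1) (4*r+1)"]
    ball_Un[of _ "ltri r r (4*r+1)"] ball_Un[of _ "ltri r (3*r+1) (5*r+1)"] 1 2 3 by blast
qed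

lemma tau_simps:
  assumes "1 \<le> i" "i < j" "j \<le> r"
  shows "tau r (r + j, 3*r + 1 + i) = (2*r + 1 + j, 3*r + 1 + i)"
    and "tau r (r + i, r + j) = (2*r + 1 + i, 2*r + 1 + j)"
    and "tau r (j, r + i) = (if j < r then j + 1 else 2*r + 1, 2*r + 1 + i)"
    and "tau r (i, j) = (i + 1, if j < r then j + 1 else 2*r + 1)"
proof -
  have ij: "(i, j) \<in> upper_positions r" using assms by (simp add: upper_positions_def)
  have "(r + j, 3*r + 1 + i) \<in> posA r" unfolding posA_def ltri_image by (rule image_eqI[OF _ ij]) simp
  thus "tau r (r + j, 3*r + 1 + i) = (2*r + 1 + j, 3*r + 1 + i)" by (simp add: tau_def)
  have "(r + i, r + j) \<in> posB r" unfolding posB_def utri_image by (rule image_eqI[OF _ ij]) simp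
  moreover have "(r + i, r + j) \<notin> posA r" unfolding posA_def ltri_def using assms by auto
  ultimately show "tau r (r + i, r + j) = (2*r + 1 + i, 2*r + 1 + j)" by (simp add: tau_def)
  have low: "(j', k) \<notin> posA r" "(j', k) \<notin> posB r" if "j' \<le> r" for j' k
    unfolding posA_def posB_def ltri_def utri_def using that by auto
  have "(j, r + i) \<in> posC r" unfolding posC_def ltri_image by (rule image_eqI[OF _ ij]) simp
  thus "tau r (j, r + i) = (if j < r then j + 1 else 2*r + 1, 2*r + 1 + i)"
    using low[of j] assms by (simp add: tau_def)
  have "(i, j) \<notin> posC r" unfolding posC_def ltri_def using assms by auto
  thus "tau r (i, j) = (i + 1, if j < r then j + 1 else 2*r + 1)"
    using low[of i] assms by (simp add: tau_def)
qed

lemma tau_last: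
  assumes "2 \<le> i" "i \<le> r"
  shows "tau r (i, 2*r + 1) = (1, r + 2 - i)"
proof -
  have "(i, 2*r + 1) \<notin> posA r" "(i, 2*r + 1) \<notin> posB r" "(i, 2*r + 1) \<notin> posC r"
    unfolding posA_def posB_def posC_def ltri_def utri_def using assms by auto
  thus ?thesis by (simp add: tau_def)
qed

section \<open>Congruence of power series modulo u^(m+1)\<close>

definition agree :: "nat \<Rightarrow> 'a::comm_ring_1 fps \<Rightarrow> 'a fps \<Rightarrow> bool" where
  "agree m F H \<longleftrightarrow> (\<forall>k\<le>m. fps_nth F k = fps_nth H k)"

lemma agree_refl [simp]: "agree m F F"
  and agree_sym: "agree m F H \<Longrightarrow> agree m H F"
  and agree_trans [trans]: "agree m F H \<Longrightarrow> agree m H K \<Longrightarrow> agree m F K"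
  and agree_add: "agree m F F' \<Longrightarrow> agree m H H' \<Longrightarrow> agree m (F + H) (F' + H')"
  and agreeD: "agree m F H \<Longrightarrow> k \<le> m \<Longrightarrow> fps_nth F k = fps_nth H k"
  by (simp_all add: agree_def)

lemma agree_mult: "agree m F F' \<Longrightarrow> agree m H H' \<Longrightarrow> agree m (F * H) (F' * H')"
  by (auto simp: agree_def fps_mult_nth intro!: sum.cong)

lemma agree_power: "agree m F F' \<Longrightarrow> agree m (F ^ k) (F' ^ k)"
  by (induction k) (auto intro: agree_mult)

lemma agree_sum: "(\<And>a. a \<in> A \<Longrightarrow> agree m (f a) (g a)) \<Longrightarrow> agree m (\<Sum>a\<in>A. f a) (\<Sum>a\<in>A. g a)"
  by (induction A rule: infinite_finite_induct) (auto intro: agree_add)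

context ut_lambda begin

lemma star_set: "star = {X \<in> N. (\<forall>\<alpha> \<in> posA r \<union> posB r \<union> posC r \<union> posD r. entry X \<alpha> = entry X (tau r \<alpha>))
    \<and> (\<forall>\<alpha> \<in> posZ r. entry X \<alpha> = 0)}"
proof -
  have A: "(\<forall>\<alpha>\<in>posA r. entry X \<alpha> = entry X (tau r \<alpha>)) \<longleftrightarrow> condA X" for X
    unfolding posA_ball condA_def by (intro ball_cong refl) (simp only: tau_simps atLeastAtMost_iff atLeastLessThan_iff)
  have B: "(\<forall>\<alpha>\<in>posB r. entry X \<alpha> = entry X (tau r \<alpha>)) \<longleftrightarrow> condB X" for X
    unfolding posB_ball condB_def by (intro ball_cong refl) (simp only: tau_simps atLeastAtMost_iff atLeastLessThan_iff)
  have C: "(\<forall>\<alpha>\<in>posC r. entry X \<alpha> = entry X (tau r \<alpha>)) \<longleftrightarrow> condC X" for X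
    unfolding posC_ball condC_def nx_def by (intro ball_cong refl) (simp only: tau_simps atLeastAtMost_iff atLeastLessThan_iff)
  have D: "(\<forall>\<alpha>\<in>posD r. entry X \<alpha> = entry X (tau r \<alpha>)) \<longleftrightarrow> condD X" for X
  proof -
    have "(\<forall>j\<in>{1..r}. \<forall>i\<in>{1..<j}. entry X (i, j) = entry X (tau r (i, j))) \<longleftrightarrow> condD X"
      unfolding condD_def nx_def by (intro ball_cong refl) (simp only: tau_simps atLeastAtMost_iff atLeastLessThan_iff)
    moreover have "\<forall>i\<in>{2..r}. entry X (i, 2*r + 1) = entry X (tau r (i, 2*r + 1))" if "condD X"
      using toeplitz_last[OF that] tau_last by auto
    ultimately show ?thesis unfolding posD_ball by blast
  qed
  have Z: "(\<forall>\<alpha>\<in>posZ r. entry X \<alpha> = 0) \<longleftrightarrow> condZ X" for X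
    unfolding posZ_ball condZ_def ..
  show ?thesis unfolding star_def ball_Un A B C D Z by blast
qed

text \<open>The place of an index in the chain 1, ..., r, 2r+1, counted from 1; the value 0 marks
  indices off the chain.\<close>

definition rho :: "nat \<Rightarrow> nat" where
  "rho i = (if i \<le> r then i else if i = 2*r + 1 then r + 1 else 0)"

text \<open>A section of the quotient map: the Toeplitz matrix on the chain with \<open>c d\<close>
  on its d-th superdiagonal.\<close>

definition chain_toeplitz :: "(nat \<Rightarrow> 'a) \<Rightarrow> 'a mat" where
  "chain_toeplitz c = mat n n (\<lambda>(a, b).
     if 0 < rho (a + 1) \<and> rho (a + 1) < rho (b + 1) then c (rho (b + 1) - rho (a + 1)) else 0)"

lemma entry_chain_toeplitz:
  "i \<in> {1..n} \<Longrightarrow> k \<in> {1..n} \<Longrightarrow>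
    entry (chain_toeplitz c) (i, k) = (if 0 < rho i \<and> rho i < rho k then c (rho k - rho i) else 0)"
  by (auto simp: chain_toeplitz_def entry_def)

lemma chain_toeplitz_N: "chain_toeplitz c \<in> N"
proof -
  have "entry (chain_toeplitz c) (i, j) = 0" if "i \<in> {1..n}" "j \<in> {1..n}" "j \<le> i" for i j
  proof -
    have "\<not> (0 < rho i \<and> rho i < rho j)" using that(3) by (auto simp: rho_def)
    thus ?thesis by (auto simp: entry_chain_toeplitz[OF that(1,2)])
  qed
  moreover have "chain_toeplitz c \<in> carrier_mat n n" by (simp add: chain_toeplitz_def)
  ultimately show ?thesis unfolding strict_upper_def by blast
qed

lemma chain_toeplitz_star: "chain_toeplitz c \<in> star"
proof -
  have row: "entry (chain_toeplitz c) (i, k) = 0"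
    if "1 \<le> i" "i \<le> n" "1 \<le> k" "k \<le> n" "r < i" "i \<noteq> 2*r + 1" for i k
    using that by (simp add: entry_chain_toeplitz rho_def)
  have col: "entry (chain_toeplitz c) (i, k) = 0"
    if "1 \<le> i" "i \<le> n" "1 \<le> k" "k \<le> n" "r < k" "k \<noteq> 2*r + 1" for i k
    using that by (simp add: entry_chain_toeplitz rho_def)
  have "condZ (chain_toeplitz c)" unfolding condZ_def
    by (intro conjI ballI; rule row) (use n in auto)
  moreover have "condA (chain_toeplitz c)" unfolding condA_def
    by (intro ballI trans[OF row row[symmetric]]) (use n in auto)
  moreover have "condB (chain_toeplitz c)" unfolding condB_def
    by (intro ballI trans[OF row row[symmetric]]) (use n in auto)
  moreover have "condC (chain_toeplitz c)" unfolding condC_def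
    by (intro ballI trans[OF col col[symmetric]]) (use n in \<open>auto simp: nx_def\<close>)
  moreover have "condD (chain_toeplitz c)" unfolding condD_def
  proof (intro ballI)
    fix j i assume ij: "j \<in> {1..r}" "i \<in> {1..<j}"
    have "i \<in> {1..n}" "j \<in> {1..n}" "i + 1 \<in> {1..n}" "nx j \<in> {1..n}"
      using ij n by (auto simp: nx_def)
    moreover have "rho (nx j) = j + 1" "rho (i + 1) = i + 1" "rho i = i" "rho j = j"
      using ij by (auto simp: rho_def nx_def)
    ultimately show "entry (chain_toeplitz c) (i, j) = entry (chain_toeplitz c) (i + 1, nx j)"
      by (simp add: entry_chain_toeplitz)
  qed
  ultimately show ?thesis using chain_toeplitz_N by (simp add: star_def)
qed

lemma chain_toeplitz_row: "2 \<le> k \<Longrightarrow> k \<le> r \<Longrightarrow> entry (chain_toeplitz c) (1, k) = c (k - 1)"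
  using n by (simp add: entry_chain_toeplitz rho_def)

text \<open>Among the positions where \<open>lam\<close> has a coefficient only (1, 2r+1) has both
  indices on the chain, and there the chain distance is \<open>r\<close>.\<close>

lemma lam_chain_toeplitz: "lam (chain_toeplitz c) = c r"
proof -
  let ?e = "\<lambda>i k. entry (chain_toeplitz c) (i, k)"
  have z: "?e i k = 0" if "1 \<le> i" "i \<le> n" "1 \<le> k" "k \<le> n" "r < k" "k \<noteq> 2*r + 1" for i k
    using that by (simp add: entry_chain_toeplitz rho_def)
  have "rowval i (?e i) = 0" if i: "i \<in> {1..n} - {1}" for i
  proof -
    have "?e i (i + r) = 0 \<and> ?e i (i + 2*r) = 0" if "i \<le> r" using that i n by (intro conjI z) auto
    moreover have "?e i (i + 2*r + 1) = 0 \<and> ?e i (i + 3*r + 1) = 0" if "r < i" "i \<le> 2*r"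
      using that i n by (intro conjI z) auto
    moreover have "?e i (i + r) = 0" if "2*r < i" "i \<le> 3*r + 1" using that i n r by (intro z) auto
    moreover have "?e i (i + 2*r) = 0" if "3*r + 1 < i" "i \<le> 4*r + 1" using that i n by (intro z) auto
    ultimately show ?thesis by (simp add: rowval_def)
  qed
  hence "(\<Sum>i\<in>{1..n}. rowval i (?e i)) = (\<Sum>i\<in>{1}. rowval i (?e i))"
    using n by (intro sum.mono_neutral_right) auto
  moreover have "?e 1 (1 + r) = 0" using n r by (intro z) auto
  moreover have "?e 1 (1 + 2*r) = c r" using n r by (simp add: entry_chain_toeplitz rho_def)
  ultimately show ?thesis using r lam_rows[OF chain_toeplitz_N] by (simp add: rowval_def)
qed

text \<open>Modulo \<open>u\<^bsup>r+1\<^esup>\<close> this is a homomorphism from \<open>sh\<close> onto the maximal ideal of the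
  power series in \<open>u\<close>; the coefficient of \<open>u\<^sup>r\<close> is \<open>lam\<close>.\<close>

definition phi :: "'a mat \<Rightarrow> 'a fps" where
  "phi X = Abs_fps (\<lambda>k. if k = 0 then 0 else if k < r then entry X (1, k + 1) else if k = r then lam X else 0)"

lemma phi_nth: "fps_nth (phi X) 0 = 0" "0 < k \<Longrightarrow> k < r \<Longrightarrow> fps_nth (phi X) k = entry X (1, k + 1)"
  "fps_nth (phi X) r = lam X"
  using r by (simp_all add: phi_def)

lemma phi_add: "X \<in> N \<Longrightarrow> Y \<in> N \<Longrightarrow> phi (X + Y) = phi X + phi Y"
proof (rule fps_ext)
  fix k assume XY: "X \<in> N" "Y \<in> N"
  have "entry (X + Y) (1, k + 1) = entry X (1, k + 1) + entry Y (1, k + 1)" if "k < r"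
    using that n by (intro entry_add[OF Nc[OF XY(1)] Nc[OF XY(2)]]) auto
  thus "fps_nth (phi (X + Y)) k = fps_nth (phi X + phi Y) k"
    using XY by (simp add: phi_def lam_add)
qed

lemma phi_smult: "X \<in> N \<Longrightarrow> phi (c \<cdot>\<^sub>m X) = fps_const c * phi X"
proof (rule fps_ext)
  fix k assume X: "X \<in> N"
  have "entry (c \<cdot>\<^sub>m X) (1, k + 1) = c * entry X (1, k + 1)" if "k < r"
    using that n Nc[OF X] by (simp add: entry_def)
  thus "fps_nth (phi (c \<cdot>\<^sub>m X)) k = fps_nth (fps_const c * phi X) k"
    using X by (simp add: phi_def lam_smult)
qed

lemma phi_mult:
  assumes X: "X \<in> sh" and Y: "Y \<in> sh"
  shows "agree r (phi (X * Y)) (phi X * phi Y)"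
  unfolding agree_def
proof (intro allI impI)
  fix k assume k: "k \<le> r"
  have st: "X \<in> star" "Y \<in> star" using X Y sh_star by auto
  show "fps_nth (phi (X * Y)) k = fps_nth (phi X * phi Y) k"
  proof (cases "k = 0")
    case False
    have L: "fps_nth (phi (X * Y)) k = (\<Sum>j\<in>{2..k}. entry X (1, j) * entry Y (1, k + 2 - j))"
    proof (cases "k = r")
      case True
      thus ?thesis using lam_mult_star[OF st] phi_nth(3) by simp
    next
      case False
      hence kr: "k < r" "2 \<le> k + 1" "k + 1 \<le> r" using k \<open>k \<noteq> 0\<close> by auto
      have "entry (X * Y) (1, k + 1) = (\<Sum>j\<in>{2..<k + 1}. entry X (1, j) * entry Y (1, k + 1 + 1 - j))"
        by (rule entry_mult_star[OF st kr(2,3)])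
      moreover have "{2..<k + 1} = {2..k}" "k + 1 + 1 = k + 2" by auto
      moreover have "fps_nth (phi (X * Y)) k = entry (X * Y) (1, k + 1)"
        using \<open>k \<noteq> 0\<close> kr by (intro phi_nth(2)) auto
      ultimately show ?thesis by (simp only:)
    qed
    have "fps_nth (phi X * phi Y) k = (\<Sum>i=0..k. fps_nth (phi X) i * fps_nth (phi Y) (k - i))"
      by (rule fps_mult_nth)
    also have "\<dots> = (\<Sum>i\<in>{1..<k}. fps_nth (phi X) i * fps_nth (phi Y) (k - i))"
    proof (rule sum.mono_neutral_right)
      show "\<forall>i\<in>{0..k} - {1..<k}. fps_nth (phi X) i * fps_nth (phi Y) (k - i) = 0"
      proof
        fix i assume "i \<in> {0..k} - {1..<k}"
        hence "i = 0 \<or> k - i = 0" by auto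
        thus "fps_nth (phi X) i * fps_nth (phi Y) (k - i) = 0" using phi_nth(1) by auto
      qed
    qed auto
    also have "\<dots> = (\<Sum>j\<in>{2..k}. entry X (1, j) * entry Y (1, k + 2 - j))"
    proof (rule sum.reindex_bij_witness[of _ "\<lambda>j. j - 1" "\<lambda>i. i + 1"])
      fix i assume i: "i \<in> {1..<k}"
      have "fps_nth (phi X) i = entry X (1, i + 1)" using i k by (intro phi_nth) auto
      moreover have "fps_nth (phi Y) (k - i) = entry Y (1, k - i + 1)" using i k by (intro phi_nth) auto
      moreover have "k - i + 1 = k + 2 - (i + 1)" using i by (auto simp: Suc_diff_le)
      ultimately show "entry X (1, i + 1) * entry Y (1, k + 2 - (i + 1)) = fps_nth (phi X) i * fps_nth (phi Y) (k - i)"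
        by (simp only:)
    qed auto
    finally show ?thesis using L by (simp only:)
  qed (simp add: phi_nth)
qed

lemma phi_surj:
  assumes "fps_nth F 0 = 0"
  shows "\<exists>X\<in>sh. agree r (phi X) F"
proof
  show "chain_toeplitz (fps_nth F) \<in> sh" using chain_toeplitz_star sh_star by simp
  show "agree r (phi (chain_toeplitz (fps_nth F))) F"
    using assms by (auto simp: agree_def phi_def lam_chain_toeplitz chain_toeplitz_row simp del: One_nat_def)
qed

text \<open>\<open>lam (X * Y)\<close> is the u^r coefficient of \<open>phi X * phi Y\<close>;
  testing against a \<open>Y\<close> over u^(r-k) reads off the coefficient \<open>k\<close> of
  \<open>phi X\<close>.\<close>

lemma lh_iff:
  assumes X: "X \<in> sh"
  shows "X \<in> lh \<longleftrightarrow> (\<forall>k<r. fps_nth (phi X) k = 0)"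
proof
  assume L: "X \<in> lh"
  show "\<forall>k<r. fps_nth (phi X) k = 0"
  proof (intro allI impI)
    fix k assume k: "k < r"
    obtain Y where Y: "Y \<in> sh" "agree r (phi Y) (fps_X ^ (r - k))"
      using phi_surj[of "fps_X ^ (r - k)"] k by auto
    have "lam (X * Y) = 0" using L Y(1) hat_eqs(5) by blast
    hence "fps_nth (phi X * phi Y) r = 0" using agreeD[OF phi_mult[OF X Y(1)], of r] phi_nth(3) by simp
    moreover have "agree r (phi X * phi Y) (phi X * fps_X ^ (r - k))" by (rule agree_mult[OF agree_refl Y(2)])
    ultimately have "fps_nth (phi X * fps_X ^ (r - k)) r = 0" using agreeD[of r _ _ r] by fastforce
    moreover have "r - (r - k) = k" "\<not> r < r - k" using k by auto
    ultimately show "fps_nth (phi X) k = 0" by (simp add: fps_X_power_mult_right_nth)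
  qed
next
  assume z: "\<forall>k<r. fps_nth (phi X) k = 0"
  have "lam (X * Y) = 0" if Y: "Y \<in> sh" for Y
  proof -
    have "fps_nth (phi X * phi Y) r = (\<Sum>i=0..r. fps_nth (phi X) i * fps_nth (phi Y) (r - i))" by (rule fps_mult_nth)
    also have "\<dots> = 0"
    proof (rule sum.neutral, rule ballI)
      fix i assume "i \<in> {0..r}"
      hence "i < r \<or> r - i = 0" by auto
      thus "fps_nth (phi X) i * fps_nth (phi Y) (r - i) = 0" using z phi_nth(1) by auto
    qed
    finally show ?thesis using agreeD[OF phi_mult[OF X Y], of r] phi_nth(3) by simp
  qed
  thus "X \<in> lh" using X hat_eqs(5) by blast
qed

lemma lh_set: "lh = {X \<in> N. (\<forall>\<alpha> \<in> posA r \<union> posB r \<union> posC r. entry X \<alpha> = entry X (tau r \<alpha>))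
    \<and> (\<forall>\<alpha> \<in> posD r \<union> posZ r. entry X \<alpha> = 0)}" (is "lh = ?R")
proof
  show "lh \<subseteq> ?R"
  proof
    fix X assume X: "X \<in> lh"
    hence Xs: "X \<in> star" using lh_sh sh_star by blast
    have D: "condD X" using Xs by (simp add: star_def)
    have row: "entry X (1, k) = 0" if "2 \<le> k" "k \<le> r" for k
    proof -
      have "fps_nth (phi X) (k - 1) = 0" using that X lh_iff[OF lh_sh[OF X]] by auto
      moreover have "fps_nth (phi X) (k - 1) = entry X (1, k - 1 + 1)" using that by (intro phi_nth) auto
      ultimately show ?thesis using that by simp
    qed
    have "\<forall>j\<in>{1..r}. \<forall>i\<in>{1..<j}. entry X (i, j) = 0"
    proof (intro ballI)
      fix j i assume ij: "j \<in> {1..r}" "i \<in> {1..<j}"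
      have "entry X (i, j) = entry X (1, j - i + 1)" by (rule toeplitz[OF D]) (use ij in auto)
      also have "\<dots> = 0" by (rule row) (use ij in auto)
      finally show "entry X (i, j) = 0" .
    qed
    moreover have "\<forall>i\<in>{2..r}. entry X (i, 2*r + 1) = 0"
    proof
      fix i assume i: "i \<in> {2..r}"
      have "entry X (i, 2*r + 1) = entry X (1, r + 2 - i)" by (rule toeplitz_last[OF D]) (use i in auto)
      also have "\<dots> = 0" by (rule row) (use i in auto)
      finally show "entry X (i, 2*r + 1) = 0" .
    qed
    ultimately have "\<forall>\<alpha>\<in>posD r. entry X \<alpha> = 0" unfolding posD_ball by blast
    thus "X \<in> ?R" using Xs unfolding star_set by blast
  qed
  show "?R \<subseteq> lh"
  proof
    fix X assume X: "X \<in> ?R"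
    hence z: "\<forall>j\<in>{1..r}. \<forall>i\<in>{1..<j}. entry X (i, j) = 0" "\<forall>i\<in>{2..r}. entry X (i, 2*r + 1) = 0"
      using posD_ball[of r "\<lambda>\<alpha>. entry X \<alpha> = 0"] by blast+
    \<comment> \<open>\<open>tau\<close> maps \<open>posD\<close> into itself, so zeros there make
      the equations of \<open>posD\<close> automatic.\<close>
    have "entry X \<alpha> = entry X (tau r \<alpha>)" if "\<alpha> \<in> posD r" for \<alpha>
    proof -
      have "(\<forall>\<alpha>\<in>posD r. entry X (tau r \<alpha>) = 0)"
        unfolding posD_ball
      proof (intro conjI ballI)
        fix j i assume ij: "j \<in> {1..r}" "i \<in> {1..<j}"
        have "tau r (i, j) = (i + 1, if j < r then j + 1 else 2*r + 1)" by (rule tau_simps) (use ij in auto)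
        moreover have "entry X (i + 1, j + 1) = 0" if "j < r" by (rule z(1)[rule_format]) (use ij that in auto)
        moreover have "entry X (i + 1, 2*r + 1) = 0" by (rule z(2)[rule_format]) (use ij in auto)
        ultimately show "entry X (tau r (i, j)) = 0" by simp
      next
        fix i assume i: "i \<in> {2..r}"
        have "tau r (i, 2*r + 1) = (1, r + 2 - i)" by (rule tau_last) (use i in auto)
        moreover have "entry X (1, r + 2 - i) = 0" by (rule z(1)[rule_format]) (use i in auto)
        ultimately show "entry X (tau r (i, 2*r + 1)) = 0" by simp
      qed
      thus ?thesis using that X by simp
    qed
    hence "X \<in> star" using X unfolding star_set by blast
    hence Xs: "X \<in> sh" using sh_star by simp
    have "fps_nth (phi X) k = 0" if "k < r" for k
    proof (cases "k = 0")
      case False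
      have "entry X (1, k + 1) = 0" by (rule z(1)[rule_format]) (use that False in auto)
      thus ?thesis using that False by (simp add: phi_nth)
    qed (simp add: phi_nth)
    thus "X \<in> lh" using lh_iff[OF Xs] by blast
  qed
qed

text \<open>Six triangles, two squares and strips of r-1 and r positions: 3 r (r-1) + 2 r^2 + (r-1)
  + r = 5 r^2 - r - 1, written without subtraction.\<close>

lemma card_constraints: "card (posD r \<union> posZ r \<union> (posA r \<union> posB r \<union> posC r)) + r + 1 = 5 * r\<^sup>2"
proof -
  let ?D2 = "{(i, 2*r + 1) | i. i \<in> {2..r}}" and ?Z2 = "{(r + i, 3*r + 1) | i. i \<in> {1..r}}"
  let ?t = "card (upper_positions r)"
  have D2: "?D2 = (\<lambda>i. (i, 2*r + 1)) ` {2..r}" and Z2: "?Z2 = (\<lambda>i. (r + i, 3*r + 1)) ` {1..r}" by auto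
  have fD: "finite ?D2" and fZ: "finite ?Z2" unfolding D2 Z2 by auto
  have cD: "card ?D2 = r - 1" unfolding D2 by (subst card_image) (auto simp: inj_on_def)
  have cZ: "card ?Z2 = r" unfolding Z2 by (subst card_image) (auto simp: inj_on_def)
  note defs = utri_def ltri_def square_def
  let ?U9 = "square r (3*r + 1) (4*r + 1) \<union> ltri r (3*r + 1) (5*r + 1)"
  let ?U8 = "ltri r r (4*r + 1) \<union> ?U9"
  let ?U7 = "?Z2 \<union> ?U8"
  let ?U6 = "square r r (2*r) \<union> ?U7"
  let ?U5 = "?D2 \<union> ?U6"
  let ?U4 = "utri r 0 0 \<union> ?U5"
  let ?U3 = "ltri r 0 r \<union> ?U4"
  let ?U2 = "utri r r r \<union> ?U3"
  let ?U1 = "ltri r r (3*r + 1) \<union> ?U2"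
  have "card ?U9 = card (square r (3*r + 1) (4*r + 1)) + card (ltri r (3*r + 1) (5*r + 1))"
    by (rule card_Un_disjoint) (use fD fZ in simp, use fD fZ in simp, auto simp: defs)
  hence c9: "card ?U9 = r * r + ?t" unfolding card_positions cD cZ .
  have "card ?U8 = card (ltri r r (4*r + 1)) + card (?U9)"
    by (rule card_Un_disjoint) (use fD fZ in simp, use fD fZ in simp, auto simp: defs)
  hence c8: "card ?U8 = ?t + (r * r + ?t)" unfolding card_positions cD cZ c9 .
  have "card ?U7 = card (?Z2) + card (?U8)"
    by (rule card_Un_disjoint) (use fD fZ in simp, use fD fZ in simp, auto simp: defs)
  hence c7: "card ?U7 = r + (?t + (r * r + ?t))" unfolding card_positions cD cZ c8 .
  have "card ?U6 = card (square r r (2*r)) + card (?U7)"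
    by (rule card_Un_disjoint) (use fD fZ in simp, use fD fZ in simp, auto simp: defs)
  hence c6: "card ?U6 = r * r + (r + (?t + (r * r + ?t)))" unfolding card_positions cD cZ c7 .
  have "card ?U5 = card (?D2) + card (?U6)"
    by (rule card_Un_disjoint) (use fD fZ in simp, use fD fZ in simp, auto simp: defs)
  hence c5: "card ?U5 = (r - 1) + (r * r + (r + (?t + (r * r + ?t))))" unfolding card_positions cD cZ c6 .
  have "card ?U4 = card (utri r 0 0) + card (?U5)"
    by (rule card_Un_disjoint) (use fD fZ in simp, use fD fZ in simp, auto simp: defs)
  hence c4: "card ?U4 = ?t + ((r - 1) + (r * r + (r + (?t + (r * r + ?t)))))" unfolding card_positions cD cZ c5 .
  have "card ?U3 = card (ltri r 0 r) + card (?U4)"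
    by (rule card_Un_disjoint) (use fD fZ in simp, use fD fZ in simp, auto simp: defs)
  hence c3: "card ?U3 = ?t + (?t + ((r - 1) + (r * r + (r + (?t + (r * r + ?t))))))" unfolding card_positions cD cZ c4 .
  have "card ?U2 = card (utri r r r) + card (?U3)"
    by (rule card_Un_disjoint) (use fD fZ in simp, use fD fZ in simp, auto simp: defs)
  hence c2: "card ?U2 = ?t + (?t + (?t + ((r - 1) + (r * r + (r + (?t + (r * r + ?t)))))))" unfolding card_positions cD cZ c3 .
  have "card ?U1 = card (ltri r r (3*r + 1)) + card (?U2)"
    by (rule card_Un_disjoint) (use fD fZ in simp, use fD fZ in simp, auto simp: defs)
  hence c1: "card ?U1 = ?t + (?t + (?t + (?t + ((r - 1) + (r * r + (r + (?t + (r * r + ?t))))))))" unfolding card_positions cD cZ c2 .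
  have "posD r \<union> posZ r \<union> (posA r \<union> posB r \<union> posC r) = ?U1"
    unfolding posA_def posB_def posC_def posD_def posZ_def by (simp only: Un_ac)
  hence "card (posD r \<union> posZ r \<union> (posA r \<union> posB r \<union> posC r)) = card ?U1" by (rule arg_cong)
  thus ?thesis using c1 card_upper_positions[of r] r by (simp add: power2_eq_square)
qed

lemma card_lh: "card lh * CARD('a) ^ (5 * r\<^sup>2 - r - 1) = card N"
proof -
  let ?Q0 = "posD r \<union> posZ r" and ?Q1 = "posA r \<union> posB r \<union> posC r"
  let ?U = "upper_positions n"
  note defs = posA_def posB_def posC_def posD_def posZ_def utri_def ltri_def square_def
  have Q0: "?Q0 \<subseteq> ?U" using n r by (auto simp: defs upper_positions_def)
  have Q1: "?Q1 \<subseteq> ?U" using n r by (auto simp: defs upper_positions_def)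
  have disj: "?Q0 \<inter> ?Q1 = {}" by (auto simp: defs)
  \<comment> \<open>Constraints avoid the rows 2r+1 to 3r+1, and in the first \<open>r\<close> rows
    everything right of column 2r+1; \<open>tau\<close> sends \<open>posA\<close>,
    \<open>posB\<close> and \<open>posC\<close> there.\<close>
  have free: "(i, k) \<in> ?U - (?Q0 \<union> ?Q1)"
    if "1 \<le> i" "i < k" "k \<le> n" "2*r < i \<and> i \<le> 3*r + 1 \<or> i \<le> r \<and> 2*r + 1 < k" for i k
    using that by (auto simp: defs upper_positions_def)
  have "\<forall>\<alpha>\<in>?Q1. tau r \<alpha> \<in> ?U - (?Q0 \<union> ?Q1)"
    unfolding ball_Un posA_ball posB_ball posC_ball
  proof (intro conjI ballI)
    fix j i assume "j \<in> {1..r}" "i \<in> {1..<j}"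
    hence ij: "1 \<le> i" "i < j" "j \<le> r" by auto
    show "tau r (r + j, 3*r + 1 + i) \<in> ?U - (?Q0 \<union> ?Q1)" unfolding tau_simps(1)[OF ij] by (rule free) (use ij n in auto)
    show "tau r (r + i, r + j) \<in> ?U - (?Q0 \<union> ?Q1)" unfolding tau_simps(2)[OF ij] by (rule free) (use ij n in auto)
    show "tau r (j, r + i) \<in> ?U - (?Q0 \<union> ?Q1)" unfolding tau_simps(3)[OF ij] by (rule free) (use ij n in auto)
  qed
  hence lh: "card lh = CARD('a) ^ (card ?U - card (?Q0 \<union> ?Q1))"
    unfolding lh_set by (intro card_pattern Q0 Q1 disj) blast
  have "card N = CARD('a) ^ (card ?U - card ({} \<union> {} :: (nat \<times> nat) set))"
    using card_pattern[of "{}" n "{}" "\<lambda>x. x", where 'a = 'a] by simp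
  hence N: "card N = CARD('a) ^ card ?U" by simp
  have "card (?Q0 \<union> ?Q1) \<le> card ?U" using Q0 Q1 by (intro card_mono) auto
  moreover have "5 * r\<^sup>2 - r - 1 = card (?Q0 \<union> ?Q1)" using card_constraints by simp
  ultimately show ?thesis unfolding lh N by (simp add: power_add[symmetric])
qed

text \<open>\<open>card_pattern\<close> does not apply to the equations of \<open>posD\<close>,
  which \<open>tau\<close> maps into itself. Instead the r-1 coefficients of u, ..., u^(r-1) in
  \<open>phi\<close> are free on \<open>sh\<close>, and their common kernel is
  \<open>lh\<close>.\<close>

lemma card_sh: "card sh = CARD('a) ^ (r - 1) * card lh"
proof -
  let ?C = "{1..<r} \<rightarrow>\<^sub>E (UNIV :: 'a set)"
  define T where "T c = chain_toeplitz (\<lambda>k. if k \<in> {1..<r} then c k else 0)" for c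
  have Ts: "T c \<in> sh" for c using chain_toeplitz_star sh_star by (simp add: T_def)
  have Tphi: "fps_nth (phi (T c)) k = c k" if "k \<in> {1..<r}" for c k
    using that by (simp add: phi_nth T_def chain_toeplitz_row del: One_nat_def)
  have diff: "phi (X - Y) = phi X - phi Y" if "X \<in> N" "Y \<in> N" for X Y
    using phi_add[OF that(1) N_closed(4)[OF that(2)], of "-1"] phi_smult[OF that(2), of "-1"] minus_smult[OF that]
    by (simp flip: fps_const_neg)
  have plus: "X + Y \<in> sh" if "X \<in> sh" "Y \<in> sh" for X Y
    using that hat_eqs(1) by (auto simp: lin_closed_def)
  have minus: "X - Y \<in> sh" if "X \<in> sh" "Y \<in> sh" for X Y
    using that hat_eqs(1) minus_smult[OF shN[OF that(1)] shN[OF that(2)]] by (auto simp: lin_closed_def)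
  have bij: "bij_betw (\<lambda>(c, X). T c + X) (?C \<times> lh) sh"
  proof (rule bij_betwI')
    fix x y assume "x \<in> ?C \<times> lh" "y \<in> ?C \<times> lh"
    then obtain c X d Y where xy: "x = (c, X)" "y = (d, Y)" "c \<in> ?C" "d \<in> ?C" "X \<in> lh" "Y \<in> lh" by auto
    have "x = y" if eq: "T c + X = T d + Y"
    proof -
      have "fps_nth (phi (T c + X)) k = c k" "fps_nth (phi (T d + Y)) k = d k" if k: "k \<in> {1..<r}" for k
        using k phi_add[OF shN[OF Ts] lhN[OF xy(5)]] phi_add[OF shN[OF Ts] lhN[OF xy(6)]]
          lh_iff[OF lh_sh[OF xy(5)]] lh_iff[OF lh_sh[OF xy(6)]] xy(5,6) Tphi by auto
      hence "c k = d k" if "k \<in> {1..<r}" for k using that eq by metis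
      hence cd: "c = d" using xy(3,4) by (intro extensionalityI[of _ "{1..<r}"]) (auto simp: PiE_def)
      have "T c \<in> carrier_mat n n" "X \<in> carrier_mat n n" "Y \<in> carrier_mat n n"
        using Nc[OF shN[OF Ts]] Nc[OF lhN[OF xy(5)]] Nc[OF lhN[OF xy(6)]] by auto
      moreover have "T c + X = T c + Y" using eq cd by simp
      moreover have "T c + W - T c = W" if "T c \<in> carrier_mat n n" "W \<in> carrier_mat n n" for W
        using that by (intro eq_matI) auto
      ultimately have "X = Y" by metis
      thus ?thesis using cd xy by simp
    qed
    thus "((case x of (c, X) \<Rightarrow> T c + X) = (case y of (c, X) \<Rightarrow> T c + X)) = (x = y)" using xy by auto
  next
    fix x assume "x \<in> ?C \<times> lh"
    thus "(case x of (c, X) \<Rightarrow> T c + X) \<in> sh" using plus Ts lh_sh by auto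
  next
    fix Z assume Z: "Z \<in> sh"
    define c where "c = restrict (fps_nth (phi Z)) {1..<r}"
    have W: "Z - T c \<in> sh" by (rule minus[OF Z Ts])
    have "fps_nth (phi (Z - T c)) k = 0" if "k < r" for k
    proof (cases "k = 0")
      case False
      hence "k \<in> {1..<r}" using that by simp
      thus ?thesis using diff[OF shN[OF Z] shN[OF Ts]] Tphi[of k c] by (simp add: c_def)
    qed (simp add: phi_nth)
    hence "Z - T c \<in> lh" using lh_iff[OF W] by blast
    moreover have "c \<in> ?C" by (simp add: c_def)
    moreover have "Z = T c + (Z - T c)" using Nc[OF shN[OF Z]] Nc[OF shN[OF Ts[of c]]] by (intro eq_matI) auto
    ultimately show "\<exists>x\<in>?C \<times> lh. Z = (case x of (c, X) \<Rightarrow> T c + X)" by (intro bexI[of _ "(c, Z - T c)"]) auto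
  qed
  have "card sh = card (?C \<times> lh)" using bij_betw_same_card[OF bij] by simp
  also have "\<dots> = CARD('a) ^ (r - 1) * card lh" by (simp add: card_cartesian_product card_PiE)
  finally show ?thesis .
qed

lemma card_sh_N: "card sh * CARD('a) ^ (5 * r\<^sup>2 - 2 * r) = card N"
proof -
  have "2 * r \<le> r * r" using r by simp
  hence "5 * r\<^sup>2 - r - 1 = (r - 1) + (5 * r\<^sup>2 - 2 * r)" using r by (simp add: power2_eq_square)
  thus ?thesis using card_lh card_sh by (simp add: power_add mult_ac)
qed

text \<open>Triple products are symmetric because \<open>lam\<close> is the u^r coefficient of
  \<open>phi\<close>, which is multiplicative modulo u^(r+1) into a commutative ring.\<close>

sublocale ut_form_comm n lam \<theta>
proof
  fix X Y assume XY: "X \<in> sh" "Y \<in> sh"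
  show "lam (X * Y) = lam (Y * X)" using XY sh_star star_iso by simp
  fix Z assume Z: "Z \<in> sh"
  have "agree r (phi (X * Y * Z)) (phi X * phi Y * phi Z)" if "X \<in> sh" "Y \<in> sh" for X Y
    by (rule agree_trans[OF phi_mult[OF hat_eqs(3)[OF that] Z] agree_mult[OF phi_mult[OF that] agree_refl]])
  from agreeD[OF this[OF XY] order_refl] agreeD[OF this[OF XY(2,1)] order_refl]
  show "lam (X * Y * Z) = lam (Y * X * Z)" by (simp add: phi_nth(3) mult.commute)
qed

end

section \<open>Constituents and their values\<close>

lemma lin_char_linear:
  fixes \<chi> :: "'g \<Rightarrow> complex"
  assumes ext: "\<chi> \<in> extensional S" and \<chi>: "lin_char G S \<chi>"
  shows "\<chi> \<in> linear_characters (G\<lparr>carrier := S\<rparr>)"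
proof -
  let ?\<rho> = "\<lambda>g. mat 1 1 (\<lambda>_. \<chi> g)"
  have rep: "is_rep (G\<lparr>carrier := S\<rparr>) 1 ?\<rho>"
    unfolding is_rep_def
  proof (intro conjI ballI)
    show "?\<rho> \<one>\<^bsub>G\<lparr>carrier := S\<rparr>\<^esub> = 1\<^sub>m 1" using \<chi> by (intro eq_matI) (auto simp: lin_char_def)
    fix g h assume "g \<in> carrier (G\<lparr>carrier := S\<rparr>)" "h \<in> carrier (G\<lparr>carrier := S\<rparr>)"
    hence "\<chi> (g \<otimes>\<^bsub>G\<^esub> h) = \<chi> g * \<chi> h" using \<chi> by (simp add: lin_char_def)
    thus "?\<rho> (g \<otimes>\<^bsub>G\<lparr>carrier := S\<rparr>\<^esub> h) = ?\<rho> g * ?\<rho> h"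
      by (intro eq_matI) (auto simp: scalar_prod_def)
  qed auto
  have char: "rep_character (G\<lparr>carrier := S\<rparr>) ?\<rho> = \<chi>"
    using ext by (auto simp: rep_character_def mat_trace_def extensional_def fun_eq_iff)
  have "\<chi> \<in> characters (G\<lparr>carrier := S\<rparr>)"
    unfolding characters_def by (rule CollectI, rule exI[of _ 1], rule exI[of _ ?\<rho>], rule conjI[OF char[symmetric] rep])
  thus ?thesis using \<chi> by (simp add: linear_characters_def lin_char_def)
qed

lemma (in group) induced_at_one:
  assumes "finite (carrier G)" "subgroup H G" "f \<one> = 1"
  shows "of_nat (card H) * induced G H f \<one> = of_nat (card (carrier G))"
proof -
  have "card H \<noteq> 0"
    using subgroup.one_closed[OF assms(2)] finite_subset[OF subgroup.subset[OF assms(2)] assms(1)] by auto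
  thus ?thesis using assms subgroup.one_closed[OF assms(2)] by (simp add: induced_altdef ext0_def)
qed

lemma CHAR_finite_prime: "prime CHAR('a::{field,finite})"
  using prime_CHAR_semidom[where 'a = 'a] finite_imp_CHAR_pos[where 'a = 'a] by simp

lemma power_CHAR_diff: "(x - y) ^ CHAR('a) ^ k = x ^ CHAR('a) ^ k - y ^ CHAR('a) ^ k" for x y :: "'a::{field,finite}"
proof -
  have "(x - y + y) ^ CHAR('a) ^ k = (x - y) ^ CHAR('a) ^ k + y ^ CHAR('a) ^ k"
    by (rule freshmans_dream'[OF CHAR_finite_prime refl])
  thus ?thesis by simp
qed

lemma frobenius_surj: "\<exists>a :: 'a::{field,finite}. a ^ CHAR('a) ^ k = b"
proof -
  have "inj (\<lambda>a :: 'a. a ^ CHAR('a) ^ k)"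
  proof (rule injI)
    fix x y :: 'a assume "x ^ CHAR('a) ^ k = y ^ CHAR('a) ^ k"
    hence "(x - y) ^ CHAR('a) ^ k = 0" by (simp add: power_CHAR_diff)
    thus "x = y" by simp
  qed
  hence "surj (\<lambda>a :: 'a. a ^ CHAR('a) ^ k)" by (rule finite_UNIV_inj_surj[OF finite_class.finite_UNIV])
  from surjD[OF this, of b] show ?thesis by auto
qed

context ut_lambda begin

abbreviation "S \<equiv> S_hat n lam"
abbreviation "L \<equiv> L_hat n lam"

lemma card_S: "card S = card sh" and card_L: "card L = card lh" and card_G: "card (carrier G) = card N"
proof -
  show "card S = card sh" by (rule card_one_plus) (use shN in blast)
  show "card L = card lh" by (rule card_one_plus) (use lhN in blast)
  show "card (carrier G) = card N" unfolding UT_simps by (rule card_one_plus) simp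
qed

lemma card_G_S: "card (carrier G) = card S * (CARD('a) ^ (5 * r\<^sup>2 - 2 * r))"
  using card_sh_N card_S card_G by simp

lemma cards_pos: "card S \<noteq> 0" "card L \<noteq> 0"
  using card_nonzero(2) card_sh card_S card_L by auto

lemma induced_degree:
  assumes "f (1\<^sub>m n) = 1"
  shows "induced G S f (1\<^sub>m n) = of_nat (CARD('a) ^ (5 * r\<^sup>2 - 2 * r))"
proof -
  have "of_nat (card S) * induced G S f (1\<^sub>m n) = of_nat (card (carrier G))"
    using G.induced_at_one[OF finite_UT S_subgroup, of f] assms by (simp del: UT_simps(3))
  also have "\<dots> = of_nat (card S) * of_nat (CARD('a) ^ (5 * r\<^sup>2 - 2 * r))" unfolding card_G_S of_nat_mult ..
  finally show ?thesis using cards_pos by simp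
qed

lemma theta_fun_one: "theta_fun \<theta> n lam (1\<^sub>m n) = 1"
  using theta_fun_lin_char by (simp add: lin_char_def)

lemma xi_one: "xi \<theta> n lam (1\<^sub>m n) = of_nat (CARD('a) ^ (5 * r\<^sup>2 - r - 1))"
proof -
  have "of_nat (card L) * induced G L (theta_fun \<theta> n lam) (1\<^sub>m n) = of_nat (card (carrier G))"
    using G.induced_at_one[OF finite_UT L_subgroup, of "theta_fun \<theta> n lam"] theta_fun_one by (simp del: UT_simps(3))
  also have "\<dots> = of_nat (card L * CARD('a) ^ (5 * r\<^sup>2 - r - 1))" using card_lh card_L card_G by simp
  finally show ?thesis using cards_pos by (simp add: xi_def)
qed

lemma card_exts_eq: "card exts = CARD('a) ^ (r - 1)"
proof -
  have "card exts * card L = CARD('a) ^ (r - 1) * card L" using card_exts card_sh card_S card_L by simp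
  thus ?thesis using cards_pos by simp
qed

lemma xi_components:
  "\<exists>\<Psi>. \<Psi> \<subseteq> irreducible_characters G \<and> card \<Psi> = CARD('a) ^ (r - 1)
    \<and> (\<forall>\<psi>\<in>\<Psi>. \<psi> (1\<^sub>m n) = of_nat (CARD('a) ^ (5 * r\<^sup>2 - 2 * r))
         \<and> (\<exists>\<chi> \<in> linear_characters (G\<lparr>carrier := S\<rparr>). \<psi> = induced G S \<chi>))
    \<and> (\<forall>g\<in>carrier G. xi \<theta> n lam g = (\<Sum>\<psi>\<in>\<Psi>. \<psi> g))"
proof (intro exI[of _ "induced G S ` exts"] conjI ballI)
  show "induced G S ` exts \<subseteq> irreducible_characters G" using induced_exts_irreducible by blast
  show "card (induced G S ` exts) = CARD('a) ^ (r - 1)" using card_image[OF induced_inj] card_exts_eq by simp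
next
  fix \<psi> assume "\<psi> \<in> induced G S ` exts"
  then obtain \<chi> where \<chi>: "\<chi> \<in> exts" "\<psi> = induced G S \<chi>" by blast
  have "\<chi> (1\<^sub>m n) = 1" using extsD(1)[OF \<chi>(1)] by (simp add: lin_char_def)
  thus "\<psi> (1\<^sub>m n) = of_nat (CARD('a) ^ (5 * r\<^sup>2 - 2 * r))" unfolding \<chi>(2) by (rule induced_degree)
  have "\<chi> \<in> linear_characters (G\<lparr>carrier := S\<rparr>)"
    using \<chi>(1) by (intro lin_char_linear) (auto simp: exts_def)
  thus "\<exists>\<chi> \<in> linear_characters (G\<lparr>carrier := S\<rparr>). \<psi> = induced G S \<chi>" using \<chi>(2) by blast
next
  fix g assume g: "g \<in> carrier G"
  show "xi \<theta> n lam g = (\<Sum>\<psi>\<in>induced G S ` exts. \<psi> g)"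
    unfolding xi_def xi_decomposition[OF g] sum.reindex[OF induced_inj] comp_def ..
qed

lemma xi_inner_self: "char_inner G (xi \<theta> n lam) (xi \<theta> n lam) = of_nat (CARD('a) ^ (r - 1))"
  unfolding xi_def xi_norm card_exts_eq ..

text \<open>The multiplicative form of \<open>phi\<close>: modulo u^(r+1) a homomorphism from
  \<open>S\<close> onto the series with constant term 1.\<close>

definition Phi :: "'a mat \<Rightarrow> 'a fps" where "Phi h = 1 + phi (h - 1\<^sub>m n)"

lemma S_elim:
  assumes "h \<in> S"
  obtains X where "X \<in> sh" "h = 1\<^sub>m n + X" "Phi h = 1 + phi X"
proof -
  obtain X where X: "X \<in> sh" "h = 1\<^sub>m n + X" using assms by (auto simp: one_plus_def)
  moreover have "Phi h = 1 + phi X" unfolding Phi_def X(2) one_plus_minus[OF Nc[OF shN[OF X(1)]]] ..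
  ultimately show ?thesis by (rule that)
qed

lemma SI: "X \<in> sh \<Longrightarrow> 1\<^sub>m n + X \<in> S" "X \<in> sh \<Longrightarrow> Phi (1\<^sub>m n + X) = 1 + phi X"
proof -
  assume X: "X \<in> sh"
  thus "1\<^sub>m n + X \<in> S" by (simp add: one_plus_def)
  show "Phi (1\<^sub>m n + X) = 1 + phi X" unfolding Phi_def one_plus_minus[OF Nc[OF shN[OF X]]] ..
qed

lemma Phi_mult:
  assumes "a \<in> S" "b \<in> S"
  shows "a * b \<in> S" "agree r (Phi (a * b)) (Phi a * Phi b)"
proof -
  obtain X where X: "X \<in> sh" "a = 1\<^sub>m n + X" "Phi a = 1 + phi X" by (rule S_elim[OF assms(1)])
  obtain Y where Y: "Y \<in> sh" "b = 1\<^sub>m n + Y" "Phi b = 1 + phi Y" by (rule S_elim[OF assms(2)])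
  have XY: "X * Y \<in> sh" "X + Y \<in> sh" "X + Y + X * Y \<in> sh"
    using X(1) Y(1) hat_eqs(3) lin_closedD(3)[OF hat_eqs(1)] by simp_all
  have ab: "a * b = 1\<^sub>m n + (X + Y + X * Y)"
    unfolding X(2) Y(2) by (rule one_plus_mult[OF Nc[OF shN[OF X(1)]] Nc[OF shN[OF Y(1)]]])
  show "a * b \<in> S" unfolding ab by (rule SI(1)[OF XY(3)])
  have "Phi (a * b) = (1 + phi X + phi Y) + phi (X * Y)"
    unfolding ab SI(2)[OF XY(3)] phi_add[OF shN[OF XY(2)] shN[OF XY(1)]]
      phi_add[OF shN[OF X(1)] shN[OF Y(1)]] by (simp add: add.assoc)
  moreover have "agree r \<dots> ((1 + phi X + phi Y) + phi X * phi Y)"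
    by (rule agree_add[OF agree_refl phi_mult[OF X(1) Y(1)]])
  moreover have "(1 + phi X + phi Y) + phi X * phi Y = Phi a * Phi b" unfolding X(3) Y(3) by (simp add: algebra_simps)
  ultimately show "agree r (Phi (a * b)) (Phi a * Phi b)" by simp
qed

lemma Phi_one: "1\<^sub>m n \<in> S" "Phi (1\<^sub>m n) = 1"
proof -
  show "1\<^sub>m n \<in> S" using subgroup.one_closed[OF S_subgroup] by simp
  have z: "1\<^sub>m n - 1\<^sub>m n = (0\<^sub>m n n :: 'a mat)" by (intro eq_matI) auto
  have p0: "phi (0\<^sub>m n n) = 0"
    using phi_smult[OF N_closed(1), of 0] by simp
  show "Phi (1\<^sub>m n) = 1" unfolding Phi_def z p0 by simp
qed

lemma Phi_pow:
  assumes h: "h \<in> S"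
  shows "h [^]\<^bsub>G\<^esub> (k::nat) \<in> S" "agree r (Phi (h [^]\<^bsub>G\<^esub> k)) (Phi h ^ k)"
proof -
  have "h [^]\<^bsub>G\<^esub> k \<in> S \<and> agree r (Phi (h [^]\<^bsub>G\<^esub> k)) (Phi h ^ k)"
  proof (induction k)
    case 0
    thus ?case using Phi_one by simp
  next
    case (Suc k)
    have "h [^]\<^bsub>G\<^esub> Suc k = h [^]\<^bsub>G\<^esub> k * h" by simp
    moreover have "agree r (Phi (h [^]\<^bsub>G\<^esub> k * h)) (Phi h ^ k * Phi h)"
      by (rule agree_trans[OF Phi_mult(2)[OF conjunct1[OF Suc] h] agree_mult[OF conjunct2[OF Suc] agree_refl]])
    ultimately show ?case using Phi_mult(1)[OF conjunct1[OF Suc] h] by (simp add: mult.commute)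
  qed
  thus "h [^]\<^bsub>G\<^esub> k \<in> S" "agree r (Phi (h [^]\<^bsub>G\<^esub> k)) (Phi h ^ k)" by blast+
qed

lemma L_iff:
  assumes "h \<in> S"
  shows "h \<in> L \<longleftrightarrow> (\<forall>k. 0 < k \<and> k < r \<longrightarrow> fps_nth (Phi h) k = 0)"
proof -
  obtain X where X: "X \<in> sh" "h = 1\<^sub>m n + X" "Phi h = 1 + phi X" by (rule S_elim[OF assms])
  have "h \<in> L \<longleftrightarrow> X \<in> lh" unfolding L_hat_iff X(2) one_plus_minus[OF Nc[OF shN[OF X(1)]]] using Nc[OF shN[OF X(1)]] by simp
  also have "\<dots> \<longleftrightarrow> (\<forall>k<r. fps_nth (phi X) k = 0)" by (rule lh_iff[OF X(1)])
  also have "\<dots> \<longleftrightarrow> (\<forall>k. 0 < k \<and> k < r \<longrightarrow> fps_nth (Phi h) k = 0)"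
    unfolding X(3) using phi_nth(1) by (auto simp: gr0_conv_Suc) (metis not0_implies_Suc)
  finally show ?thesis .
qed

lemma theta_fun_Phi:
  assumes "h \<in> S"
  shows "theta_fun \<theta> n lam h = \<theta> (fps_nth (Phi h) r)"
proof -
  obtain X where X: "X \<in> sh" "h = 1\<^sub>m n + X" "Phi h = 1 + phi X" by (rule S_elim[OF assms])
  have "theta_fun \<theta> n lam h = \<theta> (lam X)" unfolding X(2) by (rule theta_fun_one_plus[OF shN[OF X(1)]])
  moreover have "fps_nth (Phi h) r = lam X" unfolding X(3) using phi_nth(3)[of X] r by simp
  ultimately show ?thesis by simp
qed

lemma exists_Phi:
  assumes "fps_nth F 0 = 1"
  shows "\<exists>h\<in>S. agree r (Phi h) F"
proof -
  obtain X where X: "X \<in> sh" "agree r (phi X) (F - 1)" using phi_surj[of "F - 1"] assms by auto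
  have "agree r (1 + phi X) (1 + (F - 1))" by (rule agree_add[OF agree_refl X(2)])
  thus ?thesis using SI[OF X(1)] by (intro bexI[of _ "1\<^sub>m n + X"]) simp_all
qed

lemma fps_freshman: "(1 + F) ^ CHAR('a) ^ k = 1 + F ^ CHAR('a) ^ k" for F :: "'a fps"
proof -
  have "(1 + F) ^ CHAR('a) ^ k = 1 ^ CHAR('a) ^ k + F ^ CHAR('a) ^ k"
    by (rule freshmans_dream') (use CHAR_finite_prime[where 'a = 'a] in simp_all)
  thus ?thesis by simp
qed

lemma theta_pow_p: "\<theta> x ^ CHAR('a) = 1"
proof -
  have "\<theta> x ^ k = \<theta> (of_nat k * x)" for k by (induction k) (simp_all add: \<theta>_add algebra_simps)
  thus ?thesis by simp
qed

lemma norm_theta: "norm (\<theta> x) = 1"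
proof -
  have "norm (\<theta> x) ^ CHAR('a) = 1" using theta_pow_p[of x] by (simp flip: norm_power)
  moreover have "CHAR('a) > 0" using prime_gt_0_nat[OF CHAR_finite_prime] .
  ultimately show ?thesis using power_eq_iff_eq_base[of "CHAR('a)" "norm (\<theta> x)" 1] by simp
qed

text \<open>Raising 1 + F, with \<open>F\<close> divisible by u, to the power p^(i+1) gives 1 modulo
  u^(r+1), so this power of \<open>h\<close> falls into \<open>L\<close>, at a place where \<theta>
  is 1.\<close>

lemma exts_value_power:
  assumes \<chi>: "\<chi> \<in> exts" and h: "h \<in> S" and i: "r < CHAR('a) ^ Suc i"
  shows "\<chi> h ^ (CHAR('a) ^ Suc i) = 1"
proof -
  obtain X where X: "X \<in> sh" "h = 1\<^sub>m n + X" "Phi h = 1 + phi X" by (rule S_elim[OF h])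
  let ?t = "h [^]\<^bsub>G\<^esub> (CHAR('a) ^ Suc i)"
  have t: "?t \<in> S" "agree r (Phi ?t) (1 + phi X ^ CHAR('a) ^ Suc i)"
    using Phi_pow[OF h, of "CHAR('a) ^ Suc i"] unfolding X(3) fps_freshman by auto
  have z: "fps_nth (Phi ?t) k = 0" if "0 < k" "k \<le> r" for k
  proof -
    have "fps_nth (phi X ^ CHAR('a) ^ Suc i) k = 0"
      using startsby_zero_power_prefix[OF phi_nth(1), of "CHAR('a) ^ Suc i"] that i by auto
    thus ?thesis using agreeD[OF t(2) that(2)] that by simp
  qed
  have "?t \<in> L" using L_iff[OF t(1)] z by auto
  hence "\<chi> ?t = theta_fun \<theta> n lam ?t" by (rule extsD(2)[OF \<chi>])
  also have "\<dots> = 1" using theta_fun_Phi[OF t(1)] z[of r] r by simp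
  finally show ?thesis using G.lin_char_pow(1)[OF S_subgroup extsD(1)[OF \<chi>] h] by simp
qed

lemma constituent_values:
  assumes \<psi>: "\<psi> \<in> irreducible_constituents G (xi \<theta> n lam)" and g: "g \<in> carrier G" and i: "r < CHAR('a) ^ Suc i"
  shows "\<psi> g \<in> cyclotomic_field (CHAR('a) ^ Suc i)"
proof -
  obtain \<chi> where \<chi>: "\<chi> \<in> exts" "\<psi> = induced G S \<chi>" using xi_constituents[of \<psi>] \<psi> unfolding xi_def by blast
  have p0: "CHAR('a) ^ Suc i > 0" using prime_gt_0_nat[OF CHAR_finite_prime[where 'a = 'a]] by simp
  have v: "ext0 S \<chi> x \<in> cyclotomic_field (CHAR('a) ^ Suc i)" for x
  proof (cases "x \<in> S")
    case True
    obtain j where "\<chi> x = exp (2 * of_real pi * \<i> / of_nat (CHAR('a) ^ Suc i)) ^ j"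
      using root_of_unity_exp[OF exts_value_power[OF \<chi>(1) True i] p0] by blast
    thus ?thesis using True cyclotomic_field_pow[OF cyclotomic_field_closed(5)] by (simp only: ext0_def if_True)
  qed (simp add: ext0_def cyclotomic_field_closed(4))
  have "1 / of_nat (card S) \<in> cyclotomic_field (CHAR('a) ^ Suc i)" by (intro cyclotomic_field_closed(4)) simp
  from cyclotomic_field_closed(3)[OF cyclotomic_field_sum[OF v] this]
  show ?thesis unfolding \<chi>(2) G.induced_altdef[OF finite_UT g] by simp
qed

text \<open>Take an extension \<chi> with a value whose p^i-th power is not 1. Then \<chi>^(1 + p^i)
  differs from \<chi>, yet extends \<theta> as well, because i > 0 and \<theta> has p-th roots of
  unity as values. If all values of the induced character lay in the smaller field,
  \<open>cyclotomic_sum_conjugate\<close> would make both extensions induce the same character,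
  against \<open>induced_inj\<close>.\<close>

lemma constituent_nonvalue_large:
  assumes i: "i > 0" "CHAR('a) ^ i \<le> r" and big: "r < CHAR('a) ^ Suc i"
  shows "\<exists>\<psi> \<in> irreducible_constituents G (xi \<theta> n lam). \<exists>g\<in>carrier G. \<psi> g \<notin> cyclotomic_field (CHAR('a) ^ i)"
proof -
  have pr: "prime CHAR('a)" by (rule CHAR_finite_prime)
  have p0: "CHAR('a) > 0" "CHAR('a) ^ i > 0" using prime_gt_0_nat[OF pr] by auto
  have "\<exists>\<chi>\<in>exts. \<exists>h\<in>S. \<chi> h ^ (CHAR('a) ^ i) \<noteq> 1"
  proof (cases "CHAR('a) ^ i < r")
    \<comment> \<open>The p^i-th power of an element over 1 + u lies over 1 + u^(p^i), outside
      \<open>L\<close>, so two extensions differ on it and one of them is not 1 there.\<close>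
    case True
    obtain h where h: "h \<in> S" "agree r (Phi h) (1 + fps_X)" using exists_Phi[of "1 + fps_X"] by auto
    let ?t = "h [^]\<^bsub>G\<^esub> (CHAR('a) ^ i)"
    have t: "?t \<in> S" "agree r (Phi ?t) (1 + fps_X ^ CHAR('a) ^ i)"
      using Phi_pow[OF h(1), of "CHAR('a) ^ i"] agree_power[OF h(2), of "CHAR('a) ^ i"] agree_trans unfolding fps_freshman by auto
    have "fps_nth (Phi ?t) (CHAR('a) ^ i) = 1" using agreeD[OF t(2) i(2)] p0 by (simp add: fps_X_power_nth)
    hence "?t \<notin> L" using L_iff[OF t(1)] True p0 by (metis zero_neq_one)
    then obtain \<chi>1 \<chi>2 where "\<chi>1 \<in> exts" "\<chi>2 \<in> exts" "\<chi>1 ?t \<noteq> \<chi>2 ?t" using exts_separate[of ?t] t(1) by blast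
    then obtain \<chi> where \<chi>: "\<chi> \<in> exts" "\<chi> ?t \<noteq> 1" by metis
    thus ?thesis using G.lin_char_pow(1)[OF S_subgroup extsD(1)[OF \<chi>(1)] h(1)] h(1) by metis
  next
    \<comment> \<open>Now the power lands in \<open>L\<close>, where every extension agrees with
      \<theta>; the coefficient \<open>a\<close> is a p^i-th root of a scalar at which \<theta> is
      not 1.\<close>
    case False
    hence ri: "r = CHAR('a) ^ i" using i by simp
    obtain c where c: "\<theta> (c * 1) \<noteq> 1" using exists_\<theta>[of 1] by auto
    obtain a :: 'a where a: "a ^ CHAR('a) ^ i = c" using frobenius_surj by blast
    obtain h where h: "h \<in> S" "agree r (Phi h) (1 + fps_const a * fps_X)"
      using exists_Phi[of "1 + fps_const a * fps_X"] by auto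
    let ?t = "h [^]\<^bsub>G\<^esub> (CHAR('a) ^ i)"
    have "(1 + fps_const a * fps_X) ^ CHAR('a) ^ i = 1 + fps_const c * fps_X ^ CHAR('a) ^ i"
      unfolding fps_freshman power_mult_distrib fps_const_power a ..
    hence t: "?t \<in> S" "agree r (Phi ?t) (1 + fps_const c * fps_X ^ CHAR('a) ^ i)"
      using Phi_pow[OF h(1), of "CHAR('a) ^ i"] agree_power[OF h(2), of "CHAR('a) ^ i"] agree_trans by auto
    have nth: "fps_nth (Phi ?t) k = (if k = r then c else 0)" if "0 < k" "k \<le> r" for k
      using agreeD[OF t(2) that(2)] that ri by (simp add: fps_X_power_nth)
    have L: "?t \<in> L" using L_iff[OF t(1)] nth by auto
    obtain \<chi> where \<chi>: "\<chi> \<in> exts" using exts_nonempty by blast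
    have "\<chi> ?t = \<theta> c" using extsD(2)[OF \<chi> L] theta_fun_Phi[OF t(1)] nth[of r] r by simp
    hence "\<chi> h ^ (CHAR('a) ^ i) \<noteq> 1" using c G.lin_char_pow(1)[OF S_subgroup extsD(1)[OF \<chi>] h(1)] by simp
    thus ?thesis using \<chi> h(1) by blast
  qed
  then obtain \<chi> s0 where \<chi>: "\<chi> \<in> exts" and s0: "s0 \<in> S" "\<chi> s0 ^ (CHAR('a) ^ i) \<noteq> 1" by blast
  define \<chi>' where "\<chi>' = restrict (\<lambda>h. \<chi> h ^ (1 + CHAR('a) ^ i)) S"
  have lin: "lin_char G S (\<lambda>h. \<chi> h ^ (1 + CHAR('a) ^ i))"
    using extsD(1)[OF \<chi>] by (simp add: lin_char_def power_mult_distrib)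
  have "\<forall>l\<in>L. \<chi> l ^ (1 + CHAR('a) ^ i) = theta_fun \<theta> n lam l"
  proof
    fix l assume l: "l \<in> L"
    have "l \<in> S" using LS l by blast
    have "CHAR('a) ^ i = CHAR('a) * CHAR('a) ^ (i - 1)" using i(1) by (cases i) auto
    hence "\<theta> x ^ (CHAR('a) ^ i) = 1" for x by (simp add: power_mult theta_pow_p)
    thus "\<chi> l ^ (1 + CHAR('a) ^ i) = theta_fun \<theta> n lam l"
      using extsD(2)[OF \<chi> l] theta_fun_Phi[OF \<open>l \<in> S\<close>] by (simp add: power_add)
  qed
  hence \<chi>': "\<chi>' \<in> exts" unfolding \<chi>'_def by (intro exts_restrict[OF lin])
  have ne: "\<chi>' \<noteq> \<chi>"
  proof
    assume e: "\<chi>' = \<chi>"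
    have "\<chi>' s0 = \<chi> s0 * \<chi> s0 ^ (CHAR('a) ^ i)" unfolding \<chi>'_def using s0(1) by simp
    hence "\<chi> s0 = \<chi> s0 * \<chi> s0 ^ (CHAR('a) ^ i)" unfolding e .
    from eq_scaled_imp'[OF this] show False
      using s0(2) G.lin_char_inv(2)[OF S_subgroup extsD(1)[OF \<chi>] s0(1)] by simp
  qed
  show ?thesis
  proof (rule ccontr)
    assume "\<not> ?thesis"
    hence all: "induced G S \<chi> g \<in> cyclotomic_field (CHAR('a) ^ i)" if "g \<in> carrier G" for g
      using exts_constituent[OF \<chi>] that unfolding xi_def by blast
    let ?w = "exp (2 * of_real pi * \<i> / of_nat (CHAR('a) ^ Suc i)) :: complex"
    have "\<exists>j. \<chi> h = ?w ^ j" if "h \<in> S" for h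
      by (rule root_of_unity_exp[OF exts_value_power[OF \<chi> that big]]) (use p0 in simp)
    then obtain m where m: "\<And>h. h \<in> S \<Longrightarrow> \<chi> h = ?w ^ m h" by metis
    have "induced G S \<chi> g = induced G S \<chi>' g" if g: "g \<in> carrier G" for g
    proof -
      let ?Y = "{x \<in> carrier G. x \<otimes>\<^bsub>G\<^esub> g \<otimes>\<^bsub>G\<^esub> inv\<^bsub>G\<^esub> x \<in> S}"
      let ?c = "\<lambda>x. x \<otimes>\<^bsub>G\<^esub> g \<otimes>\<^bsub>G\<^esub> inv\<^bsub>G\<^esub> x"
      have fin: "finite ?Y" by (rule finite_subset[OF _ finite_UT]) blast
      have 1: "(\<Sum>x\<in>?Y. \<chi> (?c x)) = (\<Sum>x\<in>?Y. ?w ^ m (?c x))"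
        by (rule sum.cong[OF refl], rule m) blast
      have 2: "(\<Sum>x\<in>?Y. \<chi>' (?c x)) = (\<Sum>x\<in>?Y. ?w ^ ((1 + CHAR('a) ^ i) * m (?c x)))"
      proof (rule sum.cong[OF refl])
        fix x assume "x \<in> ?Y"
        hence "?c x \<in> S" by blast
        hence "\<chi>' (?c x) = (?w ^ m (?c x)) ^ (1 + CHAR('a) ^ i)" using m[of "?c x"] by (simp only: \<chi>'_def restrict_apply if_True)
        also have "\<dots> = ?w ^ ((1 + CHAR('a) ^ i) * m (?c x))" by (simp only: power_mult[symmetric] mult.commute)
        finally show "\<chi>' (?c x) = ?w ^ ((1 + CHAR('a) ^ i) * m (?c x))" .
      qed
      have "(\<Sum>x\<in>?Y. \<chi> (?c x)) / of_nat (card S) \<in> cyclotomic_field (CHAR('a) ^ i)"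
        using all[OF g] g by (simp only: induced_def restrict_apply if_True)
      hence "(\<Sum>x\<in>?Y. ?w ^ m (?c x)) / of_nat (card S) \<in> cyclotomic_field (CHAR('a) ^ (Suc i - 1))" unfolding 1 by simp
      hence "(\<Sum>x\<in>?Y. ?w ^ ((1 + CHAR('a) ^ (Suc i - 1)) * m (?c x))) = (\<Sum>x\<in>?Y. ?w ^ m (?c x))"
        using i(1) by (intro cyclotomic_sum_conjugate[OF pr _ fin cards_pos(1)]) auto
      hence "(\<Sum>x\<in>?Y. \<chi>' (?c x)) = (\<Sum>x\<in>?Y. \<chi> (?c x))" unfolding 1 2 by simp
      thus ?thesis using g by (simp only: induced_def restrict_apply if_True)
    qed
    moreover have "induced G S f \<in> extensional (carrier G)" for f by (simp add: induced_def)
    ultimately have "induced G S \<chi> = induced G S \<chi>'" by (intro extensionalityI[of _ "carrier G"])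
    thus False using inj_onD[OF induced_inj _ \<chi> \<chi>'] ne by metis
  qed
qed

text \<open>For \<open>r < CHAR('a)\<close> the values on \<open>1 + t e\<close>, where \<open>e\<close> is the elementary matrix at \<open>(1, 2r+1)\<close>,
  are nonzero multiples of \<open>\<theta> t\<close>, since all conjugates of this element lie in \<open>1 + l 1\<close>.\<close>

lemma constituent_nonvalue_small:
  assumes rp: "r < CHAR('a)"
  shows "\<exists>\<psi> \<in> irreducible_constituents G (xi \<theta> n lam). \<exists>g\<in>carrier G. \<psi> g \<notin> cyclotomic_field 1"
proof -
  let ?e = "elem_mat n 1 (2*r + 1) :: 'a mat"
  have pr: "prime CHAR('a)" by (rule CHAR_finite_prime)
  have eN: "?e \<in> N" by (rule elem_mat_strict) (use r in simp)
  have e0: "lam (?e * W) = 0" if W: "W \<in> N" for W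
  proof -
    have "entry W (2*r + 1, 1 + r) = 0" "entry W (2*r + 1, 1 + 2*r) = 0" using n by (auto intro!: entry_lower[OF W])
    thus ?thesis using lam_elem_left[OF W, of 1 "2*r + 1"] n r by (simp add: rowval_def)
  qed
  have el: "?e \<in> l (Suc 0)" by (rule l1I[OF eN e0])
  have e1: "lam ?e = 1" using lam_elem[of 1 "2*r + 1"] n r by (simp add: lambda_coeff_def)
  obtain t where t: "\<theta> (t * 1) \<noteq> 1" using exists_\<theta>[of 1] by auto
  let ?g = "1\<^sub>m n + t \<cdot>\<^sub>m ?e"
  have tN: "t \<cdot>\<^sub>m ?e \<in> N" by (rule N_closed(4)[OF eN])
  have g: "?g \<in> carrier G" using tN by (simp add: one_plus_def)
  \<comment> \<open>The first column of a strictly upper triangular matrix is zero.\<close>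
  have Xe: "X * ?e = 0\<^sub>m n n" if X: "X \<in> N" for X
  proof (rule mat_entry_eqI)
    show "X * ?e \<in> carrier_mat n n" "0\<^sub>m n n \<in> carrier_mat n n" using N_closed(6)[OF X eN] Nc by auto
    fix i k assume ik: "i \<in> {1..n}" "k \<in> {1..n}"
    have "entry (X * ?e) (i, k) = (\<Sum>j\<in>{1..n}. entry X (i, j) * entry ?e (j, k))"
      by (rule entry_mult[OF Nc[OF X] Nc[OF eN] ik])
    also have "\<dots> = 0"
    proof (rule sum.neutral, rule ballI)
      fix j assume j: "j \<in> {1..n}"
      show "entry X (i, j) * entry ?e (j, k) = 0"
        using entry_lower[OF X ik(1) j] entry_elem_mat[OF j ik(2), of 1 "2*r+1", where 'a = 'a] ik by (cases "j = 1") auto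
    qed
    also have "0 = entry (0\<^sub>m n n :: 'a mat) (i, k)"
    proof -
      have "i - 1 < n" "k - 1 < n" using ik by auto
      thus ?thesis by (simp add: entry_def)
    qed
    finally show "entry (X * ?e) (i, k) = entry (0\<^sub>m n n) (i, k)" .
  qed
  have conj: "x * ?g * inv\<^bsub>G\<^esub> x \<in> L \<and> theta_fun \<theta> n lam (x * ?g * inv\<^bsub>G\<^esub> x) = \<theta> t" if x: "x \<in> carrier G" for x
  proof -
    obtain X where X: "X \<in> N" "x = 1\<^sub>m n + X" using x by (auto simp: one_plus_def)
    obtain W where W: "W \<in> N" "inv\<^bsub>G\<^esub> x = 1\<^sub>m n + W" using G_inv(1)[OF x] by (auto simp: one_plus_def)
    have c: "X \<in> carrier_mat n n" "W \<in> carrier_mat n n" "?e \<in> carrier_mat n n" "inv\<^bsub>G\<^esub> x \<in> carrier_mat n n"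
      using X W eN Nc Gc[OF G_inv(1)[OF x]] by auto
    have "x * ?e = ?e" unfolding X(2) using c Xe[OF X(1)] by (simp add: dis)
    have f1: "x * (t \<cdot>\<^sub>m ?e) = t \<cdot>\<^sub>m (x * ?e)" by (rule mult_smult_distrib[OF Gc[OF x] c(3)])
    have f2: "(t \<cdot>\<^sub>m ?e) * inv\<^bsub>G\<^esub> x = t \<cdot>\<^sub>m (?e * inv\<^bsub>G\<^esub> x)" by (rule mult_smult_assoc_mat[OF c(3,4)])
    have "?e * (1\<^sub>m n + W) = ?e * 1\<^sub>m n + ?e * W" by (rule mult_add_distrib_mat[OF c(3) one_carrier_mat c(2)])
    hence f3: "?e * inv\<^bsub>G\<^esub> x = ?e + ?e * W" unfolding W(2) right_mult_one_mat[OF c(3)] .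
    have Z: "x * (t \<cdot>\<^sub>m ?e) * inv\<^bsub>G\<^esub> x = t \<cdot>\<^sub>m (?e + ?e * W)"
      unfolding f1 \<open>x * ?e = ?e\<close> f2 f3 ..
    have eW: "?e * W \<in> l (Suc 0)" by (rule l_right_ideal[OF el]) (use W in simp)
    have "?e + ?e * W \<in> l (Suc 0)" by (rule lin_closedD(3)[OF l_lin el eW])
    hence "t \<cdot>\<^sub>m (?e + ?e * W) \<in> l (Suc 0)" by (rule lin_closedD(4)[OF l_lin])
    hence tl: "t \<cdot>\<^sub>m (?e + ?e * W) \<in> lh" by (rule subsetD[OF hat_eqs(7)])
    moreover have "lam (t \<cdot>\<^sub>m (?e + ?e * W)) = t"
      using lam_smult[OF N_closed(2)[OF eN N_closed(6)[OF eN W(1)]], of t] lam_add[OF eN N_closed(6)[OF eN W(1)]] e0[OF W(1)] e1 by simp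
    moreover have "x * ?g * inv\<^bsub>G\<^esub> x = 1\<^sub>m n + t \<cdot>\<^sub>m (?e + ?e * W)" unfolding conj_one_plus[OF x tN] Z ..
    ultimately show ?thesis using theta_fun_one_plus[OF lhN[OF tl]] by (simp add: one_plus_def)
  qed
  obtain \<chi> where \<chi>: "\<chi> \<in> exts" using exts_nonempty by blast
  have "induced G S \<chi> ?g = (\<Sum>x\<in>carrier G. ext0 S \<chi> (x \<otimes>\<^bsub>G\<^esub> ?g \<otimes>\<^bsub>G\<^esub> inv\<^bsub>G\<^esub> x)) / of_nat (card S)"
    by (rule G.induced_altdef[OF finite_UT g])
  also have "(\<Sum>x\<in>carrier G. ext0 S \<chi> (x \<otimes>\<^bsub>G\<^esub> ?g \<otimes>\<^bsub>G\<^esub> inv\<^bsub>G\<^esub> x)) = (\<Sum>x\<in>carrier G. \<theta> t)"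
  proof (rule sum.cong[OF refl])
    fix x assume x: "x \<in> carrier G"
    have "x * ?g * inv\<^bsub>G\<^esub> x \<in> S" using conj[OF x] LS by blast
    thus "ext0 S \<chi> (x \<otimes>\<^bsub>G\<^esub> ?g \<otimes>\<^bsub>G\<^esub> inv\<^bsub>G\<^esub> x) = \<theta> t"
      using conj[OF x] extsD(2)[OF \<chi>, of "x * ?g * inv\<^bsub>G\<^esub> x"] unfolding UT_simps(1) ext0_def by simp
  qed
  also have "\<dots> / of_nat (card S) = of_nat (CARD('a) ^ (5 * r\<^sup>2 - 2 * r)) * \<theta> t"
    unfolding sum_constant card_G_S using cards_pos(1) by simp
  finally have val: "induced G S \<chi> ?g = of_nat (CARD('a) ^ (5 * r\<^sup>2 - 2 * r)) * \<theta> t" .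
  have "\<theta> t \<notin> \<real>"
  proof
    assume "\<theta> t \<in> \<real>"
    then obtain x where x: "\<theta> t = of_real x" by (auto elim: Reals_cases)
    hence "\<bar>x\<bar> = 1" using norm_theta[of t] by simp
    \<comment> \<open>Real of modulus 1 and different from 1. The value -1 contradicts
      \<open>theta_pow_p\<close>, as 1 < r < p makes the characteristic odd.\<close>
    hence "x = -1" using t x by (auto simp: abs_if split: if_splits)
    moreover have "odd CHAR('a)" using pr rp r by (intro prime_odd_nat) auto
    ultimately show False using theta_pow_p[of t] x by simp
  qed
  moreover have "\<theta> t = induced G S \<chi> ?g / of_nat (CARD('a) ^ (5 * r\<^sup>2 - 2 * r))" unfolding val by simp
  ultimately have "induced G S \<chi> ?g \<notin> \<real>" by (metis Reals_divide Reals_of_nat)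
  hence "induced G S \<chi> ?g \<notin> cyclotomic_field 1" using cyclotomic_field_1_real by blast
  thus ?thesis using exts_constituent[OF \<chi>] g unfolding xi_def by blast
qed

lemma kirillov_one: "kirillov \<theta> n lam (1\<^sub>m n) = of_nat (CARD('a) ^ (5 * r\<^sup>2 - 2 * r))"
  unfolding kirillov_induced by (rule induced_degree[of "theta_fun \<theta> n lam", OF theta_fun_one])

text \<open>\<open>theta_fun\<close> is equivariant of modulus 1, so the criterion of
  \<open>induced_character_iff\<close> applies, but it is not multiplicative on \<open>S\<close>:
  elements over 1 + u and 1 + c u^(r-1) have top coefficient 0, their product has top coefficient
  \<open>c\<close>.\<close>

lemma kirillov_not_character: "kirillov \<theta> n lam \<notin> characters G"
proof -
  have eq: "equivariant (theta_fun \<theta> n lam)"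
    unfolding equivariant_def
  proof (intro ballI)
    fix h l assume sl: "h \<in> S" "l \<in> L"
    obtain X where X: "X \<in> sh" "h = 1\<^sub>m n + X" using sl(1) by (auto simp: one_plus_def)
    obtain Y where Y: "Y \<in> lh" "l = 1\<^sub>m n + Y" using sl(2) by (auto simp: one_plus_def)
    have N: "X \<in> N" "Y \<in> N" "X + Y \<in> N" "X * Y \<in> N" "X + Y + X * Y \<in> N"
      using shN[OF X(1)] lhN[OF Y(1)] by (auto intro!: N_closed)
    have "h * l = 1\<^sub>m n + (X + Y + X * Y)" unfolding X(2) Y(2) by (rule one_plus_mult[OF Nc[OF N(1)] Nc[OF N(2)]])
    moreover have "lam (X + Y + X * Y) = lam X + lam Y"
      using lam_add[OF N(3,4)] lam_add[OF N(1,2)] hat_eqs(8)[OF X(1) Y(1)] by simp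
    ultimately show "theta_fun \<theta> n lam (h \<otimes>\<^bsub>G\<^esub> l) = theta_fun \<theta> n lam h * theta_fun \<theta> n lam l"
      using N by (simp add: X(2) Y(2) theta_fun_one_plus \<theta>_add)
  qed
  have "\<not> lin_char G S (theta_fun \<theta> n lam)"
  proof
    assume lin: "lin_char G S (theta_fun \<theta> n lam)"
    obtain c where c: "\<theta> (c * 1) \<noteq> 1" using exists_\<theta>[of 1] by auto
    obtain a where a: "a \<in> S" "agree r (Phi a) (1 + fps_X)" using exists_Phi[of "1 + fps_X"] by auto
    obtain b where b: "b \<in> S" "agree r (Phi b) (1 + fps_const c * fps_X ^ (r - 1))"
      using exists_Phi[of "1 + fps_const c * fps_X ^ (r - 1)"] r by (auto simp: fps_X_power_nth)
    have "agree r (Phi (a * b)) ((1 + fps_X) * (1 + fps_const c * fps_X ^ (r - 1)))"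
      by (rule agree_trans[OF Phi_mult(2)[OF a(1) b(1)] agree_mult[OF a(2) b(2)]])
    moreover have "(1 + fps_X) * (1 + fps_const c * fps_X ^ (r - 1)) =
        1 + fps_X + fps_const c * fps_X ^ (r - 1) + fps_const c * fps_X ^ r"
      using r power_Suc[of "fps_X :: 'a fps" "r - 1"] by (simp add: algebra_simps)
    ultimately have "fps_nth (Phi (a * b)) r = c" using r by (simp add: agree_def fps_X_power_nth fps_X_nth)
    moreover have "fps_nth (Phi a) r = 0" using agreeD[OF a(2), of r] r by (simp add: fps_X_nth)
    moreover have "fps_nth (Phi b) r = 0" using agreeD[OF b(2), of r] r by (simp add: fps_X_power_nth)
    moreover have "theta_fun \<theta> n lam (a * b) = theta_fun \<theta> n lam a * theta_fun \<theta> n lam b"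
      using lin a(1) b(1) by (simp add: lin_char_def)
    ultimately show False using c by (simp add: theta_fun_Phi a(1) b(1) Phi_mult(1))
  qed
  moreover have "norm (theta_fun \<theta> n lam h) = 1" if "h \<in> S" for h
    using theta_fun_Phi[OF that] norm_theta by simp
  ultimately show ?thesis
    unfolding kirillov_induced using induced_character_iff[OF eq] theta_fun_one by simp
qed

end

section \<open>The exponential Kirillov function\<close>

lemma depth_ge_lin:
  fixes X Y :: "'a::comm_ring_1 mat"
  shows "depth_ge n k X \<Longrightarrow> depth_ge n k Y \<Longrightarrow> depth_ge n k (X + Y)"
    and "depth_ge n k X \<Longrightarrow> depth_ge n k (c \<cdot>\<^sub>m X)"
  by (auto simp: depth_ge_def)

lemma telescope_mat:
  fixes A B X Y :: "'a::comm_ring_1 mat"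
  assumes "A \<in> carrier_mat n n" "B \<in> carrier_mat n n" "X \<in> carrier_mat n n" "Y \<in> carrier_mat n n"
  shows "A * X - B * Y = (A - B) * X + B * (X - Y)"
proof -
  have "(A - B) * X = A * X - B * X" by (rule minus_mult_distrib_mat[OF assms(1,2,3)])
  moreover have "B * (X - Y) = B * X - B * Y" by (rule mult_minus_distrib_mat[OF assms(2,3,4)])
  ultimately show ?thesis using assms by (intro eq_matI) auto
qed

lemma index_one_plus_smult:
  fixes A B :: "'a::comm_ring_1 mat"
  assumes "A \<in> carrier_mat n n" "B \<in> carrier_mat n n" "i < n" "j < n"
  shows "(1\<^sub>m n + (A + c \<cdot>\<^sub>m B)) $$ (i, j) = (1\<^sub>m n + A) $$ (i, j) + c * B $$ (i, j)"
  using assms by simp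

lemma conj_mult_mat:
  fixes g h P X :: "'a::comm_ring_1 mat"
  assumes c: "g \<in> carrier_mat n n" "h \<in> carrier_mat n n" "P \<in> carrier_mat n n" "X \<in> carrier_mat n n"
    and hg: "h * g = 1\<^sub>m n"
  shows "(g * P * h) * (g * X * h) = g * (P * X) * h"
proof -
  have "(g * P * h) * (g * X * h) = g * P * (h * g) * X * h" using c by (simp add: mat_assoc[where n = n])
  also have "\<dots> = g * (P * X) * h" unfolding hg using c by (simp add: mat_assoc[where n = n])
  finally show ?thesis .
qed

lemma conj_add_smult_mat:
  fixes g h P R :: "'a::comm_ring_1 mat"
  assumes c: "g \<in> carrier_mat n n" "h \<in> carrier_mat n n" "P \<in> carrier_mat n n" "R \<in> carrier_mat n n"
  shows "g * (R + a \<cdot>\<^sub>m P) * h = g * R * h + a \<cdot>\<^sub>m (g * P * h)"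
proof -
  have "g * (R + a \<cdot>\<^sub>m P) = g * R + g * (a \<cdot>\<^sub>m P)" using c by (intro mult_add_distrib_mat[of _ n n]) auto
  also have "g * (a \<cdot>\<^sub>m P) = a \<cdot>\<^sub>m (g * P)" by (rule mult_smult_distrib[OF c(1,3)])
  finally have "g * (R + a \<cdot>\<^sub>m P) * h = (g * R + a \<cdot>\<^sub>m (g * P)) * h" by simp
  also have "\<dots> = g * R * h + (a \<cdot>\<^sub>m (g * P)) * h" using c by (intro add_mult_distrib_mat[of _ n n]) auto
  also have "(a \<cdot>\<^sub>m (g * P)) * h = a \<cdot>\<^sub>m (g * P * h)" using c by (intro mult_smult_assoc_mat[of _ n n]) auto
  finally show ?thesis .
qed

lemma diff_add_smult_mat:
  fixes A B P Q X Y :: "'a::comm_ring_1 mat"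
  assumes "A \<in> carrier_mat n n" "B \<in> carrier_mat n n" "P \<in> carrier_mat n n" "Q \<in> carrier_mat n n"
    "X \<in> carrier_mat n n" "Y \<in> carrier_mat n n"
  shows "((A + a \<cdot>\<^sub>m P) - (B + a \<cdot>\<^sub>m Q)) - (X - Y) = ((A - B) - (X - Y)) + a \<cdot>\<^sub>m (P - Q)"
  using assms by (intro eq_matI) (auto simp: algebra_simps)

text \<open>With zero constant terms the coefficient of degree k+1 in a product involves only
  coefficients of the factors up to degree \<open>k\<close>, so one degree of agreement is
  gained.\<close>

lemma agree_mult_Suc:
  assumes "fps_nth A 0 = 0" "fps_nth B 0 = 0" "fps_nth F 0 = 0" "fps_nth H 0 = 0" "agree k A B" "agree k F H"
  shows "agree (Suc k) (A * F) (B * H)"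
  unfolding agree_def fps_mult_nth
proof (intro allI impI sum.cong refl)
  fix j i assume "j \<le> Suc k" "i \<in> {0..j}"
  then consider "i = 0" | "j - i = 0" | "i \<le> k" "j - i \<le> k" by fastforce
  thus "fps_nth A i * fps_nth F (j - i) = fps_nth B i * fps_nth H (j - i)"
    by cases (use assms in \<open>auto simp: agree_def\<close>)
qed

lemma fps_power_nth_zero: "fps_nth F 0 = 0 \<Longrightarrow> k < i \<Longrightarrow> fps_nth (F ^ i) k = 0" for F :: "'a::comm_ring_1 fps"
  using startsby_zero_power_prefix[of F i] by auto

lemma agree_power_Suc:
  assumes "fps_nth F 0 = 0" "fps_nth H 0 = 0" "agree k F H" "2 \<le> m"
  shows "agree (Suc k) (F ^ m) (H ^ m)"
proof -
  obtain j where m: "m = Suc (Suc j)" using assms(4) by (cases m; cases "m - 1") auto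
  show ?thesis unfolding m power_Suc2[of _ "Suc j"]
    using assms by (intro agree_mult_Suc agree_power fps_power_nth_zero) auto
qed

lemma fps_power_prod_nth_zero:
  fixes F H :: "'a::comm_ring_1 fps"
  assumes "fps_nth F 0 = 0" "fps_nth H 0 = 0" "k < i + j"
  shows "fps_nth (F ^ i * H ^ j) k = 0"
  unfolding fps_mult_nth
proof (rule sum.neutral, rule ballI)
  fix a assume "a \<in> {0..k}"
  hence "a < i \<or> k - a < j" using assms(3) by auto
  thus "fps_nth (F ^ i) a * fps_nth (H ^ j) (k - a) = 0" using fps_power_nth_zero[OF assms(1)] fps_power_nth_zero[OF assms(2)] by auto
qed

lemma reciprocal_mult: "a * b * d = c \<Longrightarrow> a \<noteq> 0 \<Longrightarrow> b \<noteq> 0 \<Longrightarrow> c \<noteq> 0 \<Longrightarrow> 1 / a * (1 / b) = 1 / c * d"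
  for a b c d :: "'a::field"
  by (auto simp: field_simps)

section \<open>The truncated exponential on power series\<close>

definition inv_fact :: "nat \<Rightarrow> 'a::field fps" where
  "inv_fact k = fps_const (1 / of_nat (fact k))"

definition ex :: "'a::field fps \<Rightarrow> 'a fps" where
  "ex F = (\<Sum>k<CHAR('a). inv_fact k * F ^ k)"

lemma inv_fact_simps [simp]: "inv_fact 0 = 1" "inv_fact (Suc 0) = 1"
  by (simp_all add: inv_fact_def)

context
  fixes dummy :: "'a::{field,finite} itself"
begin

lemma CHAR_ge_2: "CHAR('a) \<ge> 2"
  by (rule prime_ge_2_nat[OF CHAR_finite_prime])

lemma fact_nonzero: "k < CHAR('a) \<Longrightarrow> of_nat (fact k) \<noteq> (0 :: 'a)"
  using prime_dvd_fact_iff[OF CHAR_finite_prime[where 'a = 'a], of k] by (simp add: of_nat_eq_0_iff_char_dvd)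

lemma ex_altdef: "ex F = 1 + F + (\<Sum>k\<in>{2..<CHAR('a)}. inv_fact k * F ^ k)" for F :: "'a fps"
proof -
  have "{..<CHAR('a)} = insert 0 (insert 1 {2..<CHAR('a)})" using CHAR_ge_2 by auto
  thus ?thesis by (simp add: ex_def)
qed

lemma ex_nth_0: "fps_nth F 0 = 0 \<Longrightarrow> fps_nth (ex F) 0 = 1" for F :: "'a fps"
  by (simp add: ex_altdef fps_sum_nth fps_power_nth_zero)

lemma ex_nth_1: "fps_nth F 0 = 0 \<Longrightarrow> fps_nth (ex F) 1 = fps_nth F 1" for F :: "'a fps"
  by (simp add: ex_altdef fps_sum_nth inv_fact_def fps_power_nth_zero)

lemma ex_zero: "ex (0 :: 'a fps) = 1"
  by (simp add: ex_altdef power_0_left)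

text \<open>Coefficient by coefficient: powers of exponent at least 2 see only lower coefficients,
  by \<open>agree_power_Suc\<close>, so each new coefficient of \<open>ex F\<close> determines that
  of \<open>F\<close>.\<close>

lemma ex_agree_inj:
  fixes F H :: "'a fps"
  assumes F: "fps_nth F 0 = 0" and H: "fps_nth H 0 = 0" and eq: "agree m (ex F) (ex H)"
  shows "agree m F H"
proof -
  have "agree k F H" if "k \<le> m" for k
    using that
  proof (induction k)
    case 0
    thus ?case using F H by (simp add: agree_def)
  next
    case (Suc k)
    have A: "agree (Suc k) (\<Sum>i\<in>{2..<CHAR('a)}. inv_fact i * F ^ i) (\<Sum>i\<in>{2..<CHAR('a)}. inv_fact i * H ^ i)"
      using Suc by (intro agree_sum agree_mult agree_refl agree_power_Suc F H) auto
    have "fps_nth (ex F) (Suc k) = fps_nth (ex H) (Suc k)" by (rule agreeD[OF eq Suc.prems])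
    hence "fps_nth F (Suc k) = fps_nth H (Suc k)" using agreeD[OF A order_refl] unfolding ex_altdef by simp
    thus ?case using Suc by (auto simp: agree_def le_Suc_eq)
  qed
  thus ?thesis by blast
qed

text \<open>A change in degree \<open>m\<close> is seen modulo u^(m+1) by the linear term alone, not
  by powers of exponent at least 2.\<close>

lemma ex_top:
  fixes F :: "'a fps"
  assumes F: "fps_nth F 0 = 0" and m: "0 < m"
  shows "agree m (ex (F + fps_const y * fps_X ^ m)) (ex F + fps_const y * fps_X ^ m)"
proof -
  let ?Y = "fps_const y * fps_X ^ m :: 'a fps"
  obtain k where k: "m = Suc k" using m by (cases m) auto
  have low: "agree k (F + ?Y) F" unfolding agree_def k by (auto simp: fps_X_power_nth)
  have "fps_nth (F + ?Y) 0 = 0" using F m by (simp add: fps_X_power_nth)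
  hence A: "agree m (\<Sum>i\<in>{2..<CHAR('a)}. inv_fact i * (F + ?Y) ^ i) (\<Sum>i\<in>{2..<CHAR('a)}. inv_fact i * F ^ i)"
    unfolding k using F low[unfolded k] by (intro agree_sum agree_mult agree_refl agree_power_Suc) (auto simp: k)
  have "agree m (1 + (F + ?Y) + (\<Sum>i\<in>{2..<CHAR('a)}. inv_fact i * (F + ?Y) ^ i)) (1 + (F + ?Y) + (\<Sum>i\<in>{2..<CHAR('a)}. inv_fact i * F ^ i))"
    by (rule agree_add[OF agree_refl A])
  moreover have "1 + (F + ?Y) + (\<Sum>i\<in>{2..<CHAR('a)}. inv_fact i * F ^ i) = ex F + ?Y" by (simp add: ex_altdef)
  ultimately show ?thesis by (simp add: ex_altdef)
qed

lemma mult_top: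
  fixes F :: "'a fps"
  assumes "fps_nth F 0 = 1"
  shows "agree m (F * (1 + fps_const y * fps_X ^ m)) (F + fps_const y * fps_X ^ m)"
proof -
  have "F * (1 + fps_const y * fps_X ^ m) = F + fps_const y * (F * fps_X ^ m)" by (simp add: algebra_simps)
  moreover have "agree m (fps_const y * (F * fps_X ^ m)) (fps_const y * fps_X ^ m)"
    using assms by (auto simp: agree_def fps_X_power_mult_right_nth fps_X_power_nth)
  ultimately show ?thesis using agree_add[OF agree_refl[of m F]] by simp
qed

text \<open>The terms with i + j < p give \<open>ex (F + H)\<close> by the binomial theorem, the
  factorials up to p-1 being invertible. The remaining sum is the obstruction to a homomorphism; for
  series without constant term it starts in degree p or later.\<close>

lemma ex_add:
  fixes F H :: "'a fps"
  shows "ex F * ex H = ex (F + H) +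
    (\<Sum>(i, j)\<in>{(i, j). i < CHAR('a) \<and> j < CHAR('a) \<and> CHAR('a) \<le> i + j}. inv_fact i * inv_fact j * (F ^ i * H ^ j))"
proof -
  let ?g = "\<lambda>i j. inv_fact i * inv_fact j * (F ^ i * H ^ j)"
  let ?lo = "{(i, j). i + j < CHAR('a)}"
  let ?hi = "{(i, j). i < CHAR('a) \<and> j < CHAR('a) \<and> CHAR('a) \<le> i + j}"
  have "ex F * ex H = (\<Sum>i<CHAR('a). \<Sum>j<CHAR('a). ?g i j)"
    unfolding ex_def sum_product by (intro sum.cong refl) (simp add: mult_ac)
  also have "\<dots> = (\<Sum>(i, j)\<in>{..<CHAR('a)} \<times> {..<CHAR('a)}. ?g i j)" by (rule sum.cartesian_product)
  also have "{..<CHAR('a)} \<times> {..<CHAR('a)} = ?lo \<union> ?hi" by auto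
  also have "(\<Sum>(i, j)\<in>?lo \<union> ?hi. ?g i j) = (\<Sum>(i, j)\<in>?lo. ?g i j) + (\<Sum>(i, j)\<in>?hi. ?g i j)"
  proof (rule sum.union_disjoint)
    show "finite ?lo" by (rule finite_subset[of _ "{..<CHAR('a)} \<times> {..<CHAR('a)}"]) auto
    show "finite ?hi" by (rule finite_subset[of _ "{..<CHAR('a)} \<times> {..<CHAR('a)}"]) auto
  qed auto
  also have "(\<Sum>(i, j)\<in>?lo. ?g i j) = (\<Sum>k<CHAR('a). \<Sum>i\<le>k. ?g i (k - i))" by (rule sum.triangle_reindex)
  also have "\<dots> = ex (F + H)"
    unfolding ex_def
  proof (rule sum.cong[OF refl])
    fix k assume "k \<in> {..<CHAR('a)}"
    hence k: "k < CHAR('a)" by simp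
    have coef: "inv_fact i * inv_fact (k - i) = (inv_fact k * of_nat (k choose i) :: 'a fps)" if "i \<le> k" for i :: nat
    proof -
      have "of_nat (fact i * fact (k - i) * (k choose i)) = (of_nat (fact k) :: 'a)"
        unfolding binomial_fact_lemma[OF that] ..
      hence "of_nat (fact i) * of_nat (fact (k - i)) * of_nat (k choose i) = (of_nat (fact k) :: 'a)"
        by (simp only: of_nat_mult)
      moreover have "of_nat (fact i) \<noteq> (0::'a)" "of_nat (fact (k - i)) \<noteq> (0::'a)" "of_nat (fact k) \<noteq> (0::'a)"
        using k that by (intro fact_nonzero; simp)+
      ultimately have "1 / of_nat (fact i) * (1 / of_nat (fact (k - i))) = 1 / of_nat (fact k) * (of_nat (k choose i) :: 'a)"
        by (rule reciprocal_mult)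
      hence "fps_const (1 / of_nat (fact i) * (1 / of_nat (fact (k - i)))) = fps_const (1 / of_nat (fact k) * (of_nat (k choose i) :: 'a))"
        by (rule arg_cong)
      thus ?thesis unfolding fps_const_mult[symmetric] fps_of_nat inv_fact_def .
    qed
    have "inv_fact k * (F + H) ^ k = (\<Sum>i\<le>k. inv_fact k * (of_nat (k choose i) * F ^ i * H ^ (k - i)))"
      by (simp add: binomial_ring sum_distrib_left)
    also have "\<dots> = (\<Sum>i\<le>k. ?g i (k - i))"
      by (rule sum.cong[OF refl]) (simp add: coef mult_ac)
    finally show "(\<Sum>i\<le>k. ?g i (k - i)) = inv_fact k * (F + H) ^ k" by simp
  qed
  finally show ?thesis .
qed

end

section \<open>The truncated exponential on matrices\<close>

context ut_form begin

text \<open>The exponential series without its constant term, cut off after degree \<open>m\<close>;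
  in this recursive form its values visibly stay in a subalgebra.\<close>

fun exp_rest :: "nat \<Rightarrow> 'a mat \<Rightarrow> 'a mat" where
  "exp_rest 0 X = 0\<^sub>m n n"
| "exp_rest (Suc m) X = exp_rest m X + (1 / of_nat (fact (Suc m))) \<cdot>\<^sub>m (X ^\<^sub>m Suc m)"

definition mult_closed :: "'a mat set \<Rightarrow> bool" where
  "mult_closed V \<longleftrightarrow> (\<forall>X\<in>V. \<forall>Y\<in>V. X * Y \<in> V)"

lemma N_mult_closed: "mult_closed N" and sh_mult_closed: "mult_closed sh"
  using N_closed(6) hat_eqs(3) unfolding mult_closed_def by blast+

lemma pow_closed:
  assumes V: "lin_closed V" and mult: "mult_closed V" and X: "X \<in> V"
  shows "X ^\<^sub>m Suc k \<in> V"
proof (induction k)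
  case 0
  have "X \<in> carrier_mat n n" using lin_closedD(1)[OF V] X Nc by blast
  thus ?case using X by simp
next
  case (Suc k)
  have "X ^\<^sub>m Suc k * X \<in> V" using mult Suc X unfolding mult_closed_def by blast
  thus ?case by simp
qed

lemma exp_rest_closed:
  assumes V: "lin_closed V" and mult: "mult_closed V" and X: "X \<in> V"
  shows "exp_rest m X \<in> V"
proof (induction m)
  case 0
  show ?case using lin_closedD(2)[OF V] by simp
next
  case (Suc m)
  show ?case unfolding exp_rest.simps
    by (rule lin_closedD(3)[OF V Suc lin_closedD(4)[OF V pow_closed[OF V mult X]]])
qed

lemma exp_rest_N: "X \<in> N \<Longrightarrow> exp_rest m X \<in> N"
  by (rule exp_rest_closed[OF lin_closed_N N_mult_closed])

lemma trunc_exp_rest: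
  assumes X: "X \<in> N"
  shows "trunc_exp n X = 1\<^sub>m n + exp_rest (CHAR('a) - 1) X"
proof -
  have Xc: "X \<in> carrier_mat n n" by (rule Nc[OF X])
  have "mat n n (\<lambda>(i, j). \<Sum>k<Suc m. (X ^\<^sub>m k) $$ (i, j) / of_nat (fact k)) = 1\<^sub>m n + exp_rest m X" for m
  proof (induction m)
    case 0
    show ?case using Xc by (intro eq_matI) auto
  next
    case (Suc m)
    have c: "exp_rest m X \<in> carrier_mat n n" by (rule Nc[OF exp_rest_N[OF X]])
    have d: "X ^\<^sub>m Suc m \<in> carrier_mat n n" by (rule pow_carrier_mat[OF Xc])
    show ?case
    proof (rule eq_matI)
      fix i j assume "i < dim_row (1\<^sub>m n + exp_rest (Suc m) X)" "j < dim_col (1\<^sub>m n + exp_rest (Suc m) X)"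
      hence ij: "i < n" "j < n" using c d by (auto simp del: pow_mat.simps)
      have A: "(\<Sum>k<Suc m. (X ^\<^sub>m k) $$ (i, j) / of_nat (fact k)) = (1\<^sub>m n + exp_rest m X) $$ (i, j)"
        using arg_cong[OF Suc, of "\<lambda>A. A $$ (i, j)"] ij by (simp del: sum.lessThan_Suc pow_mat.simps)
      have B: "(1\<^sub>m n + exp_rest (Suc m) X) $$ (i, j) =
          (1\<^sub>m n + exp_rest m X) $$ (i, j) + (X ^\<^sub>m Suc m) $$ (i, j) / of_nat (fact (Suc m))"
        unfolding exp_rest.simps index_one_plus_smult[OF c d ij] by (simp del: pow_mat.simps fact_Suc)
      have "mat n n (\<lambda>(i, j). \<Sum>k<Suc (Suc m). (X ^\<^sub>m k) $$ (i, j) / of_nat (fact k)) $$ (i, j) =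
          (\<Sum>k<Suc (Suc m). (X ^\<^sub>m k) $$ (i, j) / of_nat (fact k))"
        using ij by (simp del: sum.lessThan_Suc pow_mat.simps fact_Suc)
      also have "\<dots> = (\<Sum>k<Suc m. (X ^\<^sub>m k) $$ (i, j) / of_nat (fact k)) + (X ^\<^sub>m Suc m) $$ (i, j) / of_nat (fact (Suc m))"
        by (rule sum.lessThan_Suc)
      also have "\<dots> = (1\<^sub>m n + exp_rest (Suc m) X) $$ (i, j)" unfolding A B ..
      finally show "mat n n (\<lambda>(i, j). \<Sum>k<Suc (Suc m). (X ^\<^sub>m k) $$ (i, j) / of_nat (fact k)) $$ (i, j) =
          (1\<^sub>m n + exp_rest (Suc m) X) $$ (i, j)" .
    qed (use c d in \<open>auto simp del: pow_mat.simps\<close>)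
  qed
  from this[of "CHAR('a) - 1"] show ?thesis
    using CHAR_ge_2[where 'a = 'a] by (simp add: trunc_exp_def del: sum.lessThan_Suc)
qed

lemma exp_rest_conj:
  assumes g: "g \<in> carrier G" and X: "X \<in> N"
  shows "exp_rest m (g * X * inv\<^bsub>G\<^esub> g) = g * exp_rest m X * inv\<^bsub>G\<^esub> g"
proof -
  let ?h = "inv\<^bsub>G\<^esub> g"
  have c: "g \<in> carrier_mat n n" "?h \<in> carrier_mat n n" "X \<in> carrier_mat n n"
    using Gc[OF g] Gc[OF G_inv(1)[OF g]] Nc[OF X] by auto
  have pc: "X ^\<^sub>m k \<in> carrier_mat n n" for k by (rule pow_carrier_mat[OF c(3)])
  have pow: "(g * X * ?h) ^\<^sub>m k = g * X ^\<^sub>m k * ?h" for k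
  proof (induction k)
    case 0
    show ?case using c G_inv(2)[OF g] by simp
  next
    case (Suc k)
    show ?case unfolding pow_mat.simps(2) Suc by (rule conj_mult_mat[OF c(1,2) pc c(3) G_inv(3)[OF g]])
  qed
  show ?thesis
  proof (induction m)
    case 0
    show ?case using c by simp
  next
    case (Suc m)
    have r: "exp_rest m X \<in> carrier_mat n n" by (rule Nc[OF exp_rest_N[OF X]])
    show ?case unfolding exp_rest.simps pow Suc by (rule conj_add_smult_mat[OF c(1,2) pc r, symmetric])
  qed
qed

text \<open>If \<open>X - Y\<close> has depth \<open>k\<close>, the differences of higher powers
  have depth k+1 by telescoping, so the difference of the exponentials is \<open>X - Y\<close> up to
  depth k+1. Equal exponentials thus push the depth of \<open>X - Y\<close> up until it is
  zero.\<close>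

lemma exp_rest_inj:
  assumes X: "X \<in> N" and Y: "Y \<in> N" and eq: "exp_rest (Suc m) X = exp_rest (Suc m) Y"
  shows "X = Y"
proof -
  have c: "X \<in> carrier_mat n n" "Y \<in> carrier_mat n n" using Nc[OF X] Nc[OF Y] by auto
  have pc: "X ^\<^sub>m k \<in> carrier_mat n n" "Y ^\<^sub>m k \<in> carrier_mat n n" for k
    by (rule pow_carrier_mat[OF c(1)], rule pow_carrier_mat[OF c(2)])
  have pN: "Z ^\<^sub>m Suc k \<in> N" if "Z \<in> N" for Z k by (rule pow_closed[OF lin_closed_N N_mult_closed that])
  have rc: "exp_rest k X \<in> carrier_mat n n" "exp_rest k Y \<in> carrier_mat n n" for k
    by (rule Nc[OF exp_rest_N[OF X]], rule Nc[OF exp_rest_N[OF Y]])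
  have step: "depth_ge n (Suc k) (X - Y)" if D: "depth_ge n k (X - Y)" for k
  proof -
    have pow1: "depth_ge n (Suc k) (X ^\<^sub>m Suc (Suc j) - Y ^\<^sub>m Suc (Suc j))"
      if "depth_ge n k (X ^\<^sub>m Suc j - Y ^\<^sub>m Suc j)" for j
    proof -
      have "X ^\<^sub>m Suc (Suc j) - Y ^\<^sub>m Suc (Suc j) = (X ^\<^sub>m Suc j - Y ^\<^sub>m Suc j) * X + Y ^\<^sub>m Suc j * (X - Y)"
        unfolding pow_mat.simps(2)[of _ "Suc j"] by (rule telescope_mat[OF pc c])
      moreover have "depth_ge n (k + 1) ((X ^\<^sub>m Suc j - Y ^\<^sub>m Suc j) * X)"
        using X by (intro depth_ge_mult[OF that]) (simp add: strict_upper_depth)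
      moreover have "depth_ge n (1 + k) (Y ^\<^sub>m Suc j * (X - Y))"
        using pN[OF Y, of j] unfolding strict_upper_depth by (rule depth_ge_mult[OF _ D])
      ultimately show ?thesis by (simp add: depth_ge_lin del: pow_mat.simps)
    qed
    have pow: "depth_ge n k (X ^\<^sub>m Suc j - Y ^\<^sub>m Suc j)" for j
    proof (induction j)
      case 0
      show ?case using D c by simp
    next
      case (Suc j)
      show ?case by (rule depth_ge_mono[OF pow1[OF Suc]]) simp
    qed
    have "depth_ge n (Suc k) ((exp_rest (Suc j) X - exp_rest (Suc j) Y) - (X - Y))" for j
    proof (induction j)
      case 0
      have "exp_rest (Suc 0) Z = Z" if "Z \<in> carrier_mat n n" for Z
        using that by (intro eq_matI) auto
      hence "(exp_rest (Suc 0) X - exp_rest (Suc 0) Y) - (X - Y) = (X - Y) - (X - Y)" using c by (simp only:)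
      also have "\<dots> = 0\<^sub>m n n" using c by (intro eq_matI) auto
      finally have z: "(exp_rest (Suc 0) X - exp_rest (Suc 0) Y) - (X - Y) = 0\<^sub>m n n" .
      show ?case unfolding z by (simp add: depth_ge_def)
    next
      case (Suc j)
      show ?case
        unfolding exp_rest.simps(2)[of "Suc j"] diff_add_smult_mat[OF rc pc c]
        by (rule depth_ge_lin(1)[OF Suc depth_ge_lin(2)[OF pow1[OF pow]]])
    qed
    from this[of m] have "depth_ge n (Suc k) ((-1) \<cdot>\<^sub>m (0\<^sub>m n n - (X - Y)))"
      unfolding eq using rc(2)[of "Suc m"] by (intro depth_ge_lin(2)) (simp del: exp_rest.simps)
    moreover have "(-1) \<cdot>\<^sub>m (0\<^sub>m n n - (X - Y)) = X - Y" using c by (intro eq_matI) auto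
    ultimately show ?thesis by simp
  qed
  have "depth_ge n k (X - Y)" for k
  proof (induction k)
    case 0
    have "depth_ge n 1 (X - Y)" using N_closed(3)[OF X Y] by (simp only: strict_upper_depth)
    thus ?case by (rule depth_ge_mono) simp
  qed (rule step)
  hence "X - Y = 0\<^sub>m n n" using depth_ge_large by blast
  hence "(X - Y) $$ (i, j) = 0" if "i < n" "j < n" for i j using that by simp
  thus ?thesis using c by (intro eq_matI) auto
qed

lemma trunc_exp_inj: "inj_on (trunc_exp n) N"
proof (rule inj_onI)
  fix X Y assume XY: "X \<in> N" "Y \<in> N" and "trunc_exp n X = trunc_exp n Y"
  hence "1\<^sub>m n + exp_rest (CHAR('a) - 1) X - 1\<^sub>m n = 1\<^sub>m n + exp_rest (CHAR('a) - 1) Y - 1\<^sub>m n"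
    by (simp add: trunc_exp_rest)
  hence "exp_rest (CHAR('a) - 1) X = exp_rest (CHAR('a) - 1) Y"
    by (simp only: one_plus_minus[OF Nc[OF exp_rest_N[OF XY(1)]]] one_plus_minus[OF Nc[OF exp_rest_N[OF XY(2)]]])
  moreover have "CHAR('a) - 1 = Suc (CHAR('a) - 2)" using CHAR_ge_2[where 'a = 'a] by simp
  ultimately show "X = Y" using exp_rest_inj[OF XY, of "CHAR('a) - 2"] by (simp only:)
qed

text \<open>Surjectivity by counting: an injective map of \<open>V\<close> into a set of the same
  finite cardinality.\<close>

lemma trunc_exp_image:
  assumes V: "lin_closed V" and mult: "mult_closed V"
  shows "trunc_exp n ` V = one_plus n V"
proof (rule card_subset_eq)
  have VN: "V \<subseteq> N" by (rule lin_closedD(1)[OF V])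
  show "finite (one_plus n V)" unfolding one_plus_def using finite_subset[OF VN finite_strict_upper] by simp
  show "trunc_exp n ` V \<subseteq> one_plus n V"
  proof (rule image_subsetI)
    fix X assume X: "X \<in> V"
    have "trunc_exp n X = 1\<^sub>m n + exp_rest (CHAR('a) - 1) X" by (rule trunc_exp_rest) (use X VN in blast)
    thus "trunc_exp n X \<in> one_plus n V" unfolding one_plus_def using exp_rest_closed[OF V mult X] by blast
  qed
  show "card (trunc_exp n ` V) = card (one_plus n V)"
    unfolding card_one_plus[OF VN] by (rule card_image[OF inj_on_subset[OF trunc_exp_inj VN]])
qed

abbreviation "log_UT \<equiv> the_inv_into N (trunc_exp n)"

lemma log_trunc_exp: "X \<in> N \<Longrightarrow> log_UT (trunc_exp n X) = X"
  by (rule the_inv_into_f_f[OF trunc_exp_inj])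

lemma S_image: "trunc_exp n ` sh = S_hat n lam"
  by (rule trunc_exp_image[OF hat_eqs(1) sh_mult_closed])

lemma trunc_exp_S_iff:
  assumes X: "X \<in> N"
  shows "trunc_exp n X \<in> S_hat n lam \<longleftrightarrow> X \<in> sh"
proof
  assume "trunc_exp n X \<in> S_hat n lam"
  hence "trunc_exp n X \<in> trunc_exp n ` sh" unfolding S_image .
  then obtain Y where Y: "trunc_exp n X = trunc_exp n Y" "Y \<in> sh" by (rule imageE)
  have "X = Y" by (rule inj_onD[OF trunc_exp_inj Y(1) X shN[OF Y(2)]])
  thus "X \<in> sh" using Y(2) by simp
next
  assume "X \<in> sh"
  thus "trunc_exp n X \<in> S_hat n lam" unfolding S_image[symmetric] by (rule imageI)
qed

end

context ut_lambda begin

definition exp_theta :: "'a mat \<Rightarrow> complex" where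
  "exp_theta h = \<theta> (lam (log_UT h))"

text \<open>\<open>trunc_exp\<close> commutes with conjugation and takes \<open>sh\<close> exactly
  onto \<open>S\<close>, so \<open>kirillov_induced\<close> is transported term by term.\<close>

lemma exp_kirillov_induced: "exp_kirillov \<theta> n lam = induced G S exp_theta"
proof
  fix g
  show "exp_kirillov \<theta> n lam g = induced G S exp_theta g"
  proof (cases "g \<in> carrier G")
    case g: True
    have "trunc_exp n ` N = carrier G"
      unfolding UT_simps by (rule trunc_exp_image[OF lin_closed_N N_mult_closed])
    hence "g \<in> trunc_exp n ` N" using g by (simp only:)
    then obtain X where X: "X \<in> N" "g = trunc_exp n X" by blast
    have gX: "1\<^sub>m n + X \<in> carrier G" using X(1) by (simp add: one_plus_def)
    have "exp_kirillov \<theta> n lam g = induced G S (theta_fun \<theta> n lam) (1\<^sub>m n + X)"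
      using g unfolding exp_kirillov_def kirillov_induced by (simp add: X log_trunc_exp)
    also have "\<dots> = (\<Sum>x\<in>carrier G. ext0 S (theta_fun \<theta> n lam) (x \<otimes>\<^bsub>G\<^esub> (1\<^sub>m n + X) \<otimes>\<^bsub>G\<^esub> inv\<^bsub>G\<^esub> x)) / of_nat (card S)"
      by (rule G.induced_altdef[OF finite_UT gX])
    also have "(\<Sum>x\<in>carrier G. ext0 S (theta_fun \<theta> n lam) (x \<otimes>\<^bsub>G\<^esub> (1\<^sub>m n + X) \<otimes>\<^bsub>G\<^esub> inv\<^bsub>G\<^esub> x)) =
        (\<Sum>x\<in>carrier G. ext0 S exp_theta (x \<otimes>\<^bsub>G\<^esub> g \<otimes>\<^bsub>G\<^esub> inv\<^bsub>G\<^esub> x))"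
    proof (rule sum.cong[OF refl])
      fix x assume x: "x \<in> carrier G"
      define Y where "Y = x * X * inv\<^bsub>G\<^esub> x"
      have Y: "Y \<in> N" unfolding Y_def by (rule conj_N[OF x X(1)])
      have 1: "x * (1\<^sub>m n + X) * inv\<^bsub>G\<^esub> x = 1\<^sub>m n + Y" unfolding Y_def by (rule conj_one_plus[OF x X(1)])
      have 2: "x * g * inv\<^bsub>G\<^esub> x = trunc_exp n Y"
        unfolding X(2) trunc_exp_rest[OF X(1)] trunc_exp_rest[OF Y] conj_one_plus[OF x exp_rest_N[OF X(1)]]
        unfolding Y_def exp_rest_conj[OF x X(1)] ..
      have "1\<^sub>m n + Y \<in> S \<longleftrightarrow> Y \<in> sh"
        unfolding S_hat_iff using Nc[OF Y] by (simp add: one_plus_minus)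
      thus "ext0 S (theta_fun \<theta> n lam) (x \<otimes>\<^bsub>G\<^esub> (1\<^sub>m n + X) \<otimes>\<^bsub>G\<^esub> inv\<^bsub>G\<^esub> x) = ext0 S exp_theta (x \<otimes>\<^bsub>G\<^esub> g \<otimes>\<^bsub>G\<^esub> inv\<^bsub>G\<^esub> x)"
        unfolding UT_simps(1) 1 2 ext0_def trunc_exp_S_iff[OF Y] exp_theta_def log_trunc_exp[OF Y] theta_fun_one_plus[OF Y] by simp
    qed
    also have "(\<Sum>x\<in>carrier G. ext0 S exp_theta (x \<otimes>\<^bsub>G\<^esub> g \<otimes>\<^bsub>G\<^esub> inv\<^bsub>G\<^esub> x)) / of_nat (card S) = induced G S exp_theta g"
      by (rule G.induced_altdef[OF finite_UT g, symmetric])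
    finally show ?thesis .
  qed (auto simp: exp_kirillov_def induced_def)
qed

lemma phi_pow:
  assumes X: "X \<in> sh"
  shows "agree r (phi (X ^\<^sub>m Suc k)) (phi X ^ Suc k)"
proof (induction k)
  case 0
  show ?case using Nc[OF shN[OF X]] by simp
next
  case (Suc k)
  have P: "X ^\<^sub>m Suc k \<in> sh" by (rule pow_closed[OF hat_eqs(1) sh_mult_closed X])
  have "agree r (phi (X ^\<^sub>m Suc k * X)) (phi X ^ Suc k * phi X)"
    by (rule agree_trans[OF phi_mult[OF P X] agree_mult[OF Suc agree_refl]])
  thus ?case by (simp add: mult_ac)
qed

lemma Phi_trunc_exp:
  assumes X: "X \<in> sh"
  shows "agree r (Phi (trunc_exp n X)) (ex (phi X))"
proof -
  have XN: "X \<in> N" by (rule shN[OF X])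
  have rest: "agree r (phi (exp_rest m X)) (\<Sum>k\<in>{1..m}. inv_fact k * phi X ^ k)" for m
  proof (induction m)
    case 0
    have "phi (0\<^sub>m n n) = 0" using phi_smult[OF N_closed(1), of 0] by simp
    thus ?case by simp
  next
    case (Suc m)
    have pN: "X ^\<^sub>m Suc m \<in> N" by (rule pow_closed[OF lin_closed_N N_mult_closed XN])
    have "phi (exp_rest (Suc m) X) = phi (exp_rest m X) + inv_fact (Suc m) * phi (X ^\<^sub>m Suc m)"
      unfolding exp_rest.simps phi_add[OF exp_rest_N[OF XN] N_closed(4)[OF pN]] phi_smult[OF pN] inv_fact_def ..
    moreover have "agree r \<dots> ((\<Sum>k\<in>{1..m}. inv_fact k * phi X ^ k) + inv_fact (Suc m) * phi X ^ Suc m)"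
      by (rule agree_add[OF Suc agree_mult[OF agree_refl phi_pow[OF X]]])
    ultimately show ?case by simp
  qed
  have "{..<CHAR('a)} = insert 0 {1..CHAR('a) - 1}" using CHAR_ge_2[where 'a = 'a] by auto
  hence "ex (phi X) = 1 + (\<Sum>k\<in>{1..CHAR('a) - 1}. inv_fact k * phi X ^ k)" by (simp add: ex_def)
  moreover have "Phi (trunc_exp n X) = 1 + phi (exp_rest (CHAR('a) - 1) X)"
    unfolding trunc_exp_rest[OF XN] by (rule SI(2)[OF exp_rest_closed[OF hat_eqs(1) sh_mult_closed X]])
  ultimately show ?thesis using agree_add[OF agree_refl rest] by simp
qed

text \<open>As \<open>ex\<close> is injective modulo u^(r+1), any \<open>F\<close> whose exponential
  matches \<open>Phi h\<close> serves as a logarithm of \<open>h\<close>.\<close>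

lemma exp_theta_eq:
  assumes h: "h \<in> S" "agree r (Phi h) (ex F)" and F: "fps_nth F 0 = 0"
  shows "exp_theta h = \<theta> (fps_nth F r)"
proof -
  have "h \<in> trunc_exp n ` sh" using h(1) unfolding S_image .
  then obtain X where X: "X \<in> sh" "h = trunc_exp n X" by blast
  have "agree r (ex (phi X)) (ex F)"
    using agree_trans[OF agree_sym[OF Phi_trunc_exp[OF X(1)]]] h(2) unfolding X(2) by blast
  hence "agree r (phi X) F" by (rule ex_agree_inj[OF phi_nth(1) F])
  hence "lam X = fps_nth F r" using agreeD[of r "phi X" F r] phi_nth(3) by simp
  thus ?thesis unfolding exp_theta_def X(2) log_trunc_exp[OF shN[OF X(1)]] by simp
qed

lemma exists_ex:
  assumes "h \<in> S"
  shows "\<exists>F. fps_nth F 0 = 0 \<and> agree r (Phi h) (ex F)"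
proof -
  have "h \<in> trunc_exp n ` sh" using assms unfolding S_image .
  then obtain X where X: "X \<in> sh" "h = trunc_exp n X" by blast
  show ?thesis unfolding X(2) using Phi_trunc_exp[OF X(1)] phi_nth(1) by blast
qed

lemma exists_S:
  assumes "fps_nth F 0 = 0"
  shows "\<exists>h\<in>S. agree r (Phi h) (ex F)"
  using exists_Phi[of "ex F"] ex_nth_0[OF assms] by blast

lemma exp_theta_one: "exp_theta (1\<^sub>m n) = 1"
  using exp_theta_eq[of "1\<^sub>m n" 0] Phi_one by (simp add: ex_zero)

lemma exp_kirillov_one: "exp_kirillov \<theta> n lam (1\<^sub>m n) = of_nat (CARD('a) ^ (5 * r\<^sup>2 - 2 * r))"
  unfolding exp_kirillov_induced by (rule induced_degree[of exp_theta, OF exp_theta_one])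

text \<open>An element of \<open>L\<close> lies over 1 + y u^r, and multiplying by it adds
  \<open>y\<close> to the top coefficient of the logarithm and changes nothing else modulo
  u^(r+1).\<close>

lemma exp_theta_equivariant: "equivariant exp_theta"
  unfolding equivariant_def
proof (intro ballI)
  fix a b assume a: "a \<in> S" and bL: "b \<in> L"
  have b: "b \<in> S" using bL LS by blast
  obtain F where F: "fps_nth F 0 = 0" "agree r (Phi a) (ex F)" using exists_ex[OF a] by blast
  define y where "y = fps_nth (Phi b) r"
  let ?Y = "fps_const y * fps_X ^ r"
  have "fps_nth (Phi b) 0 = 1" by (simp add: Phi_def phi_nth)
  hence B: "agree r (Phi b) (1 + ?Y)"
    using L_iff[OF b] bL r unfolding agree_def by (auto simp: y_def fps_X_power_nth le_less)
  have "agree r (Phi (a * b)) (ex F * (1 + ?Y))"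
    by (rule agree_trans[OF Phi_mult(2)[OF a b] agree_mult[OF F(2) B]])
  moreover have "agree r \<dots> (ex F + ?Y)" by (rule mult_top[OF ex_nth_0[OF F(1)]])
  moreover have "agree r \<dots> (ex (F + ?Y))" by (rule agree_sym[OF ex_top[OF F(1)]]) (use r in simp)
  ultimately have "agree r (Phi (a * b)) (ex (F + ?Y))" using agree_trans by blast
  hence "exp_theta (a * b) = \<theta> (fps_nth (F + ?Y) r)"
    using F(1) r by (intro exp_theta_eq[OF Phi_mult(1)[OF a b]]) (simp_all add: fps_X_power_nth)
  also have "\<dots> = \<theta> (fps_nth F r) * \<theta> y" by (simp add: \<theta>_add fps_X_power_nth)
  finally show "exp_theta (a \<otimes>\<^bsub>G\<^esub> b) = exp_theta a * theta_fun \<theta> n lam b"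
    using exp_theta_eq[OF a F(2,1)] theta_fun_Phi[OF b] by (simp add: y_def)
qed

text \<open>The obstruction in \<open>ex_add\<close> lies in degrees beyond \<open>r\<close>, so
  logarithms add, and \<theta> of their top coefficient is multiplicative.\<close>

lemma exp_theta_hom:
  assumes rp: "r < CHAR('a)"
  shows "lin_char G S exp_theta"
  unfolding lin_char_def
proof (intro conjI ballI)
  fix a b assume a: "a \<in> S" and b: "b \<in> S"
  obtain F where F: "fps_nth F 0 = 0" "agree r (Phi a) (ex F)" using exists_ex[OF a] by blast
  obtain H where H: "fps_nth H 0 = 0" "agree r (Phi b) (ex H)" using exists_ex[OF b] by blast
  let ?hi = "{(i, j). i < CHAR('a) \<and> j < CHAR('a) \<and> CHAR('a) \<le> i + j}"
  have "agree r (\<Sum>(i, j)\<in>?hi. inv_fact i * inv_fact j * (F ^ i * H ^ j)) (\<Sum>(i, j)\<in>?hi. 0)"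
  proof (rule agree_sum)
    fix x assume "x \<in> ?hi"
    then obtain i j where x: "x = (i, j)" "CHAR('a) \<le> i + j" by blast
    have "agree r (F ^ i * H ^ j) 0"
      using fps_power_prod_nth_zero[OF F(1) H(1)] x(2) rp by (simp add: agree_def)
    hence "agree r (inv_fact i * inv_fact j * (F ^ i * H ^ j)) (inv_fact i * inv_fact j * 0)"
      by (rule agree_mult[OF agree_refl])
    thus "agree r (case x of (i, j) \<Rightarrow> inv_fact i * inv_fact j * (F ^ i * H ^ j)) (case x of (i, j) \<Rightarrow> 0)"
      by (simp add: x(1))
  qed
  from agree_add[OF agree_refl[of r "ex (F + H)"] this]
  have "agree r (ex F * ex H) (ex (F + H))" unfolding ex_add by simp
  hence "agree r (Phi (a * b)) (ex (F + H))"
    using agree_trans[OF Phi_mult(2)[OF a b] agree_mult[OF F(2) H(2)]] agree_trans by blast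
  hence "exp_theta (a * b) = \<theta> (fps_nth (F + H) r)"
    using F(1) H(1) by (intro exp_theta_eq[OF Phi_mult(1)[OF a b]]) simp_all
  thus "exp_theta (a \<otimes>\<^bsub>G\<^esub> b) = exp_theta a * exp_theta b"
    using exp_theta_eq[OF a F(2,1)] exp_theta_eq[OF b H(2,1)] by (simp add: \<theta>_add)
qed (simp add: exp_theta_one)

text \<open>The obstruction in \<open>ex_add\<close> has to be made visible in degree
  \<open>r\<close>. For r > p a single one of its terms can be isolated there; for r = p all terms
  with i + j = p would meet in that degree, and a p-th power is used instead.\<close>

lemma exp_theta_not_hom:
  assumes rp: "CHAR('a) \<le> r"
  shows "\<not> lin_char G S exp_theta"
proof
  assume lin: "lin_char G S exp_theta"
  obtain c where c: "\<theta> (c * 1) \<noteq> 1" using exists_\<theta>[of 1] by auto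
  have p2: "CHAR('a) \<ge> 2" by (rule CHAR_ge_2)
  show False
  proof (cases "r = CHAR('a)")
    case True
    \<comment> \<open>Frobenius is onto, so \<theta> can be made nontrivial at a^p. An element over
      \<open>ex (a u)\<close> has its p-th power over 1 + c u^p; multiplicativity would make
      \<theta> c the p-th power of a value of \<theta>, which is 1.\<close>
    obtain a :: 'a where a: "a ^ CHAR('a) ^ 1 = c" using frobenius_surj by blast
    let ?F = "fps_const a * fps_X :: 'a fps"
    obtain h where h: "h \<in> S" "agree r (Phi h) (ex ?F)" using exists_S[of ?F] by auto
    define H where "H = ex ?F - 1"
    have H0: "fps_nth H 0 = 0" using ex_nth_0[of ?F] by (simp add: H_def)
    have H1: "fps_nth H 1 = a" using ex_nth_1[of ?F] by (simp add: H_def)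
    have "ex ?F ^ CHAR('a) = 1 + H ^ CHAR('a)" using fps_freshman[of H 1] by (simp add: H_def)
    moreover have "agree r (1 + H ^ CHAR('a)) (1 + fps_const c * fps_X ^ r)"
    proof (rule agree_add[OF agree_refl], unfold agree_def, intro allI impI)
      fix k assume "k \<le> r"
      show "fps_nth (H ^ CHAR('a)) k = fps_nth (fps_const c * fps_X ^ r) k"
      proof (cases "k = r")
        case k: True
        have "fps_nth (H ^ CHAR('a)) CHAR('a) = fps_nth H 1 ^ CHAR('a)"
          using startsby_zero_power_nth_same[OF H0] by simp
        thus ?thesis using k True a H1 by (simp add: fps_X_power_nth)
      next
        case False
        hence "k < CHAR('a)" using \<open>k \<le> r\<close> True by simp
        thus ?thesis using fps_power_nth_zero[OF H0] False by (simp add: fps_X_power_nth)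
      qed
    qed
    moreover have "agree r (Phi (h [^]\<^bsub>G\<^esub> CHAR('a))) (ex ?F ^ CHAR('a))"
      by (rule agree_trans[OF Phi_pow(2)[OF h(1)] agree_power[OF h(2)]])
    moreover have "agree r (1 + fps_const c * fps_X ^ r) (ex (0 + fps_const c * fps_X ^ r))"
      using agree_sym[OF ex_top[of 0 r c]] r by (simp add: ex_zero)
    ultimately have "agree r (Phi (h [^]\<^bsub>G\<^esub> CHAR('a))) (ex (0 + fps_const c * fps_X ^ r))"
      by (metis agree_trans)
    hence "exp_theta (h [^]\<^bsub>G\<^esub> CHAR('a)) = \<theta> (fps_nth (0 + fps_const c * fps_X ^ r) r)"
      using r by (intro exp_theta_eq[OF Phi_pow(1)[OF h(1)]]) (simp_all add: fps_X_power_nth)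
    hence "exp_theta h ^ CHAR('a) = \<theta> c" using G.lin_char_pow(1)[OF S_subgroup lin h(1)] by (simp add: fps_X_power_nth)
    thus False using c theta_pow_p unfolding exp_theta_def by simp
  next
    case False
    hence rp: "CHAR('a) < r" using rp by simp
    \<comment> \<open>u^(p-1) u^m has degree \<open>r\<close>, and the factor (p-1)! in
      \<open>b\<close> cancels the reciprocal factorial, so the term (p-1, 1) of the obstruction is
      c u^r.\<close>
    define m where "m = r - CHAR('a) + 1"
    define b where "b = of_nat (fact (CHAR('a) - 1)) * c"
    have m: "m < r" "0 < m" "CHAR('a) - 1 + m = r" using rp p2 by (auto simp: m_def)
    let ?F = "fps_X :: 'a fps" and ?H = "fps_const b * fps_X ^ m :: 'a fps"
    let ?C = "fps_const c * fps_X ^ r :: 'a fps"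
    have H0: "fps_nth ?H 0 = 0" using m by (simp add: fps_X_power_nth)
    obtain x where x: "x \<in> S" "agree r (Phi x) (ex ?F)" using exists_S[of ?F] by auto
    obtain y where y: "y \<in> S" "agree r (Phi y) (ex ?H)" using exists_S[OF H0] by auto
    let ?hi = "{(i, j). i < CHAR('a) \<and> j < CHAR('a) \<and> CHAR('a) \<le> i + j}"
    have fin: "finite ?hi" by (rule finite_subset[of _ "{..<CHAR('a)} \<times> {..<CHAR('a)}"]) auto
    have mem: "(CHAR('a) - 1, 1) \<in> ?hi" using p2 by simp
    have "agree r (\<Sum>(i, j)\<in>?hi. inv_fact i * inv_fact j * (?F ^ i * ?H ^ j))
        (\<Sum>ij\<in>?hi. if ij = (CHAR('a) - 1, 1) then ?C else 0)"
    proof (rule agree_sum)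
      fix z assume "z \<in> ?hi"
      then obtain i j where z: "z = (i, j)" "i < CHAR('a)" "j < CHAR('a)" "CHAR('a) \<le> i + j" by blast
      have prod: "?F ^ i * ?H ^ j = fps_const (b ^ j) * fps_X ^ (i + m * j)"
        by (simp add: power_mult_distrib power_mult power_add)
      show "agree r (case z of (i, j) \<Rightarrow> inv_fact i * inv_fact j * (?F ^ i * ?H ^ j))
          (if z = (CHAR('a) - 1, 1) then ?C else 0)"
      proof (cases "j = 1")
        case True
        hence i: "i = CHAR('a) - 1" using z by simp
        have nz: "of_nat (fact (CHAR('a) - 1)) \<noteq> (0::'a)" by (rule fact_nonzero) (use p2 in simp)
        have "inv_fact i * inv_fact j * (?F ^ i * ?H ^ j) = fps_const (1 / of_nat (fact (CHAR('a) - 1)) * b) * fps_X ^ (i + m * j)"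
          unfolding prod using True i by (simp add: inv_fact_def mult.assoc[symmetric])
        also have "1 / of_nat (fact (CHAR('a) - 1)) * b = c" unfolding b_def using nz by (simp del: of_nat_fact)
        also have "i + m * j = r" using True i m by simp
        finally show ?thesis using z(1) i True by simp
      next
        case False
        hence j: "2 \<le> j" using z by simp
        \<comment> \<open>The terms with j \<ge> 2 have degree i + m j \<ge> p + j (r-p) \<ge> 2r -
          p, which exceeds \<open>r\<close> because r > p.\<close>
        have "2 * (r - CHAR('a)) \<le> j * (r - CHAR('a))" using j by simp
        moreover have "m * j = j * (r - CHAR('a)) + j" by (simp add: m_def algebra_simps)
        ultimately have "r < i + m * j" using z rp by linarith
        hence "agree r (?F ^ i * ?H ^ j) 0" unfolding prod by (simp add: agree_def fps_X_power_nth)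
        hence "agree r (inv_fact i * inv_fact j * (?F ^ i * ?H ^ j)) (inv_fact i * inv_fact j * 0)"
          by (rule agree_mult[OF agree_refl])
        thus ?thesis using False z(1) by simp
      qed
    qed
    moreover have "(\<Sum>ij\<in>?hi. if ij = (CHAR('a) - 1, 1) then ?C else 0) = ?C"
      using sum.delta[OF fin, of "(CHAR('a) - 1, 1)" "\<lambda>_. ?C"] mem by simp
    ultimately have hi: "agree r (\<Sum>(i, j)\<in>?hi. inv_fact i * inv_fact j * (?F ^ i * ?H ^ j)) ?C" by simp
    have "agree r (ex ?F * ex ?H) (ex (?F + ?H) + ?C)"
      unfolding ex_add by (rule agree_add[OF agree_refl hi])
    moreover have "agree r (ex (?F + ?H) + ?C) (ex (?F + ?H + ?C))"
      using H0 r by (intro agree_sym[OF ex_top]) simp_all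
    moreover have "agree r (Phi (x * y)) (ex ?F * ex ?H)"
      by (rule agree_trans[OF Phi_mult(2)[OF x(1) y(1)] agree_mult[OF x(2) y(2)]])
    ultimately have "agree r (Phi (x * y)) (ex (?F + ?H + ?C))" by (metis agree_trans)
    hence "exp_theta (x * y) = \<theta> (fps_nth (?F + ?H + ?C) r)"
      using H0 r by (intro exp_theta_eq[OF Phi_mult(1)[OF x(1) y(1)]]) (simp_all add: fps_X_power_nth)
    also have "fps_nth (?F + ?H + ?C) r = c" using r m by (simp add: fps_X_power_nth fps_X_nth)
    finally have "exp_theta (x * y) = \<theta> c" .
    moreover have "exp_theta x = 1" using exp_theta_eq[OF x] r by (simp add: fps_X_nth)
    moreover have "exp_theta y = 1" using exp_theta_eq[OF y H0] m by (simp add: fps_X_power_nth)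
    moreover have "exp_theta (x * y) = exp_theta x * exp_theta y" using lin x(1) y(1) by (simp add: lin_char_def)
    ultimately show False using c by simp
  qed
qed

lemma exp_kirillov_character_iff: "exp_kirillov \<theta> n lam \<in> characters G \<longleftrightarrow> r < CHAR('a)"
proof -
  have "exp_kirillov \<theta> n lam \<in> characters G \<longleftrightarrow> lin_char G S exp_theta"
    unfolding exp_kirillov_induced
    by (rule induced_character_iff[OF exp_theta_equivariant]) (simp_all add: exp_theta_def norm_theta exp_theta_one[unfolded exp_theta_def])
  thus ?thesis using exp_theta_hom exp_theta_not_hom by (meson not_le_imp_less)
qed

end

theorem proposition3p2:
  fixes r n :: nat
    and \<theta> :: "'a::{field, finite} \<Rightarrow> complex"
    and lam :: "'a mat \<Rightarrow> 'a"
  assumes r: "r > 1"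
    and n: "n > 6 * r"
    and \<theta>: "nontrivial_additive_character \<theta>"
    and lam_dual: "lam \<in> dual n"
    and lam: "\<And>j k. 1 \<le> j \<Longrightarrow> j < k \<Longrightarrow> k \<le> n \<Longrightarrow> lam (elem_mat n j k) = lambda_coeff r j k"
  shows
    "((\<exists>\<Psi>. \<Psi> \<subseteq> irreducible_characters (UT n :: 'a mat monoid)
          \<and> card \<Psi> = CARD('a) ^ (r - 1)
          \<and> (\<forall>\<psi>\<in>\<Psi>. \<psi> (1\<^sub>m n) = of_nat (CARD('a) ^ (5 * r^2 - 2 * r))
               \<and> (\<exists>\<chi> \<in> linear_characters ((UT n)\<lparr>carrier := S_hat n lam\<rparr>).
                     \<psi> = induced (UT n) (S_hat n lam) \<chi>))
          \<and> (\<forall>g\<in>carrier (UT n). xi \<theta> n lam g = (\<Sum>\<psi>\<in>\<Psi>. \<psi> g)))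
      \<and> l_hat n lam = {X \<in> strict_upper n.
            (\<forall>\<alpha> \<in> posA r \<union> posB r \<union> posC r. entry X \<alpha> = entry X (tau r \<alpha>))
          \<and> (\<forall>\<alpha> \<in> posD r \<union> posZ r. entry X \<alpha> = 0)}
      \<and> s_hat n lam = {X \<in> strict_upper n.
            (\<forall>\<alpha> \<in> posA r \<union> posB r \<union> posC r \<union> posD r. entry X \<alpha> = entry X (tau r \<alpha>))
          \<and> (\<forall>\<alpha> \<in> posZ r. entry X \<alpha> = 0)}
      \<and> xi \<theta> n lam (1\<^sub>m n) = of_nat (CARD('a) ^ (5 * r^2 - r - 1))
      \<and> char_inner (UT n) (xi \<theta> n lam) (xi \<theta> n lam) = of_nat (CARD('a) ^ (r - 1)))
    \<and> (\<forall>i. CHAR('a) ^ i \<le> r \<and> (\<forall>k. CHAR('a) ^ k \<le> r \<longrightarrow> CHAR('a) ^ k \<le> CHAR('a) ^ i) \<longrightarrow>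
          (\<forall>\<chi> \<in> irreducible_constituents (UT n) (xi \<theta> n lam). \<forall>g\<in>carrier (UT n).
              \<chi> g \<in> cyclotomic_field (CHAR('a) ^ (i + 1)))
        \<and> (\<exists>\<chi> \<in> irreducible_constituents (UT n) (xi \<theta> n lam). \<exists>g\<in>carrier (UT n).
              \<chi> g \<notin> cyclotomic_field (CHAR('a) ^ i)))
    \<and> (kirillov \<theta> n lam (1\<^sub>m n) = of_nat (CARD('a) ^ (5 * r^2 - 2 * r))
      \<and> exp_kirillov \<theta> n lam (1\<^sub>m n) = of_nat (CARD('a) ^ (5 * r^2 - 2 * r))
      \<and> kirillov \<theta> n lam \<notin> characters (UT n)
      \<and> (exp_kirillov \<theta> n lam \<in> characters (UT n) \<longleftrightarrow> r < CHAR('a)))"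
proof -
  interpret ut_lambda n lam \<theta> r
    by unfold_locales (rule lam_dual \<theta> r n lam; assumption?)+
  have field_values: "(\<forall>\<chi> \<in> irreducible_constituents (UT n) (xi \<theta> n lam). \<forall>g\<in>carrier (UT n).
          \<chi> g \<in> cyclotomic_field (CHAR('a) ^ (i + 1)))
      \<and> (\<exists>\<chi> \<in> irreducible_constituents (UT n) (xi \<theta> n lam). \<exists>g\<in>carrier (UT n).
          \<chi> g \<notin> cyclotomic_field (CHAR('a) ^ i))"
    if i: "CHAR('a) ^ i \<le> r \<and> (\<forall>k. CHAR('a) ^ k \<le> r \<longrightarrow> CHAR('a) ^ k \<le> CHAR('a) ^ i)" for i
  proof -
    have big: "r < CHAR('a) ^ Suc i"
    proof (rule ccontr)
      assume "\<not> r < CHAR('a) ^ Suc i"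
      hence "CHAR('a) ^ Suc i \<le> CHAR('a) ^ i" using i by (simp only: not_less)
      moreover have "CHAR('a) ^ i < CHAR('a) ^ Suc i"
        using CHAR_ge_2[where 'a = 'a] by (intro power_strict_increasing) auto
      ultimately show False by simp
    qed
    have "\<exists>\<chi> \<in> irreducible_constituents (UT n) (xi \<theta> n lam). \<exists>g\<in>carrier (UT n).
        \<chi> g \<notin> cyclotomic_field (CHAR('a) ^ i)"
    proof (cases "i = 0")
      \<comment> \<open>Here r < p and the smaller field is that of the rationals, so the twist by
        the exponent 1 + p^i would no longer fix \<theta>.\<close>
      case True
      thus ?thesis using constituent_nonvalue_small big by simp
    next
      case False
      thus ?thesis using constituent_nonvalue_large[of i] i big by blast
    qed
    moreover have "\<chi> g \<in> cyclotomic_field (CHAR('a) ^ (i + 1))"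
      if "\<chi> \<in> irreducible_constituents (UT n) (xi \<theta> n lam)" "g \<in> carrier (UT n)" for \<chi> g
      using constituent_values[OF that big] by simp
    ultimately show ?thesis by blast
  qed
  note sh_set = sh_star[unfolded star_set]
  show ?thesis
    by (intro conjI allI impI xi_components lh_set sh_set xi_one xi_inner_self
        kirillov_one exp_kirillov_one kirillov_not_character exp_kirillov_character_iff)
      (rule field_values[THEN conjunct1] field_values[THEN conjunct2], simp)+
qed

end
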